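(* Fix real numbers $\vartheta\in(0,1)$ and $\Theta\in\mathbb{R}$. Then there exist $x_0$ and $C>0$ such that for all real $x\ge x_0$, \[ \left|S_{\vartheta,\Theta}(x)-(\log x)^{\Theta}S_\vartheta(x)\right|\le C\,(\log x)^{\Theta}S_\vartheta(x)\sqrt{\frac{\log\log x}{\log x}}. \]
   Context: For a natural number $m$, let $k(m)$ denote the largest square-free divisor of $m$. For $\vartheta>0$ and real $x\ge1$, let $S_\vartheta(x)$ be the number of natural numbers $m\le x$ with $k(m)\le m^{\vartheta}$. For $\vartheta\in(0,1)$ and $\Theta\in\mathbb{R}$, let $S_{\vartheta,\Theta}(x)$ be the number of integers $n$ with $2\le n\le x$ and $k(n)\le n^{\vartheta}(\log n)^{\Theta}$. *)

theory Defs
  imports "HOL-Analysis.Analysis" "HOL-Computational_Algebra.Primes"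
begin

definition kern :: "nat \<Rightarrow> nat" where
  "kern m = (\<Prod>p\<in>prime_factors m. p)"

definition S1 :: "real \<Rightarrow> real \<Rightarrow> nat" where
  "S1 th x = card {m::nat. 1 \<le> m \<and> real m \<le> x \<and> real (kern m) \<le> real m powr th}"

definition S2 :: "real \<Rightarrow> real \<Rightarrow> real \<Rightarrow> nat" where
  "S2 th Th x = card {n::nat. 2 \<le> n \<and> real n \<le> x \<and>
      real (kern n) \<le> real n powr th * ln (real n) powr Th}"

end

theory Submission
  imports Defs "HOL-Number_Theory.Prime_Powers" "HOL-Real_Asymp.Real_Asymp"
    "HOL-Computational_Algebra.Squarefree"
begin

text \<open>
  Write \<open>n = k v\<close> with \<open>k\<close> the kernel of \<open>n\<close>. The condition \<open>k \<le> \<lambda> n\<^sup>\<theta>\<close> bounds \<open>k\<close> in terms of \<open>v\<close>, and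
  counting the square-free multiples \<open>k\<close> of the kernel of \<open>v\<close> shows that the number of such \<open>n \<le> x\<close> is about
  \<open>c \<lambda> x\<^sup>\<theta> H(V)\<close> with \<open>V = x\<close> to the power \<open>1 - \<theta>\<close>, divided by \<open>\<lambda>\<close>. Here \<open>H(V)\<close> sums the weights
  \<open>\<Prod> 1 / (p + 1)\<close>, \<open>p\<close> dividing \<open>v\<close>, against the cut-off \<open>min (V / v) ((v / V)\<^sup>a)\<close>.

  So everything depends on how little \<open>H(V)\<close> changes when \<open>V\<close> is multiplied by a power of \<open>log V\<close>. Scaling
  \<open>V\<close> by a prime \<open>p\<close> affects \<open>H\<close> only through the \<open>v\<close> prime to \<open>p\<close>, which carry a proportion
  \<open>O(1 / sqrt (log V loglog V))\<close> of the sum for fixed \<open>p\<close>: a number \<open>v\<close> of typical weight has few prime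
  factors, hence is divisible by high powers of the small primes. Each prime costs little, so that
  \<open>log H\<close> moves by \<open>O(1 / sqrt (log V loglog V))\<close> under bounded shifts that are ratios of integers; such ratios
  approximate every real shift well enough. Adding up \<open>O(loglog V)\<close> bounded shifts gives the factor
  \<open>1 + O(sqrt (loglog V / log V))\<close>.
\<close>

subsection \<open>Chebyshev bounds\<close>

text \<open>The obstacle is a circle: the share of the \<open>v\<close> prime to \<open>p\<close> is
  found by comparing values of \<open>H\<close> at the points \<open>V / p ^ j\<close>, which
  presupposes that \<open>H\<close> moves slowly. A bootstrap breaks it. With
  \<open>t = ln V\<close>, counting prime powers in windows controls the growth of the sharply cut
  sum \<open>psum\<close> over windows of logarithmic length \<open>t powr (1/5)\<close>. This gives
  the crude share \<open>t powr (-3/10)\<close> of \<open>H\<close> in \<open>psum\<close>, and one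
  round of averaging over powers of a small prime sharpens it to \<open>1 / sqrt (t * ln t)\<close>.
  Each round removes one more prime, so the bounds are uniform over sums avoiding up to four primes.

  A shift by a prime \<open>q\<close> first costs \<open>q * ln q / sqrt (t * ln t)\<close>, too
  much for the \<open>q\<close> in use. The factor \<open>q\<close> disappears once the sum over the
  \<open>v\<close> prime to \<open>q\<close> is known to move by \<open>O(1 / q)\<close> under the
  same shift, which is shown with integers below \<open>q\<close> only. Real shifts use three
  numerators and three denominators of size \<open>Y\<close>, with an error of order
  \<open>1 / Y\<^sup>2\<close>; at \<open>Y\<close> about \<open>t powr (1/4)\<close> this is
  \<open>t powr (-1/2)\<close>, below the target \<open>sqrt (ln t / t)\<close>.\<close>

lemma ln_fact_mangoldt:
  assumes "n \<le> N"
  shows "ln (fact n) = (\<Sum>d\<in>{1..N}. mangoldt d * real (n div d))"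
  using assms
proof (induction n)
  case 0
  then show ?case by simp
next
  case (Suc n)
  have "ln (fact (Suc n)) = ln (real (Suc n)) + (ln (fact n) :: real)"
    by (simp add: ln_mult)
  also have "ln (real (Suc n)) = (\<Sum>d | d dvd Suc n. mangoldt d)"
    by (subst mangoldt_sum) auto
  also have "\<dots> = (\<Sum>d\<in>{1..N}. if d dvd Suc n then mangoldt d else 0)"
  proof (intro sum.mono_neutral_cong_left)
    show "{d. d dvd Suc n} \<subseteq> {1..N}"
    proof
      fix d assume "d \<in> {d. d dvd Suc n}"
      then have "d \<le> Suc n" "d > 0" by (auto intro!: Nat.gr0I dest: dvd_imp_le)
      then show "d \<in> {1..N}" using Suc.prems by auto
    qed
  qed auto
  also have "\<dots> + ln (fact n) = (\<Sum>d\<in>{1..N}. mangoldt d * real (Suc n div d))"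
  proof -
    have "(if d dvd Suc n then mangoldt d else 0) + mangoldt d * real (n div d) =
        mangoldt d * real (Suc n div d)" if "d \<in> {1..N}" for d
      using that by (auto simp: div_Suc dvd_eq_mod_eq_0 algebra_simps)
    moreover have "ln (fact n) = (\<Sum>d\<in>{1..N}. mangoldt d * real (n div d))"
      using Suc by simp
    ultimately show ?thesis by (simp only: sum.distrib[symmetric] cong: sum.cong)
  qed
  finally show ?case .
qed

text \<open>Both directions of Chebyshev's bounds rest on this formula: every coefficient is 0 or 1,
  and it is 1 for \<open>n < d \<le> 2 * n\<close>. The range of \<open>d\<close> was left free in
  \<open>ln_fact_mangoldt\<close> so that both factorials expand over
  \<open>{1..2*n}\<close>.\<close>

lemma ln_central_binomial_mangoldt:
  "ln (real ((2 * n) choose n)) =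
     (\<Sum>d\<in>{1..2*n}. mangoldt d * (real (2 * n div d) - 2 * real (n div d)))"
proof -
  have "real ((2 * n) choose n) = fact (2 * n) / (fact n * fact n)"
    by (simp add: binomial_fact mult_2)
  then have "ln (real ((2 * n) choose n)) = ln (fact (2 * n)) - 2 * ln (fact n)"
    by (simp add: ln_div ln_mult)
  also have "\<dots> = (\<Sum>d\<in>{1..2*n}. mangoldt d * real (2 * n div d)) -
      2 * (\<Sum>d\<in>{1..2*n}. mangoldt d * real (n div d))"
    by (simp only: ln_fact_mangoldt[of "2*n" "2*n"] ln_fact_mangoldt[of n "2*n"])
  finally show ?thesis
    by (simp add: sum_subtractf sum_distrib_left algebra_simps)
qed

lemma double_div_bounds:
  fixes n d :: nat
  assumes "d > 0"
  shows "2 * (n div d) \<le> 2 * n div d" "2 * n div d \<le> 2 * (n div d) + 1"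
proof -
  show "2 * (n div d) \<le> 2 * n div d"
    using assms by (simp add: less_eq_div_iff_mult_less_eq)
  have "n < (n div d + 1) * d"
    using assms by (metis Suc_eq_plus1 dividend_less_div_times mult.commute mult_Suc add.commute)
  then have "2 * n < (2 * (n div d) + 2) * d"
    by (simp add: algebra_simps)
  then have "2 * n div d < 2 * (n div d) + 2"
    using assms by (simp add: div_less_iff_less_mult)
  then show "2 * n div d \<le> 2 * (n div d) + 1" by simp
qed

text \<open>A prime in \<open>(n, 2 * n]\<close> has coefficient 1 in the expansion of the central
  binomial coefficient, no other coefficient is negative, and the binomial coefficient is at most
  \<open>2 ^ (2 * n)\<close>.\<close>

lemma sum_ln_primes_dyadic_le:
  "(\<Sum>p | prime p \<and> n < p \<and> p \<le> 2 * n. ln (real p)) \<le> 2 * real n * ln 2"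
proof -
  have "(\<Sum>p | prime p \<and> n < p \<and> p \<le> 2 * n. ln (real p)) \<le>
      (\<Sum>d\<in>{1..2*n}. mangoldt d * (real (2 * n div d) - 2 * real (n div d)))"
  proof (rule sum_le_included[where i = id])
    show "\<forall>d\<in>{1..2 * n}. 0 \<le> mangoldt d * (real (2 * n div d) - 2 * real (n div d))"
    proof
      fix d assume "d \<in> {1..2 * n}"
      then have "real (2 * (n div d)) \<le> real (2 * n div d)"
        using double_div_bounds(1)[of d n] by (simp only: of_nat_le_iff) auto
      then show "0 \<le> mangoldt d * (real (2 * n div d) - 2 * real (n div d))"
        by (intro mult_nonneg_nonneg mangoldt_nonneg) auto
    qed
    show "\<forall>p\<in>{p. prime p \<and> n < p \<and> p \<le> 2 * n}. \<exists>d\<in>{1..2 * n}. id d = p \<and>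
        ln (real p) \<le> mangoldt d * (real (2 * n div d) - 2 * real (n div d))"
    proof safe
      fix p :: nat assume p: "prime p" "n < p" "p \<le> 2 * n"
      have "2 * n div p = 1" using p by (intro div_nat_eqI) auto
      moreover have "n div p = 0" using p by simp
      ultimately show "\<exists>d\<in>{1..2 * n}. id d = p \<and>
          ln (real p) \<le> mangoldt d * (real (2 * n div d) - 2 * real (n div d))"
        using p prime_gt_0_nat[of p] by (intro bexI[of _ p]) auto
    qed
  qed auto
  also have "\<dots> = ln (real ((2 * n) choose n))"
    by (simp add: ln_central_binomial_mangoldt)
  also have "\<dots> \<le> ln (real (2 ^ (2 * n)))"
  proof -
    have "(2 * n) choose n \<le> 2 ^ (2 * n)"
      using member_le_sum[of n "{..2*n}" "\<lambda>k. (2 * n) choose k"] by (simp add: choose_row_sum)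
    then have "real ((2 * n) choose n) \<le> real (2 ^ (2 * n))"
      by (simp only: of_nat_le_iff)
    then show ?thesis by (subst ln_le_cancel_iff) auto
  qed
  also have "\<dots> = 2 * real n * ln 2" by (simp add: ln_realpow)
  finally show ?thesis .
qed

lemma card_primes_dyadic_le:
  assumes "k \<ge> 1"
  shows "real (card {p::nat. prime p \<and> 2 ^ k < p \<and> p \<le> 2 ^ Suc k}) \<le> 2 * 2 ^ k / k"
proof -
  let ?S = "{p::nat. prime p \<and> 2 ^ k < p \<and> p \<le> 2 * 2 ^ k}"
  have "real (card ?S) * (k * ln 2) = (\<Sum>p\<in>?S. ln (real (2 ^ k)))"
    by (simp add: ln_realpow)
  also have "\<dots> \<le> (\<Sum>p\<in>?S. ln (real p))"
    by (intro sum_mono) (auto simp del: of_nat_power)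
  also have "\<dots> \<le> 2 * 2 ^ k * ln 2"
    using sum_ln_primes_dyadic_le[of "2 ^ k"] by simp
  finally have "real (card ?S) * k * ln 2 \<le> 2 * 2 ^ k * ln 2" by (simp add: mult_ac)
  then have "real (card ?S) * k \<le> 2 * 2 ^ k" by simp
  then show ?thesis using assms by (simp add: field_simps)
qed

text \<open>At most \<open>ln N / ln p\<close> powers of \<open>p\<close> lie up to
  \<open>N\<close>, each weighing \<open>ln p\<close>, so every prime contributes at most
  \<open>ln N\<close>. This turns a lower bound for Chebyshev's psi function into one for the number
  of primes.\<close>

lemma sum_mangoldt_le:
  "(\<Sum>d\<in>{1..N}. mangoldt d) \<le> real (card {p. prime p \<and> p \<le> N}) * ln (real N)"
proof -
  let ?P = "{d\<in>{1..N}. primepow d}" and ?Q = "{p. prime p \<and> p \<le> N}"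
  have sub: "aprimedivisor ` ?P \<subseteq> ?Q"
    by (auto intro!: prime_aprimedivisor' dest: primepow_gt_Suc_0
        intro: order.trans[OF dvd_imp_le[OF aprimedivisor_dvd']])
  have "(\<Sum>d\<in>{1..N}. mangoldt d :: real) = (\<Sum>d\<in>?P. ln (real (aprimedivisor d)))"
    by (intro sum.mono_neutral_cong_right) (auto simp: mangoldt_def)
  also have "\<dots> = (\<Sum>p\<in>?Q. \<Sum>d\<in>{d\<in>?P. aprimedivisor d = p}. ln (real (aprimedivisor d)))"
    using sub by (intro sum.group[symmetric]) auto
  also have "\<dots> \<le> (\<Sum>p\<in>?Q. ln (real N))"
  proof (rule sum_mono)
    fix p assume "p \<in> ?Q"
    then have p: "prime p" "p \<le> N" by auto
    have lnp: "ln (real p) > 0" using prime_gt_1_nat[OF p(1)] by simp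
    let ?K = "nat \<lfloor>ln (real N) / ln (real p)\<rfloor>"
    have "{d\<in>?P. aprimedivisor d = p} \<subseteq> (\<lambda>k. p ^ k) ` {1..?K}"
    proof
      fix d assume "d \<in> {d\<in>?P. aprimedivisor d = p}"
      then have d: "primepow d" "d \<le> N" "aprimedivisor d = p" by auto
      then obtain k where k: "k > 0" "d = p ^ k"
        by (metis primepow_def aprimedivisor_prime_power)
      have "real k * ln (real p) \<le> ln (real N)"
        using d k prime_gt_0_nat[OF p(1)] p
        by (subst ln_realpow[symmetric]) (auto simp flip: of_nat_power)
      then have "real k \<le> ln (real N) / ln (real p)" using lnp by (simp add: field_simps)
      then have "k \<le> ?K" by linarith
      then show "d \<in> (\<lambda>k. p ^ k) ` {1..?K}" using k by auto
    qed
    then have "card {d\<in>?P. aprimedivisor d = p} \<le> card ((\<lambda>k. p ^ k) ` {1..?K})"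
      by (intro card_mono) auto
    also have "\<dots> \<le> ?K" using card_image_le[of "{1..?K}" "\<lambda>k. p ^ k"] by simp
    finally have "real (card {d\<in>?P. aprimedivisor d = p}) \<le> real ?K" by simp
    also have "\<dots> \<le> ln (real N) / ln (real p)"
      using lnp p prime_gt_0_nat[OF p(1)] by simp
    finally have "real (card {d\<in>?P. aprimedivisor d = p}) * ln (real p) \<le> ln (real N)"
      using lnp by (simp add: field_simps)
    then show "(\<Sum>d\<in>{d\<in>?P. aprimedivisor d = p}. ln (real (aprimedivisor d))) \<le> ln (real N)"
      by simp
  qed
  finally show ?thesis by simp
qed

lemma card_primes_ge:
  assumes "n \<ge> 1"
  shows "real (card {p. prime p \<and> p \<le> 2 * n}) * ln (real (2 * n)) \<ge>
    2 * real n * ln 2 - ln (2 * real n)"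
proof -
  have "2 * real n * ln 2 - ln (2 * real n) = ln (4 ^ n / (2 * real n))"
    using assms by (simp add: ln_div ln_realpow flip: ln_realpow[of 2 2, simplified])
  also have "\<dots> \<le> ln (real ((2 * n) choose n))"
    using central_binomial_lower_bound[of n] assms by (subst ln_le_cancel_iff) auto
  also have "\<dots> = (\<Sum>d\<in>{1..2*n}. mangoldt d * (real (2 * n div d) - 2 * real (n div d)))"
    by (rule ln_central_binomial_mangoldt)
  also have "\<dots> \<le> (\<Sum>d\<in>{1..2*n}. mangoldt d * 1)"
  proof (intro sum_mono mult_left_mono mangoldt_nonneg)
    fix d assume "d \<in> {1..2*n}"
    then have "real (2 * n div d) \<le> real (2 * (n div d) + 1)"
      using double_div_bounds(2)[of d n] by (simp only: of_nat_le_iff) auto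
    then show "real (2 * n div d) - 2 * real (n div d) \<le> 1" by simp
  qed
  also have "\<dots> \<le> real (card {p. prime p \<and> p \<le> 2 * n}) * ln (real (2 * n))"
    using sum_mangoldt_le[of "2 * n"] by simp
  finally show ?thesis .
qed


lemma powr_of_two_bracket:
  fixes y :: real
  assumes "y \<ge> 2"
  obtains K where "K \<ge> 1" "2 ^ K \<le> y" "y < 2 ^ Suc K" "ln y \<le> 2 * real K * ln 2"
    "ln y \<le> real (Suc K) * ln 2"
proof -
  define K where "K = nat \<lfloor>log 2 y\<rfloor>"
  have l1: "log 2 y \<ge> 1" using assms by (simp add: le_log_iff)
  have K: "real K \<le> log 2 y" "log 2 y < real K + 1" "K \<ge> 1"
    unfolding K_def using l1 by linarith+
  have a: "2 ^ K \<le> y"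
    using K(1) assms by (simp add: le_log_iff powr_realpow)
  have b: "y < 2 ^ Suc K"
    using K(2) assms by (simp add: log_less_iff powr_add powr_realpow)
  have c: "ln y \<le> real (Suc K) * ln 2"
    using b assms by (subst ln_realpow[symmetric]) auto
  also have "\<dots> \<le> 2 * real K * ln 2"
    using K(3) by (intro mult_right_mono) auto
  finally show ?thesis using that[of K] K a b c by auto
qed

lemma sum_inverse_squares_tail:
  assumes "K \<ge> 1"
  shows "(\<Sum>k\<in>{K..N}. 1 / real k ^ 2) \<le> 2 / K"
proof (cases "K \<le> N")
  case True
  have "(\<Sum>k\<in>{K..N}. 1 / real k ^ 2) \<le> 2 / K - 1 / N"
    using True
  proof (induction N rule: dec_induct)
    case base
    have "1 / real K ^ 2 \<le> 1 / real K"
      using assms by (simp add: field_simps power2_eq_square)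
    then show ?case by simp
  next
    case (step n)
    have n: "real n > 0" using step assms by simp
    have "1 / real (Suc n) ^ 2 \<le> 1 / real n - 1 / real (Suc n)"
      using n by (simp add: divide_simps power2_eq_square)
    then show ?case using step by simp
  qed
  then show ?thesis by (smt (verit) divide_nonneg_nonneg of_nat_0_le_iff)
qed (use assms in auto)

text \<open>In the dyadic block above \<open>2 ^ k\<close> there are at most
  \<open>2 * 2 ^ k / k\<close> primes, and each term is at most
  \<open>1 / (2 ^ k * k * ln 2)\<close>. The blocks therefore decay like
  \<open>1 / k\<^sup>2\<close>. The result is the exponent in Rankin's bound for numbers without
  small prime factors.\<close>

lemma sum_primes_inverse_mult_ln_le:
  fixes y :: real
  assumes "y \<ge> 2" "finite S" "\<And>p. p \<in> S \<Longrightarrow> prime p \<and> real p > y"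
  shows "(\<Sum>p\<in>S. 1 / (real p * ln (real p))) \<le> 8 / ln y"
proof -
  obtain K where K: "K \<ge> 1" "2 ^ K \<le> y" "ln y \<le> 2 * real K * ln 2"
    using powr_of_two_bracket[OF assms(1)] by metis
  define D where "D k = {p::nat. prime p \<and> 2 ^ k < p \<and> p \<le> 2 ^ Suc k}" for k
  have finD: "finite (D k)" for k
    by (rule finite_subset[of _ "{..2 ^ Suc k}"]) (auto simp: D_def)
  define N where "N = Max (insert 0 S)"
  have sub: "S \<subseteq> (\<Union>k\<in>{K..N}. D k)"
  proof
    fix p assume p: "p \<in> S"
    have pp: "prime p" "2 ^ K < real p" using assms(3)[OF p] K(2) by linarith+
    then have pK: "2 ^ K < p" by (metis of_nat_less_iff of_nat_numeral of_nat_power)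
    have pN: "p \<le> N" unfolding N_def using p assms(2) by simp
    have ex: "\<exists>k. p \<le> 2 ^ Suc k" using less_exp[of p] by (intro exI[of _ p]) (unfold power_Suc, linarith)
    define k where "k = (LEAST k. p \<le> 2 ^ Suc k)"
    have k1: "p \<le> 2 ^ Suc k" unfolding k_def by (rule LeastI_ex[OF ex])
    have kK: "K \<le> k"
    proof (rule ccontr)
      assume "\<not> K \<le> k"
      then have "(2::nat) ^ Suc k \<le> 2 ^ K" by (intro power_increasing) auto
      then show False using k1 pK by linarith
    qed
    have k2: "2 ^ k < p"
    proof (rule ccontr)
      assume "\<not> 2 ^ k < p"
      then have "p \<le> 2 ^ Suc (k - 1)" using kK K by simp
      then have "k \<le> k - 1" unfolding k_def by (intro Least_le) (auto simp: k_def)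
      then show False using kK K by simp
    qed
    have "k < N" using less_exp[of k] k2 pN by linarith
    then show "p \<in> (\<Union>k\<in>{K..N}. D k)" using k1 k2 kK pp(1) by (auto simp: D_def)
  qed
  have nonneg: "0 \<le> 1 / (real p * ln (real p))" for p :: nat
    by (cases "p = 0") auto
  have "(\<Sum>p\<in>S. 1 / (real p * ln (real p))) \<le> (\<Sum>p\<in>(\<Union>k\<in>{K..N}. D k). 1 / (real p * ln (real p)))"
    using sub finD nonneg by (intro sum_mono2) auto
  also have "\<dots> = (\<Sum>k\<in>{K..N}. \<Sum>p\<in>D k. 1 / (real p * ln (real p)))"
  proof (rule sum.UNION_disjoint)
    have "D k \<inter> D l = {}" if "k < l" for k l
    proof -
      have "(2::nat) ^ Suc k \<le> 2 ^ l" using that by (intro power_increasing) auto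
      then show ?thesis by (auto simp: D_def)
    qed
    then show "\<forall>i\<in>{K..N}. \<forall>j\<in>{K..N}. i \<noteq> j \<longrightarrow> D i \<inter> D j = {}"
      by (metis inf_commute nat_neq_iff)
  qed (use finD in auto)
  also have "\<dots> \<le> (\<Sum>k\<in>{K..N}. 2 / ln 2 * (1 / real k ^ 2))"
  proof (rule sum_mono)
    fix k assume k: "k \<in> {K..N}"
    then have k1: "k \<ge> 1" using K by simp
    have "(\<Sum>p\<in>D k. 1 / (real p * ln (real p))) \<le> (\<Sum>p\<in>D k. 1 / (2 ^ k * (k * ln 2)))"
    proof (rule sum_mono)
      fix p assume "p \<in> D k"
      then have "(2::nat) ^ k < p" by (simp add: D_def)
      then have p: "2 ^ k < real p" by (metis of_nat_less_iff of_nat_numeral of_nat_power)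
      have "k * ln 2 \<le> ln (real p)"
        using p by (subst ln_realpow[symmetric]) auto
      moreover have "k * ln 2 > 0" using k1 by simp
      ultimately have "ln (real p) > 0" "2 ^ k * (k * ln 2) \<le> real p * ln (real p)"
        using p by (auto intro!: mult_mono simp del: ln_gt_zero_iff)
      then show "1 / (real p * ln (real p)) \<le> 1 / (2 ^ k * (k * ln 2))"
        using k1 by (intro frac_le) auto
    qed
    also have "\<dots> = real (card (D k)) / (2 ^ k * (k * ln 2))" by simp
    also have "\<dots> \<le> (2 * 2 ^ k / k) / (2 ^ k * (k * ln 2))"
      using card_primes_dyadic_le[OF k1] by (intro divide_right_mono) (auto simp: D_def)
    also have "\<dots> = 2 / ln 2 * (1 / real k ^ 2)"
      by (simp add: field_simps power2_eq_square)
    finally show "(\<Sum>p\<in>D k. 1 / (real p * ln (real p))) \<le> 2 / ln 2 * (1 / real k ^ 2)" .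
  qed
  also have "\<dots> = 2 / ln 2 * (\<Sum>k\<in>{K..N}. 1 / real k ^ 2)" by (simp add: sum_distrib_left)
  also have "\<dots> \<le> 2 / ln 2 * (2 / K)"
    using sum_inverse_squares_tail[OF K(1)] by (intro mult_left_mono) auto
  \<comment> \<open>The sum so far is \<open>4 / (K * ln 2)\<close>, and
    \<open>ln y \<le> 2 * K * ln 2\<close> turns it into \<open>8 / ln y\<close>.\<close>
  also have "\<dots> \<le> 8 / ln y"
    using K assms(1) by (simp add: field_simps)
  finally show ?thesis .
qed

lemma card_primes_le:
  fixes y :: real
  assumes "y \<ge> 2"
  shows "real (card {p::nat. prime p \<and> real p \<le> y}) \<le> 16 * y / ln y"
proof -
  have fin: "finite {p::nat. prime p \<and> p \<le> n}" for n
    by (rule finite_subset[of _ "{..n}"]) auto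
  have pow2: "real (card {p::nat. prime p \<and> p \<le> 2 ^ K}) \<le> 8 * 2 ^ K / K" if "K \<ge> 2" for K
    using that
  proof (induction K rule: dec_induct)
    case base
    have "{p::nat. prime p \<and> p \<le> 2 ^ 2} \<subseteq> {1..4}" by (auto dest: prime_gt_0_nat simp: Suc_le_eq)
    then have "card {p::nat. prime p \<and> p \<le> 2 ^ 2} \<le> card {1..4::nat}" by (intro card_mono) auto
    then show ?case by simp
  next
    case (step K)
    have "{p::nat. prime p \<and> p \<le> 2 ^ Suc K} \<subseteq>
        {p. prime p \<and> p \<le> 2 ^ K} \<union> {p. prime p \<and> 2 ^ K < p \<and> p \<le> 2 ^ Suc K}" by auto
    then have "card {p::nat. prime p \<and> p \<le> 2 ^ Suc K} \<le>
        card {p::nat. prime p \<and> p \<le> 2 ^ K} + card {p::nat. prime p \<and> 2 ^ K < p \<and> p \<le> 2 ^ Suc K}"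
      by (intro order.trans[OF card_mono card_Un_le])
        (auto intro: finite_subset[of _ "{..2 ^ Suc K}"])
    also have "real \<dots> \<le> 8 * 2 ^ K / K + 2 * 2 ^ K / K"
      using step card_primes_dyadic_le[of K] by simp
    \<comment> \<open>This is \<open>10 * (K + 1) \<le> 16 * K\<close>, which fails at
      \<open>K = 1\<close>; hence the induction starts at 2.\<close>
    also have "\<dots> \<le> 8 * 2 ^ Suc K / Suc K"
      using step(1) by (simp add: field_simps)
    finally show ?case by simp
  qed
  obtain K where K: "K \<ge> 1" "2 ^ K \<le> y" "y < 2 ^ Suc K" "ln y \<le> real (Suc K) * ln 2"
    using powr_of_two_bracket[OF assms(1)] by metis
  have "{p::nat. prime p \<and> real p \<le> y} \<subseteq> {p. prime p \<and> p \<le> 2 ^ Suc K}"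
  proof safe
    fix p :: nat assume "real p \<le> y"
    then have "real p \<le> real (2 ^ Suc K)" using K by simp
    then show "p \<le> 2 ^ Suc K" by (simp only: of_nat_le_iff)
  qed
  then have "card {p::nat. prime p \<and> real p \<le> y} \<le> card {p::nat. prime p \<and> p \<le> 2 ^ Suc K}"
    by (intro card_mono fin)
  then have "real (card {p::nat. prime p \<and> real p \<le> y}) \<le> 8 * 2 ^ Suc K / Suc K"
    using pow2[of "Suc K"] K(1) by linarith
  also have "\<dots> \<le> 16 * y / Suc K" using K by (intro divide_right_mono) auto
  also have "\<dots> \<le> 16 * y / ln y"
  proof -
    have "ln y \<le> real (Suc K) * 1"
      by (rule order.trans[OF K(4) mult_left_mono]) (use ln_2_less_1 in auto)
    then show ?thesis using assms by (intro divide_left_mono mult_pos_pos) auto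
  qed
  finally show ?thesis .
qed

lemma eventually_card_primes_ge:
  "\<forall>\<^sub>F y :: real in at_top. real (card {p::nat. prime p \<and> real p \<le> y}) \<ge> y / (2 * ln y)"
proof -
  have "\<forall>\<^sub>F y :: real in at_top. (y - 2) * (2 / 3) - ln y \<ge> y / 2 \<and> y \<ge> 4"
    by (intro eventually_conj eventually_ge_at_top) real_asymp
  then show ?thesis
  proof eventually_elim
    case (elim y)
    \<comment> \<open>\<open>2 * n\<close> is an even number above \<open>y - 2\<close>. The loss is
      covered because \<open>2 / 3\<close>, a lower bound for \<open>ln 2\<close>, exceeds the
      \<open>1 / 2\<close> that is claimed.\<close>
    define n where "n = nat \<lfloor>y / 2\<rfloor>"
    have n: "n \<ge> 1" "real (2 * n) \<le> y" "2 * real n \<ge> y - 2"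
      unfolding n_def using elim by linarith+
    let ?c = "real (card {p::nat. prime p \<and> real p \<le> y})"
    have "finite {p::nat. prime p \<and> real p \<le> y}"
      by (rule finite_subset[of _ "{..nat \<lfloor>y\<rfloor>}"]) (auto simp: le_nat_floor)
    then have c: "card {p::nat. prime p \<and> p \<le> 2 * n} \<le> card {p::nat. prime p \<and> real p \<le> y}"
      using n(2) by (intro card_mono) auto
    have "(y - 2) * (2 / 3) \<le> (y - 2) * ln 2"
      using elim ln2_ge_two_thirds by (intro mult_left_mono) auto
    then have "y / 2 \<le> (y - 2) * ln 2 - ln y" using elim by linarith
    also have "\<dots> \<le> 2 * real n * ln 2 - ln (2 * real n)"
      using n elim by (intro diff_mono mult_right_mono) auto
    also have "\<dots> \<le> real (card {p::nat. prime p \<and> p \<le> 2 * n}) * ln (real (2 * n))"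
      by (rule card_primes_ge[OF n(1)])
    also have "\<dots> \<le> ?c * ln y"
      using c n elim by (intro mult_mono) auto
    finally show ?case using elim by (simp add: field_simps)
  qed
qed

subsection \<open>The weight and its sums\<close>

text \<open>Up to a constant, the density of the square-free multiples of the kernel of
  \<open>v\<close>, and the reciprocal of the Dedekind psi function of that kernel. It depends on
  the set of prime factors only, so that all \<open>p ^ j * v\<close> with \<open>j \<ge> 1\<close>
  weigh the same.\<close>

definition fpsi :: "nat \<Rightarrow> real" where
  "fpsi v = (\<Prod>p\<in>prime_factors v. 1 / (real p + 1))"

abbreviation omega :: "nat \<Rightarrow> nat" where
  "omega v \<equiv> card (prime_factors v)"

text \<open>\<open>M\<close> collects the primes removed in successive rounds of the argument.
  Positivity is required separately because 0 would survive for empty \<open>M\<close>.\<close>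

definition avoiding :: "nat set \<Rightarrow> nat set" where
  "avoiding M = {v. v > 0 \<and> (\<forall>p\<in>M. \<not> p dvd v)}"

definition psum :: "nat set \<Rightarrow> real \<Rightarrow> real" where
  "psum M V = (\<Sum>v | v \<in> avoiding M \<and> real v \<le> V. fpsi v)"

lemma fpsi_pos: "fpsi v > 0"
  unfolding fpsi_def by (intro prod_pos) auto

lemma fpsi_nonneg [simp]: "fpsi v \<ge> 0"
  using fpsi_pos[of v] by simp

lemma fpsi_1 [simp]: "fpsi (Suc 0) = 1"
  by (simp add: fpsi_def)

lemma fpsi_le_1: "fpsi v \<le> 1"
  unfolding fpsi_def by (intro prod_le_1) auto

lemma prime_factors_prime_mult:
  assumes "prime (p::nat)" "v > 0"
  shows "prime_factors (p * v) = insert p (prime_factors v)"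
  using assms prime_factors_product[of p v] by (auto simp: prime_prime_factors)

lemma fpsi_prime_mult:
  assumes "prime p" "v > 0"
  shows "fpsi (p * v) = (if p dvd v then fpsi v else fpsi v / (real p + 1))"
proof (cases "p dvd v")
  case True
  then have "p \<in> prime_factors v" using assms by (simp add: prime_factors_dvd)
  then show ?thesis using assms True by (simp add: fpsi_def prime_factors_prime_mult insert_absorb)
next
  case False
  then have "p \<notin> prime_factors v" by (auto simp: prime_factors_dvd)
  then show ?thesis using assms False by (simp add: fpsi_def prime_factors_prime_mult)
qed

lemma omega_prime_mult:
  assumes "prime p" "v > 0"
  shows "omega (p * v) = (if p dvd v then omega v else Suc (omega v))"
proof (cases "p dvd v")
  case True
  then have "p \<in> prime_factors v" using assms by (simp add: prime_factors_dvd)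
  then show ?thesis using assms True by (simp add: prime_factors_prime_mult insert_absorb)
next
  case False
  then have "p \<notin> prime_factors v" by (auto simp: prime_factors_dvd)
  then show ?thesis using assms False by (simp add: prime_factors_prime_mult)
qed

lemma fpsi_prime_power_mult:
  assumes "prime p" "v > 0" "j \<ge> 1"
  shows "fpsi (p ^ j * v) = fpsi (p * v)"
  using assms(3)
proof (induction j rule: dec_induct)
  case base
  then show ?case by simp
next
  case (step j)
  have pos: "p ^ j * v > 0" using assms prime_gt_0_nat[of p] by simp
  have "p dvd p ^ j * v" using step by (simp add: dvd_mult2)
  then have "fpsi (p * (p ^ j * v)) = fpsi (p ^ j * v)"
    using fpsi_prime_mult[OF assms(1) pos] by simp
  then show ?case using step by (simp add: mult_ac)
qed

lemma fpsi_mult_disjoint: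
  assumes "a > 0" "b > 0" "prime_factors a \<inter> prime_factors b = {}"
  shows "fpsi (a * b) = fpsi a * fpsi b"
  using assms by (simp add: fpsi_def prime_factors_product prod.union_disjoint)

lemma prime_dvd_prime_power_mult_iff:
  assumes "prime p" "prime q" "p \<noteq> q"
  shows "(q::nat) dvd p ^ j * v \<longleftrightarrow> q dvd v"
proof -
  have "\<not> q dvd p ^ j"
    using assms prime_dvd_power[of q p j] primes_dvd_imp_eq[of q p] by auto
  then show ?thesis using assms(2) by (simp add: prime_dvd_mult_iff)
qed

lemma avoiding_prime_power_mult:
  assumes "prime p" "p \<notin> M" "\<And>q. q \<in> M \<Longrightarrow> prime q"
  shows "p ^ j * v \<in> avoiding M \<longleftrightarrow> v \<in> avoiding M"
proof -
  have "q dvd p ^ j * v \<longleftrightarrow> q dvd v" if "q \<in> M" for q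
    using that assms by (intro prime_dvd_prime_power_mult_iff) auto
  then show ?thesis using prime_gt_0_nat[OF assms(1)] by (simp add: avoiding_def)
qed

lemma avoiding_insert: "avoiding (insert p M) = {v \<in> avoiding M. \<not> p dvd v}"
  by (auto simp: avoiding_def)

lemma one_mem_avoiding:
  assumes "\<And>q. q \<in> M \<Longrightarrow> prime q"
  shows "Suc 0 \<in> avoiding M"
proof -
  have "\<not> p dvd Suc 0" if "p \<in> M" for p
    using assms[OF that] by auto
  then show ?thesis by (simp add: avoiding_def)
qed

lemma finite_nat_real_le [simp]: "finite {v::nat. P v \<and> real v \<le> V}"
  by (rule finite_subset[of _ "{..nat \<lfloor>V\<rfloor>}"]) (auto simp: le_nat_floor)

lemma psum_nonneg: "psum M V \<ge> 0"
  unfolding psum_def by (intro sum_nonneg) auto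

lemma psum_mono: "V \<le> V' \<Longrightarrow> psum M V \<le> psum M V'"
  unfolding psum_def by (intro sum_mono2) auto

lemma psum_ge_1:
  assumes "\<And>q. q \<in> M \<Longrightarrow> prime q" "V \<ge> 1"
  shows "psum M V \<ge> 1"
proof -
  have "(\<Sum>v\<in>{Suc 0}. fpsi v) \<le> psum M V"
    unfolding psum_def using one_mem_avoiding[OF assms(1)] assms(2) by (intro sum_mono2) auto
  then show ?thesis by simp
qed

lemma psum_diff:
  assumes "V \<le> V'"
  shows "psum M V' - psum M V = (\<Sum>v | v \<in> avoiding M \<and> V < real v \<and> real v \<le> V'. fpsi v)"
proof -
  have "{v \<in> avoiding M. real v \<le> V'} =
      {v. v \<in> avoiding M \<and> real v \<le> V} \<union> {v. v \<in> avoiding M \<and> V < real v \<and> real v \<le> V'}"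
    using assms by auto
  moreover have "finite {v. v \<in> avoiding M \<and> V < real v \<and> real v \<le> V'}"
    using finite_nat_real_le[of "\<lambda>v. v \<in> avoiding M \<and> V < real v" V'] by (simp add: conj_assoc)
  ultimately have "psum M V' = psum M V + (\<Sum>v | v \<in> avoiding M \<and> V < real v \<and> real v \<le> V'. fpsi v)"
    unfolding psum_def by (subst sum.union_disjoint[symmetric]) auto
  then show ?thesis by simp
qed

text \<open>Rankin's method: in the induction step, the part of the sum over multiples of the new prime
  is at most \<open>p\<^sup>-\<^sup>s\<close> times itself plus a multiple of the old sum.\<close>

lemma rankin_sum_le:
  fixes s z :: real
  assumes "finite S" "\<And>p. p \<in> S \<Longrightarrow> prime p" "s > 0" "z \<ge> 0"
  shows "(\<Sum>b | (b > 0 \<and> prime_factors b \<subseteq> S) \<and> real b \<le> N. z ^ omega b * real b powr (- s) * fpsi b)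
    \<le> (\<Prod>p\<in>S. 1 + z / ((real p + 1) * (real p powr s - 1)))"
  using assms(1,2)
proof (induction S rule: finite_induct)
  case empty
  have "{b. (b > 0 \<and> prime_factors b \<subseteq> {}) \<and> real b \<le> N} \<subseteq> {Suc 0}"
    by (auto simp: prime_factorization_empty_iff)
  then have "(\<Sum>b | (b > 0 \<and> prime_factors b \<subseteq> {}) \<and> real b \<le> N. z ^ omega b * real b powr (- s) * fpsi b)
      \<le> (\<Sum>b\<in>{Suc 0}. z ^ omega b * real b powr (- s) * fpsi b)"
    using assms by (intro sum_mono2) auto
  then show ?case by simp
next
  case (insert p S)
  define F where "F b = z ^ omega b * real b powr (- s) * fpsi b" for b
  have p: "prime p" using insert.prems by simp
  have Fnn: "F b \<ge> 0" for b using assms by (simp add: F_def)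
  define B where "B = {b. (b > 0 \<and> prime_factors b \<subseteq> insert p S) \<and> real b \<le> N}"
  define B0 where "B0 = {b. (b > 0 \<and> prime_factors b \<subseteq> S) \<and> real b \<le> N}"
  define B1 where "B1 = {b \<in> B. p dvd b}"
  have fin: "finite B" "finite B0" by (auto simp: B_def B0_def)
  then have "finite B1" by (auto simp: B1_def intro: rev_finite_subset)
  note fin = fin this
  have "p \<notin> S" by fact
  have part: "B = B0 \<union> B1" "B0 \<inter> B1 = {}"
    using \<open>p \<notin> S\<close> p by (auto simp: B_def B0_def B1_def prime_factors_dvd)
  have Fp: "F (p * b) = real p powr (- s) * (F b * (if p dvd b then 1 else z / (real p + 1)))"
    if "b > 0" for b
    using that p by (simp add: F_def omega_prime_mult fpsi_prime_mult powr_mult)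
  define X where "X = (\<Sum>b\<in>B1. F b)"
  let ?q = "real p powr (- s)"
  have "B1 = (\<lambda>b. p * b) ` {b. p * b \<in> B}" by (auto simp: B1_def elim!: dvdE)
  moreover have "inj_on (\<lambda>b. p * b) {b. p * b \<in> B}"
    using p by (auto simp: inj_on_def)
  ultimately have "X = (\<Sum>b | p * b \<in> B. F (p * b))" unfolding X_def by (simp add: sum.reindex)
  also have "\<dots> \<le> (\<Sum>b\<in>B. ?q * (F b * (if p dvd b then 1 else z / (real p + 1))))"
  proof (rule sum_le_included[where i = id])
    show "\<forall>b\<in>{b. p * b \<in> B}. \<exists>c\<in>B. id c = b \<and>
        F (p * b) \<le> ?q * (F c * (if p dvd c then 1 else z / (real p + 1)))"
    proof
      fix b assume "b \<in> {b. p * b \<in> B}"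
      then have b: "p * b > 0" "prime_factors (p * b) \<subseteq> insert p S" "real (p * b) \<le> N"
        by (auto simp: B_def)
      then have "b > 0" by simp
      moreover have "real b \<le> real (p * b)" using b by (simp add: mult_le_cancel_right2)
      then have "real b \<le> N" using b(3) by linarith
      ultimately have "b \<in> B" using b(2) p by (auto simp: B_def prime_factors_prime_mult)
      then show "\<exists>c\<in>B. id c = b \<and> F (p * b) \<le> ?q * (F c * (if p dvd c then 1 else z / (real p + 1)))"
        using Fp[of b] \<open>b > 0\<close> by auto
    qed
    show "finite {b. p * b \<in> B}"
      by (rule finite_vimageI[OF fin(1), unfolded vimage_def]) (use p in \<open>auto simp: inj_def\<close>)
  qed (use fin Fnn assms in auto)
  also have "\<dots> = ?q * (z / (real p + 1) * (\<Sum>b\<in>B0. F b) + X)"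
  proof -
    have "(\<Sum>b\<in>B. F b * (if p dvd b then 1 else z / (real p + 1))) =
        (\<Sum>b\<in>B0. F b * (if p dvd b then 1 else z / (real p + 1))) +
        (\<Sum>b\<in>B1. F b * (if p dvd b then 1 else z / (real p + 1)))"
      unfolding part(1) using fin part(2) by (intro sum.union_disjoint) auto
    also have "(\<Sum>b\<in>B0. F b * (if p dvd b then 1 else z / (real p + 1))) =
        (\<Sum>b\<in>B0. F b * (z / (real p + 1)))"
      using \<open>p \<notin> S\<close> p by (intro sum.cong) (auto simp: B0_def prime_factors_dvd)
    also have "(\<Sum>b\<in>B1. F b * (if p dvd b then 1 else z / (real p + 1))) = X"
      unfolding X_def by (intro sum.cong) (auto simp: B1_def)
    finally show ?thesis
      by (simp only: sum_distrib_left[symmetric] sum_distrib_right[symmetric] mult.commute)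
  qed
  finally have X: "X \<le> ?q * (z / (real p + 1) * (\<Sum>b\<in>B0. F b) + X)" .
  have ps: "real p powr s > 1"
    using prime_gt_1_nat[OF p] assms(3) by (simp add: gr_one_powr)
  have q: "?q = 1 / real p powr s" by (simp add: powr_minus_divide)
  have "X * (real p powr s - 1) \<le> z / (real p + 1) * (\<Sum>b\<in>B0. F b)"
  proof -
    have "X * real p powr s \<le> z / (real p + 1) * (\<Sum>b\<in>B0. F b) + X"
      using X order.strict_trans[OF zero_less_one ps] unfolding q by (simp add: pos_le_divide_eq)
    then show ?thesis by (simp add: algebra_simps)
  qed
  then have "X \<le> z / (real p + 1) * (\<Sum>b\<in>B0. F b) / (real p powr s - 1)"
    using ps by (simp add: pos_le_divide_eq mult_ac)
  then have X': "X \<le> z / ((real p + 1) * (real p powr s - 1)) * (\<Sum>b\<in>B0. F b)"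
    by (simp add: mult_ac)
  have "(\<Sum>b\<in>B. F b) = (\<Sum>b\<in>B0. F b) + X"
    unfolding part(1) X_def using fin part(2) by (intro sum.union_disjoint) auto
  also have "\<dots> \<le> (1 + z / ((real p + 1) * (real p powr s - 1))) * (\<Sum>b\<in>B0. F b)"
    using X' by (simp add: algebra_simps)
  also have "\<dots> \<le> (1 + z / ((real p + 1) * (real p powr s - 1))) *
      (\<Prod>p\<in>S. 1 + z / ((real p + 1) * (real p powr s - 1)))"
    using insert.IH insert.prems ps assms by (intro mult_left_mono) (auto simp: B0_def F_def)
  finally show ?case
    using insert.hyps by (simp add: B_def F_def)
qed

text \<open>Since \<open>p powr s - 1 \<ge> s * ln p\<close>, each Euler factor is at most
  \<open>exp (z / (s * p * ln p))\<close>, and the primes up to \<open>y\<close> are absent. The two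
  exponents \<open>s * ln N\<close> and \<open>8 * z / (s * ln y)\<close> are balanced later by the
  choice of \<open>s\<close>.\<close>

lemma rankin_rough_le:
  fixes s y z :: real
  assumes "s > 0" "y \<ge> 2" "z \<ge> 0" "N \<ge> 0"
  shows "(\<Sum>b | (b > 0 \<and> (\<forall>p\<in>prime_factors b. real p > y)) \<and> real b \<le> N. z ^ omega b * fpsi b)
    \<le> N powr s * exp (8 * z / (s * ln y))"
proof -
  define S where "S = {p::nat. (prime p \<and> real p > y) \<and> real p \<le> N}"
  have S: "finite S" "\<And>p. p \<in> S \<Longrightarrow> prime p" by (auto simp: S_def)
  have pf: "prime_factors b \<subseteq> S" if "b > 0" "\<forall>p\<in>prime_factors b. real p > y" "real b \<le> N" for b
  proof
    fix p assume p: "p \<in> prime_factors b"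
    then have "p \<le> b" using that by (auto simp: prime_factors_dvd dest: dvd_imp_le)
    then show "p \<in> S" using p that by (auto simp: S_def prime_factors_dvd)
  qed
  have "(\<Sum>b | (b > 0 \<and> (\<forall>p\<in>prime_factors b. real p > y)) \<and> real b \<le> N. z ^ omega b * fpsi b)
      \<le> (\<Sum>b | (b > 0 \<and> prime_factors b \<subseteq> S) \<and> real b \<le> N.
            N powr s * (z ^ omega b * real b powr (- s) * fpsi b))"
  proof (rule sum_le_included[where i = id])
    show "\<forall>b\<in>{b. (b > 0 \<and> (\<forall>p\<in>prime_factors b. real p > y)) \<and> real b \<le> N}.
        \<exists>c\<in>{b. (b > 0 \<and> prime_factors b \<subseteq> S) \<and> real b \<le> N}. id c = b \<and>
          z ^ omega b * fpsi b \<le> N powr s * (z ^ omega c * real c powr (- s) * fpsi c)"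
    proof safe
      fix b assume b: "b > 0" "\<forall>p\<in>prime_factors b. real p > y" "real b \<le> N"
      have "z ^ omega b * fpsi b * 1 \<le> z ^ omega b * fpsi b * (N / real b) powr s"
        using b assms by (intro mult_left_mono ge_one_powr_ge_zero) auto
      then have "z ^ omega b * fpsi b \<le> N powr s * (z ^ omega b * real b powr (- s) * fpsi b)"
        using b assms by (simp add: powr_divide powr_minus_divide mult_ac)
      then show "\<exists>c\<in>{b. (b > 0 \<and> prime_factors b \<subseteq> S) \<and> real b \<le> N}. id c = b \<and>
          z ^ omega b * fpsi b \<le> N powr s * (z ^ omega c * real c powr (- s) * fpsi c)"
        using b pf[of b] by (intro bexI[of _ b]) auto
    qed
  qed (use assms in auto)
  also have "\<dots> = N powr s * (\<Sum>b | (b > 0 \<and> prime_factors b \<subseteq> S) \<and> real b \<le> N.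
      z ^ omega b * real b powr (- s) * fpsi b)"
    by (simp add: sum_distrib_left)
  also have "\<dots> \<le> N powr s * (\<Prod>p\<in>S. 1 + z / ((real p + 1) * (real p powr s - 1)))"
    using S assms by (intro mult_left_mono rankin_sum_le) auto
  finally have step1: "(\<Sum>b | (b > 0 \<and> (\<forall>p\<in>prime_factors b. real p > y)) \<and> real b \<le> N.
      z ^ omega b * fpsi b) \<le> N powr s * (\<Prod>p\<in>S. 1 + z / ((real p + 1) * (real p powr s - 1)))" .
  have "(\<Prod>p\<in>S. 1 + z / ((real p + 1) * (real p powr s - 1)))
      \<le> (\<Prod>p\<in>S. exp (z / s * (1 / (real p * ln (real p)))))"
  proof (rule prod_mono, safe)
    fix p assume "p \<in> S"
    then have p: "real p > 1" using prime_gt_1_nat[of p] by (auto simp: S_def)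
    have sl: "s * ln (real p) > 0" using p assms by simp
    have "s * ln (real p) \<le> exp (s * ln (real p)) - 1"
      using exp_ge_add_one_self[of "s * ln (real p)"] by linarith
    then have ps: "s * ln (real p) \<le> real p powr s - 1"
      using p by (simp add: powr_def)
    show "0 \<le> 1 + z / ((real p + 1) * (real p powr s - 1))"
      using ps sl assms by (intro add_nonneg_nonneg divide_nonneg_nonneg mult_nonneg_nonneg) auto
    have "z / ((real p + 1) * (real p powr s - 1)) \<le> z / (real p * (s * ln (real p)))"
      using ps sl assms p by (intro divide_left_mono mult_mono mult_pos_pos) auto
    also have "\<dots> = z / s * (1 / (real p * ln (real p)))" by simp
    finally show "1 + z / ((real p + 1) * (real p powr s - 1)) \<le> exp (z / s * (1 / (real p * ln (real p))))"
      using exp_ge_add_one_self[of "z / s * (1 / (real p * ln (real p)))"] by linarith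
  qed
  also have "\<dots> = exp (z / s * (\<Sum>p\<in>S. 1 / (real p * ln (real p))))"
    using S by (simp add: exp_sum sum_distrib_left)
  also have "\<dots> \<le> exp (z / s * (8 / ln y))"
    unfolding exp_le_cancel_iff using assms
    by (intro mult_left_mono sum_primes_inverse_mult_ln_le S(1)) (auto simp: S_def)
  finally have "(\<Prod>p\<in>S. 1 + z / ((real p + 1) * (real p powr s - 1))) \<le> exp (8 * z / (s * ln y))"
    by (simp add: mult_ac)
  then have "N powr s * (\<Prod>p\<in>S. 1 + z / ((real p + 1) * (real p powr s - 1)))
      \<le> N powr s * exp (8 * z / (s * ln y))"
    by (intro mult_left_mono) auto
  then show ?thesis using step1 by linarith
qed

text \<open>For fixed \<open>s > 0\<close> the Euler factors are
  \<open>1 + O(p powr (-1 - s))\<close>, because \<open>p powr s - 1\<close> is at least the fixed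
  proportion \<open>1 - 2 powr (-s)\<close> of \<open>p powr s\<close>. The bound speaks of
  arbitrary finite sets, so it can be applied to any piece of a sum.\<close>

lemma rankin_bounded:
  fixes s z :: real
  assumes "s > 0" "z \<ge> 0"
  obtains B where "B > 0" "\<And>F. finite F \<Longrightarrow> (\<And>b. b \<in> F \<Longrightarrow> b > 0) \<Longrightarrow>
    (\<Sum>b\<in>F. z ^ omega b * real b powr (- s) * fpsi b) \<le> B"
proof -
  have "summable (\<lambda>n. real n powr (- 1 - s))"
    using assms by (simp add: summable_real_powr_iff)
  define Z where "Z = (\<Sum>n. real n powr (- 1 - s))"
  have Z: "(\<Sum>p\<in>S. real p powr (- 1 - s)) \<le> Z" if "finite S" for S
    unfolding Z_def by (rule sum_le_suminf) (use that in \<open>auto intro: \<open>summable _\<close>\<close>)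
  define c where "c = 1 - 2 powr (- s)"
  have c: "c > 0" using assms by (simp add: c_def powr_less_one powr_minus_divide gr_one_powr)
  show ?thesis
  proof (rule that[of "exp (z / c * Z)"])
    fix F :: "nat set" assume F: "finite F" "\<And>b. b \<in> F \<Longrightarrow> b > 0"
    define S where "S = (\<Union>b\<in>F. prime_factors b)"
    have S: "finite S" "\<And>p. p \<in> S \<Longrightarrow> prime p" using F by (auto simp: S_def)
    define N where "N = Max (insert 0 F)"
    have "(\<Sum>b\<in>F. z ^ omega b * real b powr (- s) * fpsi b) \<le>
      (\<Sum>b | (b > 0 \<and> prime_factors b \<subseteq> S) \<and> real b \<le> real N. z ^ omega b * real b powr (- s) * fpsi b)"
      using F assms by (intro sum_mono2) (auto simp: S_def N_def)
    also have "\<dots> \<le> (\<Prod>p\<in>S. 1 + z / ((real p + 1) * (real p powr s - 1)))"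
      using S assms by (intro rankin_sum_le) auto
    also have "\<dots> \<le> (\<Prod>p\<in>S. exp (z / c * real p powr (- 1 - s)))"
    proof (rule prod_mono, safe)
      fix p assume "p \<in> S"
      then have p: "real p \<ge> 2" using S(2)[of p] prime_ge_2_nat[of p] by auto
      have "2 powr s \<le> real p powr s" using p assms by (intro powr_mono2) auto
      then have ps: "real p powr s - 1 \<ge> c * real p powr s"
        unfolding c_def by (simp add: powr_minus_divide field_simps)
      have pos: "c * real p powr s > 0" using c p by simp
      show "0 \<le> 1 + z / ((real p + 1) * (real p powr s - 1))"
        using ps pos assms by (intro add_nonneg_nonneg divide_nonneg_nonneg mult_nonneg_nonneg) auto
      have "z / ((real p + 1) * (real p powr s - 1)) \<le> z / (real p * (c * real p powr s))"
        using ps pos assms p c by (intro divide_left_mono mult_mono mult_pos_pos) auto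
      also have "\<dots> = z / c * real p powr (- 1 - s)"
        using p by (simp add: powr_diff powr_neg_one)
      finally show "1 + z / ((real p + 1) * (real p powr s - 1)) \<le> exp (z / c * real p powr (- 1 - s))"
        using exp_ge_add_one_self[of "z / c * real p powr (- 1 - s)"] by linarith
    qed
    also have "\<dots> = exp (z / c * (\<Sum>p\<in>S. real p powr (- 1 - s)))"
      using S by (simp add: exp_sum sum_distrib_left)
    also have "\<dots> \<le> exp (z / c * Z)"
      unfolding exp_le_cancel_iff using Z[OF S(1)] c assms by (intro mult_left_mono) auto
    finally show "(\<Sum>b\<in>F. z ^ omega b * real b powr (- s) * fpsi b) \<le> exp (z / c * Z)" .
  qed auto
qed

text \<open>Pairs \<open>(v, j)\<close> with \<open>p ^ j\<close> dividing \<open>v\<close> are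
  counted by the quotient \<open>w = v div p ^ j\<close>, which may still be divisible by
  \<open>p\<close>. The weight of \<open>v\<close> is \<open>fpsi (p * w)\<close> whatever
  \<open>j\<close> is, so only the number of admissible exponents matters.\<close>

lemma multiplicity_sum_eq:
  assumes p: "prime p" and W: "finite W" "\<And>v. v \<in> W \<Longrightarrow> v > 0"
    and X: "finite X" "\<And>w j. j \<ge> 1 \<Longrightarrow> p ^ j * w \<in> W \<Longrightarrow> w \<in> X"
  shows "(\<Sum>v\<in>W. real (multiplicity p v) * fpsi v) =
    (\<Sum>w\<in>X. real (card {j. j \<ge> 1 \<and> p ^ j * w \<in> W}) * fpsi (p * w))"
proof -
  have p0: "p > 0" using prime_gt_0_nat[OF p] .
  have finJ: "finite {j. j \<ge> 1 \<and> p ^ j * w \<in> W}" for w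
  proof (cases "w > 0")
    case True
    have "inj (\<lambda>j. p ^ j * w)"
      using True prime_gt_1_nat[OF p] by (auto simp: inj_def power_inject_exp)
    then have "finite {j. p ^ j * w \<in> W}"
      using finite_vimageI[OF W(1), of "\<lambda>j. p ^ j * w"] by (simp add: vimage_def)
    then show ?thesis by (rule rev_finite_subset) auto
  next
    case False
    then have "{j. j \<ge> 1 \<and> p ^ j * w \<in> W} = {}" using W(2) by force
    then show ?thesis by (simp only: finite.emptyI)
  qed
  have "(\<Sum>v\<in>W. real (multiplicity p v) * fpsi v) = (\<Sum>v\<in>W. \<Sum>j\<in>{1..multiplicity p v}. fpsi v)"
    by (intro sum.cong refl) simp
  also have "\<dots> = (\<Sum>(v, j)\<in>(SIGMA v:W. {1..multiplicity p v}). fpsi v)"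
    using W by (subst sum.Sigma) auto
  also have "\<dots> = (\<Sum>(w, j)\<in>(SIGMA w:X. {j. j \<ge> 1 \<and> p ^ j * w \<in> W}). fpsi (p * w))"
  proof (rule sum.reindex_bij_witness[where i = "\<lambda>(w, j). (p ^ j * w, j)" and
        j = "\<lambda>(v, j). (v div p ^ j, j)"])
    fix a assume "a \<in> (SIGMA v:W. {1..multiplicity p v})"
    then obtain v j where a: "a = (v, j)" "v \<in> W" "j \<ge> 1" "j \<le> multiplicity p v" by auto
    have d: "p ^ j dvd v" using a W(2)[of v] by (simp add: multiplicity_dvd')
    have eq: "p ^ j * (v div p ^ j) = v" using d by simp
    show "(case case a of (v, j) \<Rightarrow> (v div p ^ j, j) of (w, j) \<Rightarrow> (p ^ j * w, j)) = a"
      using a eq by simp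
    have w: "v div p ^ j > 0" using eq W(2)[OF a(2)] by (metis mult_0_right not_gr_zero)
    show "(case a of (v, j) \<Rightarrow> (v div p ^ j, j)) \<in> (SIGMA w:X. {j. j \<ge> 1 \<and> p ^ j * w \<in> W})"
      using a eq X(2)[of j "v div p ^ j"] by auto
    show "(case case a of (v, j) \<Rightarrow> (v div p ^ j, j) of (w, j) \<Rightarrow> fpsi (p * w)) = (case a of (v, j) \<Rightarrow> fpsi v)"
      using a fpsi_prime_power_mult[OF p w a(3)] eq by simp
  next
    fix b assume "b \<in> (SIGMA w:X. {j. j \<ge> 1 \<and> p ^ j * w \<in> W})"
    then obtain w j where b: "b = (w, j)" "j \<ge> 1" "p ^ j * w \<in> W" by auto
    then show "(case case b of (w, j) \<Rightarrow> (p ^ j * w, j) of (v, j) \<Rightarrow> (v div p ^ j, j)) = b"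
      using p0 by simp
    have "p ^ j * w \<noteq> 0" using b W(2) by blast
    then have "j \<le> multiplicity p (p ^ j * w)"
      using p by (intro multiplicity_geI) auto
    then show "(case b of (w, j) \<Rightarrow> (p ^ j * w, j)) \<in> (SIGMA v:W. {1..multiplicity p v})"
      using b by auto
  qed
  also have "\<dots> = (\<Sum>w\<in>X. \<Sum>j\<in>{j. j \<ge> 1 \<and> p ^ j * w \<in> W}. fpsi (p * w))"
    using X(1) finJ by (subst sum.Sigma) auto
  finally show ?thesis by simp
qed

text \<open>The \<open>P\<close>-part of an integer; for \<open>P\<close> of the form "at most
  \<open>y\<close>" this is its \<open>y\<close>-smooth part, and the complementary predicate gives
  its rough part.\<close>

definition ppart :: "(nat \<Rightarrow> bool) \<Rightarrow> nat \<Rightarrow> nat" where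
  "ppart P v = (\<Prod>p | p \<in> prime_factors v \<and> P p. p ^ multiplicity p v)"

lemma ppart_pos: "ppart P v > 0"
  unfolding ppart_def by (intro prod_pos) (auto dest!: in_prime_factors_imp_prime prime_gt_0_nat)

lemma ppart_mult_compl:
  assumes "v > 0"
  shows "ppart P v * ppart (\<lambda>p. \<not> P p) v = v"
proof -
  have "ppart P v * ppart (\<lambda>p. \<not> P p) v =
      (\<Prod>p\<in>{p \<in> prime_factors v. P p} \<union> {p \<in> prime_factors v. \<not> P p}. p ^ multiplicity p v)"
    unfolding ppart_def by (subst prod.union_disjoint) auto
  also have "{p \<in> prime_factors v. P p} \<union> {p \<in> prime_factors v. \<not> P p} = prime_factors v" by auto
  also have "(\<Prod>p\<in>prime_factors v. p ^ multiplicity p v) = v"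
    using assms prime_factorization_nat[of v] by simp
  finally show ?thesis .
qed

lemma prime_factors_ppart: "prime_factors (ppart P v) = {p \<in> prime_factors v. P p}"
proof -
  have "p \<in> prime_factors (ppart P v) \<longleftrightarrow> p \<in> prime_factors v \<and> P p" for p
  proof (cases "prime p")
    case True
    have "p dvd ppart P v \<longleftrightarrow> (\<exists>q\<in>{q \<in> prime_factors v. P q}. p dvd q ^ multiplicity q v)"
      unfolding ppart_def using True by (intro prime_dvd_prod_iff) auto
    also have "\<dots> \<longleftrightarrow> p \<in> prime_factors v \<and> P p"
    proof
      assume "\<exists>q\<in>{q \<in> prime_factors v. P q}. p dvd q ^ multiplicity q v"
      then obtain q where q: "q \<in> prime_factors v" "P q" "p dvd q ^ multiplicity q v" by auto
      then have "p dvd q" using True prime_dvd_power by blast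
      then have "p = q" using q True by (intro primes_dvd_imp_eq) auto
      then show "p \<in> prime_factors v \<and> P p" using q by simp
    next
      assume "p \<in> prime_factors v \<and> P p"
      moreover from this have "multiplicity p v > 0"
        by (auto simp: prime_factors_multiplicity)
      ultimately show "\<exists>q\<in>{q \<in> prime_factors v. P q}. p dvd q ^ multiplicity q v"
        by (intro bexI[of _ p]) auto
    qed
    finally show ?thesis using True ppart_pos[of P v] by (simp add: prime_factors_dvd)
  qed auto
  then show ?thesis by blast
qed

lemma ppart_dvd: "v > 0 \<Longrightarrow> ppart P v dvd v"
  using ppart_mult_compl[of v P] by (metis dvd_triv_left)

lemma fpsi_ppart_mult:
  assumes "v > 0"
  shows "fpsi v = fpsi (ppart P v) * fpsi (ppart (\<lambda>p. \<not> P p) v)"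
  using fpsi_mult_disjoint[of "ppart P v" "ppart (\<lambda>p. \<not> P p) v"] ppart_mult_compl[OF assms, of P]
  by (auto simp: ppart_pos prime_factors_ppart)

lemma ln_ppart: "ln (real (ppart P v)) = (\<Sum>p | p \<in> prime_factors v \<and> P p. multiplicity p v * ln (real p))"
proof -
  have "ln (real (ppart P v)) = (\<Sum>p | p \<in> prime_factors v \<and> P p. ln (real p ^ multiplicity p v))"
    unfolding ppart_def of_nat_prod of_nat_power by (subst ln_prod) (auto dest!: in_prime_factors_imp_prime prime_gt_0_nat)
  also have "\<dots> = (\<Sum>p | p \<in> prime_factors v \<and> P p. multiplicity p v * ln (real p))"
    by (intro sum.cong refl) (subst ln_realpow, auto dest!: in_prime_factors_imp_prime prime_gt_0_nat)
  finally show ?thesis .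
qed

text \<open>A number is the product of its two complementary parts, so \<open>W\<close> embeds into
  \<open>X\<close> times \<open>Y\<close>; the terms of the full product that are not reached are
  nonnegative.\<close>

lemma sum_ppart_mult_le:
  fixes F G :: "nat \<Rightarrow> real"
  assumes "finite X" "finite Y" "\<And>v. v \<in> W \<Longrightarrow> v > 0"
    and "\<And>v. v \<in> W \<Longrightarrow> ppart P v \<in> X" "\<And>v. v \<in> W \<Longrightarrow> ppart (\<lambda>p. \<not> P p) v \<in> Y"
    and "\<And>a. a \<in> X \<Longrightarrow> F a \<ge> 0" "\<And>b. b \<in> Y \<Longrightarrow> G b \<ge> 0"
  shows "(\<Sum>v\<in>W. F (ppart P v) * G (ppart (\<lambda>p. \<not> P p) v)) \<le> (\<Sum>a\<in>X. F a) * (\<Sum>b\<in>Y. G b)"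
proof -
  let ?h = "\<lambda>v. (ppart P v, ppart (\<lambda>p. \<not> P p) v)"
  have inj: "inj_on ?h W"
  proof (rule inj_onI)
    fix v w assume vw: "v \<in> W" "w \<in> W" "?h v = ?h w"
    have "v = ppart P v * ppart (\<lambda>p. \<not> P p) v" "w = ppart P w * ppart (\<lambda>p. \<not> P p) w"
      using vw(1,2) assms(3) by (simp_all add: ppart_mult_compl)
    then show "v = w" using vw(3) by (metis prod.inject)
  qed
  have "(\<Sum>v\<in>W. F (ppart P v) * G (ppart (\<lambda>p. \<not> P p) v)) = (\<Sum>(a, b)\<in>?h ` W. F a * G b)"
    by (simp add: sum.reindex[OF inj])
  also have "\<dots> \<le> (\<Sum>(a, b)\<in>X \<times> Y. F a * G b)"
    using assms by (intro sum_mono2) (auto intro!: mult_nonneg_nonneg)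
  also have "\<dots> = (\<Sum>a\<in>X. F a) * (\<Sum>b\<in>Y. G b)"
    by (simp add: sum_product sum.cartesian_product)
  finally show ?thesis .
qed

subsection \<open>Growth and regularity of the summatory function of the weight\<close>

text \<open>The bound 4 counts the exclusions that pile up later: the \<open>q\<close> whose sum is
  studied on its own, a prime \<open>p\<close> by which that sum is shifted, a small prime that
  gives slow variation of the result, and a second small prime in the proof of the sharp
  share.\<close>

definition few_primes :: "nat set \<Rightarrow> bool" where
  "few_primes M \<longleftrightarrow> finite M \<and> card M \<le> 4 \<and> (\<forall>q\<in>M. prime q)"

lemma few_primesD:
  assumes "few_primes M"
  shows "finite M" "card M \<le> 4" "q \<in> M \<Longrightarrow> prime q"
  using assms by (auto simp: few_primes_def)

lemma ln_le_of_le_exp: "0 < x \<Longrightarrow> x \<le> exp y \<Longrightarrow> ln x \<le> (y::real)"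
  by (metis ln_exp ln_le_cancel_iff exp_gt_zero)

section \<open>Prime powers in logarithmic windows\<close>

lemma card_nat_interval_le:
  assumes "a \<le> b"
  shows "finite {j::nat. a < real j \<and> real j \<le> b}"
    "real (card {j::nat. a < real j \<and> real j \<le> b}) \<le> b - a + 1"
proof -
  have sub: "{j::nat. a < real j \<and> real j \<le> b} \<subseteq> nat ` {\<lfloor>a\<rfloor>+1..\<lfloor>b\<rfloor>}"
  proof
    fix j :: nat assume "j \<in> {j. a < real j \<and> real j \<le> b}"
    then have "int j \<in> {\<lfloor>a\<rfloor>+1..\<lfloor>b\<rfloor>}" by (auto simp: le_floor_iff floor_less_iff add1_zle_eq)
    then show "j \<in> nat ` {\<lfloor>a\<rfloor>+1..\<lfloor>b\<rfloor>}" by (metis image_eqI nat_int)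
  qed
  show "finite {j::nat. a < real j \<and> real j \<le> b}"
    by (rule finite_subset[OF sub]) auto
  have "card {j::nat. a < real j \<and> real j \<le> b} \<le> card (nat ` {\<lfloor>a\<rfloor>+1..\<lfloor>b\<rfloor>})"
    by (rule card_mono[OF _ sub]) auto
  also have "\<dots> \<le> card {\<lfloor>a\<rfloor>+1..\<lfloor>b\<rfloor>}" by (rule card_image_le) auto
  also have "\<dots> = nat (\<lfloor>b\<rfloor> - \<lfloor>a\<rfloor>)" by simp
  finally have "real (card {j::nat. a < real j \<and> real j \<le> b}) \<le> real (nat (\<lfloor>b\<rfloor> - \<lfloor>a\<rfloor>))" by simp
  also have "\<dots> = real_of_int (\<lfloor>b\<rfloor> - \<lfloor>a\<rfloor>)" using assms by (simp add: floor_mono)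
  also have "\<dots> \<le> b - a + 1" by linarith
  finally show "real (card {j::nat. a < real j \<and> real j \<le> b}) \<le> b - a + 1" .
qed

lemma card_nat_interval_ge:
  assumes "0 \<le> a" "a \<le> b"
  shows "real (card {j::nat. a < real j \<and> real j \<le> b}) \<ge> b - a - 1"
proof -
  have "nat ` {\<lfloor>a\<rfloor>+1..\<lfloor>b\<rfloor>} \<subseteq> {j::nat. a < real j \<and> real j \<le> b}"
  proof
    fix j assume "j \<in> nat ` {\<lfloor>a\<rfloor>+1..\<lfloor>b\<rfloor>}"
    then obtain i where i: "i \<ge> \<lfloor>a\<rfloor> + 1" "i \<le> \<lfloor>b\<rfloor>" "j = nat i" by auto
    have "i \<ge> 0" using i(1) assms by (smt (verit) zero_le_floor)
    moreover have "a < real_of_int i" "real_of_int i \<le> b" using i by linarith+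
    ultimately show "j \<in> {j::nat. a < real j \<and> real j \<le> b}" using i(3) by simp
  qed
  then have "card (nat ` {\<lfloor>a\<rfloor>+1..\<lfloor>b\<rfloor>}) \<le> card {j::nat. a < real j \<and> real j \<le> b}"
    by (intro card_mono card_nat_interval_le assms)
  moreover have "inj_on nat {\<lfloor>a\<rfloor>+1..\<lfloor>b\<rfloor>}"
  proof (rule inj_onI)
    fix x y assume xy: "x \<in> {\<lfloor>a\<rfloor>+1..\<lfloor>b\<rfloor>}" "y \<in> {\<lfloor>a\<rfloor>+1..\<lfloor>b\<rfloor>}" "nat x = nat y"
    have "\<lfloor>a\<rfloor> \<ge> 0" using assms by simp
    then have "x \<ge> 0" "y \<ge> 0" using xy(1,2) unfolding atLeastAtMost_iff by linarith+
    then show "x = y" using xy(3) by simp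
  qed
  ultimately have "nat (\<lfloor>b\<rfloor> - \<lfloor>a\<rfloor>) \<le> card {j::nat. a < real j \<and> real j \<le> b}"
    by (simp add: card_image)
  then have "real (nat (\<lfloor>b\<rfloor> - \<lfloor>a\<rfloor>)) \<le> real (card {j::nat. a < real j \<and> real j \<le> b})" by simp
  moreover have "real (nat (\<lfloor>b\<rfloor> - \<lfloor>a\<rfloor>)) = real_of_int (\<lfloor>b\<rfloor> - \<lfloor>a\<rfloor>)" using assms by (simp add: floor_mono)
  ultimately show ?thesis by linarith
qed

lemma power_window_eq:
  assumes "prime p" "w > 0"
  shows "{j. exp s < real (p ^ j * w) \<and> real (p ^ j * w) \<le> exp (s + h)} =
    {j. (s - ln (real w)) / ln (real p) < real j \<and> real j \<le> (s - ln (real w)) / ln (real p) + h / ln (real p)}"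
proof -
  have p: "ln (real p) > 0" "real p > 0" using prime_gt_1_nat[OF assms(1)] by auto
  have l: "real (p ^ j * w) = exp (real j * ln (real p) + ln (real w))" for j
    using p assms(2) by (simp add: exp_add exp_of_nat_mult)
  show ?thesis
    unfolding l using p by (simp add: field_simps)
qed

lemma card_power_window_le:
  assumes "prime p" "w > 0" "h \<ge> 0"
  shows "real (card {j. j \<ge> 1 \<and> exp s < real (p ^ j * w) \<and> real (p ^ j * w) \<le> exp (s + h)}) \<le> h / ln (real p) + 1"
proof -
  let ?a = "(s - ln (real w)) / ln (real p)"
  have p: "ln (real p) > 0" using prime_gt_1_nat[OF assms(1)] by auto
  have ab: "?a \<le> ?a + h / ln (real p)" using p assms by simp
  have "card {j. j \<ge> 1 \<and> exp s < real (p ^ j * w) \<and> real (p ^ j * w) \<le> exp (s + h)} \<le>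
      card {j::nat. ?a < real j \<and> real j \<le> ?a + h / ln (real p)}"
  proof (rule card_mono[OF card_nat_interval_le(1)[OF ab]])
    have "{j. j \<ge> 1 \<and> exp s < real (p ^ j * w) \<and> real (p ^ j * w) \<le> exp (s + h)} \<subseteq>
        {j. exp s < real (p ^ j * w) \<and> real (p ^ j * w) \<le> exp (s + h)}" by blast
    then show "{j. j \<ge> 1 \<and> exp s < real (p ^ j * w) \<and> real (p ^ j * w) \<le> exp (s + h)} \<subseteq>
        {j::nat. ?a < real j \<and> real j \<le> ?a + h / ln (real p)}"
      unfolding power_window_eq[OF assms(1,2)] .
  qed
  then show ?thesis using card_nat_interval_le(2)[OF ab] by linarith
qed

lemma card_power_window_ge:
  assumes "prime p" "w > 0" "h \<ge> 0" "real w \<le> exp s"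
  shows "real (card {j. j \<ge> 1 \<and> exp s < real (p ^ j * w) \<and> real (p ^ j * w) \<le> exp (s + h)}) \<ge> h / ln (real p) - 1"
proof -
  let ?a = "(s - ln (real w)) / ln (real p)"
  have p: "ln (real p) > 0" using prime_gt_1_nat[OF assms(1)] by auto
  have ab: "?a \<le> ?a + h / ln (real p)" using p assms by simp
  have "ln (real w) \<le> s" using assms by (metis ln_exp ln_le_cancel_iff of_nat_0_less_iff exp_gt_zero)
  then have a: "?a \<ge> 0" using p by simp
  \<comment> \<open>As \<open>w\<close> does not exceed the left end, \<open>j = 0\<close> is never
    in the window and the condition \<open>j \<ge> 1\<close> costs nothing.\<close>
  have "{j. j \<ge> 1 \<and> exp s < real (p ^ j * w) \<and> real (p ^ j * w) \<le> exp (s + h)} =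
      {j. exp s < real (p ^ j * w) \<and> real (p ^ j * w) \<le> exp (s + h)}"
    using assms(4) by (auto simp: Suc_le_eq intro!: Nat.gr0I)
  then show ?thesis
    using card_nat_interval_ge[OF a ab] by (simp only: power_window_eq[OF assms(1,2)])
qed

lemma prime_power_mult_inject:
  assumes "prime (p::nat)" "\<not> p dvd w" "\<not> p dvd w'" "p ^ j * w = p ^ i * w'"
  shows "j = i \<and> w = w'"
proof -
  have aux: "j \<ge> i" if "p ^ j * w = p ^ i * w'" "\<not> p dvd w" for j i w w'
  proof (rule ccontr)
    assume "\<not> j \<ge> i"
    then have "p ^ i = p ^ j * p ^ (i - j)" by (simp flip: power_add)
    then have "p ^ j * w = p ^ j * (p ^ (i - j) * w')" using that by (simp only: mult.assoc)
    then have "w = p ^ (i - j) * w'" using prime_gt_0_nat[OF assms(1)] by simp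
    then show False using that \<open>\<not> j \<ge> i\<close> by simp
  qed
  have "j = i" using aux[of j w i w'] aux[of i w' j w] assms by simp
  then show ?thesis using assms prime_gt_0_nat[OF assms(1)] by simp
qed

text \<open>A number \<open>w\<close> prime to \<open>p\<close> is replaced by its
  \<open>p + 1\<close> multiples \<open>p ^ j * w\<close>, \<open>1 \<le> j \<le> p + 1\<close>,
  each of weight \<open>fpsi w / (p + 1)\<close>; the margin \<open>U\<close> leaves room for them.
  So the numbers prime to \<open>p\<close> and those divisible by \<open>p\<close> below
  \<open>exp (T - U)\<close> are each outweighed by the multiples of \<open>p\<close> below
  \<open>exp T\<close>.\<close>

lemma multiples_sum_ge:
  assumes p: "prime p" "p \<notin> M" and M: "\<And>q. q \<in> M \<Longrightarrow> prime q"
    and U: "U \<ge> (real p + 2) * ln (real p)"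
  shows "(\<Sum>v | (v \<in> avoiding M \<and> p dvd v) \<and> real v \<le> exp T. fpsi v) \<ge> psum M (exp (T - U)) / 2"
proof -
  have lnp: "ln (real p) > 0" using prime_gt_1_nat[OF p(1)] by auto
  have U0: "U \<ge> 0" using U lnp by (smt (verit) mult_nonneg_nonneg of_nat_0_le_iff)
  let ?Dset = "{v. (v \<in> avoiding M \<and> p dvd v) \<and> real v \<le> exp T}"
  let ?D = "\<Sum>v\<in>?Dset. fpsi v"
  define B0 where "B0 = {w. (w \<in> avoiding M \<and> \<not> p dvd w) \<and> real w \<le> exp (T - U)}"
  define B1 where "B1 = {w. (w \<in> avoiding M \<and> p dvd w) \<and> real w \<le> exp (T - U)}"
  have fin: "finite B0" "finite B1" by (auto simp: B0_def B1_def)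
  have "{w. w \<in> avoiding M \<and> real w \<le> exp (T - U)} = B0 \<union> B1" by (auto simp: B0_def B1_def)
  then have split: "psum M (exp (T - U)) = (\<Sum>w\<in>B0. fpsi w) + (\<Sum>w\<in>B1. fpsi w)"
    unfolding psum_def using fin by (simp only:) (subst sum.union_disjoint, auto simp: B0_def B1_def)
  have d: "(\<Sum>w\<in>B1. fpsi w) \<le> ?D"
    using U0 by (intro sum_mono2) (auto simp: B1_def elim: order.trans)
  define J where "J = p + 1"
  have "(\<Sum>w\<in>B0. fpsi w) = (\<Sum>w\<in>B0. \<Sum>j\<in>{1..J}. fpsi w / (real p + 1))"
    by (intro sum.cong refl) (simp add: J_def field_simps)
  also have "\<dots> = (\<Sum>(w, j)\<in>B0 \<times> {1..J}. fpsi w / (real p + 1))"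
    by (rule sum.cartesian_product)
  also have "\<dots> = (\<Sum>(w, j)\<in>B0 \<times> {1..J}. fpsi (p ^ j * w))"
  proof (intro sum.cong refl, clarify)
    fix w j assume "w \<in> B0" "j \<in> {1..J}"
    then show "fpsi w / (real p + 1) = fpsi (p ^ j * w)"
      using fpsi_prime_power_mult[OF p(1), of w j] fpsi_prime_mult[OF p(1), of w]
      by (auto simp: B0_def avoiding_def)
  qed
  also have "\<dots> = (\<Sum>v\<in>(\<lambda>(w, j). p ^ j * w) ` (B0 \<times> {1..J}). fpsi v)"
  proof (subst sum.reindex)
    show "inj_on (\<lambda>(w, j). p ^ j * w) (B0 \<times> {1..J})"
    proof (rule inj_onI, clarify)
      fix w j w' i assume "w \<in> B0" "w' \<in> B0" "p ^ j * w = p ^ i * w'"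
      then show "w = w' \<and> j = i"
        using prime_power_mult_inject[OF p(1), of w w' j i] by (simp add: B0_def)
    qed
  qed (simp add: case_prod_unfold)
  also have "\<dots> \<le> ?D"
  proof (rule sum_mono2)
    show "(\<lambda>(w, j). p ^ j * w) ` (B0 \<times> {1..J}) \<subseteq> ?Dset"
    proof safe
      fix w j assume w: "w \<in> B0" and j: "j \<in> {1..J}"
      show "p ^ j * w \<in> avoiding M"
        using w avoiding_prime_power_mult[OF p M] by (simp add: B0_def)
      show "p dvd p ^ j * w" using j by (simp add: dvd_mult2)
      have "real j * ln (real p) \<le> U"
        using j U lnp by (smt (verit) J_def atLeastAtMost_iff mult_right_mono of_nat_1 of_nat_add of_nat_mono)
      then have "real p ^ j \<le> exp U"
        using prime_gt_0_nat[OF p(1)] by (metis exp_le_cancel_iff exp_ln exp_of_nat_mult of_nat_0_less_iff)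
      then have "real p ^ j * real w \<le> exp U * exp (T - U)"
        using w by (intro mult_mono) (auto simp: B0_def)
      then show "real (p ^ j * w) \<le> exp T" by (simp flip: exp_add)
    qed
  qed auto
  finally show ?thesis using split d by simp
qed

text \<open>Weigh the \<open>v\<close> in the window \<open>(exp T, exp (T + U)]\<close> by the
  logarithm of their part composed of primes up to \<open>y\<close>. That logarithm is at most
  \<open>T + U\<close>. On the other hand each such \<open>p\<close> contributes at least
  \<open>U / 4\<close> times \<open>psum M (exp (T - U))\<close>: the multiples of \<open>p\<close>
  below \<open>exp T\<close> carry half of that sum, and each of them has at least
  \<open>U / (2 * ln p)\<close> multiples by powers of \<open>p\<close> in the window. With enough
  primes, the window must outweigh \<open>psum M (exp (T - U))\<close>.\<close>

lemma psum_growth_step: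
  "\<forall>\<^sub>F T in at_top. \<forall>M. few_primes M \<longrightarrow>
    2 * psum M (exp (T - T powr (11/20))) \<le> psum M (exp (T + T powr (11/20)))"
proof -
  define U where "U T = T powr (11/20)" for T :: real
  \<comment> \<open>Chosen so that \<open>(p + 2) * ln p \<le> U / 2\<close> for all
    \<open>p\<close> up to \<open>y\<close>.\<close>
  define y where "y T = U T / (8 * ln (U T))" for T :: real
  have "filterlim y at_top at_top" unfolding y_def U_def by real_asymp
  then have "\<forall>\<^sub>F T in at_top. real (card {p::nat. prime p \<and> real p \<le> y T}) \<ge> y T / (2 * ln (y T))"
    using eventually_card_primes_ge unfolding filterlim_iff by blast
  \<comment> \<open>Up to powers of \<open>ln T\<close> the left side is the square of
    \<open>U T\<close>, so any exponent above \<open>1 / 2\<close> in \<open>U\<close> would do; the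
    4 accounts for the primes in \<open>M\<close>.\<close>
  moreover have "\<forall>\<^sub>F T in at_top. U T * (y T / (2 * ln (y T)) - 4) / 4 \<ge> T + U T"
    unfolding y_def U_def by real_asymp
  moreover have "\<forall>\<^sub>F T in at_top. y T \<le> U T \<and> U T > exp 1 \<and> y T \<ge> 2 \<and> T > 0"
    unfolding y_def U_def by (intro eventually_conj; real_asymp)
  ultimately show ?thesis
  proof eventually_elim
    case (elim T)
    show ?case
    proof (intro allI impI)
      fix M assume "few_primes M"
      note M = few_primesD[OF this]
      let ?U = "U T"
      define P where "P = {p::nat. prime p \<and> real p \<le> y T} - M"
      have finP: "finite P" by (simp add: P_def)
      have P: "prime p" "p \<notin> M" "real p \<le> y T" if "p \<in> P" for p
        using that by (auto simp: P_def)
      have "card {p::nat. prime p \<and> real p \<le> y T} \<le> card P + card M"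
        using M(1) finP by (intro order.trans[OF card_mono card_Un_le]) (auto simp: P_def)
      then have cardP: "real (card P) \<ge> y T / (2 * ln (y T)) - 4"
        using elim(1) M(2) by linarith
      have U0: "?U > 0" using elim by (simp add: U_def)
      have "exp 1 > (1::real)" by simp
      then have "?U > 1" using elim by linarith
      then have lnU: "ln ?U > 0" by simp
      have plnp: "(real p + 2) * ln (real p) \<le> ?U / 2" if "p \<in> P" for p
      proof -
        have p2: "real p \<ge> 2" using P(1)[OF that] prime_ge_2_nat[of p] by auto
        have "(real p + 2) * ln (real p) \<le> (2 * y T) * ln ?U"
          using p2 P(3)[OF that] elim(3) by (intro mult_mono) auto
        also have "\<dots> = ?U / 4" using lnU by (simp add: y_def)
        also have "\<dots> \<le> ?U / 2" using U0 by simp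
        finally show ?thesis .
      qed
      let ?a = "psum M (exp (T - ?U))"
      define W where "W = {v. v \<in> avoiding M \<and> exp T < real v \<and> real v \<le> exp (T + ?U)}"
      have finW: "finite W" by (simp add: W_def)
      have Wpos: "v > 0" if "v \<in> W" for v using that by (auto simp: W_def avoiding_def)
      have lower: "(\<Sum>v\<in>W. real (multiplicity p v) * fpsi v) * ln (real p) \<ge> ?U / 2 * (?a / 2)"
        if p: "p \<in> P" for p
      proof -
        have lnp: "ln (real p) > 0" using prime_gt_1_nat[OF P(1)[OF p]] by auto
        have half: "ln (real p) \<le> ?U / 2"
        proof -
          have "1 * ln (real p) \<le> (real p + 2) * ln (real p)" using lnp by (intro mult_right_mono) auto
          then show ?thesis using plnp[OF p] by linarith
        qed
        define X where "X = {w. w \<in> avoiding M \<and> real w \<le> exp (T + ?U)}"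
        define D where "D = {w. (w \<in> avoiding M \<and> p dvd w) \<and> real w \<le> exp T}"
        have "(\<Sum>w\<in>D. fpsi w) \<ge> ?a / 2"
          unfolding D_def using plnp[OF p] U0 by (intro multiples_sum_ge P[OF p] M(3)) auto
        then have "?U / (2 * ln (real p)) * (?a / 2) \<le> ?U / (2 * ln (real p)) * (\<Sum>w\<in>D. fpsi w)"
          using elim lnp by (intro mult_left_mono divide_nonneg_nonneg) (auto simp: U_def)
        also have "\<dots> = (\<Sum>w\<in>D. ?U / (2 * ln (real p)) * fpsi w)" by (simp add: sum_distrib_left)
        also have "\<dots> \<le> (\<Sum>w\<in>D. real (card {j. j \<ge> 1 \<and> p ^ j * w \<in> W}) * fpsi (p * w))"
        proof (rule sum_mono)
          fix w assume w: "w \<in> D"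
          then have w0: "w > 0" "w \<in> avoiding M" "real w \<le> exp T" "p dvd w"
            by (auto simp: D_def avoiding_def)
          have "{j. j \<ge> 1 \<and> p ^ j * w \<in> W} =
              {j. j \<ge> 1 \<and> exp T < real (p ^ j * w) \<and> real (p ^ j * w) \<le> exp (T + ?U)}"
            using avoiding_prime_power_mult[OF P(1,2)[OF p] M(3)] w0 by (auto simp: W_def)
          then have "?U / ln (real p) - 1 \<le> real (card {j. j \<ge> 1 \<and> p ^ j * w \<in> W})"
            using card_power_window_ge[OF P(1)[OF p] w0(1) _ w0(3), of ?U] elim by (simp add: U_def)
          moreover have "?U / (2 * ln (real p)) \<le> ?U / ln (real p) - 1"
            using half lnp by (simp add: field_simps)
          ultimately have "?U / (2 * ln (real p)) \<le> real (card {j. j \<ge> 1 \<and> p ^ j * w \<in> W})" by linarith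
          moreover have "fpsi (p * w) = fpsi w"
            using fpsi_prime_mult[OF P(1)[OF p] w0(1)] w0(4) by simp
          ultimately show "?U / (2 * ln (real p)) * fpsi w \<le>
              real (card {j. j \<ge> 1 \<and> p ^ j * w \<in> W}) * fpsi (p * w)"
            by (simp only:) (intro mult_right_mono fpsi_nonneg)
        qed
        also have "\<dots> \<le> (\<Sum>w\<in>X. real (card {j. j \<ge> 1 \<and> p ^ j * w \<in> W}) * fpsi (p * w))"
          using elim by (intro sum_mono2) (auto simp: X_def D_def U_def elim: order.trans)
        also have "\<dots> = (\<Sum>v\<in>W. real (multiplicity p v) * fpsi v)"
        proof (rule multiplicity_sum_eq[symmetric, OF P(1)[OF p] finW Wpos])
          show "finite X" by (simp add: X_def)
          fix w j assume jw: "j \<ge> 1" "p ^ j * w \<in> W"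
          then have av: "w \<in> avoiding M"
            using avoiding_prime_power_mult[OF P(1,2)[OF p] M(3)] by (auto simp: W_def)
          have "w \<le> p ^ j * w" using prime_gt_0_nat[OF P(1)[OF p]] by simp
          then have "real w \<le> real (p ^ j * w)" by (simp only: of_nat_le_iff)
          moreover have "real (p ^ j * w) \<le> exp (T + ?U)" using jw(2) by (simp only: W_def mem_Collect_eq)
          ultimately show "w \<in> X" using av unfolding X_def by simp
        qed
        finally show ?thesis using lnp by (simp add: field_simps)
      qed
      have "real (card P) * (?U / 2 * (?a / 2)) = (\<Sum>p\<in>P. ?U / 2 * (?a / 2))" by simp
      also have "\<dots> \<le> (\<Sum>p\<in>P. (\<Sum>v\<in>W. real (multiplicity p v) * fpsi v) * ln (real p))"
        by (intro sum_mono lower)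
      also have "\<dots> = (\<Sum>v\<in>W. (\<Sum>p\<in>P. real (multiplicity p v) * ln (real p)) * fpsi v)"
        unfolding sum_distrib_right by (subst sum.swap) (simp add: mult_ac)
      also have "\<dots> \<le> (\<Sum>v\<in>W. (T + ?U) * fpsi v)"
      proof (intro sum_mono mult_right_mono)
        fix v assume v: "v \<in> W"
        have "(\<Sum>p\<in>P. real (multiplicity p v) * ln (real p)) =
            (\<Sum>p | p \<in> prime_factors v \<and> p \<in> P. real (multiplicity p v) * ln (real p))"
          using finP P(1) Wpos[OF v]
          by (intro sum.mono_neutral_right) (auto simp: prime_factors_multiplicity)
        also have "\<dots> = ln (real (ppart (\<lambda>p. p \<in> P) v))" by (simp add: ln_ppart)
        also have "\<dots> \<le> ln (real v)"
          using Wpos[OF v] ppart_pos[of "\<lambda>p. p \<in> P" v] dvd_imp_le[OF ppart_dvd[OF Wpos[OF v]] Wpos[OF v]]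
          by simp
        also have "\<dots> \<le> T + ?U"
          using v Wpos[OF v] by (intro ln_le_of_le_exp) (auto simp: W_def)
        finally show "(\<Sum>p\<in>P. real (multiplicity p v) * ln (real p)) \<le> T + ?U" .
      qed auto
      also have "\<dots> = (T + ?U) * (psum M (exp (T + ?U)) - psum M (exp T))"
        using elim by (subst psum_diff) (auto simp: W_def sum_distrib_left U_def)
      finally have main: "real (card P) * (?U / 2 * (?a / 2)) \<le>
        (T + ?U) * (psum M (exp (T + ?U)) - psum M (exp T))" .
      have a0: "?a \<ge> 0" by (rule psum_nonneg)
      have "(T + ?U) * ?a \<le> (?U * (y T / (2 * ln (y T)) - 4) / 4) * ?a"
        using elim a0 by (intro mult_right_mono) auto
      also have "\<dots> \<le> (?U * real (card P) / 4) * ?a"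
        using cardP U0 a0 by (intro mult_right_mono divide_right_mono mult_left_mono) auto
      also have "\<dots> = real (card P) * (?U / 2 * (?a / 2))" by simp
      also note main
      finally have "?a \<le> psum M (exp (T + ?U)) - psum M (exp T)"
        using elim U0 by (simp add: mult_le_cancel_left)
      moreover have "?a \<le> psum M (exp T)" using U0 by (intro psum_mono) auto
      ultimately show "2 * psum M (exp (T - T powr (11/20))) \<le> psum M (exp (T + T powr (11/20)))"
        by (simp add: U_def)
    qed
  qed
qed

text \<open>The stretch from \<open>(1 - d) * t\<close> to \<open>t\<close> holds about
  \<open>t powr (9/20)\<close> steps of length \<open>2 * t powr (11/20)\<close>, and each doubles
  the sum. The exponent \<open>21/50\<close> lies below \<open>9/20\<close> to absorb constants, and
  above the \<open>2/5\<close> that \<open>psum_rough_part_le\<close> has to beat.\<close>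

lemma psum_growth:
  assumes "0 < d" "d < 1"
  shows "\<forall>\<^sub>F t in at_top. \<forall>M. few_primes M \<longrightarrow>
    psum M (exp ((1 - d) * t)) * exp (t powr (21/50)) \<le> psum M (exp t)"
proof -
  obtain T0 where T0: "\<And>T M. T \<ge> T0 \<Longrightarrow> few_primes M \<Longrightarrow>
      2 * psum M (exp (T - T powr (11/20))) \<le> psum M (exp (T + T powr (11/20)))"
    using psum_growth_step unfolding eventually_at_top_linorder by blast
  have "\<forall>\<^sub>F t in at_top. (1 - d) * t \<ge> T0"
    using assms by real_asymp
  moreover have "\<forall>\<^sub>F t in at_top. (d * t / (2 * t powr (11/20)) - 1) * (2/3) \<ge> t powr (21/50)"
    using assms by real_asymp
  moreover have "\<forall>\<^sub>F t in at_top. t \<ge> (1::real)" by (rule eventually_ge_at_top)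
  ultimately show ?thesis
  proof eventually_elim
    case (elim t)
    show ?case
    proof (intro allI impI)
      fix M assume M: "few_primes M"
      define u where "u = t powr (11/20)"
      have u: "u > 0" using elim by (simp add: u_def)
      have step: "2 * psum M (exp S) \<le> psum M (exp (S + 2 * u))" if "(1 - d) * t \<le> S" "S + u \<le> t" for S
      proof -
        define T where "T = S + u"
        have pos: "(1 - d) * t > 0" using assms elim by simp
        have T: "T \<ge> T0" "T \<le> t" "T > 0" using that u elim pos by (auto simp: T_def)
        have Tu: "T powr (11/20) \<le> u" unfolding u_def using T by (intro powr_mono2) auto
        have "psum M (exp S) \<le> psum M (exp (T - T powr (11/20)))"
          using Tu by (intro psum_mono) (auto simp: T_def)
        moreover have "psum M (exp (T + T powr (11/20))) \<le> psum M (exp (S + 2 * u))"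
          using Tu by (intro psum_mono) (auto simp: T_def)
        ultimately show ?thesis using T0[OF T(1) M] by linarith
      qed
      define n where "n = nat \<lfloor>d * t / (2 * u)\<rfloor>"
      have n: "real n \<le> d * t / (2 * u)" "real n \<ge> d * t / (2 * u) - 1"
        unfolding n_def using assms elim u by auto
      then have n': "2 * u * real n \<le> d * t" using u by (simp add: field_simps)
      have iter: "2 ^ k * psum M (exp ((1 - d) * t)) \<le> psum M (exp ((1 - d) * t + 2 * u * real k))"
        if "k \<le> n" for k
        using that
      proof (induction k)
        case 0
        then show ?case by simp
      next
        case (Suc k)
        have "2 * u * real (Suc k) \<le> 2 * u * real n" using Suc.prems u by (intro mult_left_mono) auto
        then have "(1 - d) * t + 2 * u * real k + u \<le> t"
          using n' u by (simp add: algebra_simps)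
        then have "2 * psum M (exp ((1 - d) * t + 2 * u * real k)) \<le>
            psum M (exp ((1 - d) * t + 2 * u * real k + 2 * u))"
          using u by (intro step) auto
        then show ?case using Suc by (simp add: algebra_simps)
      qed
      have "exp (t powr (21/50)) \<le> exp (real n * ln 2)"
      proof -
        have "t powr (21/50) \<le> (d * t / (2 * u) - 1) * (2/3)" using elim by (simp add: u_def)
        also have "\<dots> \<le> real n * (2/3)" using n by (intro mult_right_mono) auto
        also have "\<dots> \<le> real n * ln 2" using ln2_ge_two_thirds by (intro mult_left_mono) auto
        finally show ?thesis by simp
      qed
      also have "\<dots> = 2 ^ n" by (simp add: exp_of_nat_mult)
      finally have "psum M (exp ((1 - d) * t)) * exp (t powr (21/50)) \<le> psum M (exp ((1 - d) * t)) * 2 ^ n"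
        by (intro mult_left_mono psum_nonneg)
      also have "\<dots> \<le> psum M (exp ((1 - d) * t + 2 * u * real n))"
        using iter[of n] by (simp add: mult.commute)
      also have "\<dots> \<le> psum M (exp t)"
        using n' by (intro psum_mono) (simp add: algebra_simps)
      finally show "psum M (exp ((1 - d) * t)) * exp (t powr (21/50)) \<le> psum M (exp t)" .
    qed
  qed
qed

text \<open>Primes up to \<open>Y = sqrt s\<close> are too few to matter, there being
  \<open>O(sqrt s / ln s)\<close> of them. For the rough part \<open>b\<close>, Rankin's bound shows
  that \<open>z ^ omega b\<close> has mean at most \<open>exp K\<close> relative to the full sum, so
  values of \<open>omega b\<close> beyond \<open>K\<close> are negligible. The choice
  \<open>sg = 1 / sqrt (s * ln s)\<close> balances both terms of \<open>K\<close> at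
  \<open>sqrt (s / ln s)\<close>.\<close>

lemma sum_omega_le:
  "\<forall>\<^sub>F s in at_top. \<forall>M. (\<Sum>v | v \<in> avoiding M \<and> real v \<le> exp s. real (omega v) * fpsi v)
    \<le> 200 * sqrt (s / ln s) * psum M (exp s)"
proof -
  have "\<forall>\<^sub>F s::real in at_top. s \<ge> 4 \<and> ln s \<ge> 1"
    by (intro eventually_conj eventually_ge_at_top) real_asymp
  moreover have "\<forall>\<^sub>F s::real in at_top. 1 \<le> sqrt (s / ln s)" by real_asymp
  ultimately show ?thesis
  proof eventually_elim
    case (elim s)
    show ?case
    proof
      fix M
      define Y where "Y = sqrt s"
      define z where "z = exp (2::real)"
      define sg where "sg = 1 / sqrt (s * ln s)"
      define K where "K = sg * s + 8 * z / (sg * ln Y)"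
      have sg: "sg > 0" using elim by (simp add: sg_def)
      have Y: "Y \<ge> 2" using elim unfolding Y_def by (intro real_le_rsqrt) simp
      have lnY: "ln Y = ln s / 2" using elim by (simp add: Y_def ln_sqrt)
      have z: "z \<le> 9"
      proof -
        have "exp (1::real) ^ 2 \<le> 3 ^ 2" using exp_le by (intro power_mono) auto
        then show ?thesis by (simp add: z_def flip: exp_of_nat_mult)
      qed
      define V where "V = {v. v \<in> avoiding M \<and> real v \<le> exp s}"
      let ?b = "ppart (\<lambda>p. \<not> real p \<le> Y)" and ?a = "ppart (\<lambda>p. real p \<le> Y)"
      have Vpos: "v > 0" if "v \<in> V" for v using that by (simp add: V_def avoiding_def)
      have om: "real (omega v) \<le> 16 * Y / ln Y + real (omega (?b v))" if "v \<in> V" for v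
      proof -
        have "prime_factors v \<subseteq> {p. prime p \<and> real p \<le> Y} \<union> prime_factors (?b v)"
          by (auto simp: prime_factors_ppart)
        then have "omega v \<le> card ({p. prime p \<and> real p \<le> Y} \<union> prime_factors (?b v))"
          by (intro card_mono) auto
        also have "\<dots> \<le> card {p::nat. prime p \<and> real p \<le> Y} + omega (?b v)" by (rule card_Un_le)
        finally show ?thesis using card_primes_le[OF Y] by linarith
      qed
      \<comment> \<open>For \<open>omega b > K\<close> one has
        \<open>omega b \<le> exp (omega b) \<le> exp (2 * omega b - K)\<close>; this dictates
        \<open>z = exp 2\<close>.\<close>
      have ob: "real (omega b) \<le> K + exp (- K) * z ^ omega b" for b :: nat
      proof (cases "real (omega b) \<le> K")
        case True
        then show ?thesis by (smt (verit) exp_gt_zero mult_nonneg_nonneg z_def zero_le_power)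
      next
        case False
        have "real (omega b) \<le> exp (real (omega b))"
          using exp_ge_add_one_self[of "real (omega b)"] by linarith
        also have "\<dots> \<le> exp (- K + 2 * real (omega b))" using False by simp
        also have "\<dots> = exp (- K) * z ^ omega b"
          unfolding exp_add z_def using exp_of_nat_mult[of "omega b" "2::real"] by (simp add: mult.commute)
        finally have "real (omega b) \<le> exp (- K) * z ^ omega b" .
        moreover have "K \<ge> 0" using sg Y elim unfolding K_def z_def by auto
        ultimately show ?thesis by simp
      qed
      have "(\<Sum>v\<in>V. real (omega v) * fpsi v) \<le>
          (\<Sum>v\<in>V. (16 * Y / ln Y + K) * fpsi v + exp (- K) * (fpsi (?a v) * (z ^ omega (?b v) * fpsi (?b v))))"
      proof (rule sum_mono)
        fix v assume v: "v \<in> V"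
        have "real (omega v) * fpsi v \<le> (16 * Y / ln Y + K + exp (- K) * z ^ omega (?b v)) * fpsi v"
          using om[OF v] ob[of "?b v"] by (intro mult_right_mono) auto
        also have "\<dots> = (16 * Y / ln Y + K) * fpsi v + exp (- K) * (z ^ omega (?b v) * fpsi v)"
          by (simp add: algebra_simps)
        finally show "real (omega v) * fpsi v \<le> (16 * Y / ln Y + K) * fpsi v +
            exp (- K) * (fpsi (?a v) * (z ^ omega (?b v) * fpsi (?b v)))"
          using fpsi_ppart_mult[OF Vpos[OF v], of "\<lambda>p. real p \<le> Y"] by (simp add: mult_ac)
      qed
      also have "\<dots> = (16 * Y / ln Y + K) * psum M (exp s) +
          exp (- K) * (\<Sum>v\<in>V. fpsi (?a v) * (z ^ omega (?b v) * fpsi (?b v)))"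
        by (simp only: sum.distrib sum_distrib_left[symmetric] psum_def V_def)
      finally have 1: "(\<Sum>v\<in>V. real (omega v) * fpsi v) \<le> (16 * Y / ln Y + K) * psum M (exp s) +
          exp (- K) * (\<Sum>v\<in>V. fpsi (?a v) * (z ^ omega (?b v) * fpsi (?b v)))" .
      have "(\<Sum>v\<in>V. fpsi (?a v) * (z ^ omega (?b v) * fpsi (?b v))) \<le>
          (\<Sum>a\<in>V. fpsi a) * (\<Sum>b | (b > 0 \<and> (\<forall>p\<in>prime_factors b. real p > Y)) \<and> real b \<le> exp s.
            z ^ omega b * fpsi b)"
      proof (rule sum_ppart_mult_le)
        show "finite V" by (simp add: V_def)
        fix v assume v: "v \<in> V"
        note v0 = Vpos[OF v]
        show "v > 0" by (fact v0)
        have d: "?a v dvd v" "?b v dvd v" using ppart_dvd[OF v0] by auto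
        have "?a v \<le> v" "?b v \<le> v" using d v0 by (auto intro: dvd_imp_le)
        then have le: "real (?a v) \<le> exp s" "real (?b v) \<le> exp s"
          using v unfolding V_def by (auto intro: order.trans[of _ "real v"])
        show "?a v \<in> V"
          using v d(1) le ppart_pos by (auto simp: V_def avoiding_def intro: dvd_trans)
        show "?b v \<in> {b. (b > 0 \<and> (\<forall>p\<in>prime_factors b. real p > Y)) \<and> real b \<le> exp s}"
          using le ppart_pos by (auto simp: prime_factors_ppart)
      qed (auto simp: z_def)
      also have "\<dots> \<le> (\<Sum>a\<in>V. fpsi a) * (exp s powr sg * exp (8 * z / (sg * ln Y)))"
        using sg Y by (intro mult_left_mono rankin_rough_le sum_nonneg) (auto simp: z_def)
      also have "exp s powr sg * exp (8 * z / (sg * ln Y)) = exp K"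
        by (simp add: K_def powr_def exp_add)
      finally have "exp (- K) * (\<Sum>v\<in>V. fpsi (?a v) * (z ^ omega (?b v) * fpsi (?b v))) \<le>
          exp (- K) * ((\<Sum>a\<in>V. fpsi a) * exp K)"
        by (intro mult_left_mono) auto
      with 1 have "(\<Sum>v\<in>V. real (omega v) * fpsi v) \<le> (16 * Y / ln Y + K) * psum M (exp s) +
          exp (- K) * ((\<Sum>a\<in>V. fpsi a) * exp K)" by linarith
      also have "\<dots> = (16 * Y / ln Y + K + 1) * psum M (exp s)"
        by (simp add: exp_minus psum_def V_def algebra_simps)
      also have "\<dots> \<le> (200 * sqrt (s / ln s)) * psum M (exp s)"
      proof (rule mult_right_mono[OF _ psum_nonneg])
        have s0: "s > 0" "ln s > 0" using elim by auto
        have r: "sqrt (s / ln s) = sqrt s / sqrt (ln s)" by (simp add: real_sqrt_divide)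
        have "sqrt (ln s) * sqrt (ln s) = ln s" "sqrt s * sqrt s = s" using s0 by auto
        then have q: "sg * s = sqrt (s / ln s)" "1 / (sg * ln s) = sqrt (s / ln s)"
          unfolding sg_def r real_sqrt_mult using s0 by (auto simp: field_simps)
        have "sqrt (ln s) \<le> ln s"
          using elim by (simp add: sqrt_le_D real_le_lsqrt power2_eq_square mult_le_cancel_left1)
        then have "sqrt s / ln s \<le> sqrt (s / ln s)"
          unfolding r using s0 by (intro divide_left_mono) auto
        then have "16 * Y / ln Y \<le> 32 * sqrt (s / ln s)" unfolding lnY by (simp add: Y_def)
        moreover have "8 * z / (sg * ln Y) = 16 * z * (1 / (sg * ln s))" unfolding lnY by simp
        then have "8 * z / (sg * ln Y) \<le> 16 * 9 * sqrt (s / ln s)"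
          unfolding q(2) using z s0 by (simp add: mult_right_mono)
        ultimately show "16 * Y / ln Y + K + 1 \<le> 200 * sqrt (s / ln s)"
          using elim q(1) unfolding K_def by linarith
      qed
      finally show "(\<Sum>v | v \<in> avoiding M \<and> real v \<le> exp s. real (omega v) * fpsi v)
          \<le> 200 * sqrt (s / ln s) * psum M (exp s)" by (simp add: V_def)
    qed
  qed
qed

section \<open>Regularity of \<open>psum\<close> over short logarithmic windows\<close>

lemma sum_inverse_le_ln:
  assumes "n \<ge> 1"
  shows "(\<Sum>k\<in>{1..n}. 1 / real k) \<le> 1 + ln (real n)"
  using assms
proof (induction n rule: dec_induct)
  case base
  then show ?case by simp
next
  case (step n)
  have n: "real n > 0" using step by simp
  have "1 / real (Suc n) \<le> ln (real (Suc n) / real n)"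
  proof -
    have "ln (real n / real (Suc n)) \<le> real n / real (Suc n) - 1"
      using n by (intro ln_le_minus_one) auto
    also have "\<dots> = - (1 / real (Suc n))" by (simp add: field_simps)
    finally show ?thesis using n by (simp add: ln_div)
  qed
  then have "1 / real (Suc n) \<le> ln (real (Suc n)) - ln (real n)"
    using n by (simp add: ln_div)
  then show ?case using step by simp
qed

text \<open>If the smooth part stays below \<open>exp (t / 3)\<close>, the sum over smooth parts is
  at most \<open>psum M (exp (t / 3))\<close>, smaller than \<open>psum M (exp t)\<close> by the
  factor \<open>exp (- (t powr (21/50)))\<close>. The rough parts, free of primes up to
  \<open>exp (t powr (1/5))\<close>, cost by Rankin only
  \<open>exp (O(t powr (2/5)))\<close>.\<close>

lemma psum_rough_part_le:
  "\<forall>\<^sub>F t in at_top. \<forall>M. few_primes M \<longrightarrow>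
    (\<Sum>v | v \<in> avoiding M \<and> exp t < real v \<and> real v \<le> exp (t + t powr (1/5)) \<and>
        ln (real (ppart (\<lambda>p. real p \<le> exp (t powr (1/5))) v)) < t / 3. fpsi v) \<le> psum M (exp t) / t"
proof -
  have "\<forall>\<^sub>F t in at_top. \<forall>M. few_primes M \<longrightarrow>
      psum M (exp ((1 - 2/3) * t)) * exp (t powr (21/50)) \<le> psum M (exp t)"
    by (rule psum_growth) auto
  moreover have "\<forall>\<^sub>F t::real in at_top. (t + t powr (1/5)) / sqrt (t * t powr (1/5)) +
      8 * sqrt (t * t powr (1/5)) / t powr (1/5) + ln t \<le> t powr (21/50)" by real_asymp
  moreover have "\<forall>\<^sub>F t::real in at_top. t \<ge> 2 \<and> exp (t powr (1/5)) \<ge> 2"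
    by (intro eventually_conj eventually_ge_at_top) real_asymp
  ultimately show ?thesis
  proof eventually_elim
    case (elim t)
    show ?case
    proof (intro allI impI)
      fix M assume M: "few_primes M"
      define h where "h = t powr (1/5)"
      have h: "h > 0" using elim by (simp add: h_def)
      define sg where "sg = 1 / sqrt (t * h)"
      have sg: "sg > 0" using elim h by (simp add: sg_def)
      let ?b = "ppart (\<lambda>p. \<not> real p \<le> exp h)" and ?a = "ppart (\<lambda>p. real p \<le> exp h)"
      define W where "W = {v. v \<in> avoiding M \<and> exp t < real v \<and> real v \<le> exp (t + h) \<and> ln (real (?a v)) < t / 3}"
      have Wpos: "v > 0" if "v \<in> W" for v using that by (simp add: W_def avoiding_def)
      have "(\<Sum>v\<in>W. fpsi v) = (\<Sum>v\<in>W. fpsi (?a v) * (1 ^ omega (?b v) * fpsi (?b v)))"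
        using Wpos fpsi_ppart_mult[of _ "\<lambda>p. real p \<le> exp h"] by (intro sum.cong refl) simp
      also have "\<dots> \<le> (\<Sum>a | a \<in> avoiding M \<and> real a \<le> exp (t / 3). fpsi a) *
          (\<Sum>b | (b > 0 \<and> (\<forall>p\<in>prime_factors b. real p > exp h)) \<and> real b \<le> exp (t + h). 1 ^ omega b * fpsi b)"
      proof (rule sum_ppart_mult_le)
        fix v assume v: "v \<in> W"
        note v0 = Wpos[OF v]
        show "v > 0" by (fact v0)
        have d: "?a v dvd v" "?b v dvd v" using ppart_dvd[OF v0] by auto
        have "?b v \<le> v" using d v0 by (auto intro: dvd_imp_le)
        then have le: "real (?b v) \<le> exp (t + h)"
          using v unfolding W_def by (auto intro: order.trans[of _ "real v"])
        have "ln (real (?a v)) < t / 3" using v by (simp add: W_def)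
        then have "real (?a v) \<le> exp (t / 3)"
          using ppart_pos[of "\<lambda>p. real p \<le> exp h" v]
          by (metis exp_le_cancel_iff exp_ln less_imp_le of_nat_0_less_iff)
        then show "?a v \<in> {a. a \<in> avoiding M \<and> real a \<le> exp (t / 3)}"
          using v d(1) ppart_pos by (auto simp: W_def avoiding_def intro: dvd_trans)
        show "?b v \<in> {b. (b > 0 \<and> (\<forall>p\<in>prime_factors b. real p > exp h)) \<and> real b \<le> exp (t + h)}"
          using le ppart_pos by (auto simp: prime_factors_ppart)
      qed auto
      also have "\<dots> \<le> psum M (exp (t / 3)) * (exp (t + h) powr sg * exp (8 * 1 / (sg * ln (exp h))))"
        unfolding psum_def[symmetric] using sg elim
        by (intro mult_left_mono psum_nonneg rankin_rough_le) (auto simp: h_def)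
      also have "exp (t + h) powr sg * exp (8 * 1 / (sg * ln (exp h))) =
          exp ((t + h) / sqrt (t * h) + 8 * sqrt (t * h) / h)"
        by (simp add: powr_def sg_def flip: exp_add)
      also have "\<dots> \<le> exp (t powr (21/50) - ln t)"
        using elim by (simp add: h_def)
      finally have "(\<Sum>v\<in>W. fpsi v) \<le> psum M (exp (t / 3)) * exp (t powr (21/50) - ln t)"
        by (smt (verit) mult_left_mono psum_nonneg)
      also have "\<dots> = psum M (exp ((1 - 2/3) * t)) * exp (t powr (21/50)) / t"
        using elim by (simp add: exp_diff)
      also have "\<dots> \<le> psum M (exp t) / t"
        using elim M by (intro divide_right_mono) auto
      finally show "(\<Sum>v | v \<in> avoiding M \<and> exp t < real v \<and> real v \<le> exp (t + t powr (1/5)) \<and>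
          ln (real (ppart (\<lambda>p. real p \<le> exp (t powr (1/5))) v)) < t / 3. fpsi v) \<le> psum M (exp t) / t"
        by (simp add: W_def h_def)
    qed
  qed
qed

text \<open>For given \<open>p\<close> and \<open>w\<close>, at most \<open>h / ln p + 1\<close> of
  the \<open>p ^ j * w\<close> lie in the window; times \<open>ln p\<close> this is at most
  \<open>2 * h\<close>. The weight of \<open>p * w\<close> is that of \<open>w\<close> if
  \<open>p\<close> divides \<open>w\<close>, and smaller by \<open>p + 1\<close> otherwise. Summing
  over \<open>p\<close> produces \<open>omega w\<close> from the first case and a harmonic sum, at
  most \<open>h + 1\<close>, from the second.\<close>

lemma psum_smooth_part_le:
  assumes h: "h \<ge> 1" and M: "\<And>q. q \<in> M \<Longrightarrow> prime q"
    and W: "W = {v. v \<in> avoiding M \<and> exp t < real v \<and> real v \<le> exp (t + h)}"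
  shows "(\<Sum>v\<in>W. ln (real (ppart (\<lambda>p. real p \<le> exp h) v)) * fpsi v) \<le>
    2 * h * ((\<Sum>v | v \<in> avoiding M \<and> real v \<le> exp (t + h). real (omega v) * fpsi v) +
      (h + 1) * psum M (exp (t + h)))"
proof -
  define P where "P = {p. (prime p \<and> p \<notin> M) \<and> real p \<le> exp h}"
  define X where "X = {v. v \<in> avoiding M \<and> real v \<le> exp (t + h)}"
  have fin: "finite P" "finite X" "finite W" by (auto simp: P_def X_def W)
  have Wpos: "v > 0" if "v \<in> W" for v using that by (auto simp: W avoiding_def)
  have Xpos: "v > 0" if "v \<in> X" for v using that by (auto simp: X_def avoiding_def)
  have "(\<Sum>v\<in>W. ln (real (ppart (\<lambda>p. real p \<le> exp h) v)) * fpsi v) =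
      (\<Sum>v\<in>W. (\<Sum>p\<in>P. real (multiplicity p v) * ln (real p)) * fpsi v)"
  proof (intro sum.cong refl arg_cong2[where f = times])
    fix v assume v: "v \<in> W"
    have "p \<notin> M" if "p \<in> prime_factors v" for p
      using that v by (auto simp: W avoiding_def prime_factors_dvd)
    then show "ln (real (ppart (\<lambda>p. real p \<le> exp h) v)) = (\<Sum>p\<in>P. real (multiplicity p v) * ln (real p))"
      unfolding ln_ppart using fin Wpos[OF v]
      by (intro sum.mono_neutral_left) (auto simp: prime_factors_multiplicity P_def)
  qed
  also have "\<dots> = (\<Sum>p\<in>P. (\<Sum>v\<in>W. real (multiplicity p v) * fpsi v) * ln (real p))"
    unfolding sum_distrib_right by (subst sum.swap) (simp add: mult_ac)
  also have "\<dots> \<le> (\<Sum>p\<in>P. 2 * h * (\<Sum>w\<in>X. (of_bool (p dvd w) + 1 / (real p + 1)) * fpsi w))"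
  proof (rule sum_mono)
    fix p assume "p \<in> P"
    then have p: "prime p" "p \<notin> M" "real p \<le> exp h" by (auto simp: P_def)
    have lnp: "ln (real p) > 0" using prime_gt_1_nat[OF p(1)] by auto
    have lnph: "ln (real p) \<le> h"
      using p prime_gt_0_nat[OF p(1)] by (intro ln_le_of_le_exp) auto
    have "(\<Sum>v\<in>W. real (multiplicity p v) * fpsi v) =
        (\<Sum>w\<in>X. real (card {j. j \<ge> 1 \<and> p ^ j * w \<in> W}) * fpsi (p * w))"
    proof (rule multiplicity_sum_eq[OF p(1) fin(3) Wpos fin(2)])
      fix w j assume jw: "j \<ge> 1" "p ^ j * w \<in> W"
      then have av: "w \<in> avoiding M"
        using avoiding_prime_power_mult[OF p(1,2) M] by (auto simp: W)
      have "w \<le> p ^ j * w" using prime_gt_0_nat[OF p(1)] by simp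
      then have "real w \<le> real (p ^ j * w)" by (simp only: of_nat_le_iff)
      moreover have "real (p ^ j * w) \<le> exp (t + h)" using jw(2) by (simp only: W mem_Collect_eq)
      ultimately show "w \<in> X" using av unfolding X_def by simp
    qed
    also have "\<dots> \<le> (\<Sum>w\<in>X. (h / ln (real p) + 1) * ((of_bool (p dvd w) + 1 / (real p + 1)) * fpsi w))"
    proof (intro sum_mono mult_mono)
      fix w assume w: "w \<in> X"
      have "{j. j \<ge> 1 \<and> p ^ j * w \<in> W} =
          {j. j \<ge> 1 \<and> exp t < real (p ^ j * w) \<and> real (p ^ j * w) \<le> exp (t + h)}"
        using avoiding_prime_power_mult[OF p(1,2) M] w by (auto simp: W X_def)
      then show "real (card {j. j \<ge> 1 \<and> p ^ j * w \<in> W}) \<le> h / ln (real p) + 1"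
        using card_power_window_le[OF p(1) Xpos[OF w], of h t] h by simp
      show "fpsi (p * w) \<le> (of_bool (p dvd w) + 1 / (real p + 1)) * fpsi w"
        using fpsi_prime_mult[OF p(1) Xpos[OF w]] by (auto simp: algebra_simps)
      show "0 \<le> h / ln (real p) + 1" using h lnp by simp
    qed auto
    finally have "(\<Sum>v\<in>W. real (multiplicity p v) * fpsi v) \<le>
        (h / ln (real p) + 1) * (\<Sum>w\<in>X. (of_bool (p dvd w) + 1 / (real p + 1)) * fpsi w)"
      by (simp only: sum_distrib_left)
    then have "(\<Sum>v\<in>W. real (multiplicity p v) * fpsi v) * ln (real p) \<le>
        (h / ln (real p) + 1) * (\<Sum>w\<in>X. (of_bool (p dvd w) + 1 / (real p + 1)) * fpsi w) * ln (real p)"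
      using lnp by (intro mult_right_mono) auto
    also have "\<dots> = (h + ln (real p)) * (\<Sum>w\<in>X. (of_bool (p dvd w) + 1 / (real p + 1)) * fpsi w)"
      using lnp by (simp add: field_simps)
    also have "\<dots> \<le> 2 * h * (\<Sum>w\<in>X. (of_bool (p dvd w) + 1 / (real p + 1)) * fpsi w)"
      using lnph by (intro mult_right_mono sum_nonneg mult_nonneg_nonneg) auto
    finally show "(\<Sum>v\<in>W. real (multiplicity p v) * fpsi v) * ln (real p) \<le>
        2 * h * (\<Sum>w\<in>X. (of_bool (p dvd w) + 1 / (real p + 1)) * fpsi w)" .
  qed
  also have "\<dots> = 2 * h * (\<Sum>w\<in>X. (\<Sum>p\<in>P. of_bool (p dvd w) + 1 / (real p + 1)) * fpsi w)"
    by (simp only: sum_distrib_left[symmetric] sum_distrib_right sum.swap[of _ X P])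
  also have "\<dots> \<le> 2 * h * (\<Sum>w\<in>X. real (omega w) * fpsi w + (h + 1) * fpsi w)"
  proof (intro mult_left_mono sum_mono)
    fix w assume w: "w \<in> X"
    have "(\<Sum>p\<in>P. of_bool (p dvd w) :: real) = real (card {p \<in> P. p dvd w})"
      using fin by (simp add: of_bool_def sum.If_cases Int_def)
    also have "\<dots> \<le> real (omega w)"
      using Xpos[OF w] by (intro of_nat_mono card_mono) (auto simp: P_def prime_factors_dvd)
    finally have 1: "(\<Sum>p\<in>P. of_bool (p dvd w) :: real) \<le> real (omega w)" .
    define n where "n = nat \<lfloor>exp h\<rfloor>"
    have "exp h \<ge> 1" using h by simp
    then have n: "n \<ge> 1" "real n \<le> exp h" unfolding n_def by linarith+
    have "(\<Sum>p\<in>P. 1 / (real p + 1)) \<le> (\<Sum>p\<in>P. 1 / real p)"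
      by (intro sum_mono frac_le) (auto simp: P_def prime_gt_0_nat)
    also have "\<dots> \<le> (\<Sum>p\<in>{1..n}. 1 / real p)"
    proof (intro sum_mono2)
      show "P \<subseteq> {1..n}" by (auto simp: P_def n_def le_nat_floor prime_gt_0_nat Suc_le_eq)
    qed auto
    also have "\<dots> \<le> 1 + ln (real n)" by (rule sum_inverse_le_ln[OF n(1)])
    also have "ln (real n) \<le> h" using n by (intro ln_le_of_le_exp) auto
    finally have 2: "(\<Sum>p\<in>P. 1 / (real p + 1)) \<le> h + 1" by simp
    have "(\<Sum>p\<in>P. of_bool (p dvd w) + 1 / (real p + 1)) * fpsi w \<le> (real (omega w) + (h + 1)) * fpsi w"
      unfolding sum.distrib using 1 2 by (intro mult_right_mono add_mono) auto
    then show "(\<Sum>p\<in>P. of_bool (p dvd w) + 1 / (real p + 1)) * fpsi w \<le>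
        real (omega w) * fpsi w + (h + 1) * fpsi w"
      by (simp add: algebra_simps)
  qed (use h in auto)
  also have "\<dots> = 2 * h * ((\<Sum>w\<in>X. real (omega w) * fpsi w) + (h + 1) * psum M (exp (t + h)))"
    by (simp only: sum.distrib sum_distrib_left[symmetric] psum_def X_def)
  finally show ?thesis by (simp add: X_def)
qed

text \<open>Apart from the exceptions of \<open>psum_rough_part_le\<close>, a \<open>v\<close> in
  the window has a smooth part whose logarithm is at least \<open>t / 3\<close>. But the weighted
  sum of these logarithms is \<open>O(h * sqrt (t / ln t))\<close> times \<open>psum\<close>, by the
  mean of \<open>omega\<close>; dividing by \<open>t / 3\<close> gives the saving.\<close>

lemma psum_regular:
  "\<exists>C>0. \<forall>\<^sub>F t in at_top. \<forall>M. few_primes M \<longrightarrow>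
    psum M (exp (t + t powr (1/5))) - psum M (exp t) \<le>
      C * t powr (1/5) / sqrt (t * ln t) * psum M (exp t)"
proof (intro exI[of _ "7204::real"] conjI)
  define h where "h t = t powr (1/5)" for t :: real
  have "filterlim (\<lambda>t. t + h t) at_top at_top" unfolding h_def by real_asymp
  then have "\<forall>\<^sub>F t in at_top. \<forall>M. (\<Sum>v | v \<in> avoiding M \<and> real v \<le> exp (t + h t). real (omega v) * fpsi v)
      \<le> 200 * sqrt ((t + h t) / ln (t + h t)) * psum M (exp (t + h t))"
    using sum_omega_le unfolding filterlim_iff by blast
  moreover note psum_rough_part_le
  moreover have "\<forall>\<^sub>F t in at_top. 200 * sqrt ((t + h t) / ln (t + h t)) + (h t + 1) \<le> 300 * sqrt (t / ln t)"
    unfolding h_def by real_asymp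
  moreover have "\<forall>\<^sub>F t in at_top. 3600 * (h t / sqrt (t * ln t)) \<le> 1/2 \<and> 1 / t \<le> h t / sqrt (t * ln t) \<and>
      h t \<ge> 1 \<and> t > 0 \<and> ln t > 0"
    unfolding h_def by (intro eventually_conj; real_asymp)
  ultimately show "\<forall>\<^sub>F t in at_top. \<forall>M. few_primes M \<longrightarrow>
    psum M (exp (t + t powr (1/5))) - psum M (exp t) \<le>
      7204 * t powr (1/5) / sqrt (t * ln t) * psum M (exp t)"
  proof eventually_elim
    case (elim t)
    show ?case
    proof (intro allI impI)
      fix M assume M: "few_primes M"
      define W where "W = {v. v \<in> avoiding M \<and> exp t < real v \<and> real v \<le> exp (t + h t)}"
      define k where "k = h t / sqrt (t * ln t)"
      let ?a = "ppart (\<lambda>p. real p \<le> exp (h t))"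
      define Wa where "Wa = {v \<in> W. ln (real (?a v)) \<ge> t / 3}"
      define Wb where "Wb = {v \<in> W. ln (real (?a v)) < t / 3}"
      have fin: "finite W" by (simp add: W_def)
      have W: "W = Wa \<union> Wb" "Wa \<inter> Wb = {}" by (auto simp: Wa_def Wb_def)
      let ?p = "psum M (exp t)" and ?q = "psum M (exp (t + h t))"
      have sW: "?q - ?p = (\<Sum>v\<in>W. fpsi v)"
        unfolding W_def using elim by (intro psum_diff) auto
      have sWb: "(\<Sum>v\<in>Wb. fpsi v) \<le> ?p / t"
        using elim(2) M by (simp add: Wb_def W_def h_def conj_assoc)
      have "(\<Sum>v\<in>Wa. t / 3 * fpsi v) \<le> (\<Sum>v\<in>Wa. ln (real (?a v)) * fpsi v)"
        by (intro sum_mono mult_right_mono) (auto simp: Wa_def)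
      also have "\<dots> \<le> (\<Sum>v\<in>W. ln (real (?a v)) * fpsi v)"
      proof (intro sum_mono2 fin)
        fix v
        have "real (?a v) \<ge> 1" using ppart_pos[of _ v] by (simp add: Suc_le_eq)
        then show "0 \<le> ln (real (?a v)) * fpsi v" by (intro mult_nonneg_nonneg ln_ge_zero) auto
      qed (auto simp: Wa_def)
      also have "\<dots> \<le> 2 * h t * ((\<Sum>v | v \<in> avoiding M \<and> real v \<le> exp (t + h t). real (omega v) * fpsi v) +
          (h t + 1) * ?q)"
        using elim few_primesD(3)[OF M] by (intro psum_smooth_part_le) (auto simp: W_def)
      also have "\<dots> \<le> 2 * h t * (300 * sqrt (t / ln t) * ?q)"
      proof (intro mult_left_mono)
        have "(\<Sum>v | v \<in> avoiding M \<and> real v \<le> exp (t + h t). real (omega v) * fpsi v) + (h t + 1) * ?q \<le>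
            (200 * sqrt ((t + h t) / ln (t + h t)) + (h t + 1)) * ?q"
          using elim(1) by (simp add: algebra_simps)
        also have "\<dots> \<le> 300 * sqrt (t / ln t) * ?q"
          using elim by (intro mult_right_mono psum_nonneg) auto
        finally show "(\<Sum>v | v \<in> avoiding M \<and> real v \<le> exp (t + h t). real (omega v) * fpsi v) +
            (h t + 1) * ?q \<le> 300 * sqrt (t / ln t) * ?q" .
      qed (use elim in auto)
      finally have "t / 3 * (\<Sum>v\<in>Wa. fpsi v) \<le> 600 * h t * sqrt (t / ln t) * ?q"
        by (simp add: sum_distrib_left)
      then have "(\<Sum>v\<in>Wa. fpsi v) \<le> 1800 * h t * (sqrt (t / ln t) / t) * ?q"
        using elim by (simp add: field_simps)
      also have "sqrt (t / ln t) / t = 1 / sqrt (t * ln t)"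
      proof -
        have "sqrt (t / ln t) / t = sqrt t / t / sqrt (ln t)" by (simp add: real_sqrt_divide)
        also have "sqrt t / t = 1 / sqrt t"
          using elim sqrt_divide_self_eq[of t] by (simp add: inverse_eq_divide)
        finally show ?thesis by (simp add: real_sqrt_mult)
      qed
      finally have sWa: "(\<Sum>v\<in>Wa. fpsi v) \<le> 1800 * k * ?q" by (simp add: k_def)
      have "?q - ?p \<le> 1800 * k * ?q + ?p / t"
        unfolding sW using sWa sWb fin W by (simp add: sum.union_disjoint)
      also have "?p / t \<le> k * ?p"
        using elim mult_right_mono[of "1 / t" k ?p] psum_nonneg[of M "exp t"] by (simp add: k_def)
      finally have 1: "?q - ?p \<le> 1800 * k * (?q - ?p) + 1801 * (k * ?p)" by (simp add: algebra_simps)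
      \<comment> \<open>The sum at the right end \<open>?q\<close> occurs on both sides. Since
        \<open>k\<close> tends to 0, its excess over \<open>?p\<close> is absorbed on the left, at
        the price of a factor 2.\<close>
      have "(1800 * k) * (?q - ?p) \<le> (1/2) * (?q - ?p)"
        using elim psum_mono[of "exp t" "exp (t + h t)" M] by (intro mult_right_mono) (auto simp: k_def)
      with 1 have "?q - ?p \<le> (1/2) * (?q - ?p) + 1801 * (k * ?p)" by linarith
      then have "?q - ?p \<le> 3602 * (k * ?p)" by (simp add: field_simps)
      also have "\<dots> \<le> 7204 * (k * ?p)"
        using elim psum_nonneg[of M "exp t"] by (intro mult_right_mono) (auto simp: k_def)
      finally show "psum M (exp (t + t powr (1/5))) - psum M (exp t) \<le>
          7204 * t powr (1/5) / sqrt (t * ln t) * psum M (exp t)"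
        by (simp add: k_def h_def)
    qed
  qed
qed auto

subsection \<open>Localised sums\<close>

locale kernel =
  fixes a :: real
  assumes a_pos: "a > 0"
begin

text \<open>The two branches are the normalised forms of \<open>n \<le> x\<close> and of the kernel
  condition, both read as bounds on the kernel for a given cofactor; see
  \<open>cofactor_bound_eq\<close>, where \<open>a = th / (1 - th)\<close>.\<close>

definition g :: "real \<Rightarrow> real" where
  "g y = min (1 / y) (y powr a)"

definition H :: "nat set \<Rightarrow> real \<Rightarrow> real" where
  "H M V = infsum (\<lambda>v. g (real v / V) * fpsi v) (avoiding M)"

text \<open>The Lipschitz constant of \<open>ln (g (exp u))\<close> as a function of
  \<open>u\<close>, inherited by \<open>ln (H M (exp t))\<close>.\<close>

definition lip :: real where "lip = max 1 a"

lemma lip_pos: "lip > 0" by (simp add: lip_def)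

lemma g_pos: "y > 0 \<Longrightarrow> g y > 0"
  by (simp add: g_def)

lemma g_nonneg: "y \<ge> 0 \<Longrightarrow> g y \<ge> 0"
  by (simp add: g_def)

lemma g_le_one: "y > 0 \<Longrightarrow> g y \<le> 1"
  using a_pos by (cases "y \<le> 1") (auto simp: g_def min_le_iff_disj powr_le1)

lemma g_le_inverse: "g y \<le> 1 / y"
  by (simp add: g_def)

lemma g_le_powr: "g y \<le> y powr a"
  by (simp add: g_def)

lemma g_eq_powr: "0 < y \<Longrightarrow> y \<le> 1 \<Longrightarrow> g y = y powr a"
proof -
  assume y: "0 < y" "y \<le> 1"
  then have "1 \<le> 1 / y" "y powr a \<le> 1" using a_pos powr_le1[of a y] by auto
  then show ?thesis unfolding g_def by (intro min_absorb2) linarith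
qed

lemma g_eq_inverse: "y \<ge> 1 \<Longrightarrow> g y = 1 / y"
proof -
  assume y: "y \<ge> 1"
  then have "1 / y \<le> 1" "1 \<le> y powr a" using a_pos ge_one_powr_ge_zero[of y a] by auto
  then show ?thesis unfolding g_def by (intro min_absorb1) linarith
qed

text \<open>Brings in a small negative power of \<open>v\<close>, which is what makes
  \<open>rankin_bounded\<close> applicable to error terms.\<close>

lemma g_le_powr_neg:
  assumes "y > 0" "0 \<le> e" "e \<le> 1"
  shows "g y \<le> y powr (- e)"
proof (cases "y \<ge> 1")
  case True
  have "y powr (- 1) \<le> y powr (- e)" using True assms by (intro powr_mono) auto
  then show ?thesis using g_le_inverse[of y] assms by (simp add: powr_neg_one)
next
  case False
  have "1 \<le> y powr (- e)"
    using False assms by (simp add: powr_minus_divide powr_le1)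
  then show ?thesis using g_le_one[of y] assms by simp
qed

lemma g_scale:
  assumes "y > 0" "c \<ge> 1"
  shows "g (c * y) \<le> c powr lip * g y" "g y \<le> c powr lip * g (c * y)"
proof -
  have c: "c powr a \<le> c powr lip" "1 \<le> c powr lip" "c \<le> c powr lip"
    using assms a_pos powr_mono[of 1 lip c] by (auto simp: lip_def intro!: powr_mono ge_one_powr_ge_zero)
  have "1 / (c * y) \<le> c powr lip * (1 / y)"
    using assms c mult_mono[of 1 c 1 "c powr lip"] by (simp add: field_simps)
  moreover have "(c * y) powr a \<le> c powr lip * (y powr a)"
    using assms c by (simp add: powr_mult mult_right_mono)
  ultimately show "g (c * y) \<le> c powr lip * g y"
    unfolding g_def min_mult_distrib_left[of "c powr lip"] by (auto simp: min_le_iff_disj min_def)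
  have "1 / y \<le> c powr lip * (1 / (c * y))"
    using assms c by (simp add: field_simps)
  moreover have "y powr a \<le> c powr lip * ((c * y) powr a)"
  proof -
    have "1 * y powr a \<le> (c powr lip * c powr a) * y powr a"
      using assms c a_pos mult_mono[of 1 "c powr lip" 1 "c powr a"] ge_one_powr_ge_zero[of c a]
      by (intro mult_right_mono) auto
    then show ?thesis using assms by (simp add: powr_mult mult_ac)
  qed
  ultimately show "g y \<le> c powr lip * g (c * y)"
    unfolding g_def by (auto simp: min_def)
qed

lemma summable_H:
  assumes "V > 0"
  shows "(\<lambda>v. g (real v / V) * fpsi v) summable_on (avoiding M)"
proof (rule nonneg_bdd_above_summable_on)
  show "0 \<le> g (real v / V) * fpsi v" for v
    using assms by (intro mult_nonneg_nonneg g_nonneg) auto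
  obtain B where B: "\<And>F. finite F \<Longrightarrow> (\<And>b. b \<in> F \<Longrightarrow> b > 0) \<Longrightarrow>
      (\<Sum>b\<in>F. 1 ^ omega b * real b powr (- 1) * fpsi b) \<le> B"
    by (rule rankin_bounded[of 1 1, OF zero_less_one zero_le_one]) (rule that, blast)
  show "bdd_above (sum (\<lambda>v. g (real v / V) * fpsi v) ` {F. F \<subseteq> avoiding M \<and> finite F})"
  proof (rule bdd_aboveI2)
    fix F assume "F \<in> {F. F \<subseteq> avoiding M \<and> finite F}"
    then have F: "finite F" "\<And>b. b \<in> F \<Longrightarrow> b > 0" by (auto simp: avoiding_def)
    have "(\<Sum>v\<in>F. g (real v / V) * fpsi v) \<le> (\<Sum>v\<in>F. V * (1 ^ omega v * real v powr (- 1) * fpsi v))"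
    proof (rule sum_mono)
      fix v assume v: "v \<in> F"
      have "g (real v / V) * fpsi v \<le> 1 / (real v / V) * fpsi v"
        by (intro mult_right_mono g_le_inverse) auto
      then show "g (real v / V) * fpsi v \<le> V * (1 ^ omega v * real v powr (- 1) * fpsi v)"
        using F(2)[OF v] by (simp add: powr_neg_one)
    qed
    also have "\<dots> \<le> V * B"
      unfolding sum_distrib_left[symmetric] using B[OF F] assms by (intro mult_left_mono) auto
    finally show "(\<Sum>v\<in>F. g (real v / V) * fpsi v) \<le> V * B" .
  qed
qed

lemma H_nonneg: "V > 0 \<Longrightarrow> H M V \<ge> 0"
  unfolding H_def by (intro infsum_nonneg mult_nonneg_nonneg g_nonneg) auto

lemma sum_le_H:
  assumes "V > 0" "finite F" "F \<subseteq> avoiding M"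
  shows "(\<Sum>v\<in>F. g (real v / V) * fpsi v) \<le> H M V"
  unfolding H_def using assms
  by (intro finite_sum_le_infsum summable_H) (auto intro!: mult_nonneg_nonneg g_nonneg)

lemma H_le:
  assumes "V > 0"
    and "\<And>F. finite F \<Longrightarrow> F \<subseteq> avoiding M \<Longrightarrow> (\<Sum>v\<in>F. g (real v / V) * fpsi v) \<le> B"
  shows "H M V \<le> B"
  unfolding H_def using assms by (intro infsum_le_finite_sums summable_H) auto

lemma H_pos:
  assumes "V > 0" "\<And>q. q \<in> M \<Longrightarrow> prime q"
  shows "H M V > 0"
proof -
  have "(\<Sum>v\<in>{Suc 0}. g (real v / V) * fpsi v) \<le> H M V"
    using assms one_mem_avoiding by (intro sum_le_H) auto
  moreover have "g (real (Suc 0) / V) > 0" using assms by (intro g_pos) auto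
  ultimately show ?thesis by simp
qed

lemma H_antimono_set:
  assumes "V > 0" "M \<subseteq> M'"
  shows "H M' V \<le> H M V"
  using assms sum_le_H by (intro H_le) (auto simp: avoiding_def subset_iff)

lemma H_scale:
  assumes "V > 0" "c \<ge> 1"
  shows "H M (c * V) \<le> c powr lip * H M V" "H M V \<le> c powr lip * H M (c * V)"
proof -
  have cV: "c * V > 0" using assms by simp
  show "H M (c * V) \<le> c powr lip * H M V"
  proof (rule H_le[OF cV])
    fix F assume F: "finite F" "F \<subseteq> avoiding M"
    have "(\<Sum>v\<in>F. g (real v / (c * V)) * fpsi v) \<le> (\<Sum>v\<in>F. c powr lip * (g (real v / V) * fpsi v))"
    proof (rule sum_mono)
      fix v assume "v \<in> F"
      then have v: "real v / (c * V) > 0" using F cV by (auto simp: avoiding_def)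
      have eq: "c * (real v / (c * V)) = real v / V" using assms by simp
      show "g (real v / (c * V)) * fpsi v \<le> c powr lip * (g (real v / V) * fpsi v)"
        using g_scale(2)[OF v assms(2)] unfolding eq by (simp add: mult_right_mono flip: mult.assoc)
    qed
    also have "\<dots> \<le> c powr lip * H M V"
      unfolding sum_distrib_left[symmetric] using F assms by (intro mult_left_mono sum_le_H) auto
    finally show "(\<Sum>v\<in>F. g (real v / (c * V)) * fpsi v) \<le> c powr lip * H M V" .
  qed
  show "H M V \<le> c powr lip * H M (c * V)"
  proof (rule H_le[OF assms(1)])
    fix F assume F: "finite F" "F \<subseteq> avoiding M"
    have "(\<Sum>v\<in>F. g (real v / V) * fpsi v) \<le> (\<Sum>v\<in>F. c powr lip * (g (real v / (c * V)) * fpsi v))"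
    proof (rule sum_mono)
      fix v assume "v \<in> F"
      then have v: "real v / (c * V) > 0" using F cV by (auto simp: avoiding_def)
      have eq: "c * (real v / (c * V)) = real v / V" using assms by simp
      show "g (real v / V) * fpsi v \<le> c powr lip * (g (real v / (c * V)) * fpsi v)"
        using g_scale(1)[OF v assms(2)] unfolding eq by (simp add: mult_right_mono flip: mult.assoc)
    qed
    also have "\<dots> \<le> c powr lip * H M (c * V)"
      unfolding sum_distrib_left[symmetric] using F cV by (intro mult_left_mono sum_le_H) auto
    finally show "(\<Sum>v\<in>F. g (real v / V) * fpsi v) \<le> c powr lip * H M (c * V)" .
  qed
qed

text \<open>The multiples of \<open>p\<close> in \<open>avoiding M\<close> are the numbers \<open>p * v\<close> with \<open>v\<close> in \<open>avoiding M\<close>, so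
  scaling by \<open>p\<close> changes the sum only through the numbers prime to \<open>p\<close>.\<close>

lemma H_prime_shift:
  assumes V: "V > 0" and p: "prime p" "p \<notin> M" and M: "\<And>q. q \<in> M \<Longrightarrow> prime q"
  shows "H M (real p * V) = H (insert p M) (real p * V) + H M V - real p / (real p + 1) * H (insert p M) V"
proof -
  have p0: "real p > 0" using prime_gt_0_nat[OF p(1)] by simp
  then have pV: "real p * V > 0" using V by simp
  let ?f = "\<lambda>W v. g (real v / W) * fpsi v"
  have mem: "p * v \<in> avoiding M \<longleftrightarrow> v \<in> avoiding M" for v
    using avoiding_prime_power_mult[OF p M, of 1 v] by simp
  have split: "avoiding M = avoiding (insert p M) \<union> (\<lambda>v. p * v) ` avoiding M"
    using mem by (auto simp: avoiding_insert elim!: dvdE)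
  have disj: "avoiding (insert p M) \<inter> (\<lambda>v. p * v) ` avoiding M = {}"
    by (auto simp: avoiding_insert)
  have inj: "inj_on (\<lambda>v. p * v) (avoiding M)" using p0 by (auto simp: inj_on_def)
  have "H M (real p * V) = infsum (?f (real p * V)) (avoiding (insert p M)) +
      infsum (?f (real p * V)) ((\<lambda>v. p * v) ` avoiding M)"
    unfolding H_def using disj mem
    by (subst split, intro infsum_Un_disjoint summable_on_subset_banach[OF summable_H[OF pV, of M]])
      (auto simp: avoiding_insert)
  also have "infsum (?f (real p * V)) ((\<lambda>v. p * v) ` avoiding M) =
      infsum (?f (real p * V) \<circ> (\<lambda>v. p * v)) (avoiding M)"
    by (rule infsum_reindex[OF inj])
  also have "\<dots> = infsum (\<lambda>v. ?f V v + (- (real p / (real p + 1))) * (if p dvd v then 0 else ?f V v)) (avoiding M)"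
  proof (rule infsum_cong)
    fix v assume "v \<in> avoiding M"
    then have v: "v > 0" by (simp add: avoiding_def)
    show "(?f (real p * V) \<circ> (\<lambda>v. p * v)) v =
        ?f V v + (- (real p / (real p + 1))) * (if p dvd v then 0 else ?f V v)"
    proof (cases "p dvd v")
      case True
      then show ?thesis using p0 fpsi_prime_mult[OF p(1) v] by simp
    next
      case False
      have "1 / (real p + 1) = 1 - real p / (real p + 1)" using p0 by (simp add: field_simps)
      then have "x * (fpsi v / (real p + 1)) = x * fpsi v - real p / (real p + 1) * (x * fpsi v)" for x
        by (metis (no_types, opaque_lifting) left_diff_distrib mult.commute mult.left_commute mult_1 times_divide_eq_left)
      then show ?thesis using False p0 fpsi_prime_mult[OF p(1) v] by simp
    qed
  qed
  also have "\<dots> = infsum (?f V) (avoiding M) +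
      infsum (\<lambda>v. (- (real p / (real p + 1))) * (if p dvd v then 0 else ?f V v)) (avoiding M)"
  proof (intro infsum_add summable_H[OF V] summable_on_cmult_right)
    show "(\<lambda>v. if p dvd v then 0 else ?f V v) summable_on avoiding M"
      by (rule summable_on_comparison_test[OF summable_H[OF V]])
        (use V in \<open>auto intro!: mult_nonneg_nonneg g_nonneg\<close>)
  qed
  also have "infsum (\<lambda>v. (- (real p / (real p + 1))) * (if p dvd v then 0 else ?f V v)) (avoiding M) =
      - (real p / (real p + 1)) * infsum (\<lambda>v. if p dvd v then 0 else ?f V v) (avoiding M)"
    by (rule infsum_cmult_right')
  also have "infsum (\<lambda>v. if p dvd v then 0 else ?f V v) (avoiding M) = infsum (?f V) (avoiding (insert p M))"
    by (rule infsum_cong_neutral) (auto simp: avoiding_insert)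
  finally show ?thesis by (simp add: H_def)
qed

lemma H_prime_shift_le:
  assumes V: "V > 0" and p: "prime p" "p \<notin> M" and M: "\<And>q. q \<in> M \<Longrightarrow> prime q"
  shows "\<bar>H M (real p * V) - H M V\<bar> \<le> H (insert p M) (real p * V) + H (insert p M) V"
proof -
  have "real p * V > 0" using V prime_gt_0_nat[OF p(1)] by simp
  then have nn: "H (insert p M) (real p * V) \<ge> 0" "H (insert p M) V \<ge> 0" using V by (auto intro: H_nonneg)
  have "real p / (real p + 1) * H (insert p M) V \<le> 1 * H (insert p M) V"
    using nn by (intro mult_right_mono) auto
  moreover have "real p / (real p + 1) * H (insert p M) V \<ge> 0" using nn by auto
  ultimately show ?thesis using H_prime_shift[OF V p M] nn by linarith
qed

text \<open>Apply \<open>H_prime_shift\<close> at \<open>V / p\<close>, \<open>V / p ^ 2\<close> and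
  so on: each step leaves a surplus of \<open>1 / (p + 1)\<close> times the sum avoiding
  \<open>p\<close>. If that sum varies little over \<open>J\<close> scales, it is at most about
  \<open>(p + 1) / J\<close> times the full sum.\<close>

lemma H_ge_sum_prime_shifts:
  assumes V: "V > 0" and p: "prime p" "p \<notin> M" and M: "\<And>q. q \<in> M \<Longrightarrow> prime q"
  shows "H M V \<ge> H (insert p M) V + 1 / (real p + 1) * (\<Sum>j\<in>{1..J}. H (insert p M) (V / real p ^ j))"
  using V
proof (induction J arbitrary: V)
  case 0
  then show ?case using H_antimono_set[of V M "insert p M"] by auto
next
  case (Suc J)
  have p0: "real p > 0" using prime_gt_0_nat[OF p(1)] by simp
  let ?h = "\<lambda>j. H (insert p M) (V / real p ^ j)"
  have Vp: "V / real p > 0" using Suc.prems p0 by simp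
  have eq: "H M V = ?h 0 + H M (V / real p) - real p / (real p + 1) * ?h 1"
    using H_prime_shift[OF Vp p M] p0 by simp
  have "H M (V / real p) \<ge> ?h 1 + 1 / (real p + 1) * (\<Sum>j\<in>{1..J}. ?h (Suc j))"
    using Suc.IH[OF Vp] p0 by (simp add: mult.commute)
  moreover have "(\<Sum>j\<in>{1..Suc J}. ?h j) = ?h 1 + (\<Sum>j\<in>{1..J}. ?h (Suc j))"
    by (simp only: sum.atLeast_Suc_atMost[of 1 "Suc J"] sum.atLeast_Suc_atMost_Suc_shift o_def)
  moreover have "real p / (real p + 1) * ?h 1 = ?h 1 - 1 / (real p + 1) * ?h 1"
    using p0 by (simp add: field_simps)
  ultimately show ?case using eq by (simp add: algebra_simps)
qed

text \<open>Each \<open>w \<le> V\<close> prime to \<open>r\<close> is multiplied by the largest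
  power of \<open>r\<close> that keeps it below \<open>V\<close>. It then lies in
  \<open>(V / r, V]\<close>, where the cut-off is at least \<open>r powr (-a)\<close>, and its
  weight drops by at most the factor \<open>r + 1\<close>. Different \<open>w\<close> give different
  products.\<close>

lemma H_ge_psum:
  assumes V: "V > 0" and r: "prime r" "r \<notin> M" and M: "\<And>q. q \<in> M \<Longrightarrow> prime q"
  shows "H M V \<ge> real r powr (- a) / (real r + 1) * psum (insert r M) V"
proof -
  have r1: "real r > 1" using prime_gt_1_nat[OF r(1)] by simp
  define B where "B = {w. w \<in> avoiding (insert r M) \<and> real w \<le> V}"
  have Bpos: "w > 0" "\<not> r dvd w" "w \<in> avoiding M" if "w \<in> B" for w
    using that by (auto simp: B_def avoiding_def)
  have ex: "\<exists>j. V < real r ^ Suc j * real w" if "w \<in> B" for w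
  proof -
    obtain n where "V / real w < real r ^ n" using real_arch_pow[OF r1] by blast
    also have "\<dots> \<le> real r ^ Suc n" using r1 by (intro power_increasing) auto
    finally show ?thesis using Bpos(1)[OF that] by (auto simp: field_simps)
  qed
  define k where "k w = (LEAST j. V < real r ^ Suc j * real w)" for w
  have k1: "V < real r ^ Suc (k w) * real w" if "w \<in> B" for w
    unfolding k_def by (rule LeastI_ex[OF ex[OF that]])
  have k2: "real r ^ k w * real w \<le> V" if "w \<in> B" for w
  proof (cases "k w")
    case 0
    then show ?thesis using that by (simp add: B_def)
  next
    case (Suc i)
    then have "i < k w" by simp
    then show ?thesis using not_less_Least[of i "\<lambda>j. V < real r ^ Suc j * real w"] Suc
      unfolding k_def by simp
  qed
  have inj: "inj_on (\<lambda>w. r ^ k w * w) B"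
    using prime_power_mult_inject[OF r(1)] Bpos by (intro inj_onI) blast
  have "real r powr (- a) / (real r + 1) * psum (insert r M) V =
      (\<Sum>w\<in>B. real r powr (- a) * (fpsi w / (real r + 1)))"
    unfolding psum_def B_def by (simp add: sum_distrib_left)
  also have "\<dots> \<le> (\<Sum>w\<in>B. g (real (r ^ k w * w) / V) * fpsi (r ^ k w * w))"
  proof (intro sum_mono mult_mono)
    fix w assume w: "w \<in> B"
    let ?y = "real (r ^ k w * w) / V"
    have y: "0 < ?y" "?y \<le> 1" using k2[OF w] Bpos(1)[OF w] V r1 by auto
    have "1 / real r \<le> ?y"
      using k1[OF w] V r1 by (simp add: field_simps)
    then have "(1 / real r) powr a \<le> ?y powr a" using a_pos r1 by (intro powr_mono2) auto
    then show "real r powr (- a) \<le> g ?y"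
      using g_eq_powr[OF y] r1 by (simp add: powr_divide powr_minus_divide)
    show "fpsi w / (real r + 1) \<le> fpsi (r ^ k w * w)"
    proof (cases "k w = 0")
      case True
      have "fpsi w * 1 \<le> fpsi w * (real r + 1)" by (intro mult_left_mono) auto
      then show ?thesis using True by (simp add: field_simps)
    next
      case False
      then show ?thesis
        using fpsi_prime_power_mult[OF r(1) Bpos(1)[OF w], of "k w"] fpsi_prime_mult[OF r(1) Bpos(1)[OF w]]
          Bpos(2)[OF w] by simp
    qed
    show "0 \<le> g ?y" using y by (intro g_nonneg) auto
  qed auto
  also have "\<dots> = (\<Sum>v\<in>(\<lambda>w. r ^ k w * w) ` B. g (real v / V) * fpsi v)"
    by (simp only: sum.reindex[OF inj] o_def)
  also have "\<dots> \<le> H M V"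
    using Bpos(3) avoiding_prime_power_mult[OF r M] V by (intro sum_le_H) (auto simp: B_def)
  finally show ?thesis .
qed


text \<open>Split at \<open>2 * V\<close>, where the factor \<open>V / v\<close> halves. The
  constant 3 is reproduced because
  \<open>eta + (1/2) * 3 * eta * (1 + 1/3) = 3 * eta\<close>.\<close>

lemma right_tail_le:
  assumes eta: "0 \<le> eta" "eta \<le> 1/3"
    and reg: "\<And>V. V \<ge> V0 \<Longrightarrow> psum M (2 * V) - psum M V \<le> eta * psum M V"
    and V0: "V0 > 0" "V \<ge> V0" and N: "N \<le> 2 ^ k * V"
  shows "(\<Sum>v | v \<in> avoiding M \<and> V < real v \<and> real v \<le> N. V / real v * fpsi v) \<le> 3 * eta * psum M V"
  using V0(2) N
proof (induction k arbitrary: V)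
  case 0
  have "{v. v \<in> avoiding M \<and> V < real v \<and> real v \<le> N} = {}" using 0 by auto
  moreover have "0 \<le> 3 * eta * psum M V" using eta psum_nonneg[of M V] by simp
  ultimately show ?case by (simp only: sum.empty)
next
  case (Suc k)
  have V: "V > 0" using Suc V0 by simp
  define W1 where "W1 = {v. v \<in> avoiding M \<and> V < real v \<and> real v \<le> 2 * V}"
  define W2 where "W2 = {v. v \<in> avoiding M \<and> 2 * V < real v \<and> real v \<le> N}"
  have fin: "finite W1" "finite W2" by (simp_all add: W1_def W2_def)
  have nn: "0 \<le> V / real v * fpsi v" for v using V by simp
  have 1: "(\<Sum>v | v \<in> avoiding M \<and> V < real v \<and> real v \<le> N. V / real v * fpsi v)
      \<le> (\<Sum>v\<in>W1 \<union> W2. V / real v * fpsi v)"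
    using fin nn by (intro sum_mono2) (auto simp: W1_def W2_def)
  have 2: "(\<Sum>v\<in>W1 \<union> W2. V / real v * fpsi v) =
      (\<Sum>v\<in>W1. V / real v * fpsi v) + (\<Sum>v\<in>W2. V / real v * fpsi v)"
    using fin by (intro sum.union_disjoint) (auto simp: W1_def W2_def)
  have "(\<Sum>v\<in>W1. V / real v * fpsi v) \<le> (\<Sum>v\<in>W1. 1 * fpsi v)"
    using V by (intro sum_mono mult_right_mono) (auto simp: W1_def)
  also have "\<dots> = psum M (2 * V) - psum M V" using V by (subst psum_diff) (auto simp: W1_def)
  also have "\<dots> \<le> eta * psum M V" by (rule reg[OF Suc(2)])
  finally have 3: "(\<Sum>v\<in>W1. V / real v * fpsi v) \<le> eta * psum M V" .
  have "(\<Sum>v\<in>W2. 2 * V / real v * fpsi v) \<le> 3 * eta * psum M (2 * V)"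
    unfolding W2_def using Suc.IH[of "2 * V"] Suc.prems V by (simp add: mult_ac)
  also have "\<dots> \<le> 3 * eta * (psum M V + 1/3 * psum M V)"
  proof (rule mult_left_mono)
    have "eta * psum M V \<le> 1/3 * psum M V" using eta psum_nonneg by (intro mult_right_mono) auto
    then show "psum M (2 * V) \<le> psum M V + 1/3 * psum M V" using reg[OF Suc(2)] by linarith
  qed (use eta in auto)
  also have "(\<Sum>v\<in>W2. 2 * V / real v * fpsi v) = 2 * (\<Sum>v\<in>W2. V / real v * fpsi v)"
    by (simp add: sum_distrib_left mult_ac)
  finally have "(\<Sum>v\<in>W2. V / real v * fpsi v) \<le> 2 * (eta * psum M V)" by (simp add: algebra_simps)
  with 1 2 3 have "(\<Sum>v | v \<in> avoiding M \<and> V < real v \<and> real v \<le> N. V / real v * fpsi v)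
      \<le> 3 * (eta * psum M V)" by linarith
  then show ?case by simp
qed

text \<open>Halving \<open>V\<close> gains \<open>q = 2 powr (-a)\<close>, and
  \<open>eta / (1 - q)\<close> is the fixed point of \<open>x = eta + q * x\<close>. The term
  \<open>q ^ k\<close> pays for the part below \<open>V / 2 ^ k\<close>, where no regularity is
  assumed.\<close>

lemma left_tail_le:
  assumes eta: "0 \<le> eta" and reg: "\<And>V. V \<ge> V0 \<Longrightarrow> psum M (2 * V) - psum M V \<le> eta * psum M V"
    and V0: "V0 > 0" "V \<ge> 2 ^ k * V0"
  shows "(\<Sum>v | v \<in> avoiding M \<and> real v \<le> V. (real v / V) powr a * fpsi v) \<le>
    (eta / (1 - 2 powr (- a)) + (2 powr (- a)) ^ k) * psum M V"
  using V0(2)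
proof (induction k arbitrary: V)
  case 0
  then have V: "V > 0" using V0 by simp
  have q: "2 powr (- a) < (1::real)" using a_pos by (simp add: powr_less_one)
  have "(\<Sum>v | v \<in> avoiding M \<and> real v \<le> V. (real v / V) powr a * fpsi v) \<le>
      (\<Sum>v | v \<in> avoiding M \<and> real v \<le> V. 1 * fpsi v)"
    using a_pos V by (intro sum_mono mult_right_mono powr_le1) auto
  also have "\<dots> = 1 * psum M V" by (simp add: psum_def)
  also have "\<dots> \<le> (eta / (1 - 2 powr (- a)) + (2 powr (- a)) ^ 0) * psum M V"
    using eta q by (intro mult_right_mono psum_nonneg) auto
  finally show ?case .
next
  case (Suc k)
  let ?q = "2 powr (- a)"
  have V: "V > 0" using Suc V0 by (smt (verit) mult_pos_pos zero_less_power)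
  have q: "?q < (1::real)" "?q > 0" using a_pos by (auto simp: powr_less_one)
  define V' where "V' = V / 2"
  have V': "V' > 0" "V' \<ge> 2 ^ k * V0" "V = 2 * V'" using V Suc.prems by (auto simp: V'_def)
  have "2 ^ k * V0 \<ge> 1 * V0" using V0 by (intro mult_right_mono) auto
  then have V'0: "V' \<ge> V0" using V' by linarith
  define W1 where "W1 = {v. v \<in> avoiding M \<and> V' < real v \<and> real v \<le> V}"
  define W2 where "W2 = {v. v \<in> avoiding M \<and> real v \<le> V'}"
  have fin: "finite W1" "finite W2" by (simp_all add: W1_def W2_def)
  have "{v. v \<in> avoiding M \<and> real v \<le> V} = W1 \<union> W2" using V' by (auto simp: W1_def W2_def)
  then have 2: "(\<Sum>v | v \<in> avoiding M \<and> real v \<le> V. (real v / V) powr a * fpsi v) =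
      (\<Sum>v\<in>W1. (real v / V) powr a * fpsi v) + (\<Sum>v\<in>W2. (real v / V) powr a * fpsi v)"
    using fin by (simp only:) (intro sum.union_disjoint, auto simp: W1_def W2_def)
  have "(\<Sum>v\<in>W1. (real v / V) powr a * fpsi v) \<le> (\<Sum>v\<in>W1. 1 * fpsi v)"
    using a_pos V by (intro sum_mono mult_right_mono powr_le1) (auto simp: W1_def)
  also have "\<dots> = psum M (2 * V') - psum M V'" using V' by (subst psum_diff) (auto simp: W1_def)
  also have "\<dots> \<le> eta * psum M V'" by (rule reg[OF V'0])
  finally have 3: "(\<Sum>v\<in>W1. (real v / V) powr a * fpsi v) \<le> eta * psum M V'" .
  have "(\<Sum>v\<in>W2. (real v / V) powr a * fpsi v) = (\<Sum>v\<in>W2. ?q * ((real v / V') powr a * fpsi v))"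
    using V' by (intro sum.cong refl) (simp add: powr_divide powr_mult powr_minus_divide)
  also have "\<dots> = ?q * (\<Sum>v\<in>W2. (real v / V') powr a * fpsi v)" by (simp add: sum_distrib_left)
  also have "\<dots> \<le> ?q * ((eta / (1 - ?q) + ?q ^ k) * psum M V')"
    using Suc.IH[OF V'(2)] q by (intro mult_left_mono) (auto simp: W2_def)
  finally have "(\<Sum>v | v \<in> avoiding M \<and> real v \<le> V. (real v / V) powr a * fpsi v) \<le>
      eta * psum M V' + ?q * ((eta / (1 - ?q) + ?q ^ k) * psum M V')"
    using 2 3 by linarith
  also have "\<dots> = (eta + ?q * (eta / (1 - ?q)) + ?q ^ Suc k) * psum M V'"
    by (simp add: algebra_simps)
  also have "eta + ?q * (eta / (1 - ?q)) = eta / (1 - ?q)"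
    using q a_pos by (simp add: divide_simps) (simp add: algebra_simps)
  also have "(eta / (1 - ?q) + ?q ^ Suc k) * psum M V' \<le> (eta / (1 - ?q) + ?q ^ Suc k) * psum M V"
    using eta q V' by (intro mult_left_mono psum_mono add_nonneg_nonneg) auto
  finally show ?case .
qed

lemma H_le_tails:
  assumes V: "V > 0"
    and right: "\<And>N. (\<Sum>v | v \<in> avoiding M \<and> V < real v \<and> real v \<le> N. V / real v * fpsi v) \<le> R"
    and left: "(\<Sum>v | v \<in> avoiding M \<and> real v \<le> V. (real v / V) powr a * fpsi v) \<le> L"
  shows "H M V \<le> L + R"
proof (rule H_le[OF V])
  fix F assume F: "finite F" "F \<subseteq> avoiding M"
  define N where "N = real (Max (insert 0 F))"
  define W1 where "W1 = {v. v \<in> avoiding M \<and> V < real v \<and> real v \<le> N}"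
  define W2 where "W2 = {v. v \<in> avoiding M \<and> real v \<le> V}"
  have fin: "finite W1" "finite W2" by (simp_all add: W1_def W2_def)
  have sub: "F \<subseteq> W2 \<union> W1" using F by (auto simp: W1_def W2_def N_def not_le)
  have nn: "0 \<le> g (real v / V) * fpsi v" for v using V by (intro mult_nonneg_nonneg g_nonneg) auto
  have "(\<Sum>v\<in>F. g (real v / V) * fpsi v) \<le> (\<Sum>v\<in>W2 \<union> W1. g (real v / V) * fpsi v)"
    using sub fin nn by (intro sum_mono2) auto
  also have "\<dots> = (\<Sum>v\<in>W2. g (real v / V) * fpsi v) + (\<Sum>v\<in>W1. g (real v / V) * fpsi v)"
    using fin by (intro sum.union_disjoint) (auto simp: W1_def W2_def)
  also have "(\<Sum>v\<in>W2. g (real v / V) * fpsi v) \<le> (\<Sum>v\<in>W2. (real v / V) powr a * fpsi v)"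
    by (intro sum_mono mult_right_mono g_le_powr) auto
  also have "\<dots> \<le> L" using left by (simp add: W2_def)
  also have "(\<Sum>v\<in>W1. g (real v / V) * fpsi v) \<le> (\<Sum>v\<in>W1. V / real v * fpsi v)"
    using g_le_inverse[of "real v / V" for v] by (intro sum_mono mult_right_mono) auto
  also have "\<dots> \<le> R" using right by (simp add: W1_def)
  finally show "(\<Sum>v\<in>F. g (real v / V) * fpsi v) \<le> L + R" by simp
qed

text \<open>A doubling has length only \<open>ln 2\<close> on the logarithmic scale, but is bounded
  by the whole window of length \<open>t powr (1/5)\<close>; this waste is why the exponent is
  \<open>1/5 - 1/2 = -3/10\<close> instead of nearly \<open>-1/2\<close>.\<close>

lemma psum_double_le:
  "\<exists>C>0. \<forall>\<^sub>F t in at_top. \<forall>M. few_primes M \<longrightarrow>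
    (\<forall>V\<ge>exp t. psum M (2 * V) - psum M V \<le> C * t powr (-3/10) * psum M V)"
proof -
  obtain C where C: "C > 0" and ev: "\<forall>\<^sub>F t in at_top. \<forall>M. few_primes M \<longrightarrow>
      psum M (exp (t + t powr (1/5))) - psum M (exp t) \<le> C * t powr (1/5) / sqrt (t * ln t) * psum M (exp t)"
    using psum_regular by blast
  have ev2: "\<forall>\<^sub>F t::real in at_top. t powr (1/5) / sqrt (t * ln t) \<le> t powr (-3/10) \<and> t powr (1/5) \<ge> 1 \<and> t > 0"
    by (intro eventually_conj; real_asymp)
  have "\<forall>\<^sub>F t in at_top. (\<forall>M. few_primes M \<longrightarrow>
      psum M (exp (t + t powr (1/5))) - psum M (exp t) \<le> C * t powr (1/5) / sqrt (t * ln t) * psum M (exp t))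
      \<and> (t powr (1/5) / sqrt (t * ln t) \<le> t powr (-3/10) \<and> t powr (1/5) \<ge> 1 \<and> t > 0)"
    by (rule eventually_conj[OF ev ev2])
  then obtain t0 where t0: "\<And>t M. t \<ge> t0 \<Longrightarrow> few_primes M \<Longrightarrow>
      psum M (exp (t + t powr (1/5))) - psum M (exp t) \<le> C * t powr (1/5) / sqrt (t * ln t) * psum M (exp t)"
    "\<And>t. t \<ge> t0 \<Longrightarrow> t powr (1/5) / sqrt (t * ln t) \<le> t powr (-3/10) \<and> t powr (1/5) \<ge> 1 \<and> t > 0"
    unfolding eventually_at_top_linorder by blast
  show ?thesis
  proof (intro exI[of _ C] conjI C, unfold eventually_at_top_linorder, intro exI[of _ t0] allI impI)
    fix t M V assume t: "t \<ge> t0" and M: "few_primes M" and V: "exp t \<le> V"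
    define u where "u = ln V"
    have V0: "V > 0" using V less_le_trans[OF exp_gt_zero V] by simp
    have u: "V = exp u" "u \<ge> t" using V V0 by (auto simp: u_def ln_ge_iff)
    have u0: "u \<ge> t0" using u t by linarith
    note f = t0(2)[OF u0]
    have "ln 2 \<le> u powr (1/5)" using f ln_2_less_1 by linarith
    then have "2 * V \<le> exp (u + u powr (1/5))"
      unfolding u(1) exp_add using exp_le_cancel_iff[of "ln 2" "u powr (1/5)"] by (simp add: mult.commute)
    then have "psum M (2 * V) - psum M V \<le> psum M (exp (u + u powr (1/5))) - psum M (exp u)"
      unfolding u(1) by (intro diff_right_mono psum_mono) auto
    also have "\<dots> \<le> C * (u powr (1/5) / sqrt (u * ln u)) * psum M (exp u)"
      using t0(1)[OF u0 M] by simp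
    also have "\<dots> \<le> C * u powr (-3/10) * psum M (exp u)"
      using f C by (intro mult_right_mono mult_left_mono psum_nonneg) auto
    also have "\<dots> \<le> C * t powr (-3/10) * psum M (exp u)"
      using t0(2)[OF t] u C by (intro mult_right_mono mult_left_mono psum_nonneg powr_mono2') auto
    finally show "psum M (2 * V) - psum M V \<le> C * t powr (-3/10) * psum M V" using u by simp
  qed
qed

text \<open>Both tails are controlled by the relative growth of \<open>psum\<close> under doubling.
  The left tail uses about \<open>t / (2 * ln 2)\<close> halvings, down to
  \<open>exp (t / 2)\<close>, after which \<open>q ^ k\<close> is exponentially small in
  \<open>t\<close>.\<close>

lemma H_le_psum_weak:
  "\<exists>C>0. \<forall>\<^sub>F t in at_top. \<forall>M. few_primes M \<longrightarrow> H M (exp t) \<le> C * t powr (-3/10) * psum M (exp t)"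
proof -
  obtain C where C: "C > 0" and ev: "\<forall>\<^sub>F t in at_top. \<forall>M. few_primes M \<longrightarrow>
      (\<forall>V\<ge>exp t. psum M (2 * V) - psum M V \<le> C * t powr (-3/10) * psum M V)"
    using psum_double_le by blast
  define q :: real where "q = 2 powr (- a)"
  have q: "q < 1" "q > 0" using a_pos by (auto simp: powr_less_one q_def)
  have "filterlim (\<lambda>t::real. t / 2) at_top at_top" by real_asymp
  then have "\<forall>\<^sub>F t in at_top. \<forall>M. few_primes M \<longrightarrow>
      (\<forall>V\<ge>exp (t / 2). psum M (2 * V) - psum M V \<le> C * (t / 2) powr (-3/10) * psum M V)"
    using ev unfolding filterlim_iff by blast
  moreover have "\<forall>\<^sub>F t in at_top. C * (t / 2) powr (-3/10) \<le> 1/3"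
    using C by real_asymp
  moreover have "\<forall>\<^sub>F t in at_top. 2 powr a * exp (- (a * t / 2)) \<le> t powr (-3/10) \<and> t \<ge> 2"
    using a_pos by (intro eventually_conj eventually_ge_at_top) real_asymp
  ultimately have "\<forall>\<^sub>F t in at_top. \<forall>M. few_primes M \<longrightarrow>
      H M (exp t) \<le> (2 * C / (1 - q) + 1 + 6 * C) * t powr (-3/10) * psum M (exp t)"
  proof eventually_elim
    case (elim t)
    show ?case
    proof (intro allI impI)
      fix M assume M: "few_primes M"
      define eta where "eta = C * (t / 2) powr (-3/10)"
      have eta: "0 \<le> eta" "eta \<le> 1/3" using elim C by (auto simp: eta_def)
      have reg: "\<And>V. V \<ge> exp (t / 2) \<Longrightarrow> psum M (2 * V) - psum M V \<le> eta * psum M V"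
        using elim(1) M unfolding eta_def by blast
      define k where "k = nat \<lfloor>t / (2 * ln 2)\<rfloor>"
      have k: "real k \<le> t / (2 * ln 2)" "real k \<ge> t / (2 * ln 2) - 1"
        unfolding k_def using elim by auto
      have "2 ^ k * exp (t / 2) = exp (real k * ln 2 + t / 2)"
        by (simp add: exp_add exp_of_nat_mult)
      also have "\<dots> \<le> exp t" using k(1) by (simp add: field_simps)
      finally have kV: "exp t \<ge> 2 ^ k * exp (t / 2)" .
      have "q ^ k = exp (- (real k * (a * ln 2)))"
        by (simp add: q_def powr_def exp_of_nat_mult[symmetric] mult_ac)
      also have "\<dots> \<le> exp (a * ln 2 - a * t / 2)"
        using mult_right_mono[OF k(2), of "a * ln 2"] a_pos by (simp add: algebra_simps)
      also have "\<dots> = 2 powr a * exp (- (a * t / 2))"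
        by (simp add: powr_def flip: exp_add)
      finally have qk: "q ^ k \<le> t powr (-3/10)" using elim by simp
      have eta2: "eta \<le> 2 * C * t powr (-3/10)"
      proof -
        have "(t / 2) powr (-3/10) = t powr (-3/10) * 2 powr (3/10)"
          using elim by (simp add: powr_divide powr_minus_divide)
        also have "2 powr (3/10) \<le> (2::real) powr 1" by (intro powr_mono) auto
        finally have "(t / 2) powr (-3/10) \<le> t powr (-3/10) * 2"
          by (simp add: mult_left_mono)
        then show ?thesis unfolding eta_def using C by (simp add: mult_left_mono mult_ac)
      qed
      have "H M (exp t) \<le> (eta / (1 - q) + q ^ k) * psum M (exp t) + 3 * eta * psum M (exp t)"
      proof (rule H_le_tails)
        show "(\<Sum>v | v \<in> avoiding M \<and> real v \<le> exp t. (real v / exp t) powr a * fpsi v)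
            \<le> (eta / (1 - q) + q ^ k) * psum M (exp t)"
          unfolding q_def using left_tail_le[OF eta(1) reg exp_gt_zero kV] .
        fix N
        obtain n where "N / exp t < 2 ^ n" using real_arch_pow[of 2] by auto
        then have "N \<le> 2 ^ n * exp t" by (simp add: field_simps)
        moreover have "exp t \<ge> exp (t / 2)" using elim by simp
        ultimately show "(\<Sum>v | v \<in> avoiding M \<and> exp t < real v \<and> real v \<le> N. exp t / real v * fpsi v)
            \<le> 3 * eta * psum M (exp t)"
          using right_tail_le[OF eta reg exp_gt_zero] by blast
      qed auto
      also have "\<dots> = (eta / (1 - q) + q ^ k + 3 * eta) * psum M (exp t)" by (simp add: algebra_simps)
      also have "\<dots> \<le> ((2 * C / (1 - q) + 1 + 6 * C) * t powr (-3/10)) * psum M (exp t)"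
      proof (intro mult_right_mono psum_nonneg)
        have "eta / (1 - q) \<le> 2 * C * t powr (-3/10) / (1 - q)"
          using eta2 q by (intro divide_right_mono) auto
        then show "eta / (1 - q) + q ^ k + 3 * eta \<le> (2 * C / (1 - q) + 1 + 6 * C) * t powr (-3/10)"
          using qk eta2 by (simp add: algebra_simps)
      qed
      finally show "H M (exp t) \<le> (2 * C / (1 - q) + 1 + 6 * C) * t powr (-3/10) * psum M (exp t)" .
    qed
  qed
  moreover have "2 * C / (1 - q) + 1 + 6 * C > 0" using C q by (intro add_pos_pos) auto
  ultimately show ?thesis by blast
qed

end

text \<open>With \<open>t = ln V\<close>, the order of the relative change of \<open>H\<close> under
  a shift by a fixed prime.\<close>

definition sg :: "real \<Rightarrow> real" where
  "sg t = 1 / sqrt (t * ln t)"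

lemma sg_pos: "t > 1 \<Longrightarrow> sg t > 0"
  by (simp add: sg_def)

lemma sg_antimono:
  assumes "1 < t" "t \<le> u"
  shows "sg u \<le> sg t"
proof -
  have "t * ln t \<le> u * ln u" using assms by (intro mult_mono) auto
  then show ?thesis unfolding sg_def using assms by (intro frac_le) auto
qed

text \<open>Steps of length \<open>t powr (1/5)\<close> are chained. Up to
  \<open>t powr (3/10)\<close> the total relative growth stays below 1, so compounding loses only a
  constant factor.\<close>

lemma psum_regular_iterate:
  "\<exists>C>0. \<forall>\<^sub>F t in at_top. \<forall>M l. few_primes M \<longrightarrow> t powr (1/5) \<le> l \<longrightarrow> l \<le> t powr (3/10) \<longrightarrow>
    psum M (exp (t + l)) - psum M (exp t) \<le> C * l * sg t * psum M (exp t)"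
proof -
  obtain C where C: "C > 0" and ev: "\<forall>\<^sub>F t in at_top. \<forall>M. few_primes M \<longrightarrow>
      psum M (exp (t + t powr (1/5))) - psum M (exp t) \<le> C * t powr (1/5) / sqrt (t * ln t) * psum M (exp t)"
    using psum_regular by blast
  then obtain t0 where t0: "\<And>t M. t \<ge> t0 \<Longrightarrow> few_primes M \<Longrightarrow>
      psum M (exp (t + t powr (1/5))) - psum M (exp t) \<le> C * t powr (1/5) / sqrt (t * ln t) * psum M (exp t)"
    unfolding eventually_at_top_linorder by blast
  have "\<forall>\<^sub>F t in at_top. 2 * C * (t powr (3/10) * sg t) \<le> 1"
    unfolding sg_def using C by real_asymp
  then have "\<forall>\<^sub>F t in at_top. 2 * C * (t powr (3/10) * sg t) \<le> 1 \<and> t > 1 \<and> t \<ge> t0"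
    by (intro eventually_conj eventually_gt_at_top eventually_ge_at_top)
  then have "\<forall>\<^sub>F t in at_top. \<forall>M l. few_primes M \<longrightarrow> t powr (1/5) \<le> l \<longrightarrow> l \<le> t powr (3/10) \<longrightarrow>
      psum M (exp (t + l)) - psum M (exp t) \<le> 4 * C * l * sg t * psum M (exp t)"
  proof eventually_elim
    case (elim t)
    show ?case
    proof (intro allI impI)
      fix M l assume M: "few_primes M" and l: "t powr (1/5) \<le> l" "l \<le> t powr (3/10)"
      define h where "h = t powr (1/5)"
      have h: "h > 0" using elim by (simp add: h_def)
      have s0: "sg t > 0" using elim by (intro sg_pos) auto
      define k where "k = C * (h * sg t)"
      have k: "k \<ge> 0" using C h s0 by (simp add: k_def)
      have step: "psum M (exp (u + h)) \<le> (1 + k) * psum M (exp u)" if u: "u \<ge> t" for u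
      proof -
        have u1: "u > 1" using u elim by simp
        \<comment> \<open>In this form the function is visibly decreasing, so that a step starting
          later than \<open>t\<close> costs no more than one at \<open>t\<close>.\<close>
        have eq: "x powr (1/5) * sg x = x powr (-3/10) * (1 / sqrt (ln x))" if "x > 1" for x :: real
        proof -
          have "x powr (1/5) = x powr (-3/10) * x powr (1/2)" by (simp flip: powr_add)
          then show ?thesis using that by (simp add: sg_def real_sqrt_mult powr_half_sqrt)
        qed
        have "u powr (1/5) * sg u \<le> h * sg t"
          unfolding h_def eq[OF u1] eq[OF conjunct1[OF conjunct2[OF elim]]] using u u1 elim
          by (intro mult_mono powr_mono2' divide_left_mono) auto
        then have ks: "C * (u powr (1/5) * sg u) \<le> k" unfolding k_def using C by (intro mult_left_mono) auto
        have "psum M (exp (u + h)) \<le> psum M (exp (u + u powr (1/5)))"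
          unfolding h_def using u elim by (intro psum_mono) (auto intro!: powr_mono2)
        also have "\<dots> \<le> psum M (exp u) + C * (u powr (1/5) * sg u) * psum M (exp u)"
          using t0[of u M] u elim M by (simp add: sg_def)
        also have "\<dots> \<le> psum M (exp u) + k * psum M (exp u)"
          using ks by (intro add_left_mono mult_right_mono psum_nonneg)
        finally show ?thesis by (simp add: algebra_simps)
      qed
      have iter: "psum M (exp (t + real i * h)) \<le> (1 + k) ^ i * psum M (exp t)" for i
      proof (induction i)
        case 0
        then show ?case by simp
      next
        case (Suc i)
        have "psum M (exp (t + real (Suc i) * h)) \<le> (1 + k) * psum M (exp (t + real i * h))"
          using step[of "t + real i * h"] h by (simp add: algebra_simps)
        also have "\<dots> \<le> (1 + k) * ((1 + k) ^ i * psum M (exp t))"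
          using Suc k by (intro mult_left_mono) auto
        finally show ?case by simp
      qed
      define n where "n = nat \<lceil>l / h\<rceil>"
      have lh: "l / h \<ge> 1" using l h by (simp add: h_def)
      have n: "real n \<ge> l / h" "real n \<le> 2 * (l / h)" unfolding n_def using lh by linarith+
      have nh: "real n * h \<ge> l" using n(1) h by (simp add: field_simps)
      define x where "x = 2 * C * l * sg t"
      have "k * real n \<le> k * (2 * (l / h))" using k n by (intro mult_left_mono) auto
      also have "\<dots> = x" using h by (simp add: k_def x_def)
      finally have kn: "k * real n \<le> x" .
      have "l > 0" using l(1) h unfolding h_def by linarith
      then have x0: "x \<ge> 0" using C s0 by (simp add: x_def)
      have "l * sg t \<le> t powr (3/10) * sg t" using l s0 by (intro mult_right_mono) auto
      then have "2 * C * (l * sg t) \<le> 2 * C * (t powr (3/10) * sg t)" using C by (intro mult_left_mono) auto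
      then have x1: "x \<le> 1" using elim by (simp add: x_def mult_ac)
      have "psum M (exp (t + l)) \<le> psum M (exp (t + real n * h))" using nh by (intro psum_mono) auto
      also have "\<dots> \<le> (1 + k) ^ n * psum M (exp t)" by (rule iter)
      also have "(1 + k) ^ n \<le> exp k ^ n" using k by (intro power_mono) auto
      also have "\<dots> = exp (k * real n)" by (simp add: exp_of_nat2_mult)
      also have "\<dots> \<le> exp x" using kn by simp
      also have "\<dots> \<le> 1 + x + x\<^sup>2" using x0 x1 by (rule exp_bound)
      also have "x\<^sup>2 \<le> x" using x0 x1 by (simp add: power2_eq_square mult_left_le)
      finally have "psum M (exp (t + l)) \<le> (1 + x + x) * psum M (exp t)"
        using psum_nonneg by (simp add: mult_right_mono)
      then show "psum M (exp (t + l)) - psum M (exp t) \<le> 4 * C * l * sg t * psum M (exp t)"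
        by (simp add: x_def algebra_simps)
    qed
  qed
  then show ?thesis using C by (intro exI[of _ "4 * C"]) auto
qed

lemma geometric_sum_le:
  fixes q :: real
  assumes "0 \<le> q" "q < 1" "finite A"
  shows "(\<Sum>j\<in>A. q ^ j) \<le> 1 / (1 - q)"
proof -
  have "(\<Sum>j\<in>A. q ^ j) \<le> (\<Sum>j. q ^ j)" using assms by (intro sum_le_suminf summable_geometric) auto
  also have "\<dots> = 1 / (1 - q)" using assms by (intro suminf_geometric) auto
  finally show ?thesis .
qed

lemma geometric_sum_inj_le:
  fixes q :: real and f :: "nat \<Rightarrow> nat"
  assumes "0 \<le> q" "q < 1" "finite A" "inj_on f A"
  shows "(\<Sum>j\<in>A. q ^ f j) \<le> 1 / (1 - q)"
proof -
  have "(\<Sum>j\<in>A. q ^ f j) = (\<Sum>j\<in>f ` A. q ^ j)" using assms(4) by (simp add: sum.reindex)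
  then show ?thesis using geometric_sum_le[of q "f ` A"] assms by simp
qed

lemma infsum_sum_lessThan:
  fixes f :: "nat \<Rightarrow> 'a \<Rightarrow> real"
  assumes "\<And>j. f j summable_on A"
  shows "(\<lambda>v. \<Sum>j<J. f j v) summable_on A" "infsum (\<lambda>v. \<Sum>j<J. f j v) A = (\<Sum>j<J. infsum (f j) A)"
proof -
  have "(\<lambda>v. \<Sum>j<J. f j v) summable_on A \<and> infsum (\<lambda>v. \<Sum>j<J. f j v) A = (\<Sum>j<J. infsum (f j) A)"
    by (induction J) (auto simp: infsum_add assms intro!: summable_on_add)
  then show "(\<lambda>v. \<Sum>j<J. f j v) summable_on A" "infsum (\<lambda>v. \<Sum>j<J. f j v) A = (\<Sum>j<J. infsum (f j) A)"
    by auto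
qed

text \<open>Four of them, so that a set of at most three primes misses one; all are at most 7, which
  makes the constants uniform in the choice.\<close>

definition small_primes :: "nat set" where "small_primes = {2, 3, 5, 7}"

lemma small_primesD:
  assumes "r \<in> small_primes"
  shows "prime r" "2 \<le> r" "r \<le> 7"
  using assms by (auto simp: small_primes_def)

lemma small_prime_notin:
  assumes "finite M" "card M \<le> 3"
  obtains r where "r \<in> small_primes" "r \<notin> M"
proof -
  have "\<not> small_primes \<subseteq> M"
  proof
    assume "small_primes \<subseteq> M"
    then have "card small_primes \<le> card M" using assms by (intro card_mono) auto
    then show False using assms by (simp add: small_primes_def)
  qed
  then show ?thesis using that by blast
qed

section \<open>Averaging the localised sum over powers of a small prime\<close>

context kernel
begin

text \<open>The points \<open>y / r ^ j\<close> form a geometric progression and \<open>g\<close>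
  decays geometrically away from 1 on both sides. The sum is bounded if the progression passes 1,
  and is dominated by its end term nearest to 1 otherwise.\<close>

lemma sum_g_le:
  assumes y: "y > 0" and r: "(r::real) \<ge> 2"
  shows "(\<Sum>j<J. g (y / r ^ j)) \<le>
    (2 + 1 / (1 - 2 powr (- a))) * (of_bool (1 < y \<and> y \<le> r ^ J) + g y + g (y / r ^ J))"
proof -
  define q :: real where "q = 2 powr (- a)"
  have q: "q < 1" "q > 0" using a_pos by (auto simp: powr_less_one q_def)
  have q1: "1 / (1 - q) > 0" using q by simp
  have yJ: "y / r ^ J > 0" using y r by simp
  have gnn: "g y \<ge> 0" "g (y / r ^ J) \<ge> 0" using y yJ by (auto intro!: g_nonneg)
  have rq: "(1 / r ^ i) powr a \<le> q ^ i" for i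
  proof -
    have "(1 / r ^ i) powr a \<le> (1 / 2 ^ i) powr a"
      using r a_pos by (intro powr_mono2 frac_le power_mono) auto
    also have "\<dots> = q ^ i"
      by (simp add: q_def powr_divide powr_minus_divide powr_realpow[symmetric] powr_powr mult.commute power_one_over)
    finally show ?thesis .
  qed
  have rh: "1 / r ^ i \<le> (1/2) ^ i" for i
    using r by (simp add: power_one_over frac_le power_mono)
  consider "y \<le> 1" | "y > r ^ J" | "1 < y" "y \<le> r ^ J" by linarith
  then show ?thesis
  proof cases
    case 1
    have "(\<Sum>j<J. g (y / r ^ j)) \<le> (\<Sum>j<J. g y * q ^ j)"
    proof (rule sum_mono)
      fix j
      have "g (y / r ^ j) \<le> (y / r ^ j) powr a" by (rule g_le_powr)
      also have "\<dots> = y powr a * (1 / r ^ j) powr a" using y r by (simp add: powr_divide)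
      also have "\<dots> \<le> y powr a * q ^ j" using rq by (intro mult_left_mono) auto
      finally show "g (y / r ^ j) \<le> g y * q ^ j" using g_eq_powr[OF y 1] by simp
    qed
    also have "\<dots> = g y * (\<Sum>j<J. q ^ j)" by (simp add: sum_distrib_left)
    also have "\<dots> \<le> g y * (1 / (1 - q))" using q gnn by (intro mult_left_mono geometric_sum_le) auto
    also have "\<dots> \<le> (2 + 1 / (1 - q)) * (of_bool (1 < y \<and> y \<le> r ^ J) + g y + g (y / r ^ J))"
      using gnn q1 by (subst mult.commute, intro mult_mono) auto
    finally show ?thesis by (simp add: q_def)
  next
    case 2
    have ge: "y / r ^ J \<ge> 1" using 2 r by (simp add: field_simps)
    have "(\<Sum>j<J. g (y / r ^ j)) \<le> (\<Sum>j<J. g (y / r ^ J) * (1/2) ^ (J - j))"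
    proof (rule sum_mono)
      fix j assume j: "j \<in> {..<J}"
      have "g (y / r ^ j) \<le> r ^ j / y" using g_le_inverse[of "y / r ^ j"] by simp
      also have "r ^ j / y = r ^ J / y * (1 / r ^ (J - j))"
        using j r by (simp add: power_diff field_simps)
      also have "\<dots> \<le> r ^ J / y * (1/2) ^ (J - j)"
        using r y rh by (intro mult_left_mono) auto
      finally show "g (y / r ^ j) \<le> g (y / r ^ J) * (1/2) ^ (J - j)" using g_eq_inverse[OF ge] by simp
    qed
    also have "\<dots> = g (y / r ^ J) * (\<Sum>j<J. (1/2) ^ (J - j))" by (simp add: sum_distrib_left)
    also have "\<dots> \<le> g (y / r ^ J) * (1 / (1 - 1/2))"
      using gnn by (intro mult_left_mono geometric_sum_inj_le) (auto simp: inj_on_def)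
    also have "\<dots> \<le> (2 + 1 / (1 - q)) * (of_bool (1 < y \<and> y \<le> r ^ J) + g y + g (y / r ^ J))"
      using gnn q1 by (subst mult.commute, intro mult_mono) auto
    finally show ?thesis by (simp add: q_def)
  next
    case 3
    have ex: "\<exists>m. y < r ^ Suc m"
    proof -
      have "r ^ J < r ^ Suc J" using r by (intro power_strict_increasing) auto
      then show ?thesis using 3 by (intro exI[of _ J]) linarith
    qed
    \<comment> \<open>The place of \<open>y\<close> among the powers of \<open>r\<close>: terms with
      \<open>j \<le> m\<close> have argument at least 1 and decay like
      \<open>(1/2) ^ (m - j)\<close>, the later ones like \<open>q ^ (j - Suc m)\<close>.\<close>
    define m where "m = (LEAST m. y < r ^ Suc m)"
    have m1: "y < r ^ Suc m" unfolding m_def by (rule LeastI_ex[OF ex])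
    have m2: "r ^ m \<le> y"
    proof (cases m)
      case 0
      then show ?thesis using 3 by simp
    next
      case (Suc i)
      then show ?thesis using not_less_Least[of i "\<lambda>m. y < r ^ Suc m"] unfolding m_def by simp
    qed
    have "(\<Sum>j<J. g (y / r ^ j)) \<le>
        (\<Sum>j<J. (if j \<le> m then (1/2) ^ (m - j) else 0) + (if m < j then q ^ (j - Suc m) else 0))"
    proof (rule sum_mono)
      fix j
      show "g (y / r ^ j) \<le> (if j \<le> m then (1/2) ^ (m - j) else 0) + (if m < j then q ^ (j - Suc m) else 0)"
      proof (cases "j \<le> m")
        case True
        have "g (y / r ^ j) \<le> r ^ j / y" using g_le_inverse[of "y / r ^ j"] by simp
        also have "\<dots> \<le> r ^ j / r ^ m" using m2 r y by (intro divide_left_mono) auto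
        also have "\<dots> = 1 / r ^ (m - j)" using True r by (simp add: power_diff)
        also have "\<dots> \<le> (1/2) ^ (m - j)" by (rule rh)
        finally show ?thesis using True by simp
      next
        case False
        have "g (y / r ^ j) \<le> (y / r ^ j) powr a" by (rule g_le_powr)
        also have "\<dots> \<le> (r ^ Suc m / r ^ j) powr a"
          using m1 r y a_pos by (intro powr_mono2 divide_right_mono) auto
        also have "r ^ Suc m / r ^ j = 1 / r ^ (j - Suc m)" using False r by (simp add: power_diff)
        also have "(1 / r ^ (j - Suc m)) powr a \<le> q ^ (j - Suc m)" by (rule rq)
        finally show ?thesis using False by simp
      qed
    qed
    also have "\<dots> = (\<Sum>j\<in>{j\<in>{..<J}. j \<le> m}. (1/2) ^ (m - j)) + (\<Sum>j\<in>{j\<in>{..<J}. m < j}. q ^ (j - Suc m))"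
      by (simp add: sum.distrib sum.If_cases Int_def)
    also have "\<dots> \<le> 1 / (1 - 1/2) + 1 / (1 - q)"
      using q by (intro add_mono geometric_sum_inj_le) (auto simp: inj_on_def)
    also have "\<dots> \<le> (2 + 1 / (1 - q)) * 1" by simp
    also have "\<dots> \<le> (2 + 1 / (1 - q)) * (of_bool (1 < y \<and> y \<le> r ^ J) + g y + g (y / r ^ J))"
      using gnn q1 3 by (intro mult_left_mono) auto
    finally show ?thesis by (simp add: q_def)
  qed
qed

text \<open>Adding up dilated cut-offs gives, up to a constant, the indicator of the range between
  \<open>V\<close> and \<open>r ^ J * V\<close> plus two boundary terms. This carries the regularity
  of \<open>psum\<close> in long windows over to an average of \<open>H\<close>.\<close>

lemma H_sum_dilates_le:
  assumes V: "V > 0" and r: "(r::real) \<ge> 2"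
  shows "(\<Sum>j<J. H M (r ^ j * V)) \<le>
    (2 + 1 / (1 - 2 powr (- a))) * (psum M (r ^ J * V) - psum M V + H M V + H M (r ^ J * V))"
proof -
  define K where "K = 2 + 1 / (1 - 2 powr (- a))"
  have K: "K > 0" unfolding K_def using a_pos by (intro add_pos_pos) (auto simp: powr_less_one)
  have rV: "r ^ j * V > 0" for j using V r by simp
  define W where "W = {v. v \<in> avoiding M \<and> V < real v \<and> real v \<le> r ^ J * V}"
  have finW: "finite W" by (simp add: W_def)
  have "V \<le> r ^ J * V" using V r by (simp add: one_le_power)
  then have sW: "psum M (r ^ J * V) - psum M V = (\<Sum>v\<in>W. fpsi v)" unfolding W_def by (rule psum_diff)
  let ?f = "\<lambda>v. (\<Sum>j<J. g (real v / (r ^ j * V)) * fpsi v)"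
  have "(\<Sum>j<J. H M (r ^ j * V)) = infsum ?f (avoiding M)"
    unfolding H_def by (rule infsum_sum_lessThan(2)[symmetric, OF summable_H[OF rV]])
  also have "\<dots> \<le> K * (psum M (r ^ J * V) - psum M V + H M V + H M (r ^ J * V))"
  proof (rule infsum_le_finite_sums)
    show "?f summable_on avoiding M" by (rule infsum_sum_lessThan(1)[OF summable_H[OF rV]])
    fix F assume F: "finite F" "F \<subseteq> avoiding M"
    have "(\<Sum>v\<in>F. ?f v) \<le> (\<Sum>v\<in>F. K * (of_bool (v \<in> W) * fpsi v + g (real v / V) * fpsi v +
        g (real v / (r ^ J * V)) * fpsi v))"
    proof (rule sum_mono)
      fix v assume v: "v \<in> F"
      then have y: "real v / V > 0" using F V by (auto simp: avoiding_def)
      have e: "real v / (r ^ j * V) = (real v / V) / r ^ j" for j by simp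
      have w: "(1 < real v / V \<and> real v / V \<le> r ^ J) = (v \<in> W)"
        using v F V by (auto simp: W_def field_simps)
      have "?f v = (\<Sum>j<J. g ((real v / V) / r ^ j)) * fpsi v"
        unfolding e by (simp add: sum_distrib_right)
      also have "\<dots> \<le> (K * (of_bool (v \<in> W) + g (real v / V) + g ((real v / V) / r ^ J))) * fpsi v"
        using sum_g_le[OF y r, of J] unfolding w K_def by (intro mult_right_mono) auto
      finally show "?f v \<le> K * (of_bool (v \<in> W) * fpsi v + g (real v / V) * fpsi v +
          g (real v / (r ^ J * V)) * fpsi v)"
        unfolding e by (simp add: algebra_simps)
    qed
    also have "\<dots> = K * ((\<Sum>v\<in>F. of_bool (v \<in> W) * fpsi v) + (\<Sum>v\<in>F. g (real v / V) * fpsi v) +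
        (\<Sum>v\<in>F. g (real v / (r ^ J * V)) * fpsi v))"
      by (simp only: sum_distrib_left[symmetric] sum.distrib)
    also have "\<dots> \<le> K * (psum M (r ^ J * V) - psum M V + H M V + H M (r ^ J * V))"
    proof (intro mult_left_mono add_mono sum_le_H V rV F)
      have "(\<Sum>v\<in>F. of_bool (v \<in> W) * fpsi v) = (\<Sum>v\<in>F \<inter> W. fpsi v)"
        unfolding sum.inter_restrict[OF F(1)] by (intro sum.cong) auto
      also have "\<dots> \<le> (\<Sum>v\<in>W. fpsi v)" using finW by (intro sum_mono2) auto
      finally show "(\<Sum>v\<in>F. of_bool (v \<in> W) * fpsi v) \<le> psum M (r ^ J * V) - psum M V" using sW by simp
    qed (use K in auto)
    finally show "(\<Sum>v\<in>F. ?f v) \<le> K * (psum M (r ^ J * V) - psum M V + H M V + H M (r ^ J * V))" .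
  qed
  finally show ?thesis by (simp add: K_def)
qed

text \<open>Taken together, the relative change of \<open>H M\<close> under the shift by
  \<open>r\<close> is at most a constant times the ratio of \<open>H\<close> to \<open>psum\<close>
  for the enlarged set \<open>insert r M\<close>.\<close>

lemma H_small_prime_shift:
  assumes "V > 0" "r \<in> small_primes" "r \<notin> M" "few_primes M"
  shows "\<bar>H M (real r * V) - H M V\<bar> \<le> (1 + 7 powr lip) * H (insert r M) V"
    "H M V \<ge> 7 powr (- a) / 8 * psum (insert r M) V"
proof -
  note r = small_primesD[OF assms(2)]
  note M = few_primesD(3)[OF assms(4)]
  have r1: "real r \<ge> 1" "real r \<le> 7" using r by auto
  have "H (insert r M) (real r * V) \<le> real r powr lip * H (insert r M) V"
    using assms r1 by (intro H_scale) auto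
  also have "\<dots> \<le> 7 powr lip * H (insert r M) V"
    using r1 lip_pos assms H_nonneg by (intro mult_right_mono powr_mono2) auto
  finally show "\<bar>H M (real r * V) - H M V\<bar> \<le> (1 + 7 powr lip) * H (insert r M) V"
    using H_prime_shift_le[OF assms(1) r(1) assms(3) M] by (simp add: algebra_simps)
  have "7 powr (- a) / 8 * psum (insert r M) V \<le> real r powr (- a) / (real r + 1) * psum (insert r M) V"
    using r1 a_pos by (intro mult_right_mono psum_nonneg frac_le powr_mono2') auto
  then show "H M V \<ge> 7 powr (- a) / 8 * psum (insert r M) V"
    using H_ge_psum[OF assms(1) r(1) assms(3) M] by linarith
qed

lemma few_primes_subset: "few_primes M \<Longrightarrow> N \<subseteq> M \<Longrightarrow> few_primes N"
  unfolding few_primes_def using card_mono finite_subset by (metis order.trans subsetD)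

text \<open>The crude share for \<open>insert r M\<close> makes \<open>H M\<close> nearly constant
  over \<open>O(t powr (3/10))\<close> shifts by \<open>r\<close>, enough for the averaging in
  \<open>H_le_psum\<close>.\<close>

lemma H_small_shift_weak:
  "\<exists>C>0. \<forall>\<^sub>F t in at_top. \<forall>M r. few_primes (insert r M) \<longrightarrow> r \<notin> M \<longrightarrow> r \<in> small_primes \<longrightarrow>
    \<bar>H M (real r * exp t) - H M (exp t)\<bar> \<le> C * t powr (-3/10) * H M (exp t)"
proof -
  obtain C where C: "C > 0" and ev: "\<forall>\<^sub>F t in at_top. \<forall>M. few_primes M \<longrightarrow>
      H M (exp t) \<le> C * t powr (-3/10) * psum M (exp t)"
    using H_le_psum_weak by blast
  define c where "c = (7::real) powr (- a) / 8"
  define B where "B = 1 + (7::real) powr lip"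
  have cB: "c > 0" "B > 0" by (auto simp: c_def B_def add_pos_pos)
  from ev have "\<forall>\<^sub>F t in at_top. \<forall>M r. few_primes (insert r M) \<longrightarrow> r \<notin> M \<longrightarrow> r \<in> small_primes \<longrightarrow>
      \<bar>H M (real r * exp t) - H M (exp t)\<bar> \<le> (B * C / c) * t powr (-3/10) * H M (exp t)"
  proof eventually_elim
    case (elim t)
    show ?case
    proof (intro allI impI)
      fix M r assume fr: "few_primes (insert r M)" and r: "r \<notin> M" "r \<in> small_primes"
      have M: "few_primes M" using few_primes_subset[OF fr] by auto
      have "\<bar>H M (real r * exp t) - H M (exp t)\<bar> \<le> B * H (insert r M) (exp t)"
        unfolding B_def by (rule H_small_prime_shift[OF exp_gt_zero r(2,1) M])
      also have "\<dots> \<le> B * (C * t powr (-3/10) * psum (insert r M) (exp t))"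
        using elim fr cB by (intro mult_left_mono) auto
      also have "\<dots> \<le> B * (C * t powr (-3/10) * (H M (exp t) / c))"
      proof -
        have "psum (insert r M) (exp t) \<le> H M (exp t) / c"
          using H_small_prime_shift(2)[OF exp_gt_zero r(2,1) M, of t] cB by (simp add: c_def field_simps)
        then show ?thesis using cB C by (intro mult_left_mono) auto
      qed
      finally show "\<bar>H M (real r * exp t) - H M (exp t)\<bar> \<le> (B * C / c) * t powr (-3/10) * H M (exp t)"
        by (simp add: mult_ac)
    qed
  qed
  then show ?thesis using cB C by (intro exI[of _ "B * C / c"]) auto
qed

end

lemma few_primes_insert:
  assumes "few_primes M" "card M \<le> 3" "prime r"
  shows "few_primes (insert r M)" "card (insert r M) \<le> Suc (card M)"
  using assms card_insert_le_m1[of _ M r] card_insert_if[of M r] by (auto simp: few_primes_def)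

lemma half_le_nat_floor:
  fixes z :: real
  assumes "z \<ge> 1"
  shows "z / 2 \<le> real (nat \<lfloor>z\<rfloor>)"
proof (cases "z \<ge> 2")
  case True
  have "real (nat \<lfloor>z\<rfloor>) > z - 1" by linarith
  then show ?thesis using True by linarith
next
  case False
  have "nat \<lfloor>z\<rfloor> \<ge> 1" using assms by (simp add: le_nat_floor)
  then have "real (nat \<lfloor>z\<rfloor>) \<ge> 1" by linarith
  then show ?thesis using False by linarith
qed

lemma sg_half_le:
  assumes "t \<ge> 4"
  shows "sg (t / 2) \<le> 2 * sg t"
proof -
  have "ln t \<ge> ln 4" using assms by simp
  also have "ln 4 = 2 * ln (2::real)" using ln_realpow[of 2 2] by simp
  finally have "t * ln t \<le> 4 * (t / 2 * ln (t / 2))"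
    using assms by (simp add: ln_div algebra_simps)
  then have "sqrt (t * ln t) \<le> sqrt (4 * (t / 2 * ln (t / 2)))" by (rule real_sqrt_le_mono)
  also have "\<dots> = 2 * sqrt (t / 2 * ln (t / 2))" by (simp only: real_sqrt_mult real_sqrt_four)
  finally have le: "sqrt (t * ln t) \<le> 2 * sqrt (t / 2 * ln (t / 2))" .
  have pos: "t * ln t > 0" "t / 2 * ln (t / 2) > 0" using assms by auto
  have "sg (t / 2) = 2 / (2 * sqrt (t / 2 * ln (t / 2)))" by (simp add: sg_def)
  also have "\<dots> \<le> 2 / sqrt (t * ln t)" using le pos by (intro divide_left_mono) auto
  finally show ?thesis by (simp add: sg_def)
qed

section \<open>The sharp share, and the share of the numbers prime to a given prime\<close>

context kernel
begin

text \<open>Over \<open>J\<close>, of order \<open>t powr (3/10)\<close>, successive shifts by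
  \<open>r\<close> the value of \<open>H\<close> does not fall below half of the initial one, so
  \<open>J * H\<close> is bounded by the sum over dilates. That sum is the growth of
  \<open>psum\<close> over a window of length \<open>J * ln r\<close>, namely
  \<open>O(J * sg t)\<close> times \<open>psum\<close>, plus end terms
  \<open>O(t powr (-3/10))\<close> times \<open>psum\<close>. Dividing by \<open>J\<close> turns the
  end terms into \<open>t powr (-6/10)\<close>, which is below \<open>sg t\<close>.\<close>

lemma H_le_psum:
  "\<exists>C>0. \<forall>\<^sub>F t in at_top. \<forall>M. few_primes M \<longrightarrow> card M \<le> 3 \<longrightarrow>
    H M (exp t) \<le> C * sg t * psum M (exp t)"
proof -
  obtain C0 where C0: "C0 > 0" and "\<forall>\<^sub>F t in at_top. \<forall>M. few_primes M \<longrightarrow>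
      H M (exp t) \<le> C0 * t powr (-3/10) * psum M (exp t)"
    using H_le_psum_weak by blast
  then obtain t1 where t1: "\<And>t M. t \<ge> t1 \<Longrightarrow> few_primes M \<Longrightarrow>
      H M (exp t) \<le> C0 * t powr (-3/10) * psum M (exp t)"
    unfolding eventually_at_top_linorder by blast
  obtain C1 where C1: "C1 > 0" and "\<forall>\<^sub>F t in at_top. \<forall>M r. few_primes (insert r M) \<longrightarrow> r \<notin> M \<longrightarrow>
      r \<in> small_primes \<longrightarrow> \<bar>H M (real r * exp t) - H M (exp t)\<bar> \<le> C1 * t powr (-3/10) * H M (exp t)"
    using H_small_shift_weak by blast
  then obtain t2 where t2: "\<And>t M r. t \<ge> t2 \<Longrightarrow> few_primes (insert r M) \<Longrightarrow> r \<notin> M \<Longrightarrow>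
      r \<in> small_primes \<Longrightarrow> \<bar>H M (real r * exp t) - H M (exp t)\<bar> \<le> C1 * t powr (-3/10) * H M (exp t)"
    unfolding eventually_at_top_linorder by blast
  obtain C2 where C2: "C2 > 0" and ev2: "\<forall>\<^sub>F t in at_top. \<forall>M l. few_primes M \<longrightarrow> t powr (1/5) \<le> l \<longrightarrow>
      l \<le> t powr (3/10) \<longrightarrow> psum M (exp (t + l)) - psum M (exp t) \<le> C2 * l * sg t * psum M (exp t)"
    using psum_regular_iterate by blast
  \<comment> \<open>\<open>1 / 6\<close> keeps the window \<open>J * ln r\<close> within
    \<open>t powr (3/10)\<close>, as \<open>ln r \<le> 6\<close>; \<open>1 / (2 * C1)\<close> keeps
    the accumulated decrease of \<open>H\<close> below one half.\<close>
  define e where "e = min (1/6) (1 / (2 * C1))"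
  have e: "e > 0" "e \<le> 1/6" "e * C1 \<le> 1/2" using C1 by (auto simp: e_def min_def field_simps)
  define K where "K = 2 + 1 / (1 - 2 powr (- a))"
  have K: "K > 0" unfolding K_def using a_pos by (intro add_pos_pos) (auto simp: powr_less_one)
  have "\<forall>\<^sub>F t in at_top. (e * t powr (3/10) - 1) * (2/3) \<ge> t powr (1/5)" using e(1) by real_asymp
  moreover have "\<forall>\<^sub>F t in at_top. e * t powr (3/10) \<ge> 2" using e(1) by real_asymp
  moreover have "\<forall>\<^sub>F t in at_top. C1 * t powr (-3/10) \<le> 1" by real_asymp
  moreover have "\<forall>\<^sub>F t in at_top. C2 * (t powr (3/10) * sg t) \<le> 1" unfolding sg_def by real_asymp
  moreover have "\<forall>\<^sub>F t::real in at_top. t powr (-6/10) \<le> sg t" unfolding sg_def by real_asymp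
  moreover have "\<forall>\<^sub>F t in at_top. t \<ge> t1 \<and> t \<ge> t2 \<and> t > 1"
    by (intro eventually_conj eventually_ge_at_top eventually_gt_at_top)
  moreover note ev2
  ultimately have "\<forall>\<^sub>F t in at_top. \<forall>M. few_primes M \<longrightarrow> card M \<le> 3 \<longrightarrow>
      H M (exp t) \<le> (2 * K * (6 * C2 + 6 * C0 / e)) * sg t * psum M (exp t)"
  proof eventually_elim
    case (elim t)
    show ?case
    proof (intro allI impI)
      fix M assume M: "few_primes M" "card M \<le> 3"
      obtain r where r: "r \<in> small_primes" "r \<notin> M"
        using small_prime_notin few_primesD(1)[OF M(1)] M(2) by blast
      note rp = small_primesD[OF r(1)]
      have fr: "few_primes (insert r M)" using M rp by (intro few_primes_insert) auto
      have lnr: "ln (real r) \<ge> 2/3" "ln (real r) \<le> 6"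
      proof -
        have "ln 2 \<le> ln (real r)" using rp by simp
        then show "ln (real r) \<ge> 2/3" using ln2_ge_two_thirds by linarith
        have "ln (real r) \<le> real r - 1" using rp by (intro ln_le_minus_one) auto
        then show "ln (real r) \<le> 6" using rp by simp
      qed
      let ?p = "psum M (exp t)" and ?h = "H M (exp t)"
      have h0: "?h \<ge> 0" by (intro H_nonneg) simp
      have p0: "?p \<ge> 0" by (rule psum_nonneg)
      have s0: "sg t > 0" using elim by (intro sg_pos) auto
      define J where "J = nat \<lfloor>e * t powr (3/10)\<rfloor>"
      have J: "real J \<le> e * t powr (3/10)" "real J \<ge> e * t powr (3/10) - 1" "real J > 0"
        unfolding J_def using elim by linarith+
      have J2: "real J \<ge> e * t powr (3/10) / 2" using J elim by linarith
      define x where "x = C1 * t powr (-3/10)"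
      have x: "0 \<le> x" "x \<le> 1" using C1 elim by (auto simp: x_def)
      have pw: "real r ^ j * exp t = exp (t + real j * ln (real r))" for j
        using rp by (simp add: exp_add exp_of_nat_mult)
      have dec: "H M (real r ^ j * exp t) \<ge> (1 - x) ^ j * ?h" for j
      proof (induction j)
        case 0
        then show ?case by simp
      next
        case (Suc j)
        let ?u = "t + real j * ln (real r)"
        have u: "?u \<ge> t" using lnr by simp
        have hu: "H M (exp ?u) \<ge> 0" by (intro H_nonneg) simp
        have "\<bar>H M (real r * exp ?u) - H M (exp ?u)\<bar> \<le> C1 * ?u powr (-3/10) * H M (exp ?u)"
          using u elim fr r by (intro t2) auto
        also have "\<dots> \<le> x * H M (exp ?u)"
          unfolding x_def using u elim C1 hu by (intro mult_right_mono mult_left_mono powr_mono2') auto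
        finally have "H M (real r * exp ?u) \<ge> (1 - x) * H M (exp ?u)" by (simp add: algebra_simps)
        moreover have "(1 - x) * H M (exp ?u) \<ge> (1 - x) * ((1 - x) ^ j * ?h)"
          using Suc x unfolding pw by (intro mult_left_mono) auto
        moreover have "real r ^ Suc j * exp t = real r * exp ?u" by (simp add: pw[symmetric])
        ultimately show ?case by (simp only: power_Suc mult.assoc)
      qed
      have half: "H M (real r ^ j * exp t) \<ge> ?h / 2" if "j < J" for j
      proof -
        have "real j * x \<le> (e * t powr (3/10)) * (C1 * t powr (-3/10))"
          unfolding x_def using that J C1 e elim by (intro mult_mono) auto
        also have "\<dots> = e * C1" using elim by (simp add: powr_minus field_simps)
        finally have "real j * x \<le> 1/2" using e by linarith
        moreover have "1 + real j * (- x) \<le> (1 + (- x)) ^ j" using x by (intro Bernoulli_inequality) auto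
        ultimately have "1/2 \<le> (1 - x) ^ j" by simp
        then have "1/2 * ?h \<le> (1 - x) ^ j * ?h" using h0 by (intro mult_right_mono)
        then show ?thesis using dec[of j] by simp
      qed
      have "real J * (?h / 2) = (\<Sum>j<J. ?h / 2)" by simp
      also have "\<dots> \<le> (\<Sum>j<J. H M (real r ^ j * exp t))" using half by (intro sum_mono) auto
      also have "\<dots> \<le> K * (psum M (real r ^ J * exp t) - ?p + ?h + H M (real r ^ J * exp t))"
        unfolding K_def using rp by (intro H_sum_dilates_le) auto
      finally have main: "real J * (?h / 2) \<le> K * (psum M (real r ^ J * exp t) - ?p + ?h + H M (real r ^ J * exp t))" .
      define l where "l = real J * ln (real r)"
      have l1: "t powr (1/5) \<le> l"
      proof -
        have "t powr (1/5) \<le> (e * t powr (3/10) - 1) * (2/3)" using elim by simp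
        also have "\<dots> \<le> l" unfolding l_def using J lnr by (intro mult_mono) auto
        finally show ?thesis .
      qed
      have l2: "l \<le> t powr (3/10)"
      proof -
        have "l \<le> (e * t powr (3/10)) * 6" unfolding l_def using J lnr e by (intro mult_mono) auto
        also have "\<dots> \<le> 1 * t powr (3/10)" using e mult_right_mono[of "e * 6" 1 "t powr (3/10)"] by (simp add: mult_ac)
        finally show ?thesis by simp
      qed
      have l6: "l \<le> real J * 6" unfolding l_def using lnr by (intro mult_left_mono) auto
      have A1: "psum M (exp (t + l)) - ?p \<le> C2 * l * sg t * ?p" using elim l1 l2 M by blast
      have "C2 * (l * sg t) \<le> C2 * (t powr (3/10) * sg t)"
        using C2 l2 s0 by (intro mult_left_mono mult_right_mono) auto
      then have "C2 * l * sg t \<le> 1" using elim by (simp add: mult_ac)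
      then have "C2 * l * sg t * ?p \<le> 1 * ?p" using p0 by (intro mult_right_mono) auto
      then have A2: "psum M (exp (t + l)) \<le> 2 * ?p" using A1 by linarith
      have l0: "l \<ge> 0" using l1 by (smt (verit) powr_ge_zero)
      have "H M (exp (t + l)) \<le> C0 * (t + l) powr (-3/10) * psum M (exp (t + l))"
        using t1[of "t + l" M] elim l0 M by simp
      also have "\<dots> \<le> C0 * t powr (-3/10) * (2 * ?p)"
        using C0 l0 elim A2 psum_nonneg by (intro mult_mono powr_mono2') auto
      finally have A3: "H M (exp (t + l)) \<le> 2 * (C0 * t powr (-3/10) * ?p)" by simp
      have A4: "?h \<le> C0 * t powr (-3/10) * ?p" using t1[of t M] elim M by simp
      have A5: "C2 * l * sg t * ?p \<le> C2 * (real J * 6) * sg t * ?p"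
        using l6 C2 s0 p0 by (intro mult_right_mono mult_left_mono) auto
      have A6: "C0 * t powr (-3/10) \<le> real J * (2 * C0 / e) * sg t"
      proof -
        have "C0 * t powr (-3/10) = e * t powr (3/10) / 2 * (2 * C0 / e) * t powr (-6/10)"
        proof -
          have "t powr (-3/10) = t powr (3/10) * t powr (-6/10)" by (simp flip: powr_add)
          then show ?thesis using e by simp
        qed
        also have "\<dots> \<le> real J * (2 * C0 / e) * sg t"
          using J2 C0 e elim by (intro mult_mono) auto
        finally show ?thesis .
      qed
      have A7: "C0 * t powr (-3/10) * ?p \<le> real J * (2 * C0 / e) * sg t * ?p"
        using A6 p0 by (intro mult_right_mono) auto
      have "real J * (?h / 2) \<le> K * (C2 * (real J * 6) * sg t * ?p + 3 * (real J * (2 * C0 / e) * sg t * ?p))"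
      proof -
        have "psum M (real r ^ J * exp t) - ?p + ?h + H M (real r ^ J * exp t) \<le>
            C2 * (real J * 6) * sg t * ?p + 3 * (real J * (2 * C0 / e) * sg t * ?p)"
          unfolding pw l_def[symmetric] using A1 A3 A4 A5 A7 by linarith
        then show ?thesis using main K by (smt (verit) mult_left_mono)
      qed
      also have "\<dots> = real J * (K * (6 * C2 + 6 * C0 / e) * sg t * ?p)" by (simp add: algebra_simps)
      finally have "?h / 2 \<le> K * (6 * C2 + 6 * C0 / e) * sg t * ?p"
        using J(3) by (simp only: mult_le_cancel_left_pos)
      then show "?h \<le> (2 * K * (6 * C2 + 6 * C0 / e)) * sg t * ?p" by (simp add: algebra_simps)
    qed
  qed
  moreover have "2 * K * (6 * C2 + 6 * C0 / e) > 0" using K C2 C0 e by (intro mult_pos_pos add_pos_pos) auto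
  ultimately show ?thesis by blast
qed

text \<open>The same reduction to \<open>insert r M\<close> as in the weak version, now fed with the
  sharp share; it costs one more prime, whence the limit 2 on \<open>card M\<close>.\<close>

lemma H_small_shift:
  "\<exists>C>0. \<forall>\<^sub>F t in at_top. \<forall>M r. few_primes M \<longrightarrow> card M \<le> 2 \<longrightarrow> r \<notin> M \<longrightarrow> r \<in> small_primes \<longrightarrow>
    \<bar>H M (real r * exp t) - H M (exp t)\<bar> \<le> C * sg t * H M (exp t)"
proof -
  obtain C where C: "C > 0" and ev: "\<forall>\<^sub>F t in at_top. \<forall>M. few_primes M \<longrightarrow> card M \<le> 3 \<longrightarrow>
      H M (exp t) \<le> C * sg t * psum M (exp t)"
    using H_le_psum by blast
  define c where "c = (7::real) powr (- a) / 8"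
  define B where "B = 1 + (7::real) powr lip"
  have cB: "c > 0" "B > 0" by (auto simp: c_def B_def add_pos_pos)
  have "\<forall>\<^sub>F t::real in at_top. t > 1" by (rule eventually_gt_at_top)
  with ev have "\<forall>\<^sub>F t in at_top. \<forall>M r. few_primes M \<longrightarrow> card M \<le> 2 \<longrightarrow> r \<notin> M \<longrightarrow> r \<in> small_primes \<longrightarrow>
      \<bar>H M (real r * exp t) - H M (exp t)\<bar> \<le> (B * C / c) * sg t * H M (exp t)"
  proof eventually_elim
    case (elim t)
    show ?case
    proof (intro allI impI)
      fix M r assume M: "few_primes M" "card M \<le> 2" and r: "r \<notin> M" "r \<in> small_primes"
      have fr: "few_primes (insert r M)" "card (insert r M) \<le> 3"
        using few_primes_insert[of M r] M small_primesD(1)[OF r(2)] by auto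
      have s0: "sg t > 0" using elim by (intro sg_pos) auto
      have "\<bar>H M (real r * exp t) - H M (exp t)\<bar> \<le> B * H (insert r M) (exp t)"
        unfolding B_def by (rule H_small_prime_shift[OF exp_gt_zero r(2,1) M(1)])
      also have "\<dots> \<le> B * (C * sg t * psum (insert r M) (exp t))"
        using elim fr cB by (intro mult_left_mono) auto
      also have "\<dots> \<le> B * (C * sg t * (H M (exp t) / c))"
      proof -
        have "psum (insert r M) (exp t) \<le> H M (exp t) / c"
          using H_small_prime_shift(2)[OF exp_gt_zero r(2,1) M(1), of t] cB by (simp add: c_def field_simps)
        then show ?thesis using cB C s0 by (intro mult_left_mono) auto
      qed
      finally show "\<bar>H M (real r * exp t) - H M (exp t)\<bar> \<le> (B * C / c) * sg t * H M (exp t)"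
        by (simp add: mult_ac)
    qed
  qed
  then show ?thesis using cB C by (intro exI[of _ "B * C / c"]) auto
qed

text \<open>A single shift by a small prime changes \<open>H\<close> by a factor
  \<open>1 + O(sg t)\<close>, and a distance up to \<open>sqrt (t * ln t) = 1 / sg t\<close> takes
  \<open>O(1 / sg t)\<close> of them.\<close>

lemma H_doubling:
  "\<exists>C>0. \<forall>\<^sub>F t in at_top. \<forall>M s. few_primes M \<longrightarrow> card M \<le> 2 \<longrightarrow> 0 \<le> s \<longrightarrow> s \<le> sqrt (t * ln t) \<longrightarrow>
    H M (exp t) \<le> C * H M (exp (t - s))"
proof -
  obtain C where C: "C > 0" and "\<forall>\<^sub>F t in at_top. \<forall>M r. few_primes M \<longrightarrow> card M \<le> 2 \<longrightarrow> r \<notin> M \<longrightarrow>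
      r \<in> small_primes \<longrightarrow> \<bar>H M (real r * exp t) - H M (exp t)\<bar> \<le> C * sg t * H M (exp t)"
    using H_small_shift by blast
  then obtain t0 where t0: "\<And>t M r. t \<ge> t0 \<Longrightarrow> few_primes M \<Longrightarrow> card M \<le> 2 \<Longrightarrow> r \<notin> M \<Longrightarrow>
      r \<in> small_primes \<Longrightarrow> \<bar>H M (real r * exp t) - H M (exp t)\<bar> \<le> C * sg t * H M (exp t)"
    unfolding eventually_at_top_linorder by blast
  have "\<forall>\<^sub>F t in at_top. sqrt (t * ln t) \<le> t / 2" by real_asymp
  moreover have "\<forall>\<^sub>F t in at_top. sg (t / 2) \<le> 2 * sg t"
    using eventually_ge_at_top[of "4::real"] by eventually_elim (rule sg_half_le)
  moreover have "\<forall>\<^sub>F t in at_top. t / 2 \<ge> t0 \<and> t > 2"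
    by (intro eventually_conj eventually_gt_at_top) real_asymp
  ultimately have "\<forall>\<^sub>F t in at_top. \<forall>M s. few_primes M \<longrightarrow> card M \<le> 2 \<longrightarrow> 0 \<le> s \<longrightarrow> s \<le> sqrt (t * ln t) \<longrightarrow>
      H M (exp t) \<le> (exp (3 * C) * 7 powr lip) * H M (exp (t - s))"
  proof eventually_elim
    case (elim t)
    show ?case
    proof (intro allI impI)
      fix M s assume M: "few_primes M" "card M \<le> 2" and s: "0 \<le> s" "s \<le> sqrt (t * ln t)"
      obtain r where r: "r \<in> small_primes" "r \<notin> M"
        using small_prime_notin[of M] few_primesD(1)[OF M(1)] M(2) by auto
      note rp = small_primesD[OF r(1)]
      have lnr: "ln (real r) \<ge> 2/3"
      proof -
        have "ln 2 \<le> ln (real r)" using rp by simp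
        then show "ln (real r) \<ge> 2/3" using ln2_ge_two_thirds by linarith
      qed
      define n where "n = nat \<lfloor>s / ln (real r)\<rfloor>"
      have n: "real n \<le> s / ln (real r)" "real n > s / ln (real r) - 1" unfolding n_def using s lnr by auto
      then have n1: "real n * ln (real r) \<le> s" "s < real n * ln (real r) + ln (real r)"
        using lnr by (auto simp: field_simps)
      define x where "x = 2 * C * sg t"
      have s0: "sg t > 0" using elim by (intro sg_pos) auto
      have x0: "x \<ge> 0" using C s0 by (simp add: x_def)
      define u where "u = t - real n * ln (real r)"
      have u2: "u \<ge> t / 2" using n1 s elim by (simp add: u_def)
      have inc: "H M (exp (u + real j * ln (real r))) \<le> (1 + x) ^ j * H M (exp u)" for j
      proof (induction j)
        case 0
        then show ?case by simp
      next
        case (Suc j)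
        let ?w = "u + real j * ln (real r)"
        have w: "?w \<ge> t / 2" using u2 lnr by (simp add: add_increasing2)
        have hw: "H M (exp ?w) \<ge> 0" by (intro H_nonneg) simp
        have "\<bar>H M (real r * exp ?w) - H M (exp ?w)\<bar> \<le> C * sg ?w * H M (exp ?w)"
          using w elim M r by (intro t0) auto
        also have "\<dots> \<le> x * H M (exp ?w)"
        proof (rule mult_right_mono[OF _ hw])
          have "sg ?w \<le> sg (t / 2)" using w elim by (intro sg_antimono) auto
          then have "C * sg ?w \<le> C * (2 * sg t)" using elim C by (intro mult_left_mono) auto
          then show "C * sg ?w \<le> x" by (simp add: x_def)
        qed
        finally have "H M (real r * exp ?w) \<le> (1 + x) * H M (exp ?w)" by (simp add: algebra_simps)
        also have "\<dots> \<le> (1 + x) * ((1 + x) ^ j * H M (exp u))" using Suc x0 by (intro mult_left_mono) auto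
        also have "real r * exp ?w = exp (u + real (Suc j) * ln (real r))"
          using rp by (simp add: exp_add algebra_simps)
        finally show ?case by simp
      qed
      have hu: "H M (exp u) \<ge> 0" by (intro H_nonneg) simp
      have "H M (exp t) \<le> (1 + x) ^ n * H M (exp u)" using inc[of n] by (simp add: u_def)
      also have "(1 + x) ^ n \<le> exp x ^ n" using x0 by (intro power_mono) auto
      also have "exp x ^ n = exp (real n * x)" by (simp add: exp_of_nat_mult)
      also have "\<dots> \<le> exp (3 * C)"
      proof -
        have "real n * (2/3) \<le> real n * ln (real r)" using lnr by (intro mult_left_mono) auto
        then have "real n \<le> 3/2 * s" using n1 by linarith
        then have "real n * x \<le> 3/2 * s * x" using x0 by (intro mult_right_mono) auto
        also have "\<dots> \<le> 3/2 * sqrt (t * ln t) * x" using x0 s by (intro mult_right_mono mult_left_mono) auto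
        also have "\<dots> = 3 * C" using elim by (simp add: x_def sg_def)
        finally show ?thesis by simp
      qed
      finally have 1: "H M (exp t) \<le> exp (3 * C) * H M (exp u)" using hu by (simp add: mult_right_mono)
      \<comment> \<open>What is left after \<open>n\<close> whole shifts; it is less than one shift,
        so the crude Lipschitz bound suffices.\<close>
      define d where "d = exp (s - real n * ln (real r))"
      have d: "d \<ge> 1" "d \<le> 7"
      proof -
        show "d \<ge> 1" using n1 by (simp add: d_def)
        have "d \<le> exp (ln (real r))" unfolding d_def using n1 by simp
        then show "d \<le> 7" using rp by simp
      qed
      have "exp u = d * exp (t - s)" by (simp add: d_def u_def flip: exp_add)
      then have "H M (exp u) \<le> d powr lip * H M (exp (t - s))" using d by (simp add: H_scale)
      also have "\<dots> \<le> 7 powr lip * H M (exp (t - s))"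
        using d lip_pos H_nonneg by (intro mult_right_mono powr_mono2) auto
      finally have "exp (3 * C) * H M (exp u) \<le> exp (3 * C) * (7 powr lip * H M (exp (t - s)))"
        by (intro mult_left_mono) auto
      from order.trans[OF 1 this] show "H M (exp t) \<le> (exp (3 * C) * 7 powr lip) * H M (exp (t - s))"
        by (simp only: mult.assoc)
    qed
  qed
  then show ?thesis by (intro exI[of _ "exp (3 * C) * 7 powr lip"]) auto
qed

text \<open>The sum avoiding \<open>p\<close> keeps its order of magnitude over a logarithmic
  distance \<open>R = sqrt (t * ln t)\<close>, that is over \<open>R / ln p\<close> scales
  \<open>V / p ^ j\<close>. By \<open>H_ge_sum_prime_shifts\<close> the full sum then exceeds it by
  the factor \<open>R / (p * ln p)\<close>, up to a constant.\<close>

lemma H_insert_prime_le: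
  "\<exists>C>0. \<forall>\<^sub>F t in at_top. \<forall>M p. few_primes M \<longrightarrow> card M \<le> 1 \<longrightarrow> p \<notin> M \<longrightarrow> prime p \<longrightarrow>
    real p \<le> t powr (2/5) \<longrightarrow> H (insert p M) (exp t) \<le> C * sg t * (real p * ln (real p)) * H M (exp t)"
proof -
  obtain C where C: "C > 0" and ev: "\<forall>\<^sub>F t in at_top. \<forall>M s. few_primes M \<longrightarrow> card M \<le> 2 \<longrightarrow> 0 \<le> s \<longrightarrow>
      s \<le> sqrt (t * ln t) \<longrightarrow> H M (exp t) \<le> C * H M (exp (t - s))"
    using H_doubling by blast
  have "\<forall>\<^sub>F t in at_top. ln (t powr (2/5)) \<le> sqrt (t * ln t) \<and> t > (1::real)"
    by (intro eventually_conj eventually_gt_at_top) real_asymp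
  with ev have "\<forall>\<^sub>F t in at_top. \<forall>M p. few_primes M \<longrightarrow> card M \<le> 1 \<longrightarrow> p \<notin> M \<longrightarrow> prime p \<longrightarrow>
      real p \<le> t powr (2/5) \<longrightarrow> H (insert p M) (exp t) \<le> (4 * C) * sg t * (real p * ln (real p)) * H M (exp t)"
  proof eventually_elim
    case (elim t)
    show ?case
    proof (intro allI impI)
      fix M p assume M: "few_primes M" "card M \<le> 1" and p: "p \<notin> M" "prime p" "real p \<le> t powr (2/5)"
      have fr: "few_primes (insert p M)" "card (insert p M) \<le> 2"
        using few_primes_insert[of M p] M p(2) by auto
      have p1: "real p > 1" using prime_gt_1_nat[OF p(2)] by simp
      have lnp: "ln (real p) > 0" using p1 by simp
      have "ln (real p) \<le> ln (t powr (2/5))" using p p1 by (subst ln_le_cancel_iff) auto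
      then have lnp2: "ln (real p) \<le> sqrt (t * ln t)" using elim by linarith
      define R where "R = sqrt (t * ln t)"
      have R: "R > 0" using elim by (simp add: R_def)
      define J where "J = nat \<lfloor>R / ln (real p)\<rfloor>"
      have ge1: "R / ln (real p) \<ge> 1" using lnp lnp2 by (simp add: R_def)
      have J: "real J \<le> R / ln (real p)" "real J \<ge> R / (2 * ln (real p))"
      proof -
        show "real J \<le> R / ln (real p)" unfolding J_def using ge1 by linarith
        have "real J \<ge> R / ln (real p) / 2" unfolding J_def using half_le_nat_floor[OF ge1] .
        then show "real J \<ge> R / (2 * ln (real p))" by (simp add: mult.commute)
      qed
      let ?h = "H (insert p M) (exp t)"
      have each: "?h / C \<le> H (insert p M) (exp t / real p ^ j)" if "j \<in> {1..J}" for j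
      proof -
        have "real j * ln (real p) \<le> real J * ln (real p)" using that lnp by (intro mult_right_mono) auto
        also have "\<dots> \<le> R" using J(1) lnp by (simp add: field_simps)
        finally have "?h \<le> C * H (insert p M) (exp (t - real j * ln (real p)))"
          using elim fr lnp by (simp add: R_def)
        also have "exp (t - real j * ln (real p)) = exp t / real p ^ j"
          using p1 by (simp add: exp_diff exp_of_nat_mult)
        finally show ?thesis using C by (simp add: field_simps)
      qed
      have "real J * (?h / C) = (\<Sum>j\<in>{1..J}. ?h / C)" by simp
      also have "\<dots> \<le> (\<Sum>j\<in>{1..J}. H (insert p M) (exp t / real p ^ j))" by (intro sum_mono each)
      finally have "1 / (real p + 1) * (real J * (?h / C)) \<le>
          1 / (real p + 1) * (\<Sum>j\<in>{1..J}. H (insert p M) (exp t / real p ^ j))"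
        by (intro mult_left_mono) auto
      also have "\<dots> \<le> H M (exp t)"
        using H_ge_sum_prime_shifts[of "exp t" p M J] p few_primesD(3)[OF M(1)]
          H_nonneg[of "exp t" "insert p M"] by fastforce
      finally have "C * (real p + 1) * (1 / (real p + 1) * (real J * (?h / C))) \<le> C * (real p + 1) * H M (exp t)"
        using C by (intro mult_left_mono) auto
      moreover have "real p + 1 \<noteq> 0" by linarith
      ultimately have 1: "real J * ?h \<le> C * (real p + 1) * H M (exp t)" using C by simp
      have hn: "?h \<ge> 0" "H M (exp t) \<ge> 0" by (auto intro!: H_nonneg)
      have "R / (2 * ln (real p)) * ?h \<le> real J * ?h" using J hn by (intro mult_right_mono) auto
      also note 1
      also have "C * (real p + 1) * H M (exp t) \<le> C * (2 * real p) * H M (exp t)"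
        using C p1 hn by (intro mult_right_mono mult_left_mono) auto
      finally have "R / (2 * ln (real p)) * ?h \<le> C * (2 * real p) * H M (exp t)" .
      then have "?h \<le> (4 * C) * (1 / R) * (real p * ln (real p)) * H M (exp t)"
        using R lnp by (simp add: field_simps)
      then show "?h \<le> (4 * C) * sg t * (real p * ln (real p)) * H M (exp t)"
        by (simp add: R_def sg_def)
    qed
  qed
  then show ?thesis using C by (intro exI[of _ "4 * C"]) auto
qed

end

section \<open>Approximating real shifts by logarithms of ratios of integers\<close>

lemma abs_ln_diff_le:
  fixes x y e :: real
  assumes "\<bar>x - y\<bar> \<le> e * y" "y > 0" "0 \<le> e" "e \<le> 1/2"
  shows "\<bar>ln x - ln y\<bar> \<le> 2 * e"
proof -
  have xy: "x \<ge> (1 - e) * y" "x \<le> (1 + e) * y" using assms by (auto simp: abs_le_iff algebra_simps)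
  have pos: "(1 - e) * y > 0" using assms by (intro mult_pos_pos) auto
  have x: "x > 0" using xy pos by linarith
  have "ln x \<le> ln ((1 + e) * y)" using xy x by simp
  also have "\<dots> = ln (1 + e) + ln y" using assms by (subst ln_mult) auto
  also have "ln (1 + e) \<le> e" using assms by (intro ln_add_one_self_le_self) auto
  finally have 1: "ln x - ln y \<le> 2 * e" using assms by linarith
  have "- e - 2 * e\<^sup>2 \<le> ln (1 - e)" using assms by (intro ln_one_minus_pos_lower_bound) auto
  moreover have "e\<^sup>2 \<le> e * (1/2)" unfolding power2_eq_square using assms by (intro mult_left_mono) auto
  ultimately have "- 2 * e \<le> ln (1 - e)" by linarith
  moreover have "ln (1 - e) + ln y = ln ((1 - e) * y)" using assms by (subst ln_mult) auto
  moreover have "ln ((1 - e) * y) \<le> ln x" using xy pos x by simp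
  ultimately show ?thesis using 1 by linarith
qed

lemma abs_exp_minus_one_le:
  fixes x :: real
  shows "\<bar>exp x - 1\<bar> \<le> \<bar>x\<bar> * exp \<bar>x\<bar>"
proof (cases "x \<ge> 0")
  case True
  have "1 - x \<le> exp (- x)" using exp_ge_add_one_self[of "- x"] by simp
  then have "(1 - x) * exp x \<le> exp (- x) * exp x" by (intro mult_right_mono) auto
  then have "exp x - 1 \<le> x * exp x" by (simp add: exp_minus algebra_simps)
  then show ?thesis using True by simp
next
  case False
  have "1 + x \<le> exp x" by (rule exp_ge_add_one_self)
  moreover have "exp x \<le> 1" using False by simp
  ultimately have "\<bar>exp x - 1\<bar> \<le> \<bar>x\<bar> * 1" using False by linarith
  also have "\<dots> \<le> \<bar>x\<bar> * exp \<bar>x\<bar>" by (intro mult_left_mono) auto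
  finally show ?thesis .
qed

lemma ln_one_plus_inverse:
  fixes x :: real
  assumes "x > 0"
  shows "ln (1 + 1 / x) = ln (x + 1) - ln x"
proof -
  have "1 + 1 / x = (x + 1) / x" using assms by (simp add: field_simps)
  then show ?thesis using assms by (simp add: ln_div)
qed

text \<open>A number in \<open>[0, ln 2]\<close> is \<open>ln (n / Y)\<close> up to \<open>1 / Y\<close>, and
  a number in \<open>[0, 1 / Y]\<close> is \<open>ln ((k + 1) / k) - ln ((m + 1) / m)\<close> up to \<open>O(1 / Y\<^sup>2)\<close>.\<close>

lemma ln_ratio_approximation:
  fixes s :: real and Y :: nat
  assumes Y: "Y \<ge> 8" and s: "0 \<le> s" "s \<le> ln 2"
  obtains n1 n2 n3 m1 m2 m3 :: nat
  where "n1 \<in> {1..4*Y}" "n2 \<in> {1..4*Y}" "n3 \<in> {1..4*Y}" "m1 \<in> {1..4*Y}" "m2 \<in> {1..4*Y}" "m3 \<in> {1..4*Y}"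
    "\<bar>s - (ln n1 + ln n2 + ln n3 - ln m1 - ln m2 - ln m3)\<bar> \<le> 16 / real Y ^ 2"
proof -
  have Y8: "real Y \<ge> 8" using Y by simp
  define n where "n = nat \<lfloor>real Y * exp s\<rfloor>"
  have es: "exp s \<ge> 1" "exp s \<le> 2"
  proof -
    show "exp s \<ge> 1" using s by simp
    have "exp s \<le> exp (ln 2)" using s by (simp only: exp_le_cancel_iff)
    then show "exp s \<le> 2" by simp
  qed
  have Ye: "real Y * 1 \<le> real Y * exp s" "real Y * exp s \<le> real Y * 2"
    by (intro mult_left_mono es; simp)+
  have n: "real n \<le> real Y * exp s" "real n > real Y * exp s - 1" "real n \<ge> real Y" "real n \<le> 2 * real Y"
  proof -
    have fl: "\<lfloor>real Y * exp s\<rfloor> \<ge> int Y" using Ye by (simp add: le_floor_iff)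
    show "real n \<le> real Y * exp s" "real n > real Y * exp s - 1" "real n \<ge> real Y"
      unfolding n_def using fl by linarith+
    then show "real n \<le> 2 * real Y" using Ye by linarith
  qed
  define rho where "rho = s - (ln n - ln Y)"
  have rho_eq: "rho = ln (real Y * exp s / real n)"
    unfolding rho_def using n Y8 by (subst ln_div) (auto simp: ln_mult)
  have rho0: "rho \<ge> 0" unfolding rho_eq using n Y8 by (intro ln_ge_zero) (simp add: field_simps)
  have "rho \<le> real Y * exp s / real n - 1" unfolding rho_eq using n Y8 by (intro ln_le_minus_one) auto
  also have "\<dots> = (real Y * exp s - real n) / real n" using n Y8 by (simp add: diff_divide_distrib)
  also have "\<dots> \<le> 1 / real n" using n Y8 by (intro divide_right_mono) auto
  also have "\<dots> \<le> 1 / real Y" using n Y8 by (intro divide_left_mono) auto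
  finally have rho1: "rho \<le> 1 / real Y" .
  \<comment> \<open>With \<open>k\<close> about \<open>Y / 2\<close>, the number
    \<open>ln (1 + 1 / k)\<close> exceeds \<open>rho\<close> by at least \<open>1 / (2 * Y)\<close>.
    Hence the remaining amount \<open>tau\<close> is positive and the next denominator stays of size
    \<open>O(Y)\<close>.\<close>
  define k where "k = Y div 2"
  have k: "2 * real k \<le> real Y" "2 * real k \<ge> real Y - 1" "real k \<ge> real Y / 4" "k \<ge> 1"
  proof -
    have "2 * k \<le> Y" "2 * k + 1 \<ge> Y" by (auto simp: k_def)
    then show a: "2 * real k \<le> real Y" "2 * real k \<ge> real Y - 1" by linarith+
    show "real k \<ge> real Y / 4" using a Y8 by linarith
    show "k \<ge> 1" using Y by (simp add: k_def)
  qed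
  define tau where "tau = ln (1 + 1 / real k) - rho"
  have l1k: "ln (1 + 1 / real k) \<ge> 1 / (real k + 1)"
  proof -
    have "ln (real k / (real k + 1)) \<le> real k / (real k + 1) - 1" using k by (intro ln_le_minus_one) auto
    also have "\<dots> = - (1 / (real k + 1))" by (simp add: field_simps)
    finally have "ln (real k) - ln (real k + 1) \<le> - (1 / (real k + 1))" using k by (simp add: ln_div)
    moreover have "ln (1 + 1 / real k) = ln (real k + 1) - ln (real k)"
      using k by (intro ln_one_plus_inverse) auto
    ultimately show ?thesis by linarith
  qed
  have "1 / (real k + 1) \<ge> 1 / (real Y / 2 + 1)" using k Y8 by (intro divide_left_mono) auto
  moreover have "1 / (real Y / 2 + 1) - 1 / real Y \<ge> 1 / (2 * real Y)"
  proof -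
    have "1 / real Y + 1 / (2 * real Y) = 1 / (2 / 3 * real Y)" using Y8 by (simp add: field_simps)
    also have "\<dots> \<le> 1 / (real Y / 2 + 1)" using Y8 by (intro divide_left_mono) auto
    finally show ?thesis by linarith
  qed
  ultimately have tau1: "tau \<ge> 1 / (2 * real Y)" using l1k rho1 unfolding tau_def by linarith
  then have tau0: "tau > 0" using Y8 by (smt (verit) divide_pos_pos)
  \<comment> \<open>The solution of \<open>ln (1 + 1 / z) = tau\<close>. Rounding it down to
    \<open>m\<close> encloses \<open>tau\<close> between two consecutive values of
    \<open>ln (1 + 1 / n)\<close>.\<close>
  define z where "z = 1 / (exp tau - 1)"
  have et: "exp tau - 1 \<ge> tau" using exp_ge_add_one_self[of tau] by linarith
  have zpos: "z > 0" unfolding z_def using et tau0 by simp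
  have zk: "z \<ge> real k"
  proof -
    have "exp tau \<le> exp (ln (1 + 1 / real k))" unfolding tau_def exp_le_cancel_iff using rho0 by simp
    then have "exp tau - 1 \<le> 1 / real k" using k by (simp add: add_pos_pos)
    then have "1 / (1 / real k) \<le> z" unfolding z_def using et tau0 k by (intro divide_left_mono) auto
    then show ?thesis by simp
  qed
  have z2: "z \<le> 2 * real Y"
  proof -
    have "z \<le> 1 / tau" unfolding z_def using et tau0 by (intro divide_left_mono) auto
    also have "\<dots> \<le> 1 / (1 / (2 * real Y))" using tau1 tau0 Y8 by (intro divide_left_mono) auto
    finally show ?thesis by simp
  qed
  define m where "m = nat \<lfloor>z\<rfloor>"
  have m: "real m \<le> z" "z < real m + 1" unfolding m_def using zpos by linarith+
  have mk: "m \<ge> k" unfolding m_def using zk by (simp add: le_nat_floor)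
  have m1: "real m \<ge> 1" using mk k(4) by simp
  have tau_z: "tau = ln (1 + 1 / z)" unfolding z_def using et tau0 by simp
  have up: "tau \<le> ln (1 + 1 / real m)"
    unfolding tau_z using m m1 zpos by (subst ln_le_cancel_iff) (auto intro!: add_pos_pos divide_left_mono)
  have lo: "tau \<ge> ln (1 + 1 / (real m + 1))"
    unfolding tau_z using m m1 zpos by (subst ln_le_cancel_iff) (auto intro!: add_pos_pos divide_left_mono)
  \<comment> \<open>Consecutive values differ by at most \<open>1 / (m * (m + 2))\<close>, and
    \<open>m \<ge> k \<ge> Y / 4\<close>: this is the gain of a second order error from integers of
    size \<open>Y\<close>.\<close>
  have gap: "ln (1 + 1 / real m) - ln (1 + 1 / (real m + 1)) \<le> 16 / real Y ^ 2"
  proof -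
    have "ln (1 + 1 / real m) - ln (1 + 1 / (real m + 1)) =
        ln ((1 + 1 / real m) / (1 + 1 / (real m + 1)))"
      using less_imp_neq[OF add_pos_pos[of 1 "1 / real m"]] less_imp_neq[OF add_pos_pos[of 1 "1 / (real m + 1)"]] m1
      by (subst ln_div) auto
    also have "(1 + 1 / real m) / (1 + 1 / (real m + 1)) = 1 + 1 / (real m * (real m + 2))"
      using m1 by (simp add: divide_simps) (simp add: algebra_simps)
    also have "ln \<dots> \<le> 1 / (real m * (real m + 2))" using m1 by (intro ln_add_one_self_le_self) auto
    also have "\<dots> \<le> 1 / (real Y / 4 * (real Y / 4))"
      using m1 mk k Y8 by (intro divide_left_mono mult_mono) auto
    finally show ?thesis by (simp add: power2_eq_square)
  qed
  have eq1: "ln (1 + 1 / real k) = ln (real (k + 1)) - ln (real k)"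
    using k ln_one_plus_inverse[of "real k"] by (simp add: add.commute)
  have eq2: "ln (1 + 1 / real m) = ln (real (m + 1)) - ln (real m)"
    using m1 ln_one_plus_inverse[of "real m"] by (simp add: add.commute)
  show ?thesis
  proof (rule that[of n "k + 1" m Y k "m + 1"])
    show "n \<in> {1..4*Y}" using n Y8 by (auto simp flip: of_nat_le_iff)
    show "k + 1 \<in> {1..4*Y}" "k \<in> {1..4*Y}" using k Y by (auto simp: k_def)
    have "real m \<le> 2 * real Y" using m z2 by linarith
    then show "m \<in> {1..4*Y}" "m + 1 \<in> {1..4*Y}" using m1 Y by (auto simp flip: of_nat_le_iff)
    show "Y \<in> {1..4*Y}" using Y by auto
    have "s - (ln (real n) + ln (real (k + 1)) + ln (real m) - ln (real Y) - ln (real k) - ln (real (m + 1)))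
        = ln (1 + 1 / real m) - tau"
      unfolding eq2 using eq1 unfolding tau_def rho_def by simp
    then show "\<bar>s - (ln (real n) + ln (real (k + 1)) + ln (real m) - ln (real Y) - ln (real k) - ln (real (m + 1)))\<bar>
        \<le> 16 / real Y ^ 2"
      using up lo gap by linarith
  qed
qed

section \<open>The logarithm of the localised sum under shifts\<close>

context kernel
begin

definition L :: "nat set \<Rightarrow> real \<Rightarrow> real" where
  "L M t = ln (H M (exp t))"

lemma L_lipschitz:
  assumes "\<And>q. q \<in> M \<Longrightarrow> prime q"
  shows "\<bar>L M x - L M y\<bar> \<le> lip * \<bar>x - y\<bar>"
proof -
  have aux: "\<bar>L M x - L M y\<bar> \<le> lip * \<bar>x - y\<bar>" if "x \<ge> y" for x y
  proof -
    have ex: "exp x = exp (x - y) * exp y" by (simp flip: exp_add)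
    have c: "exp (x - y) powr lip = exp (lip * (x - y))" by (simp add: powr_def)
    have pos: "H M (exp x) > 0" "H M (exp y) > 0" using assms by (auto intro!: H_pos)
    have "H M (exp x) \<le> exp (lip * (x - y)) * H M (exp y)" "H M (exp y) \<le> exp (lip * (x - y)) * H M (exp x)"
      unfolding ex c[symmetric] using that by (auto intro!: H_scale)
    then have "ln (H M (exp x)) \<le> ln (exp (lip * (x - y)) * H M (exp y))"
      "ln (H M (exp y)) \<le> ln (exp (lip * (x - y)) * H M (exp x))"
      using pos by (auto simp del: ln_exp)
    then show ?thesis using pos that by (simp add: L_def ln_mult)
  qed
  show ?thesis using aux[of x y] aux[of y x] by (cases "x \<ge> y") (auto simp: abs_minus_commute)
qed

text \<open>The change of \<open>H M\<close> is at most the sum avoiding \<open>p\<close> at the two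
  ends; \<open>H_doubling\<close> reduces the upper end to the lower one, and
  \<open>H_insert_prime_le\<close> bounds the latter.\<close>

lemma L_prime_shift:
  "\<exists>C>0. \<forall>\<^sub>F t in at_top. \<forall>M p. few_primes M \<longrightarrow> card M \<le> 1 \<longrightarrow> p \<notin> M \<longrightarrow> prime p \<longrightarrow>
    real p \<le> t powr (2/5) \<longrightarrow> \<bar>L M (t + ln (real p)) - L M t\<bar> \<le> C * sg t * (real p * ln (real p))"
proof -
  obtain C1 where C1: "C1 > 0" and ev1: "\<forall>\<^sub>F t in at_top. \<forall>M p. few_primes M \<longrightarrow> card M \<le> 1 \<longrightarrow> p \<notin> M \<longrightarrow> prime p \<longrightarrow>
      real p \<le> t powr (2/5) \<longrightarrow> H (insert p M) (exp t) \<le> C1 * sg t * (real p * ln (real p)) * H M (exp t)"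
    using H_insert_prime_le by blast
  obtain C2 where C2: "C2 > 0" and "\<forall>\<^sub>F t in at_top. \<forall>M s. few_primes M \<longrightarrow> card M \<le> 2 \<longrightarrow> 0 \<le> s \<longrightarrow>
      s \<le> sqrt (t * ln t) \<longrightarrow> H M (exp t) \<le> C2 * H M (exp (t - s))"
    using H_doubling by blast
  then obtain t2 where t2: "\<And>t M s. t \<ge> t2 \<Longrightarrow> few_primes M \<Longrightarrow> card M \<le> 2 \<Longrightarrow> 0 \<le> s \<Longrightarrow>
      s \<le> sqrt (t * ln t) \<Longrightarrow> H M (exp t) \<le> C2 * H M (exp (t - s))"
    unfolding eventually_at_top_linorder by blast
  define B where "B = (1 + C2) * C1"
  have B: "B > 0" using C1 C2 by (simp add: B_def)
  have "\<forall>\<^sub>F t in at_top. B * sg t * (t powr (2/5) * ln (t powr (2/5))) \<le> 1/2" unfolding sg_def by real_asymp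
  moreover have "\<forall>\<^sub>F t in at_top. ln (t powr (2/5)) \<le> sqrt (t * ln t)" by real_asymp
  moreover have "\<forall>\<^sub>F t in at_top. t > 1 \<and> t \<ge> t2" by (intro eventually_conj eventually_gt_at_top eventually_ge_at_top)
  moreover note ev1
  ultimately have "\<forall>\<^sub>F t in at_top. \<forall>M p. few_primes M \<longrightarrow> card M \<le> 1 \<longrightarrow> p \<notin> M \<longrightarrow> prime p \<longrightarrow>
      real p \<le> t powr (2/5) \<longrightarrow> \<bar>L M (t + ln (real p)) - L M t\<bar> \<le> (2 * B) * sg t * (real p * ln (real p))"
  proof eventually_elim
    case (elim t)
    show ?case
    proof (intro allI impI)
      fix M p assume M: "few_primes M" "card M \<le> 1" and p: "p \<notin> M" "prime p" "real p \<le> t powr (2/5)"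
      have fr: "few_primes (insert p M)" "card (insert p M) \<le> 2"
        using few_primes_insert[of M p] M p(2) by auto
      have p1: "real p > 1" using prime_gt_1_nat[OF p(2)] by simp
      have s0: "sg t > 0" using elim by (intro sg_pos) auto
      have lnp: "ln (real p) > 0" using p1 by simp
      moreover have "ln (real p) \<le> ln (t powr (2/5))" using p p1 by (subst ln_le_cancel_iff) auto
      ultimately have lnp: "ln (real p) > 0" "ln (real p) \<le> ln (t powr (2/5))" by blast+
      let ?h = "H (insert p M)"
      have "t * ln t \<le> (t + ln (real p)) * ln (t + ln (real p))" using elim lnp by (intro mult_mono) auto
      then have "ln (real p) \<le> sqrt ((t + ln (real p)) * ln (t + ln (real p)))"
        using lnp elim by (smt (verit) real_sqrt_le_iff)
      then have "?h (exp (t + ln (real p))) \<le> C2 * ?h (exp (t + ln (real p) - ln (real p)))"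
        using fr lnp elim by (intro t2) auto
      moreover have ep: "exp (t + ln (real p)) = real p * exp t" using p1 by (simp add: exp_add)
      ultimately have h1: "?h (real p * exp t) \<le> C2 * ?h (exp t)" by simp
      have "\<bar>H M (real p * exp t) - H M (exp t)\<bar> \<le> ?h (real p * exp t) + ?h (exp t)"
        using p few_primesD(3)[OF M(1)] by (intro H_prime_shift_le) auto
      also have "\<dots> \<le> (1 + C2) * ?h (exp t)" using h1 by (simp add: algebra_simps)
      also have "\<dots> \<le> (1 + C2) * (C1 * sg t * (real p * ln (real p)) * H M (exp t))"
        using elim M p C2 by (intro mult_left_mono) auto
      finally have 1: "\<bar>H M (real p * exp t) - H M (exp t)\<bar> \<le> (B * sg t * (real p * ln (real p))) * H M (exp t)"
        by (simp add: B_def mult_ac)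
      have "B * sg t * (real p * ln (real p)) \<le> B * sg t * (t powr (2/5) * ln (t powr (2/5)))"
        using lnp p p1 B s0 by (intro mult_left_mono mult_mono) auto
      also have "\<dots> \<le> 1/2" using elim by simp
      finally have 2: "B * sg t * (real p * ln (real p)) \<le> 1/2" .
      have "\<bar>ln (H M (real p * exp t)) - ln (H M (exp t))\<bar> \<le> 2 * (B * sg t * (real p * ln (real p)))"
        using 1 2 few_primesD(3)[OF M(1)] B s0 lnp by (intro abs_ln_diff_le H_pos) auto
      then show "\<bar>L M (t + ln (real p)) - L M t\<bar> \<le> (2 * B) * sg t * (real p * ln (real p))"
        unfolding L_def ep by simp
    qed
  qed
  then show ?thesis using B by (intro exI[of _ "2 * B"]) auto
qed

text \<open>One prime factor is split off at a time. The cost function \<open>n * ln n\<close> is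
  superadditive for this purpose: \<open>p * ln p + m * ln m \<le> p * m * ln (p * m)\<close>, since
  \<open>p + m \<le> p * m\<close> for \<open>p, m \<ge> 2\<close>.\<close>

lemma L_nat_shift:
  "\<exists>C>0. \<forall>\<^sub>F t in at_top. \<forall>M n. few_primes M \<longrightarrow> card M \<le> 1 \<longrightarrow> n \<in> avoiding M \<longrightarrow>
    real n \<le> t powr (2/5) \<longrightarrow> \<bar>L M (t + ln (real n)) - L M t\<bar> \<le> C * sg t * (real n * ln (real n))"
proof -
  obtain C where C: "C > 0" and "\<forall>\<^sub>F t in at_top. \<forall>M p. few_primes M \<longrightarrow> card M \<le> 1 \<longrightarrow> p \<notin> M \<longrightarrow> prime p \<longrightarrow>
      real p \<le> t powr (2/5) \<longrightarrow> \<bar>L M (t + ln (real p)) - L M t\<bar> \<le> C * sg t * (real p * ln (real p))"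
    using L_prime_shift by blast
  then obtain t0 where t0: "\<And>t M p. t \<ge> t0 \<Longrightarrow> few_primes M \<Longrightarrow> card M \<le> 1 \<Longrightarrow> p \<notin> M \<Longrightarrow> prime p \<Longrightarrow>
      real p \<le> t powr (2/5) \<Longrightarrow> \<bar>L M (t + ln (real p)) - L M t\<bar> \<le> C * sg t * (real p * ln (real p))"
    unfolding eventually_at_top_linorder by blast
  have "\<bar>L M (t + ln (real n)) - L M t\<bar> \<le> C * sg t * (real n * ln (real n))"
    if "t \<ge> max t0 2" "few_primes M" "card M \<le> 1" "n \<in> avoiding M" "real n \<le> t powr (2/5)" for t M n
    using that(4,5)
  proof (induction n rule: less_induct)
    case (less n)
    note t = that(1) and M = that(2,3)
    have s0: "sg t > 0" using t by (intro sg_pos) auto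
    have n0: "n > 0" using less.prems by (simp add: avoiding_def)
    show ?case
    proof (cases "n = 1")
      case True
      then show ?thesis by simp
    next
      case False
      then obtain p where p: "prime p" "p dvd n" using prime_factor_nat by blast
      then obtain m where m: "n = p * m" by (auto elim: dvdE)
      have m0: "m > 0" using n0 m by simp
      have p2: "real p \<ge> 2" using prime_ge_2_nat[OF p(1)] by simp
      have mn: "m < n" using m m0 prime_gt_1_nat[OF p(1)] by simp
      have pM: "p \<notin> M" using less.prems p by (auto simp: avoiding_def)
      have mav: "m \<in> avoiding M" using less.prems m by (auto simp: avoiding_def)
      have nr: "real n = real p * real m" using m by simp
      have pn: "real p \<le> real n" unfolding nr using m0 p2 by (simp add: mult_le_cancel_left1)
      have lnm: "ln (real m) \<ge> 0" using m0 by simp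
      have ih: "\<bar>L M (t + ln (real m)) - L M t\<bar> \<le> C * sg t * (real m * ln (real m))"
        using less.IH[OF mn mav] less.prems(2) mn by simp
      have "t powr (2/5) \<le> (t + ln (real m)) powr (2/5)" using t lnm by (intro powr_mono2) auto
      then have "\<bar>L M (t + ln (real m) + ln (real p)) - L M (t + ln (real m))\<bar> \<le>
          C * sg (t + ln (real m)) * (real p * ln (real p))"
        using t lnm M pM p less.prems pn by (intro t0) auto
      also have "\<dots> \<le> C * sg t * (real p * ln (real p))"
        using t lnm C p2 by (intro mult_right_mono mult_left_mono sg_antimono) auto
      finally have st: "\<bar>L M (t + ln (real m) + ln (real p)) - L M (t + ln (real m))\<bar> \<le>
          C * sg t * (real p * ln (real p))" .
      have "real p * ln (real p) + real m * ln (real m) \<le> real n * ln (real n)"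
      proof (cases "m = 1")
        case True
        then show ?thesis using nr by simp
      next
        case False
        then have m2: "real m \<ge> 2" using m0 by simp
        have "real p * ln (real p) + real m * ln (real m) \<le> real p * ln (real n) + real m * ln (real n)"
          using p2 m2 pn mn by (intro add_mono mult_left_mono) auto
        also have "\<dots> = (real p + real m) * ln (real n)" by (simp add: algebra_simps)
        also have "\<dots> \<le> real n * ln (real n)"
        proof (rule mult_right_mono)
          have "0 \<le> (real p - 1) * (real m - 1) - 1"
            using mult_mono[of 1 "real p - 1" 1 "real m - 1"] p2 m2 by simp
          then show "real p + real m \<le> real n" unfolding nr by (simp add: algebra_simps)
        qed (use n0 in auto)
        finally show ?thesis .
      qed
      then have "C * sg t * (real p * ln (real p) + real m * ln (real m)) \<le> C * sg t * (real n * ln (real n))"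
        using C s0 by (intro mult_left_mono) auto
      moreover have "t + ln (real n) = t + ln (real m) + ln (real p)"
        unfolding nr using p2 m0 by (simp add: ln_mult)
      ultimately show ?thesis using ih st by (simp add: algebra_simps)
    qed
  qed
  then show ?thesis using C unfolding eventually_at_top_linorder by blast
qed

text \<open>The shift \<open>s\<close> is replaced by three integer shifts upwards and three
  downwards. Going up first keeps all intermediate points above \<open>t - 1\<close>, because the
  last point is within 1 of \<open>t + s\<close>. The approximation error is paid with the Lipschitz
  bound.\<close>

lemma L_shift_approx:
  assumes M: "\<And>q. q \<in> M \<Longrightarrow> prime q" and Y: "Y \<ge> 8" and s: "0 \<le> s" "s \<le> ln 2"
    and step: "\<And>u n. u \<ge> t - 1 \<Longrightarrow> n \<in> {1..4*Y} \<Longrightarrow> \<bar>L M (u + ln (real n)) - L M u\<bar> \<le> c"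
  shows "\<bar>L M (t + s) - L M t\<bar> \<le> 6 * c + lip * (16 / real Y ^ 2)"
proof -
  obtain n1 n2 n3 m1 m2 m3 :: nat where
    r: "n1 \<in> {1..4*Y}" "n2 \<in> {1..4*Y}" "n3 \<in> {1..4*Y}" "m1 \<in> {1..4*Y}" "m2 \<in> {1..4*Y}" "m3 \<in> {1..4*Y}" and
    err: "\<bar>s - (ln n1 + ln n2 + ln n3 - ln m1 - ln m2 - ln m3)\<bar> \<le> 16 / real Y ^ 2"
    using ln_ratio_approximation[OF Y s] by metis
  have l0: "ln (real n1) \<ge> 0" "ln (real n2) \<ge> 0" "ln (real m1) \<ge> 0" "ln (real m2) \<ge> 0" "ln (real m3) \<ge> 0"
    using r by auto
  have "16 / real Y ^ 2 \<le> 16 / 8 ^ 2" using Y by (intro divide_left_mono power_mono) auto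
  then have err1: "16 / real Y ^ 2 \<le> 1" by simp
  define x1 where "x1 = t + ln (real n1)"
  define x2 where "x2 = x1 + ln (real n2)"
  define x3 where "x3 = x2 + ln (real n3)"
  define y1 where "y1 = x3 - ln (real m1)"
  define y2 where "y2 = y1 - ln (real m2)"
  define y3 where "y3 = y2 - ln (real m3)"
  have y3: "\<bar>t + s - y3\<bar> \<le> 16 / real Y ^ 2"
    using err unfolding y3_def y2_def y1_def x3_def x2_def x1_def by (simp add: algebra_simps)
  then have "y3 \<ge> t - 1" using err1 s by linarith
  then have ge: "y3 \<ge> t - 1" "y2 \<ge> t - 1" "y1 \<ge> t - 1" "x1 \<ge> t - 1" "x2 \<ge> t - 1"
    using l0 unfolding y3_def y2_def x1_def x2_def by linarith+
  have "\<bar>L M x1 - L M t\<bar> \<le> c" using step[of t n1] r by (simp add: x1_def)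
  moreover have "\<bar>L M x2 - L M x1\<bar> \<le> c" using step[of x1 n2] r ge by (simp add: x2_def)
  moreover have "\<bar>L M x3 - L M x2\<bar> \<le> c" using step[of x2 n3] r ge by (simp add: x3_def)
  moreover have "\<bar>L M x3 - L M y1\<bar> \<le> c" using step[of y1 m1] r ge by (simp add: y1_def)
  moreover have "\<bar>L M y1 - L M y2\<bar> \<le> c" using step[of y2 m2] r ge by (simp add: y2_def)
  moreover have "\<bar>L M y2 - L M y3\<bar> \<le> c" using step[of y3 m3] r ge by (simp add: y3_def)
  moreover have "\<bar>L M (t + s) - L M y3\<bar> \<le> lip * (16 / real Y ^ 2)"
    using L_lipschitz[of M "t + s" y3, OF M] mult_left_mono[OF y3, of lip] lip_pos by linarith
  ultimately show ?thesis by linarith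
qed


text \<open>The sum avoids \<open>q\<close>, so \<open>q\<close> itself cannot serve as a shift.
  Instead \<open>ln q\<close> is reached by steps of \<open>ln 2\<close> and one remainder in
  \<open>[0, ln 2]\<close>, the latter by ratios of integers below \<open>q\<close>, which are
  automatically prime to it. With \<open>Y\<close> about \<open>sqrt q\<close> the approximation
  error is \<open>O(1 / q)\<close>, and the shifts cost \<open>O(sqrt q * ln q * sg t)\<close>,
  again \<open>O(1 / q)\<close> as long as \<open>q\<close> is
  \<open>O(t powr (1/4))\<close>.\<close>

lemma L_self_shift_coprime:
  "\<exists>C>0. \<forall>\<^sub>F t in at_top. \<forall>q. prime q \<longrightarrow> 64 \<le> q \<longrightarrow> real q \<le> 4 * t powr (1/4) \<longrightarrow>
    \<bar>L {q} (t + ln (real q)) - L {q} t\<bar> \<le> C / real q"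
proof -
  obtain C where C: "C > 0" and "\<forall>\<^sub>F t in at_top. \<forall>M n. few_primes M \<longrightarrow> card M \<le> 1 \<longrightarrow> n \<in> avoiding M \<longrightarrow>
      real n \<le> t powr (2/5) \<longrightarrow> \<bar>L M (t + ln (real n)) - L M t\<bar> \<le> C * sg t * (real n * ln (real n))"
    using L_nat_shift by blast
  then obtain t0 where t0: "\<And>t M n. t \<ge> t0 \<Longrightarrow> few_primes M \<Longrightarrow> card M \<le> 1 \<Longrightarrow> n \<in> avoiding M \<Longrightarrow>
      real n \<le> t powr (2/5) \<Longrightarrow> \<bar>L M (t + ln (real n)) - L M t\<bar> \<le> C * sg t * (real n * ln (real n))"
    unfolding eventually_at_top_linorder by blast
  define D where "D = 51 * C + 64 * lip"
  have "\<forall>\<^sub>F t::real in at_top. 4 * t powr (1/4) \<le> (t - 1) powr (2/5)" by real_asymp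
  moreover have "\<forall>\<^sub>F t::real in at_top. (4 * t powr (1/4)) * (4 * t powr (1/4)) powr (1/2) * ln (4 * t powr (1/4)) * sg t \<le> 1"
    unfolding sg_def by real_asymp
  moreover have "\<forall>\<^sub>F t in at_top. t - 1 \<ge> t0 \<and> t \<ge> (4::real)"
    by (intro eventually_conj eventually_ge_at_top) real_asymp
  ultimately have "\<forall>\<^sub>F t in at_top. \<forall>q. prime q \<longrightarrow> 64 \<le> q \<longrightarrow> real q \<le> 4 * t powr (1/4) \<longrightarrow>
      \<bar>L {q} (t + ln (real q)) - L {q} t\<bar> \<le> D / real q"
  proof eventually_elim
    case (elim t)
    show ?case
    proof (intro allI impI)
      fix q :: nat assume q: "prime q" "64 \<le> q" "real q \<le> 4 * t powr (1/4)"
      have q64: "real q \<ge> 64" using q by simp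
      have fq: "few_primes {q}" using q by (simp add: few_primes_def)
      define rq where "rq = sqrt (real q)"
      have rq: "rq \<ge> 8" "rq * rq = real q" using q64 by (auto simp: rq_def intro!: real_le_rsqrt)
      have rq_powr: "rq = real q powr (1/2)" using q64 by (simp add: rq_def powr_half_sqrt)
      have lnq: "ln (real q) \<ge> 0" using q64 by simp
      have s0: "sg t > 0" using elim by (intro sg_pos) auto
      have s1: "sg (t - 1) \<le> 2 * sg t"
        using sg_antimono[of "t / 2" "t - 1"] sg_half_le[of t] elim by simp
      have lq: "ln (real q) \<le> ln (4 * t powr (1/4))" using q q64 elim by (subst ln_le_cancel_iff) auto
      have key: "sg t * (rq * ln (real q)) \<le> 1 / real q"
      proof -
        have "real q * rq * ln (real q) * sg t \<le>
            (4 * t powr (1/4)) * (4 * t powr (1/4)) powr (1/2) * ln (4 * t powr (1/4)) * sg t"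
          unfolding rq_powr using q q64 s0 lnq lq by (intro mult_right_mono mult_mono powr_mono2) auto
        then show ?thesis using elim q64 by (simp add: field_simps)
      qed
      have nat_shift: "\<bar>L {q} (u + ln (real n)) - L {q} u\<bar> \<le> C * (2 * sg t) * (real n * ln (real n))"
        if "u \<ge> t - 1" "1 \<le> n" "n < q" for u n
      proof -
        have "n \<in> avoiding {q}" using that by (auto simp: avoiding_def dest: dvd_imp_le)
        moreover have "real n \<le> u powr (2/5)"
        proof -
          have "real n \<le> (t - 1) powr (2/5)" using that q elim by linarith
          also have "\<dots> \<le> u powr (2/5)" using that elim by (intro powr_mono2) auto
          finally show ?thesis .
        qed
        ultimately have "\<bar>L {q} (u + ln (real n)) - L {q} u\<bar> \<le> C * sg u * (real n * ln (real n))"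
          using that elim fq by (intro t0) auto
        also have "\<dots> \<le> C * (2 * sg t) * (real n * ln (real n))"
          using sg_antimono[of "t - 1" u] s1 that elim C by (intro mult_right_mono mult_left_mono) auto
        finally show ?thesis .
      qed
      obtain i where i: "2 ^ i \<le> real q" "real q < 2 ^ Suc i"
        using powr_of_two_bracket[of "real q"] q64 by auto
      have il: "real i * ln 2 \<le> ln (real q)" "ln (real q) < real (Suc i) * ln 2"
      proof -
        have "ln (2 ^ i) \<le> ln (real q)" "ln (real q) < ln (2 ^ Suc i)" using i q64 by (auto simp del: power_Suc)
        then show "real i * ln 2 \<le> ln (real q)" "ln (real q) < real (Suc i) * ln 2"
          by (simp_all only: ln_realpow zero_less_numeral)
      qed
      have iter: "\<bar>L {q} (t + real j * ln 2) - L {q} t\<bar> \<le> real j * (C * (2 * sg t) * (2 * ln 2))" for j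
      proof (induction j)
        case 0
        then show ?case by simp
      next
        case (Suc j)
        have "\<bar>L {q} (t + real j * ln 2 + ln (real 2)) - L {q} (t + real j * ln 2)\<bar> \<le>
            C * (2 * sg t) * (real 2 * ln (real 2))"
        proof (intro nat_shift)
          have "0 \<le> real j * ln 2" by simp
          then show "t - 1 \<le> t + real j * ln 2" by linarith
        qed (use q in auto)
        moreover have "t + real (Suc j) * ln 2 = t + real j * ln 2 + ln (real 2)" by (simp add: algebra_simps)
        ultimately show ?case using Suc by (simp add: algebra_simps)
      qed
      have part1: "\<bar>L {q} (t + real i * ln 2) - L {q} t\<bar> \<le> 3 * C / real q"
      proof -
        have "real i * (C * (2 * sg t) * (2 * ln 2)) = 4 * C * (sg t * (real i * ln 2))" by simp
        also have "\<dots> \<le> 4 * C * (sg t * ln (real q))"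
          using il C s0 by (intro mult_left_mono) auto
        also have "\<dots> \<le> C / 2 * (sg t * (rq * ln (real q)))"
        proof -
          have "8 * (sg t * ln (real q)) \<le> rq * (sg t * ln (real q))"
            using rq s0 lnq by (intro mult_right_mono) auto
          then have "C / 2 * (8 * (sg t * ln (real q))) \<le> C / 2 * (rq * (sg t * ln (real q)))"
            using C by (intro mult_left_mono) auto
          then show ?thesis by (simp add: mult_ac)
        qed
        also have "\<dots> \<le> 3 * C * (1 / real q)"
          using key C s0 lnq rq by (intro mult_mono) auto
        finally show ?thesis using iter[of i] by simp
      qed
      \<comment> \<open>The lower bound 64 for \<open>q\<close> guarantees \<open>Y \<ge> 8\<close>,
        as the approximation demands, and \<open>4 * Y < q\<close>.\<close>
      define Y where "Y = nat \<lfloor>rq\<rfloor>"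
      have Y: "real Y \<le> rq" "real Y > rq - 1" "Y \<ge> 8"
        unfolding Y_def using rq by (auto simp: le_nat_floor)
      have Yhalf: "real Y \<ge> rq / 2" using Y rq by linarith
      have Yq: "4 * Y < q"
      proof -
        have "4 * real Y \<le> 4 * rq" using Y by simp
        also have "\<dots> < rq * rq" using rq by (intro mult_strict_right_mono) auto
        finally show ?thesis using rq by simp
      qed
      define s where "s = ln (real q) - real i * ln 2"
      have s: "0 \<le> s" "s \<le> ln 2" using il by (auto simp: s_def algebra_simps)
      have "\<bar>L {q} (t + real i * ln 2 + s) - L {q} (t + real i * ln 2)\<bar> \<le>
          6 * (C * (2 * sg t) * (4 * rq * ln (real q))) + lip * (16 / real Y ^ 2)"
      proof (rule L_shift_approx[OF _ Y(3) s])
        show "prime p" if "p \<in> {q}" for p using that q by simp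
        fix u n assume u: "u \<ge> t + real i * ln 2 - 1" and n: "n \<in> {1..4 * Y}"
        have "\<bar>L {q} (u + ln (real n)) - L {q} u\<bar> \<le> C * (2 * sg t) * (real n * ln (real n))"
        proof (intro nat_shift)
          have "0 \<le> real i * ln 2" by simp
          then show "t - 1 \<le> u" using u by linarith
        qed (use n Yq in auto)
        also have "\<dots> \<le> C * (2 * sg t) * (4 * rq * ln (real q))"
        proof -
          have "real n \<le> 4 * rq" using n Y by (simp add: order.trans[of _ "4 * real Y"] flip: of_nat_le_iff)
          moreover have "ln (real n) \<le> ln (real q)" using n Yq by simp
          ultimately show ?thesis using C s0 n rq by (intro mult_left_mono mult_mono) auto
        qed
        finally show "\<bar>L {q} (u + ln (real n)) - L {q} u\<bar> \<le> C * (2 * sg t) * (4 * rq * ln (real q))" .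
      qed
      also have "6 * (C * (2 * sg t) * (4 * rq * ln (real q))) = 48 * C * (sg t * (rq * ln (real q)))" by simp
      also have "\<dots> \<le> 48 * C * (1 / real q)" using key C by (intro mult_left_mono) auto
      also have "lip * (16 / real Y ^ 2) \<le> lip * (64 / real q)"
      proof (rule mult_left_mono)
        have "(rq / 2) ^ 2 \<le> real Y ^ 2" using Yhalf rq by (intro power_mono) auto
        then have "16 / real Y ^ 2 \<le> 16 / (rq / 2) ^ 2" using rq Y by (intro divide_left_mono) auto
        also have "(rq / 2) ^ 2 = real q / 4" using rq by (simp add: power2_eq_square)
        finally show "16 / real Y ^ 2 \<le> 64 / real q" by simp
      qed (use lip_pos in auto)
      finally have part2: "\<bar>L {q} (t + ln (real q)) - L {q} (t + real i * ln 2)\<bar> \<le> 48 * C / real q + 64 * lip / real q"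
        by (simp add: s_def mult_ac)
      have "\<bar>L {q} (t + ln (real q)) - L {q} t\<bar> \<le> 3 * C / real q + (48 * C / real q + 64 * lip / real q)"
        using part1 part2 by linarith
      also have "\<dots> = D / real q" by (simp add: D_def add_divide_distrib)
      finally show "\<bar>L {q} (t + ln (real q)) - L {q} t\<bar> \<le> D / real q" .
    qed
  qed
  moreover have "D > 0" using C lip_pos by (simp add: D_def)
  ultimately show ?thesis by blast
qed

text \<open>In the shift identity the two sums avoiding \<open>q\<close> nearly cancel: their
  difference is \<open>O(1 / q)\<close> of one of them by \<open>L_self_shift_coprime\<close>, and
  the coefficient \<open>q / (q + 1)\<close> is off by another \<open>1 / (q + 1)\<close>. This
  saves a factor \<open>q\<close> over \<open>L_prime_shift\<close>, which is kept for
  \<open>q < 64\<close>.\<close>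

lemma L_prime_shift_sharp:
  "\<exists>C>0. \<forall>\<^sub>F t in at_top. \<forall>q. prime q \<longrightarrow> real q \<le> 4 * t powr (1/4) \<longrightarrow>
    \<bar>L {} (t + ln (real q)) - L {} t\<bar> \<le> C * sg t * ln (real q)"
proof -
  obtain C1 where C1: "C1 > 0" and ev1: "\<forall>\<^sub>F t in at_top. \<forall>M p. few_primes M \<longrightarrow> card M \<le> 1 \<longrightarrow> p \<notin> M \<longrightarrow> prime p \<longrightarrow>
      real p \<le> t powr (2/5) \<longrightarrow> \<bar>L M (t + ln (real p)) - L M t\<bar> \<le> C1 * sg t * (real p * ln (real p))"
    using L_prime_shift by blast
  obtain C2 where C2: "C2 > 0" and ev2: "\<forall>\<^sub>F t in at_top. \<forall>q. prime q \<longrightarrow> 64 \<le> q \<longrightarrow> real q \<le> 4 * t powr (1/4) \<longrightarrow>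
      \<bar>L {q} (t + ln (real q)) - L {q} t\<bar> \<le> C2 / real q"
    using L_self_shift_coprime by blast
  obtain C3 where C3: "C3 > 0" and ev3: "\<forall>\<^sub>F t in at_top. \<forall>M p. few_primes M \<longrightarrow> card M \<le> 1 \<longrightarrow> p \<notin> M \<longrightarrow> prime p \<longrightarrow>
      real p \<le> t powr (2/5) \<longrightarrow> H (insert p M) (exp t) \<le> C3 * sg t * (real p * ln (real p)) * H M (exp t)"
    using H_insert_prime_le by blast
  define B where "B = (C2 * exp C2 + 1) * C3"
  have B: "B > 0" using C2 C3 by (simp add: B_def add_pos_pos)
  have "\<forall>\<^sub>F t::real in at_top. 4 * t powr (1/4) \<le> t powr (2/5)" by real_asymp
  moreover have "\<forall>\<^sub>F t in at_top. B * sg t * ln (4 * t powr (1/4)) \<le> 1/2" unfolding sg_def by real_asymp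
  moreover have "\<forall>\<^sub>F t::real in at_top. t > 1" by (rule eventually_gt_at_top)
  moreover note ev1 ev2 ev3
  ultimately have "\<forall>\<^sub>F t in at_top. \<forall>q. prime q \<longrightarrow> real q \<le> 4 * t powr (1/4) \<longrightarrow>
      \<bar>L {} (t + ln (real q)) - L {} t\<bar> \<le> (64 * C1 + 2 * B) * sg t * ln (real q)"
  proof eventually_elim
    case (elim t)
    show ?case
    proof (intro allI impI)
      fix q :: nat assume q: "prime q" "real q \<le> 4 * t powr (1/4)"
      have q1: "real q > 1" using prime_gt_1_nat[OF q(1)] by simp
      have q25: "real q \<le> t powr (2/5)" using q elim by linarith
      have s0: "sg t > 0" using elim by (intro sg_pos) auto
      have lnq: "ln (real q) > 0" using q1 by simp
      have fe: "few_primes {}" by (simp add: few_primes_def)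
      show "\<bar>L {} (t + ln (real q)) - L {} t\<bar> \<le> (64 * C1 + 2 * B) * sg t * ln (real q)"
      proof (cases "q < 64")
        case True
        have "\<bar>L {} (t + ln (real q)) - L {} t\<bar> \<le> C1 * sg t * (real q * ln (real q))"
          using elim(4) fe q q25 by simp
        also have "\<dots> \<le> C1 * sg t * (64 * ln (real q))"
          using True C1 s0 lnq by (intro mult_left_mono mult_right_mono) auto
        also have "\<dots> = (64 * C1) * (sg t * ln (real q))" by simp
        also have "\<dots> \<le> (64 * C1 + 2 * B) * (sg t * ln (real q))"
          using B s0 lnq by (intro mult_right_mono) auto
        finally show ?thesis by (simp add: mult_ac)
      next
        case False
        let ?V = "exp t" and ?h = "H {q}"
        have ep: "exp (t + ln (real q)) = real q * ?V" using q1 by (simp add: exp_add)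
        have hpos: "?h ?V > 0" "?h (real q * ?V) > 0" "H {} ?V > 0" "H {} (real q * ?V) > 0"
          using q q1 by (auto intro!: H_pos)
        define x where "x = L {q} (t + ln (real q)) - L {q} t"
        have x: "\<bar>x\<bar> \<le> C2 / real q" unfolding x_def using elim(5) q False by auto
        also have "\<dots> \<le> C2 / 1" using q1 C2 by (intro divide_left_mono) auto
        finally have x1: "\<bar>x\<bar> \<le> C2" by simp
        have "?h (real q * ?V) = exp x * ?h ?V"
          unfolding x_def L_def ep using hpos by (simp add: exp_diff)
        then have "?h (real q * ?V) - ?h ?V = (exp x - 1) * ?h ?V" by (simp add: algebra_simps)
        then have "\<bar>?h (real q * ?V) - ?h ?V\<bar> = \<bar>exp x - 1\<bar> * ?h ?V"
          using hpos by (simp only: abs_mult abs_of_pos)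
        also have "\<dots> \<le> (\<bar>x\<bar> * exp \<bar>x\<bar>) * ?h ?V"
          using abs_exp_minus_one_le hpos by (intro mult_right_mono) auto
        also have "\<dots> \<le> (C2 / real q * exp C2) * ?h ?V"
          using x x1 hpos C2 by (intro mult_right_mono mult_mono) auto
        finally have d1: "\<bar>?h (real q * ?V) - ?h ?V\<bar> \<le> (C2 / real q * exp C2) * ?h ?V" .
        have d2: "1 / (real q + 1) * ?h ?V \<le> 1 / real q * ?h ?V"
          using hpos q1 by (intro mult_right_mono divide_left_mono) auto
        have "H {} (real q * ?V) - H {} ?V = (?h (real q * ?V) - ?h ?V) + 1 / (real q + 1) * ?h ?V"
        proof -
          have "real q / (real q + 1) = 1 - 1 / (real q + 1)" using q1 by (simp add: field_simps)
          then have "real q / (real q + 1) * ?h ?V = ?h ?V - 1 / (real q + 1) * ?h ?V"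
            by (simp only: left_diff_distrib mult_1)
          moreover have "H {} (real q * ?V) = ?h (real q * ?V) + H {} ?V - real q / (real q + 1) * ?h ?V"
            using q by (intro H_prime_shift) auto
          ultimately show ?thesis by linarith
        qed
        moreover have "1 / (real q + 1) * ?h ?V \<ge> 0" using hpos by simp
        ultimately have "\<bar>H {} (real q * ?V) - H {} ?V\<bar> \<le> (C2 / real q * exp C2) * ?h ?V + 1 / real q * ?h ?V"
          using d1 d2 by linarith
        also have "\<dots> = (C2 * exp C2 + 1) / real q * ?h ?V" by (simp add: add_divide_distrib algebra_simps)
        also have "\<dots> \<le> (C2 * exp C2 + 1) / real q * (C3 * sg t * (real q * ln (real q)) * H {} ?V)"
          using elim(6) fe q q25 C2 by (intro mult_left_mono divide_nonneg_nonneg) auto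
        also have "\<dots> = (B * sg t * ln (real q)) * H {} ?V" using q1 by (simp add: B_def field_simps)
        finally have 1: "\<bar>H {} (real q * ?V) - H {} ?V\<bar> \<le> (B * sg t * ln (real q)) * H {} ?V" .
        have "ln (real q) \<le> ln (4 * t powr (1/4))" using q q1 elim by (subst ln_le_cancel_iff) auto
        then have "B * sg t * ln (real q) \<le> B * sg t * ln (4 * t powr (1/4))"
          using B s0 by (intro mult_left_mono) auto
        then have 2: "B * sg t * ln (real q) \<le> 1/2" using elim by linarith
        have "\<bar>ln (H {} (real q * ?V)) - ln (H {} ?V)\<bar> \<le> 2 * (B * sg t * ln (real q))"
          using 1 2 hpos B s0 lnq by (intro abs_ln_diff_le) auto
        also have "\<dots> = (2 * B) * (sg t * ln (real q))" by simp
        also have "\<dots> \<le> (64 * C1 + 2 * B) * (sg t * ln (real q))"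
          using C1 s0 lnq by (intro mult_right_mono) auto
        finally show ?thesis unfolding L_def ep by (simp add: mult_ac)
      qed
    qed
  qed
  moreover have "64 * C1 + 2 * B > 0" using C1 B by simp
  ultimately show ?thesis by blast
qed

text \<open>The cost \<open>ln n\<close> is additive over prime factors, so shifts by long products
  do not degrade the bound.\<close>

lemma L_nat_shift_sharp:
  "\<exists>C>0. \<forall>\<^sub>F t in at_top. \<forall>n\<ge>1. real n \<le> 4 * t powr (1/4) \<longrightarrow>
    \<bar>L {} (t + ln (real n)) - L {} t\<bar> \<le> C * sg t * ln (real n)"
proof -
  obtain C where C: "C > 0" and "\<forall>\<^sub>F t in at_top. \<forall>q. prime q \<longrightarrow> real q \<le> 4 * t powr (1/4) \<longrightarrow>
      \<bar>L {} (t + ln (real q)) - L {} t\<bar> \<le> C * sg t * ln (real q)"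
    using L_prime_shift_sharp by blast
  then obtain t0 where t0: "\<And>t q. t \<ge> t0 \<Longrightarrow> prime q \<Longrightarrow> real q \<le> 4 * t powr (1/4) \<Longrightarrow>
      \<bar>L {} (t + ln (real q)) - L {} t\<bar> \<le> C * sg t * ln (real q)"
    unfolding eventually_at_top_linorder by blast
  have "\<bar>L {} (t + ln (real n)) - L {} t\<bar> \<le> C * sg t * ln (real n)"
    if "t \<ge> max t0 2" "n \<ge> 1" "real n \<le> 4 * t powr (1/4)" for t n
    using that(2,3)
  proof (induction n rule: less_induct)
    case (less n)
    note t = that(1)
    show ?case
    proof (cases "n = 1")
      case True
      then show ?thesis by simp
    next
      case False
      then obtain p where p: "prime p" "p dvd n" using prime_factor_nat by blast
      then obtain m where m: "n = p * m" by (auto elim: dvdE)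
      have m0: "m > 0" using less.prems m by (cases m) auto
      have p2: "real p \<ge> 2" using prime_ge_2_nat[OF p(1)] by simp
      have mn: "m < n" using m m0 prime_gt_1_nat[OF p(1)] by simp
      have nr: "real n = real p * real m" using m by simp
      have pn: "real p \<le> real n" unfolding nr using m0 p2 by (simp add: mult_le_cancel_left1)
      have lnm: "ln (real m) \<ge> 0" using m0 by simp
      have ih: "\<bar>L {} (t + ln (real m)) - L {} t\<bar> \<le> C * sg t * ln (real m)"
        using less.IH[OF mn] less.prems(2) mn m0 by simp
      have "t powr (1/4) \<le> (t + ln (real m)) powr (1/4)" using t lnm by (intro powr_mono2) auto
      then have "\<bar>L {} (t + ln (real m) + ln (real p)) - L {} (t + ln (real m))\<bar> \<le>
          C * sg (t + ln (real m)) * ln (real p)"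
        using t lnm p less.prems pn by (intro t0) auto
      also have "\<dots> \<le> C * sg t * ln (real p)"
        using t lnm C p2 by (intro mult_right_mono mult_left_mono sg_antimono) auto
      finally have st: "\<bar>L {} (t + ln (real m) + ln (real p)) - L {} (t + ln (real m))\<bar> \<le>
          C * sg t * ln (real p)" .
      have l: "ln (real n) = ln (real m) + ln (real p)" unfolding nr using p2 m0 by (simp add: ln_mult)
      have "L {} (t + ln (real n)) = L {} (t + ln (real m) + ln (real p))" unfolding l by (simp only: add.assoc)
      then have "\<bar>L {} (t + ln (real n)) - L {} t\<bar> \<le> C * sg t * ln (real m) + C * sg t * ln (real p)"
        using ih st by linarith
      then show ?thesis unfolding l by (simp add: algebra_simps)
    qed
  qed
  then show ?thesis using C unfolding eventually_at_top_linorder by blast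
qed

text \<open>Ratios of integers of size \<open>t powr (1/4)\<close> cost \<open>sg t * ln t\<close>
  and leave an error of order \<open>t powr (-1/2)\<close>, which is smaller still. Compared with
  shifts by \<open>ln 2\<close> a factor \<open>ln t\<close> is lost; hence this may be used only
  once in \<open>L_shift_log\<close>.\<close>

lemma L_shift_bounded:
  "\<exists>C>0. \<forall>\<^sub>F t in at_top. \<forall>s. 0 \<le> s \<longrightarrow> s \<le> ln 2 \<longrightarrow> \<bar>L {} (t + s) - L {} t\<bar> \<le> C * (sg t * ln t)"
proof -
  obtain C where C: "C > 0" and "\<forall>\<^sub>F t in at_top. \<forall>n\<ge>1. real n \<le> 4 * t powr (1/4) \<longrightarrow>
      \<bar>L {} (t + ln (real n)) - L {} t\<bar> \<le> C * sg t * ln (real n)"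
    using L_nat_shift_sharp by blast
  then obtain t0 where t0: "\<And>t n. t \<ge> t0 \<Longrightarrow> n \<ge> 1 \<Longrightarrow> real n \<le> 4 * t powr (1/4) \<Longrightarrow>
      \<bar>L {} (t + ln (real n)) - L {} t\<bar> \<le> C * sg t * ln (real n)"
    unfolding eventually_at_top_linorder by blast
  have "\<forall>\<^sub>F t::real in at_top. 2 * t powr (1/4) \<le> 4 * (t - 1) powr (1/4)" by real_asymp
  moreover have "\<forall>\<^sub>F t::real in at_top. t powr (1/4) / 2 \<ge> 8" by real_asymp
  moreover have "\<forall>\<^sub>F t::real in at_top. 2 * t powr (1/4) \<le> t" by real_asymp
  moreover have "\<forall>\<^sub>F t::real in at_top. t powr (-1/2) \<le> sg t * ln t" unfolding sg_def by real_asymp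
  moreover have "\<forall>\<^sub>F t in at_top. t - 1 \<ge> t0 \<and> t \<ge> (4::real)"
    by (intro eventually_conj eventually_ge_at_top) real_asymp
  ultimately have "\<forall>\<^sub>F t in at_top. \<forall>s. 0 \<le> s \<longrightarrow> s \<le> ln 2 \<longrightarrow>
      \<bar>L {} (t + s) - L {} t\<bar> \<le> (12 * C + 256 * lip) * (sg t * ln t)"
  proof eventually_elim
    case (elim t)
    show ?case
    proof (intro allI impI)
      fix s assume s: "0 \<le> (s::real)" "s \<le> ln 2"
      have s0: "sg t > 0" using elim by (intro sg_pos) auto
      have s1: "sg (t - 1) \<le> 2 * sg t"
        using sg_antimono[of "t / 2" "t - 1"] sg_half_le[of t] elim by simp
      define z where "z = t powr (1/4) / 2"
      define Y where "Y = nat \<lfloor>z\<rfloor>"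
      have z8: "z \<ge> 8" using elim by (simp add: z_def)
      have Y: "real Y \<le> z" "Y \<ge> 8" "real Y \<ge> z / 2"
        unfolding Y_def using z8 half_le_nat_floor[of z] by (auto simp: le_nat_floor)
      have Yt: "4 * real Y \<le> 2 * t powr (1/4)" using Y by (simp add: z_def)
      have "\<bar>L {} (t + s) - L {} t\<bar> \<le> 6 * (C * (2 * sg t) * ln t) + lip * (16 / real Y ^ 2)"
      proof (rule L_shift_approx[OF _ Y(2) s])
        fix u n assume u: "u \<ge> t - 1" and n: "n \<in> {1..4 * Y}"
        have nY: "real n \<le> 4 * real Y" using n by (simp flip: of_nat_le_iff)
        have "(t - 1) powr (1/4) \<le> u powr (1/4)" using u elim by (intro powr_mono2) auto
        then have "\<bar>L {} (u + ln (real n)) - L {} u\<bar> \<le> C * sg u * ln (real n)"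
          using u n elim nY Yt by (intro t0) auto
        also have "\<dots> \<le> C * (2 * sg t) * ln t"
        proof (intro mult_mono mult_left_mono)
          show "sg u \<le> 2 * sg t" using sg_antimono[of "t - 1" u] s1 u elim by simp
          have "real n \<le> t" using nY Yt elim by linarith
          then show "ln (real n) \<le> ln t" using n by simp
        qed (use C s0 n sg_pos[of u] u elim in auto)
        finally show "\<bar>L {} (u + ln (real n)) - L {} u\<bar> \<le> C * (2 * sg t) * ln t" .
      qed auto
      also have "lip * (16 / real Y ^ 2) \<le> lip * (256 * (sg t * ln t))"
      proof (rule mult_left_mono)
        have "(z / 2) ^ 2 \<le> real Y ^ 2" using Y z8 by (intro power_mono) auto
        then have "16 / real Y ^ 2 \<le> 16 / (z / 2) ^ 2" using z8 Y by (intro divide_left_mono) auto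
        also have "(z / 2) ^ 2 = t powr (1/2) / 16"
          by (simp add: z_def power2_eq_square flip: powr_add)
        also have "16 / (t powr (1/2) / 16) = 256 * t powr (-1/2)" using elim by (simp add: powr_minus_divide)
        also have "\<dots> \<le> 256 * (sg t * ln t)" using elim by simp
        finally show "16 / real Y ^ 2 \<le> 256 * (sg t * ln t)" .
      qed (use lip_pos in auto)
      finally show "\<bar>L {} (t + s) - L {} t\<bar> \<le> (12 * C + 256 * lip) * (sg t * ln t)"
        by (simp add: algebra_simps)
    qed
  qed
  moreover have "12 * C + 256 * lip > 0" using C lip_pos by simp
  ultimately show ?thesis by blast
qed

text \<open>A shift by \<open>O(ln t)\<close> consists of \<open>O(ln t)\<close> shifts by exactly
  \<open>ln 2\<close>, each costing \<open>O(sg t)\<close>, and a single remainder costing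
  \<open>O(sg t * ln t)\<close>. Both parts are
  \<open>O(sg t * ln t) = O(sqrt (ln t / t))\<close>.\<close>

lemma L_shift_log:
  assumes B: "B > 0"
  shows "\<exists>C>0. \<forall>\<^sub>F t in at_top. \<forall>s. \<bar>s\<bar> \<le> B * ln t \<longrightarrow> \<bar>L {} (t + s) - L {} t\<bar> \<le> C * (sg t * ln t)"
proof -
  obtain C1 where C1: "C1 > 0" and "\<forall>\<^sub>F t in at_top. \<forall>n\<ge>1. real n \<le> 4 * t powr (1/4) \<longrightarrow>
      \<bar>L {} (t + ln (real n)) - L {} t\<bar> \<le> C1 * sg t * ln (real n)"
    using L_nat_shift_sharp by blast
  then obtain t1 where t1: "\<And>t n. t \<ge> t1 \<Longrightarrow> n \<ge> 1 \<Longrightarrow> real n \<le> 4 * t powr (1/4) \<Longrightarrow>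
      \<bar>L {} (t + ln (real n)) - L {} t\<bar> \<le> C1 * sg t * ln (real n)"
    unfolding eventually_at_top_linorder by blast
  obtain C2 where C2: "C2 > 0" and "\<forall>\<^sub>F t in at_top. \<forall>s. 0 \<le> s \<longrightarrow> s \<le> ln 2 \<longrightarrow>
      \<bar>L {} (t + s) - L {} t\<bar> \<le> C2 * (sg t * ln t)"
    using L_shift_bounded by blast
  then obtain t2 where t2: "\<And>t s. t \<ge> t2 \<Longrightarrow> 0 \<le> s \<Longrightarrow> s \<le> ln 2 \<Longrightarrow>
      \<bar>L {} (t + s) - L {} t\<bar> \<le> C2 * (sg t * ln t)"
    unfolding eventually_at_top_linorder by blast
  \<comment> \<open>The constant \<open>D\<close> stays free since a shift downwards from
    \<open>t\<close> is read as one upwards from \<open>t + s\<close>, where \<open>ln\<close> is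
    slightly smaller; \<open>D = 2 * B\<close> makes up for that.\<close>
  have up: "\<bar>L {} (u + s) - L {} u\<bar> \<le> (2 * C1 * D + 2 * C2) * (sg u * ln u)"
    if u: "u \<ge> t1" "u \<ge> t2" "u \<ge> 4" "D * ln u \<le> u" and s: "0 \<le> s" "s \<le> D * ln u" and D: "D > 0" for u s D
  proof -
    have u1: "u powr (1/4) \<ge> 1" using u by (intro ge_one_powr_ge_zero) auto
    define i where "i = nat \<lfloor>s / ln 2\<rfloor>"
    have i: "real i \<le> s / ln 2" "real i > s / ln 2 - 1" unfolding i_def using s by auto
    then have il: "real i * ln 2 \<le> s" "s < real i * ln 2 + ln 2" by (auto simp: field_simps)
    have s0: "sg u > 0" using u by (intro sg_pos) auto
    have iter: "\<bar>L {} (u + real j * ln 2) - L {} u\<bar> \<le> real j * (C1 * sg u * ln 2)" for j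
    proof (induction j)
      case 0
      then show ?case by simp
    next
      case (Suc j)
      let ?w = "u + real j * ln 2"
      have w: "?w \<ge> u" by simp
      have "1 \<le> ?w" using u w by linarith
      then have "1 \<le> ?w powr (1/4)" by (intro ge_one_powr_ge_zero) auto
      moreover have "t1 \<le> ?w" using u(1) w by linarith
      ultimately have "\<bar>L {} (?w + ln (real 2)) - L {} ?w\<bar> \<le> C1 * sg ?w * ln (real 2)"
        by (intro t1) auto
      also have "\<dots> \<le> C1 * sg u * ln (real 2)"
        using u w C1 by (intro mult_right_mono mult_left_mono sg_antimono) auto
      finally have "\<bar>L {} (?w + ln 2) - L {} ?w\<bar> \<le> C1 * sg u * ln 2" by simp
      moreover have "L {} (u + real (Suc j) * ln 2) = L {} (?w + ln 2)" by (simp add: algebra_simps)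
      moreover have "real (Suc j) * (C1 * sg u * ln 2) = real j * (C1 * sg u * ln 2) + C1 * sg u * ln 2"
        by (simp add: algebra_simps)
      ultimately show ?case using Suc by linarith
    qed
    have "real i * (C1 * sg u * ln 2) = C1 * sg u * (real i * ln 2)" by simp
    also have "\<dots> \<le> C1 * sg u * (D * ln u)" using il s C1 s0 by (intro mult_left_mono) auto
    finally have p1: "\<bar>L {} (u + real i * ln 2) - L {} u\<bar> \<le> C1 * D * (sg u * ln u)"
      using iter[of i] by (simp add: mult_ac)
    let ?w = "u + real i * ln 2"
    have w: "?w \<ge> u" "?w \<le> 2 * u" using il s u by auto
    have lw: "ln ?w \<ge> 0" using u w by (intro ln_ge_zero) linarith
    have "\<bar>L {} (?w + (s - real i * ln 2)) - L {} ?w\<bar> \<le> C2 * (sg ?w * ln ?w)"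
      using order.trans[OF u(2) w(1)] il by (intro t2) auto
    also have "\<dots> \<le> C2 * (sg u * (2 * ln u))"
    proof (intro mult_left_mono mult_mono sg_antimono)
      have "?w > 0" using w u by linarith
      then have "ln ?w \<le> ln (2 * u)" using w(2) u by (subst ln_le_cancel_iff) auto
      also have "\<dots> = ln 2 + ln u" using u by (simp add: ln_mult)
      also have "ln 2 \<le> ln u" using u by simp
      finally show "ln ?w \<le> 2 * ln u" by simp
    qed (use u w C2 s0 lw in auto)
    finally have p2: "\<bar>L {} (u + s) - L {} ?w\<bar> \<le> 2 * C2 * (sg u * ln u)" by (simp add: mult_ac)
    have "C1 * D * (sg u * ln u) \<le> 2 * C1 * D * (sg u * ln u)"
      using C1 D s0 u by (intro mult_right_mono) auto
    then show ?thesis using p1 p2 by (simp add: distrib_right)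
  qed
  have "\<forall>\<^sub>F t in at_top. 2 * B * ln t \<le> t / 2 \<and> 2 * B * ln (t / 2) \<le> t / 2 \<and> B * ln t \<le> 2 * B * ln (t / 2) \<and> B * ln t \<le> t / 2"
    using B by (intro eventually_conj; real_asymp)
  moreover have "\<forall>\<^sub>F t in at_top. t / 2 \<ge> t1 \<and> t / 2 \<ge> t2 \<and> t \<ge> (8::real)"
    by (intro eventually_conj eventually_ge_at_top; real_asymp)
  moreover have "\<forall>\<^sub>F t in at_top. \<forall>u\<ge>t. 2 * B * ln u \<le> u"
  proof -
    have "\<forall>\<^sub>F u in at_top. 2 * B * ln u \<le> u" by real_asymp
    then show ?thesis unfolding eventually_at_top_linorder by (meson order.trans)
  qed
  ultimately have "\<forall>\<^sub>F t in at_top. \<forall>s. \<bar>s\<bar> \<le> B * ln t \<longrightarrow>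
      \<bar>L {} (t + s) - L {} t\<bar> \<le> (2 * (4 * C1 * B + 2 * C2)) * (sg t * ln t)"
  proof eventually_elim
    case (elim t)
    show ?case
    proof (intro allI impI)
      fix s assume s: "\<bar>s\<bar> \<le> B * ln t"
      have s0: "sg t > 0" "ln t > 0" using elim by (auto intro!: sg_pos)
      define E where "E = 4 * C1 * B + 2 * C2"
      have E: "E > 0" using C1 C2 B by (simp add: E_def add_pos_pos)
      show "\<bar>L {} (t + s) - L {} t\<bar> \<le> (2 * (4 * C1 * B + 2 * C2)) * (sg t * ln t)"
      proof (cases "s \<ge> 0")
        case True
        have "B * ln t \<le> 2 * B * ln t" using B s0 by simp
        then have "\<bar>L {} (t + s) - L {} t\<bar> \<le> (2 * C1 * (2 * B) + 2 * C2) * (sg t * ln t)"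
          using elim s True B by (intro up) auto
        also have "\<dots> = E * (sg t * ln t)" by (simp add: E_def)
        also have "\<dots> \<le> (2 * E) * (sg t * ln t)" using E s0 by (intro mult_right_mono) auto
        finally show ?thesis by (simp add: E_def)
      next
        case False
        define u where "u = t + s"
        have u: "u \<ge> t / 2" "u \<le> t" using s False elim by (auto simp: u_def)
        have u0: "ln (t / 2) \<le> ln u" using u elim by simp
        have "- s \<le> 2 * B * ln (t / 2)" using s elim by linarith
        also have "\<dots> \<le> 2 * B * ln u" using u0 B by (intro mult_left_mono) auto
        finally have ms: "- s \<le> 2 * B * ln u" .
        have "2 * B * ln u \<le> 2 * B * ln t" using u elim B by (intro mult_left_mono) auto
        also have "\<dots> \<le> u" using u elim by linarith
        finally have "\<bar>L {} (u + (- s)) - L {} u\<bar> \<le> (2 * C1 * (2 * B) + 2 * C2) * (sg u * ln u)"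
          using elim u False B ms by (intro up) auto
        also have "\<dots> \<le> E * ((2 * sg t) * ln t)"
        proof -
          have "sg u \<le> sg (t / 2)" using u elim by (intro sg_antimono) auto
          also have "\<dots> \<le> 2 * sg t" using elim by (intro sg_half_le) auto
          finally have "sg u \<le> 2 * sg t" .
          moreover have "ln u \<ge> 0" "ln u \<le> ln t" using u elim by auto
          ultimately have "sg u * ln u \<le> (2 * sg t) * ln t" using s0 by (intro mult_mono) auto
          then have "E * (sg u * ln u) \<le> E * ((2 * sg t) * ln t)" using E by (intro mult_left_mono) auto
          then show ?thesis by (simp add: E_def mult_ac)
        qed
        finally show ?thesis by (simp add: u_def E_def abs_minus_commute mult_ac)
      qed
    qed
  qed
  moreover have "2 * (4 * C1 * B + 2 * C2) > 0" using C1 C2 B by (simp add: add_pos_pos)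
  ultimately show ?thesis by blast
qed

end

subsection \<open>Counting square-free numbers\<close>

definition sqfree_upto :: "nat set \<Rightarrow> real \<Rightarrow> nat set" where
  "sqfree_upto P J = {j. (squarefree j \<and> (\<forall>p\<in>P. \<not> p dvd j)) \<and> real j \<le> J}"

lemma finite_sqfree_upto [simp]: "finite (sqfree_upto P J)"
  by (simp add: sqfree_upto_def)

lemma sqfree_upto_empty: "J < 1 \<Longrightarrow> sqfree_upto P J = {}"
proof -
  assume "J < 1"
  have "j \<notin> sqfree_upto P J" for j
    using \<open>J < 1\<close> by (cases "j = 0") (auto simp: sqfree_upto_def)
  then show ?thesis by auto
qed

lemma power_powr: "(x::real) > 0 \<Longrightarrow> (x ^ n) powr s = x powr (real n * s)"
  by (metis powr_powr powr_realpow)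

text \<open>Comparison with the integral of \<open>x powr (- 31/16)\<close>, the first term being
  kept. What remains is \<open>2 powr (- 15/16) \<le> 5/9\<close>, which follows from
  \<open>(9/5) ^ 16 \<le> 2 ^ 15\<close>.\<close>

lemma sum_powr_tail_le:
  assumes "2 \<le> E"
  shows "(\<Sum>e\<in>{2..E}. real e powr (- 31/16)) \<le> 9/10"
proof -
  have "(\<Sum>e\<in>{2..E}. real e powr (- 31/16)) \<le>
      2 powr (- 31/16) + 16/15 * (2 powr (- 15/16) - real E powr (- 15/16))"
    using assms
  proof (induction E rule: dec_induct)
    case base
    then show ?case by simp
  next
    case (step E)
    define x where "x = real (Suc E)"
    have x: "x \<ge> 3" "real E = x - 1" using step by (auto simp: x_def)
    have "15/16 * x powr (- 31/16) \<le> (x - 1) powr (- 15/16) - x powr (- 15/16)"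
    proof -
      have "1 + 15/16 * (1 / x) \<le> exp (15/16 * (1 / x))" by (rule exp_ge_add_one_self)
      also have "\<dots> \<le> exp (15/16 * (- ln (1 - 1 / x)))"
      proof -
        have "ln (1 - 1 / x) \<le> 1 - 1 / x - 1" using x by (intro ln_le_minus_one) auto
        then show ?thesis by simp
      qed
      also have "\<dots> = (1 - 1 / x) powr (- 15/16)" using x by (simp add: powr_def)
      finally have "(1 + 15/16 * (1 / x)) * x powr (- 15/16) \<le> (1 - 1 / x) powr (- 15/16) * x powr (- 15/16)"
        by (intro mult_right_mono) auto
      also have "\<dots> = ((1 - 1 / x) * x) powr (- 15/16)" using x by (simp add: powr_mult)
      also have "(1 - 1 / x) * x = x - 1" using x by (simp add: field_simps)
      finally have "x powr (- 15/16) + 15/16 * (x powr (- 15/16) / x) \<le> (x - 1) powr (- 15/16)"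
        by (simp add: algebra_simps)
      moreover have "x powr (- 15/16) / x = x powr (- 31/16)"
      proof -
        have "x powr (- 15/16) / x = x powr (- 15/16) / x powr 1" using x by simp
        also have "\<dots> = x powr (- 15/16 - 1)" by (simp only: powr_diff)
        finally show ?thesis by simp
      qed
      ultimately show ?thesis by linarith
    qed
    moreover have "(\<Sum>e\<in>{2..Suc E}. real e powr (- 31/16)) = (\<Sum>e\<in>{2..E}. real e powr (- 31/16)) + x powr (- 31/16)"
      using step by (simp add: x_def)
    moreover have "(\<Sum>e\<in>{2..E}. real e powr (- 31/16)) \<le>
        2 powr (- 31/16) + 16/15 * (2 powr (- 15/16) - (x - 1) powr (- 15/16))"
      using step.IH unfolding x(2) .
    moreover have "S + X \<le> K + 16/15 * (c - b)" if "15/16 * X \<le> u - b" "S \<le> K + 16/15 * (c - u)"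
      for S X K c b u :: real
    proof -
      have "X \<le> 16/15 * (u - b)" using that(1) by simp
      then have "S + X \<le> K + 16/15 * (c - u) + 16/15 * (u - b)" using that(2) by (rule add_mono[rotated])
      also have "\<dots> = K + (16/15 * (c - u) + 16/15 * (u - b))" by simp
      also have "16/15 * (c - u) + 16/15 * (u - b) = 16/15 * ((c - u) + (u - b))" by (simp only: distrib_left)
      finally show ?thesis by simp
    qed
    ultimately show ?case unfolding x_def[symmetric] by (simp only:)
  qed
  also have "\<dots> \<le> 2 powr (- 31/16) + 16/15 * 2 powr (- 15/16)" by simp
  also have "(2::real) powr (- 31/16) = 2 powr (- 15/16) / 2"
  proof -
    have "(2::real) powr (- 15/16) / 2 powr 1 = 2 powr (- 15/16 - 1)" by (simp only: powr_diff)
    then show ?thesis by simp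
  qed
  also have "2 powr (- 15/16) / 2 + 16/15 * 2 powr (- 15/16) \<le> (9/10 :: real)"
  proof -
    have "(9/5 :: real) = ((9/5) ^ 16) powr (1/16)" by (subst power_powr) auto
    also have "\<dots> \<le> (2 ^ 15) powr (1/16)" by (intro powr_mono2) (auto simp: field_simps)
    also have "\<dots> = 2 powr (15/16)" by (subst power_powr) auto
    finally have "1 / 2 powr (15/16) \<le> 1 / (9/5 :: real)" by (intro divide_left_mono) auto
    moreover have "2 powr (- 15/16) = 1 / (2::real) powr (15/16)" by (simp add: powr_minus_divide)
    ultimately have "2 powr (- 15/16) \<le> (5/9 :: real)" by simp
    moreover have "x / 2 + 16/15 * x \<le> 9/10" if "x \<le> 5/9" for x :: real using that by simp
    ultimately show ?thesis by blast
  qed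
  finally show ?thesis .
qed

lemma card_le_real: "J \<ge> 0 \<Longrightarrow> card {n::nat. 0 < n \<and> real n \<le> J} = nat \<lfloor>J\<rfloor>"
proof -
  assume "J \<ge> 0"
  then have "{n::nat. 0 < n \<and> real n \<le> J} = {1..nat \<lfloor>J\<rfloor>}" by (auto simp: le_nat_floor Suc_le_eq) linarith
  then show ?thesis by simp
qed

text \<open>Every positive integer is uniquely \<open>j * e ^ 2\<close> with \<open>j\<close>
  square-free. Values of \<open>e\<close> beyond the square root of \<open>J\<close> contribute
  nothing, so any \<open>E \<ge> J\<close> will do.\<close>

lemma floor_eq_sum_sqfree:
  assumes J: "J \<ge> 0" and E: "real E \<ge> J"
  shows "nat \<lfloor>J\<rfloor> = (\<Sum>e\<in>{1..E}. card (sqfree_upto {} (J / real e ^ 2)))"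
proof -
  have "bij_betw (\<lambda>(e, j). j * e ^ 2) (SIGMA e:{1..E}. sqfree_upto {} (J / real e ^ 2)) {n. 0 < n \<and> real n \<le> J}"
  proof (rule bij_betwI[where g = "\<lambda>n. (square_part n, squarefree_part n)"])
    show "(\<lambda>(e, j). j * e ^ 2) \<in> (SIGMA e:{1..E}. sqfree_upto {} (J / real e ^ 2)) \<rightarrow> {n. 0 < n \<and> real n \<le> J}"
    proof clarify
      fix e j assume e: "e \<in> {1..E}" and j: "j \<in> sqfree_upto {} (J / real e ^ 2)"
      have "j > 0" using j by (cases "j = 0") (auto simp: sqfree_upto_def)
      moreover have "real j * real e ^ 2 \<le> J" using j e by (simp add: sqfree_upto_def field_simps)
      ultimately show "0 < j * e ^ 2 \<and> real (j * e ^ 2) \<le> J" using e by simp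
    qed
    show "(\<lambda>n. (square_part n, squarefree_part n)) \<in> {n. 0 < n \<and> real n \<le> J} \<rightarrow>
        (SIGMA e:{1..E}. sqfree_upto {} (J / real e ^ 2))"
    proof clarify
      fix n :: nat assume n: "0 < n" "real n \<le> J"
      have dec: "n = squarefree_part n * square_part n ^ 2" by (rule squarefree_decompose)
      have s0: "square_part n > 0" using n by (intro Nat.gr0I) simp
      have f0: "squarefree_part n > 0" by (intro Nat.gr0I) simp
      have r: "real n = real (squarefree_part n) * real (square_part n) ^ 2"
        by (subst dec) (simp only: of_nat_mult of_nat_power)
      have "square_part n * 1 \<le> square_part n * square_part n" using s0 by (intro mult_left_mono) auto
      also have "\<dots> \<le> squarefree_part n * (square_part n * square_part n)" using f0 by simp
      also have "\<dots> = n" by (subst (4) dec) (simp add: power2_eq_square)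
      finally have "real (square_part n) \<le> real E" using n E by linarith
      then show "square_part n \<in> {1..E} \<and> squarefree_part n \<in> sqfree_upto {} (J / real (square_part n) ^ 2)"
        using s0 n r by (auto simp: sqfree_upto_def field_simps)
    qed
    fix x assume "x \<in> (SIGMA e:{1..E}. sqfree_upto {} (J / real e ^ 2))"
    then obtain e j where x: "x = (e, j)" "e > 0" "squarefree j" by (auto simp: sqfree_upto_def)
    let ?n = "j * e ^ 2"
    have "e dvd square_part ?n" by (simp add: dvd_square_part_iff)
    then obtain f where f: "square_part ?n = e * f" by (auto elim: dvdE)
    have "e\<^sup>2 * f\<^sup>2 dvd e\<^sup>2 * j"
      using square_part_square_dvd[of ?n] unfolding f by (simp add: power_mult_distrib mult.commute)
    then have "f\<^sup>2 dvd j" using x(2) by simp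
    then have "f = 1" using squarefreeD[OF x(3), of f] by simp
    then have sp: "square_part ?n = e" using f by simp
    have "squarefree_part ?n * e ^ 2 = j * e ^ 2"
      using squarefree_decompose[of ?n] unfolding sp by (rule sym)
    then have "squarefree_part ?n = j" using x(2) by simp
    then show "(\<lambda>n. (square_part n, squarefree_part n)) (case x of (e, j) \<Rightarrow> j * e ^ 2) = x"
      using sp unfolding x(1) by simp
  next
    fix n assume "n \<in> {n. 0 < n \<and> real n \<le> J}"
    show "(case (square_part n, squarefree_part n) of (e, j) \<Rightarrow> j * e ^ 2) = n"
      using squarefree_decompose[of n] by simp
  qed
  from bij_betw_same_card[OF this]
  have "card {n. 0 < n \<and> real n \<le> J} = card (SIGMA e:{1..E}. sqfree_upto {} (J / real e ^ 2))"
    by (rule sym)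
  also have "\<dots> = (\<Sum>e\<in>{1..E}. card (sqfree_upto {} (J / real e ^ 2)))" by (intro card_SigmaI) auto
  finally show ?thesis using card_le_real[OF J] by simp
qed

text \<open>Comparing \<open>\<lfloor>J\<rfloor> = \<Sum> Q (J / e\<^sup>2)\<close> with \<open>J = \<Sum> c J / e\<^sup>2\<close> bounds the error at \<open>J\<close> by the errors at
  \<open>J / e\<^sup>2\<close> for \<open>e \<ge> 2\<close>; the induction closes because \<open>\<zeta>(31/16) < 2\<close>.\<close>

lemma sqfree_density:
  obtains c :: real where "0 < c" "c \<le> 1"
    "\<And>J. J > 0 \<Longrightarrow> \<bar>real (card (sqfree_upto {} J)) - c * J\<bar> \<le> 20 * J powr (31/32)"
proof -
  have summ: "summable (\<lambda>e. 1 / real (Suc e) ^ 2)"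
    using inverse_power_summable[of 2, where ?'a = real] by (subst summable_Suc_iff) (simp add: inverse_eq_divide)
  define z where "z = (\<Sum>e. 1 / real (Suc e) ^ 2)"
  have z1: "z \<ge> 1"
  proof -
    have "(\<Sum>e\<in>{0}. 1 / real (Suc e) ^ 2) \<le> z" unfolding z_def by (intro sum_le_suminf summ) auto
    then show ?thesis by simp
  qed
  have lim: "(\<lambda>E. \<Sum>e\<in>{1..E}. 1 / real e ^ 2) \<longlonglongrightarrow> z"
  proof -
    have "(\<lambda>E. \<Sum>e<E. 1 / real (Suc e) ^ 2) \<longlonglongrightarrow> z"
      unfolding z_def using summable_LIMSEQ[OF summ] .
    moreover have "(\<Sum>e<E. 1 / real (Suc e) ^ 2) = (\<Sum>e\<in>{1..E}. 1 / real e ^ 2)" for E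
      by (rule sum.reindex_bij_witness[of _ "\<lambda>e. e - 1" Suc]) auto
    ultimately show ?thesis by simp
  qed
  define c where "c = 1 / z"
  have c: "0 < c" "c \<le> 1" "c * z = 1" using z1 by (auto simp: c_def)
  define Er where "Er J = real (card (sqfree_upto {} J)) - c * J" for J
  have small: "\<bar>Er J\<bar> \<le> 20 * J powr (31/32)" if "0 < J" "J < 1" for J
  proof -
    have "\<bar>Er J\<bar> = c * J" using that c by (simp add: Er_def sqfree_upto_empty)
    also have "\<dots> \<le> 1 * J powr 1" using that c by (intro mult_mono) auto
    also have "\<dots> \<le> 20 * J powr (31/32)" using that by (intro mult_mono powr_mono') auto
    finally show ?thesis .
  qed
  have "\<bar>Er J\<bar> \<le> 20 * J powr (31/32)" if "0 < J" "J < 4 ^ k" for J k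
    using that
  proof (induction k arbitrary: J)
    case 0
    then show ?case using small by simp
  next
    case (Suc k)
    show ?case
    proof (cases "J < 1")
      case True
      then show ?thesis using small Suc by simp
    next
      case False
      then have J: "J \<ge> 1" by simp
      have "\<forall>\<^sub>F E in sequentially. dist (\<Sum>e\<in>{1..E}. 1 / real e ^ 2) z < 1 / J"
        using tendstoD[OF lim, of "1 / J"] J by simp
      moreover have "\<forall>\<^sub>F E in sequentially. E \<ge> nat \<lceil>J\<rceil> + 2" by (rule eventually_ge_at_top)
      ultimately have "\<forall>\<^sub>F E in sequentially. dist (\<Sum>e\<in>{1..E}. 1 / real e ^ 2) z < 1 / J \<and> E \<ge> nat \<lceil>J\<rceil> + 2"
        by (rule eventually_conj)
      then obtain E where E: "dist (\<Sum>e\<in>{1..E}. 1 / real e ^ 2) z < 1 / J" "E \<ge> nat \<lceil>J\<rceil> + 2"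
        using eventually_happens'[OF sequentially_bot] by blast
      have EJ: "real E \<ge> J" "E \<ge> 2" using E(2) by linarith+
      define w where "w = (\<Sum>e\<in>{1..E}. 1 / real e ^ 2)"
      have "\<bar>c * J * (w - z)\<bar> \<le> 1"
      proof -
        have "\<bar>c * J * (w - z)\<bar> = (c * J) * \<bar>w - z\<bar>" using c J by (simp add: abs_mult)
        also have "\<dots> \<le> (1 * J) * (1 / J)"
          using c J E(1) unfolding w_def dist_real_def by (intro mult_mono) auto
        finally show ?thesis using J by simp
      qed
      then have tail: "\<bar>c * J * w - J\<bar> \<le> 1" using c(3) by (simp add: algebra_simps)
      have "real (nat \<lfloor>J\<rfloor>) = (\<Sum>e\<in>{1..E}. real (card (sqfree_upto {} (J / real e ^ 2))))"
        using floor_eq_sum_sqfree[OF _ EJ(1)] J by simp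
      also have "\<dots> = (\<Sum>e\<in>{1..E}. Er (J / real e ^ 2) + c * J * (1 / real e ^ 2))"
        by (intro sum.cong refl) (simp add: Er_def)
      also have "\<dots> = (\<Sum>e\<in>{1..E}. Er (J / real e ^ 2)) + c * J * w"
        by (simp only: sum.distrib sum_distrib_left[symmetric] w_def)
      also have "(\<Sum>e\<in>{1..E}. Er (J / real e ^ 2)) = Er J + (\<Sum>e\<in>{2..E}. Er (J / real e ^ 2))"
        using EJ by (subst sum.atLeast_Suc_atMost) (auto simp: numeral_2_eq_2)
      finally have "\<bar>Er J\<bar> \<le> 2 + \<bar>\<Sum>e\<in>{2..E}. Er (J / real e ^ 2)\<bar>"
        using tail J by linarith
      also have "\<bar>\<Sum>e\<in>{2..E}. Er (J / real e ^ 2)\<bar> \<le> (\<Sum>e\<in>{2..E}. 20 * J powr (31/32) * real e powr (- 31/16))"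
      proof (rule order.trans[OF sum_abs sum_mono])
        fix e assume e: "e \<in> {2..E}"
        then have e2: "real e \<ge> 2" by simp
        have "J / real e ^ 2 \<le> J / 2 ^ 2" using e2 J by (intro divide_left_mono power_mono) auto
        also have "\<dots> < 4 ^ k" using Suc.prems by simp
        finally have "\<bar>Er (J / real e ^ 2)\<bar> \<le> 20 * (J / real e ^ 2) powr (31/32)"
          using J e2 by (intro Suc.IH) auto
        also have "(J / real e ^ 2) powr (31/32) = J powr (31/32) * real e powr (- 31/16)"
        proof -
          have "(real e ^ 2) powr (31/32) = real e powr (31/16)"
            using e2 by (subst power_powr) auto
          then show ?thesis using J e2 by (simp add: powr_divide powr_minus_divide)
        qed
        finally show "\<bar>Er (J / real e ^ 2)\<bar> \<le> 20 * J powr (31/32) * real e powr (- 31/16)" by simp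
      qed
      also have "\<dots> = 20 * J powr (31/32) * (\<Sum>e\<in>{2..E}. real e powr (- 31/16))"
        by (simp add: sum_distrib_left)
      also have "\<dots> \<le> 20 * J powr (31/32) * (9/10)"
        using sum_powr_tail_le[OF EJ(2)] by (intro mult_left_mono) auto
      \<comment> \<open>Origin of the constant 20: the errors at \<open>J / e\<^sup>2\<close>
        contribute \<open>20 * (9/10) = 18\<close>, while the floor and the truncation of the series
        for \<open>z\<close> contribute at most 1 each.\<close>
      finally have "\<bar>Er J\<bar> \<le> 2 + 18 * J powr (31/32)" by simp
      moreover have "J powr (31/32) \<ge> 1" using J by (intro ge_one_powr_ge_zero) auto
      ultimately show ?thesis by linarith
    qed
  qed
  then have "\<bar>Er J\<bar> \<le> 20 * J powr (31/32)" if "0 < J" for J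
    using that real_arch_pow[of 4 J] by auto
  then show ?thesis using that c unfolding Er_def by blast
qed

text \<open>A square-free number is either prime to \<open>p\<close> or \<open>p\<close> times a
  square-free number prime to \<open>p\<close>. Solved for the enlarged set, this is a recursion
  from \<open>J\<close> to \<open>J / p\<close>.\<close>

lemma card_sqfree_upto_insert:
  assumes p: "prime p" "p \<notin> P" and P: "\<And>q. q \<in> P \<Longrightarrow> prime q"
  shows "card (sqfree_upto P J) = card (sqfree_upto (insert p P) J) + card (sqfree_upto (insert p P) (J / real p))"
proof -
  have p0: "p > 0" using prime_gt_0_nat[OF p(1)] .
  have "sqfree_upto P J = sqfree_upto (insert p P) J \<union> (\<lambda>j. p * j) ` sqfree_upto (insert p P) (J / real p)"
  proof (intro equalityI subsetI)
    fix j assume j: "j \<in> sqfree_upto P J"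
    show "j \<in> sqfree_upto (insert p P) J \<union> (\<lambda>j. p * j) ` sqfree_upto (insert p P) (J / real p)"
    proof (cases "p dvd j")
      case True
      then obtain i where i: "j = p * i" by (auto elim: dvdE)
      have sq: "squarefree (p * i)" using j i by (simp add: sqfree_upto_def)
      have "\<not> p dvd i"
      proof
        assume "p dvd i"
        then have "p\<^sup>2 dvd p * i" by (auto simp: power2_eq_square)
        then have "p dvd 1" using squarefreeD[OF sq] by blast
        then show False using p by auto
      qed
      moreover have "squarefree i" using squarefree_mono[OF _ sq, of i] by simp
      moreover have "\<not> q dvd i" if "q \<in> P" for q using that j i by (auto simp: sqfree_upto_def)
      moreover have "real i \<le> J / real p" using j i p0 by (simp add: sqfree_upto_def field_simps)
      ultimately show ?thesis using i by (auto simp: sqfree_upto_def)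
    next
      case False
      then show ?thesis using j by (auto simp: sqfree_upto_def)
    qed
  next
    fix j assume "j \<in> sqfree_upto (insert p P) J \<union> (\<lambda>j. p * j) ` sqfree_upto (insert p P) (J / real p)"
    then show "j \<in> sqfree_upto P J"
    proof
      assume "j \<in> (\<lambda>j. p * j) ` sqfree_upto (insert p P) (J / real p)"
      then obtain i where i: "j = p * i" "i \<in> sqfree_upto (insert p P) (J / real p)" by auto
      have "coprime p i" using i p by (auto simp: sqfree_upto_def prime_imp_coprime)
      then have "squarefree (p * i)"
        using i squarefree_prime[OF p(1)] by (intro squarefree_mult_coprime) (auto simp: sqfree_upto_def)
      moreover have "\<not> q dvd p * i" if "q \<in> P" for q
        using prime_dvd_prime_power_mult_iff[OF p(1) P[OF that], of 1 i] that p i by (auto simp: sqfree_upto_def)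
      moreover have "real (p * i) \<le> J" using i p0 by (simp add: sqfree_upto_def field_simps)
      ultimately show ?thesis using i by (auto simp: sqfree_upto_def)
    qed (auto simp: sqfree_upto_def)
  qed
  moreover have "sqfree_upto (insert p P) J \<inter> (\<lambda>j. p * j) ` sqfree_upto (insert p P) (J / real p) = {}"
    by (auto simp: sqfree_upto_def)
  moreover have "inj_on (\<lambda>j. p * j) (sqfree_upto (insert p P) (J / real p))" using p0 by (auto simp: inj_on_def)
  ultimately show ?thesis by (simp add: card_Un_disjoint card_image)
qed

text \<open>With \<open>E\<close> the error for \<open>insert p P\<close>, the recursion gives
  \<open>E(J) = E'(J) - E(J / p)\<close>, where \<open>E'\<close> is the error for \<open>P\<close>.
  If \<open>E'\<close> has constant \<open>B\<close>, the constant \<open>4 * B\<close> is stable: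
  \<open>B + (3/4) * (4 * B) = 4 * B\<close>, where \<open>3/4\<close> bounds
  \<open>2 powr (- 31/32)\<close>. Hence one factor 4 per prime.\<close>

lemma sqfree_coprime_density:
  assumes c: "0 < c" "c \<le> 1"
    and base: "\<And>J. J > 0 \<Longrightarrow> \<bar>real (card (sqfree_upto {} J)) - c * J\<bar> \<le> 20 * J powr (31/32)"
    and P: "finite P" "\<And>p. p \<in> P \<Longrightarrow> prime p" and J: "J > 0"
  shows "\<bar>real (card (sqfree_upto P J)) - c * (\<Prod>p\<in>P. real p / (real p + 1)) * J\<bar> \<le> 20 * 4 ^ card P * J powr (31/32)"
  using P J
proof (induction P arbitrary: J rule: finite_induct)
  case empty
  then show ?case using base by simp
next
  case (insert p P)
  have p: "prime p" "p \<notin> P" "\<And>q. q \<in> P \<Longrightarrow> prime q" using insert by auto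
  have p2: "real p \<ge> 2" using prime_ge_2_nat[OF p(1)] by simp
  define d where "d = c * (\<Prod>p\<in>insert p P. real p / (real p + 1))"
  have dP: "c * (\<Prod>p\<in>P. real p / (real p + 1)) = d + d / real p"
  proof -
    have "1 + 1 / real p = (real p + 1) / real p" "real p + 1 \<noteq> 0"
      using p2 by (auto simp: add_divide_distrib)
    then have "real p / (real p + 1) * (1 + 1 / real p) = 1" using p2 by simp
    then have "c * (\<Prod>p\<in>P. real p / (real p + 1)) =
        c * (real p / (real p + 1) * (1 + 1 / real p)) * (\<Prod>p\<in>P. real p / (real p + 1))" by (simp only: mult_1_right)
    also have "\<dots> = d * (1 + 1 / real p)" unfolding d_def by (simp only: prod.insert[OF insert.hyps] mult_ac)
    finally show ?thesis by (simp add: algebra_simps)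
  qed
  have d: "0 \<le> d" "d \<le> 1"
  proof -
    show "0 \<le> d" unfolding d_def using c by (intro mult_nonneg_nonneg prod_nonneg) auto
    have "(\<Prod>p\<in>insert p P. real p / (real p + 1)) \<le> 1" by (intro prod_le_1) auto
    moreover have "(\<Prod>p\<in>insert p P. real p / (real p + 1)) \<ge> 0" by (intro prod_nonneg) auto
    ultimately show "d \<le> 1" unfolding d_def using c mult_mono[of c 1 _ 1] by auto
  qed
  define B where "B = 20 * 4 ^ card P * (1::real)"
  have B: "B \<ge> 20" unfolding B_def by simp
  define Er where "Er J = real (card (sqfree_upto (insert p P) J)) - d * J" for J
  have IH: "\<bar>real (card (sqfree_upto P J)) - (d + d / real p) * J\<bar> \<le> B * J powr (31/32)" if "J > 0" for J
    using insert.IH[of J] insert.prems that unfolding dP by (simp add: B_def)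
  have rec: "Er J = (real (card (sqfree_upto P J)) - (d + d / real p) * J) - Er (J / real p)" for J
    unfolding Er_def using card_sqfree_upto_insert[OF p, of J] by (simp add: algebra_simps)
  have "\<bar>Er J\<bar> \<le> 4 * B * J powr (31/32)" if "0 < J" "J < 2 ^ k" for J k
    using that
  proof (induction k arbitrary: J)
    case 0
    have "\<bar>Er J\<bar> = d * J" using 0 d by (simp add: Er_def sqfree_upto_empty)
    also have "\<dots> \<le> 1 * J powr 1" using 0 d by (intro mult_mono) auto
    also have "\<dots> \<le> 4 * B * J powr (31/32)" using 0 B by (intro mult_mono powr_mono') auto
    finally show ?case .
  next
    case (Suc k)
    have "J / real p \<le> J / 2" using Suc.prems p2 by (intro divide_left_mono) auto
    moreover have "J / 2 < 2 ^ k" using Suc.prems by simp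
    ultimately have "J / real p < 2 ^ k" by linarith
    then have Jp: "0 < J / real p" "J / real p < 2 ^ k" using Suc.prems p2 by auto
    have "\<bar>Er J\<bar> \<le> B * J powr (31/32) + \<bar>Er (J / real p)\<bar>" using rec[of J] IH[OF Suc.prems(1)] by linarith
    also have "\<bar>Er (J / real p)\<bar> \<le> 4 * B * (J / real p) powr (31/32)" by (rule Suc.IH[OF Jp])
    also have "\<dots> \<le> 4 * B * (J powr (31/32) * (3/4))"
    proof (intro mult_left_mono)
      have "(J / real p) powr (31/32) \<le> (J / 2) powr (31/32)"
        using Suc.prems p2 by (intro powr_mono2 divide_left_mono) auto
      also have "\<dots> = J powr (31/32) * (1 / 2 powr (31/32))" using Suc.prems by (simp add: powr_divide)
      also have "\<dots> \<le> J powr (31/32) * (3/4)"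
      proof (intro mult_left_mono)
        have "(4/3 :: real) = ((4/3) ^ 2) powr (1/2)" by (subst power_powr) auto
        also have "\<dots> \<le> 2 powr (1/2)" by (intro powr_mono2) (auto simp: field_simps power2_eq_square)
        also have "\<dots> \<le> 2 powr (31/32)" by (intro powr_mono) auto
        finally have "1 / 2 powr (31/32) \<le> 1 / (4/3 :: real)" by (intro divide_left_mono) auto
        then show "1 / 2 powr (31/32) \<le> (3/4 :: real)" by simp
      qed auto
      finally show "(J / real p) powr (31/32) \<le> J powr (31/32) * (3/4)" .
    qed (use B in auto)
    finally show ?case by simp
  qed
  then have "\<bar>Er J\<bar> \<le> 4 * B * J powr (31/32)" if "J > 0" for J
    using that real_arch_pow[of 2 J] by auto
  from this[OF insert.prems(2)] show ?case
    using insert.hyps unfolding Er_def d_def B_def by (simp add: mult_ac)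
qed

subsection \<open>Parametrising integers by kernel and cofactor\<close>

lemma kern_pos: "kern v > 0"
  unfolding kern_def by (intro prod_pos) (auto dest!: in_prime_factors_imp_prime prime_gt_0_nat)

lemma prime_dvd_kern_iff:
  assumes "prime p"
  shows "p dvd kern v \<longleftrightarrow> p \<in> prime_factors v"
proof -
  have "p dvd kern v \<longleftrightarrow> (\<exists>q\<in>prime_factors v. p dvd q)"
    unfolding kern_def using assms by (intro prime_dvd_prod_iff) auto
  also have "\<dots> \<longleftrightarrow> p \<in> prime_factors v"
    using assms primes_dvd_imp_eq[of p] by (auto intro: bexI[of _ p])
  finally show ?thesis .
qed

lemma prime_factors_kern [simp]: "prime_factors (kern v) = prime_factors v"
  using prime_dvd_kern_iff[of _ v] kern_pos[of v] by (auto simp: prime_factors_dvd)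

lemma squarefree_kern: "squarefree (kern v)"
  unfolding kern_def
proof (rule squarefree_prod_coprime)
  fix p q assume "p \<in> prime_factors v" "q \<in> prime_factors v" "p \<noteq> q"
  then show "coprime p q" by (intro primes_coprime) auto
qed (auto intro: squarefree_prime)

lemma kern_eq_self:
  assumes "squarefree k"
  shows "kern k = k"
proof -
  have k: "k \<noteq> 0" using assms by (intro notI) simp
  have "k = (\<Prod>p\<in>prime_factors k. p ^ multiplicity p k)"
    using k by (intro prime_factorization_nat) simp
  also have "\<dots> = kern k"
    unfolding kern_def using assms squarefree_factorial_semiring'[OF k] by (intro prod.cong) auto
  finally show ?thesis by simp
qed

lemma kern_dvd:
  assumes "n > 0"
  shows "kern n dvd n"
proof -
  have "kern n dvd (\<Prod>p\<in>prime_factors n. p ^ multiplicity p n)"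
    unfolding kern_def by (intro prod_dvd_prod) (auto simp: prime_factors_multiplicity)
  also have "\<dots> = n" using assms by (intro prime_factorization_nat[symmetric]) simp
  finally show ?thesis .
qed

lemma kern_dvd_kern: "prime_factors v \<subseteq> prime_factors w \<Longrightarrow> kern v dvd kern w"
  unfolding kern_def by (intro prod_dvd_prod_subset) auto

lemma kern_mult:
  assumes "squarefree k" "kern v dvd k" "v > 0"
  shows "kern (k * v) = k"
proof -
  have k: "k > 0" using assms by (intro Nat.gr0I) auto
  have "prime_factors v \<subseteq> prime_factors k"
    using assms(2) k dvd_prime_factors[of k "kern v"] by simp
  then have "prime_factors (k * v) = prime_factors k"
    using assms k by (simp add: prime_factors_product Un_absorb2)
  then have "kern (k * v) = kern k" unfolding kern_def by simp
  then show ?thesis using kern_eq_self[OF assms(1)] by simp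
qed

lemma fpsi_kern: "fpsi v = (\<Prod>p\<in>prime_factors v. real p / (real p + 1)) / real (kern v)"
proof -
  have "(\<Prod>p\<in>prime_factors v. real p / (real p + 1)) / real (kern v) =
      (\<Prod>p\<in>prime_factors v. (real p / (real p + 1)) / real p)"
    unfolding kern_def of_nat_prod by (rule prod_dividef[symmetric])
  also have "\<dots> = fpsi v"
    unfolding fpsi_def by (intro prod.cong) (auto dest!: in_prime_factors_imp_prime prime_gt_0_nat)
  finally show ?thesis by simp
qed

lemma fpsi_le_inverse_kern: "fpsi v \<le> 1 / real (kern v)"
  unfolding fpsi_kern using kern_pos[of v] by (intro divide_right_mono prod_le_1) auto

lemma inverse_kern_le_power: "1 / real (kern v) \<le> 2 ^ omega v * fpsi v"
proof -
  have "1 / real (kern v) = (\<Prod>p\<in>prime_factors v. 1 / real p)"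
    unfolding kern_def of_nat_prod by (simp add: prod_dividef)
  also have "\<dots> \<le> (\<Prod>p\<in>prime_factors v. 2 * (1 / (real p + 1)))"
  proof (intro prod_mono conjI)
    fix p assume "p \<in> prime_factors v"
    then have "real p \<ge> 1" using prime_gt_0_nat[of p] by (auto simp: Suc_le_eq)
    then show "1 / real p \<le> 2 * (1 / (real p + 1))" by (simp add: field_simps)
  qed auto
  also have "\<dots> = 2 ^ omega v * fpsi v" unfolding fpsi_def by (simp only: prod.distrib prod_constant)
  finally show ?thesis .
qed

text \<open>The \<open>i\<close>-th smallest element is at least \<open>i + 1\<close>, and the
  product of the \<open>(i + 2) / (i + 1)\<close> telescopes.\<close>

lemma prod_one_plus_inverse_le:
  assumes "finite A" "\<And>p. p \<in> A \<Longrightarrow> p \<ge> (2::nat)"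
  shows "(\<Prod>p\<in>A. 1 + 1 / real p) \<le> real (card A + 2) / 2"
  using assms
proof (induction A rule: finite_linorder_max_induct)
  case empty
  then show ?case by simp
next
  case (insert b A)
  have "A \<subseteq> {2..<b}" using insert by auto
  then have "card A \<le> card {2..<b}" by (intro card_mono) auto
  moreover have "b \<ge> 2" using insert by simp
  ultimately have cb: "card A + 2 \<le> b" by simp
  have nb: "b \<notin> A" using insert by auto
  have "(\<Prod>p\<in>insert b A. 1 + 1 / real p) = (1 + 1 / real b) * (\<Prod>p\<in>A. 1 + 1 / real p)"
    using insert.hyps nb by simp
  also have "\<dots> \<le> (1 + 1 / real (card A + 2)) * (real (card A + 2) / 2)"
  proof (intro mult_mono)
    show "1 + 1 / real b \<le> 1 + 1 / real (card A + 2)"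
      using cb by (intro add_left_mono divide_left_mono) (auto simp del: of_nat_add)
    show "(\<Prod>p\<in>A. 1 + 1 / real p) \<le> real (card A + 2) / 2" using insert by auto
    show "0 \<le> (\<Prod>p\<in>A. 1 + 1 / real p)" by (intro prod_nonneg) auto
  qed auto
  also have "\<dots> = real (card (insert b A) + 2) / 2"
    using insert.hyps nb by (simp add: field_simps)
  finally show ?case .
qed

text \<open>Only a factor linear in \<open>omega v\<close> is lost, as opposed to
  \<open>2 ^ omega v\<close>. The weaker form suffices inside Rankin sums, this one is needed where
  only powers of \<open>t\<close> can be afforded.\<close>

lemma inverse_kern_le_omega: "1 / real (kern v) \<le> real (omega v + 2) / 2 * fpsi v"
proof -
  have "1 / real (kern v) = (\<Prod>p\<in>prime_factors v. 1 / real p)"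
    unfolding kern_def of_nat_prod by (simp add: prod_dividef)
  also have "\<dots> = (\<Prod>p\<in>prime_factors v. (1 + 1 / real p) * (1 / (real p + 1)))"
  proof (intro prod.cong refl)
    fix p assume "p \<in> prime_factors v"
    then have p: "real p > 0" using prime_gt_0_nat[of p] by auto
    have "1 + 1 / real p = (real p + 1) / real p" "real p + 1 \<noteq> 0" using p by (auto simp: add_divide_distrib)
    then show "1 / real p = (1 + 1 / real p) * (1 / (real p + 1))" using p by simp
  qed
  also have "\<dots> = (\<Prod>p\<in>prime_factors v. 1 + 1 / real p) * fpsi v"
    unfolding fpsi_def by (simp only: prod.distrib)
  also have "\<dots> \<le> real (omega v + 2) / 2 * fpsi v"
    by (intro mult_right_mono prod_one_plus_inverse_le) (auto dest!: in_prime_factors_imp_prime prime_ge_2_nat)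
  finally show ?thesis .
qed

lemma two_power_omega_le:
  assumes "v > 0"
  shows "2 ^ omega v \<le> v"
proof -
  have "2 ^ omega v = (\<Prod>p\<in>prime_factors v. 2::nat)" by simp
  also have "\<dots> \<le> kern v"
    unfolding kern_def by (intro prod_mono) (auto dest!: in_prime_factors_imp_prime prime_ge_2_nat)
  also have "\<dots> \<le> v" using kern_dvd[OF assms] assms by (rule dvd_imp_le)
  finally show ?thesis .
qed

text \<open>The \<open>k\<close> counted are those that can be the kernel of \<open>k * v\<close>:
  square-free and divisible by all primes of \<open>v\<close>.\<close>

definition kcount :: "nat \<Rightarrow> real \<Rightarrow> nat" where
  "kcount v K = card {k. (squarefree k \<and> kern v dvd k) \<and> real k \<le> K}"

lemma kcount_eq: "kcount v K = card (sqfree_upto (prime_factors v) (K / real (kern v)))"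
proof -
  let ?r = "kern v"
  have r0: "?r > 0" by (rule kern_pos)
  have "{k. (squarefree k \<and> ?r dvd k) \<and> real k \<le> K} = (\<lambda>j. ?r * j) ` sqfree_upto (prime_factors v) (K / real ?r)"
  proof (intro equalityI subsetI)
    fix k assume k: "k \<in> {k. (squarefree k \<and> ?r dvd k) \<and> real k \<le> K}"
    then have "?r dvd k" by simp
    then obtain j where "k = ?r * j" by (rule dvdE)
    with k have j: "k = ?r * j" "squarefree (?r * j)" "real (?r * j) \<le> K" by simp_all
    have "\<not> p dvd j" if p: "p \<in> prime_factors v" for p
    proof
      assume "p dvd j"
      moreover have "p dvd ?r" using p prime_dvd_kern_iff by auto
      ultimately have "p\<^sup>2 dvd ?r * j" unfolding power2_eq_square by (intro mult_dvd_mono)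
      then have "p dvd 1" using squarefreeD[OF j(2)] by blast
      then show False using in_prime_factors_imp_prime[OF p] by auto
    qed
    moreover have "squarefree j" using squarefree_mono[OF _ j(2), of j] by simp
    moreover have "real j \<le> K / real ?r" using j(3) r0 by (simp add: field_simps)
    ultimately show "k \<in> (\<lambda>j. ?r * j) ` sqfree_upto (prime_factors v) (K / real ?r)"
      using j(1) by (auto simp: sqfree_upto_def)
  next
    fix k assume "k \<in> (\<lambda>j. ?r * j) ` sqfree_upto (prime_factors v) (K / real ?r)"
    then obtain j where j: "k = ?r * j" "squarefree j" "\<forall>p\<in>prime_factors v. \<not> p dvd j" "real j \<le> K / real ?r"
      by (auto simp: sqfree_upto_def)
    have "coprime ?r j"
      unfolding kern_def using j(3) by (intro prod_coprime_left) (auto intro: prime_imp_coprime)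
    then have "squarefree (?r * j)" using squarefree_kern j(2) by (intro squarefree_mult_coprime) auto
    then show "k \<in> {k. (squarefree k \<and> ?r dvd k) \<and> real k \<le> K}" using j r0 by (auto simp: field_simps)
  qed
  moreover have "inj_on (\<lambda>j. ?r * j) (sqfree_upto (prime_factors v) (K / real ?r))"
    using r0 by (auto simp: inj_on_def)
  ultimately show ?thesis unfolding kcount_def by (simp add: card_image)
qed

lemma kcount_le:
  assumes "K \<ge> 0"
  shows "real (kcount v K) \<le> K / real (kern v)"
proof -
  let ?J = "K / real (kern v)"
  have J: "?J \<ge> 0" using assms by simp
  have "j > 0" if "j \<in> sqfree_upto (prime_factors v) ?J" for j
    using that by (intro Nat.gr0I) (auto simp: sqfree_upto_def)
  then have "sqfree_upto (prime_factors v) ?J \<subseteq> {n. 0 < n \<and> real n \<le> ?J}"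
    by (auto simp: sqfree_upto_def)
  then have "card (sqfree_upto (prime_factors v) ?J) \<le> card {n. 0 < n \<and> real n \<le> ?J}"
    by (intro card_mono) auto
  then have "kcount v K \<le> nat \<lfloor>?J\<rfloor>" using card_le_real[OF J] by (simp add: kcount_eq)
  then have "real (kcount v K) \<le> real (nat \<lfloor>?J\<rfloor>)" by simp
  also have "\<dots> \<le> ?J" using J by simp
  finally show ?thesis .
qed

lemma kcount_density:
  assumes c: "0 < c" "c \<le> 1"
    and base: "\<And>J. J > 0 \<Longrightarrow> \<bar>real (card (sqfree_upto {} J)) - c * J\<bar> \<le> 20 * J powr (31/32)"
    and K: "K > 0"
  shows "\<bar>real (kcount v K) - c * K * fpsi v\<bar> \<le> 20 * 4 ^ omega v * (K / real (kern v)) powr (31/32)"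
proof -
  have "\<bar>real (card (sqfree_upto (prime_factors v) (K / real (kern v)))) -
      c * (\<Prod>p\<in>prime_factors v. real p / (real p + 1)) * (K / real (kern v))\<bar> \<le>
      20 * 4 ^ omega v * (K / real (kern v)) powr (31/32)"
    using K kern_pos by (intro sqfree_coprime_density[OF c base]) auto
  then show ?thesis by (simp add: kcount_eq fpsi_kern mult_ac)
qed

text \<open>The power of the logarithm in \<open>S2\<close> is replaced by a constant
  \<open>lam\<close>, so that both counting functions are compared with the same two-parameter
  family; \<open>S1\<close> is the case \<open>lam = 1\<close>.\<close>

definition Tcount :: "real \<Rightarrow> real \<Rightarrow> real \<Rightarrow> nat" where
  "Tcount th lam x = card {n. (0 < n \<and> real (kern n) \<le> real n powr th * lam) \<and> real n \<le> x}"

text \<open>The factor \<open>k powr th\<close> cancels on both sides, which leaves a condition on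
  \<open>k powr (1 - th)\<close> with a bound depending on \<open>v\<close> alone.\<close>

lemma kern_condition_iff:
  fixes th lam :: real
  assumes th: "0 < th" "th < 1" and lam: "lam > 0" and kv: "k > 0" "v > (0::nat)"
  shows "real k \<le> real (k * v) powr th * lam \<longleftrightarrow> real k \<le> (real v powr th * lam) powr (1 / (1 - th))"
proof -
  define y where "y = real v powr th * lam"
  have y: "y > 0" using lam kv by (simp add: y_def)
  have k: "real k = real k powr th * real k powr (1 - th)" using kv by (simp flip: powr_add)
  have "real k \<le> real (k * v) powr th * lam \<longleftrightarrow> real k powr th * real k powr (1 - th) \<le> real k powr th * y"
    unfolding y_def k[symmetric] using kv by (simp add: powr_mult mult_ac)
  also have "\<dots> \<longleftrightarrow> real k powr (1 - th) \<le> y" using kv by (intro mult_le_cancel_left_pos) simp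
  also have "\<dots> \<longleftrightarrow> real k \<le> y powr (1 / (1 - th))"
  proof
    assume "real k powr (1 - th) \<le> y"
    then have "(real k powr (1 - th)) powr (1 / (1 - th)) \<le> y powr (1 / (1 - th))"
      using th by (intro powr_mono2) auto
    then show "real k \<le> y powr (1 / (1 - th))" using th kv by (simp add: powr_powr)
  next
    assume "real k \<le> y powr (1 / (1 - th))"
    then have "real k powr (1 - th) \<le> (y powr (1 / (1 - th))) powr (1 - th)"
      using th by (intro powr_mono2) auto
    then show "real k powr (1 - th) \<le> y" using th y by (simp add: powr_powr)
  qed
  finally show ?thesis by (simp add: y_def)
qed

text \<open>\<open>n\<close> corresponds to the pair of its cofactor \<open>n div kern n\<close> and
  its kernel; conversely \<open>kern (k * v) = k\<close> for admissible \<open>k\<close>. Both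
  restrictions on \<open>n\<close> become upper bounds for \<open>k\<close>.\<close>

lemma Tcount_eq_sum:
  fixes th lam x :: real
  assumes th: "0 < th" "th < 1" and lam: "lam > 0" and N: "real N \<ge> x"
  shows "Tcount th lam x =
    (\<Sum>v\<in>{1..N}. kcount v (min (x / real v) ((real v powr th * lam) powr (1 / (1 - th)))))"
proof -
  define K where "K v = min (x / real v) ((real v powr th * lam) powr (1 / (1 - th)))" for v
  define A where "A v = {k. (squarefree k \<and> kern v dvd k) \<and> real k \<le> K v}" for v
  have finA: "finite (A v)" for v by (simp add: A_def)
  have "bij_betw (\<lambda>(v, k). k * v) (SIGMA v:{1..N}. A v)
      {n. (0 < n \<and> real (kern n) \<le> real n powr th * lam) \<and> real n \<le> x}" (is "bij_betw _ ?S ?T")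
  proof (rule bij_betwI[where g = "\<lambda>n. (n div kern n, kern n)"])
    show "(\<lambda>(v, k). k * v) \<in> ?S \<rightarrow> ?T"
    proof clarify
      fix v k assume v: "v \<in> {1..N}" and "k \<in> A v"
      then have k: "squarefree k" "kern v dvd k" "real k \<le> x / real v"
        "real k \<le> (real v powr th * lam) powr (1 / (1 - th))" by (auto simp: A_def K_def)
      have k0: "k > 0" using k(1) by (intro Nat.gr0I) auto
      have v0: "v > 0" using v by simp
      have "real k \<le> real (k * v) powr th * lam" using kern_condition_iff[OF th lam k0 v0] k by simp
      moreover have "real (k * v) \<le> x" using k(3) v0 by (simp add: field_simps)
      ultimately show "(0 < k * v \<and> real (kern (k * v)) \<le> real (k * v) powr th * lam) \<and> real (k * v) \<le> x"
        using kern_mult[OF k(1,2) v0] k0 v0 by simp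
    qed
    show "(\<lambda>n. (n div kern n, kern n)) \<in> ?T \<rightarrow> ?S"
    proof clarify
      fix n assume n: "0 < n" "real (kern n) \<le> real n powr th * lam" "real n \<le> x"
      define v where "v = n div kern n"
      have nv: "n = kern n * v" using kern_dvd[OF n(1)] by (simp add: v_def)
      have v0: "v > 0" using n(1) nv by (intro Nat.gr0I) auto
      have "v \<le> n" by (simp add: v_def)
      then have "real v \<le> real N" using n(3) N by linarith
      moreover have "prime_factors v \<subseteq> prime_factors n"
        using n(1) nv by (intro dvd_prime_factors) (auto intro: dvdI[of n _ "kern n"] simp: mult.commute)
      then have "kern v dvd kern n" by (rule kern_dvd_kern)
      moreover have "real (kern n) \<le> x / real v"
      proof -
        have "real (kern n) * real v = real n" by (subst (2) nv) simp
        then show ?thesis using n(3) v0 by (simp add: field_simps)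
      qed
      moreover have "real (kern n) \<le> (real v powr th * lam) powr (1 / (1 - th))"
        using kern_condition_iff[OF th lam kern_pos v0, of n] n(2) nv by simp
      ultimately show "n div kern n \<in> {1..N} \<and> kern n \<in> A (n div kern n)"
        unfolding v_def[symmetric] using v0 squarefree_kern by (auto simp: A_def K_def)
    qed
    fix y assume "y \<in> ?S"
    then obtain v k where y: "y = (v, k)" "v > 0" "squarefree k" "kern v dvd k" by (auto simp: A_def)
    have "k > 0" using y(3) by (intro Nat.gr0I) auto
    then show "(\<lambda>n. (n div kern n, kern n)) (case y of (v, k) \<Rightarrow> k * v) = y"
      using kern_mult[OF y(3,4,2)] y(1) by simp
  next
    fix n assume "n \<in> ?T"
    then show "(case (n div kern n, kern n) of (v, k) \<Rightarrow> k * v) = n" using kern_dvd[of n] by simp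
  qed
  from bij_betw_same_card[OF this] have "Tcount th lam x = card ?S" unfolding Tcount_def by simp
  also have "\<dots> = (\<Sum>v\<in>{1..N}. card (A v))" using finA by (intro card_SigmaI) auto
  finally show ?thesis by (simp add: kcount_def A_def K_def)
qed

subsection \<open>From the sum over cofactors to the localised sum\<close>

text \<open>Write \<open>v = kern v * w\<close>. The primes of \<open>w\<close> are among those of
  \<open>v\<close>, so \<open>kern v = kern w * s\<close>, and \<open>(w, s)\<close> determines
  \<open>v\<close>. A kernel above \<open>R\<close> forces \<open>w\<close> below
  \<open>R' / R\<close>, so the sum moves to a shorter range at the cost of a harmonic sum over
  \<open>s\<close>.\<close>

lemma sum_inverse_kern_le:
  fixes R R' :: real
  assumes F: "finite F" and R: "R > 0"
    and Fv: "\<And>v. v \<in> F \<Longrightarrow> v > 0 \<and> real (kern v) > R \<and> real v \<le> R'"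
  shows "(\<Sum>v\<in>F. 1 / real (kern v)) \<le>
    (\<Sum>w | w > 0 \<and> real w \<le> R' / R. 1 / real (kern w)) * (\<Sum>s\<in>{1..nat \<lfloor>R'\<rfloor>}. 1 / real s)"
proof -
  define w where "w v = v div kern v" for v
  define s where "s v = kern v div kern (w v)" for v
  have vw: "v = kern v * w v" and w0: "w v > 0" and ks: "kern v = kern (w v) * s v" and s0: "s v > 0"
    if "v > 0" for v
  proof -
    show vw: "v = kern v * w v" using kern_dvd[OF that] by (simp add: w_def)
    show "w v > 0" using that vw by (intro Nat.gr0I) auto
    have "prime_factors (w v) \<subseteq> prime_factors v"
      using that vw by (intro dvd_prime_factors) (auto intro: dvdI[of v _ "kern v"] simp: mult.commute)
    then have "kern (w v) dvd kern v" by (rule kern_dvd_kern)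
    then show ks: "kern v = kern (w v) * s v" by (simp add: s_def)
    show "s v > 0" using kern_pos[of v] ks by (intro Nat.gr0I) auto
  qed
  have inj: "inj_on (\<lambda>v. (w v, s v)) F"
  proof (rule inj_onI)
    fix u v assume uv: "u \<in> F" "v \<in> F" "(w u, s u) = (w v, s v)"
    have "kern u = kern v" using ks[of u] ks[of v] uv Fv by auto
    then show "u = v" using vw[of u] vw[of v] uv Fv by (metis prod.inject)
  qed
  define X where "X = {w. w > 0 \<and> real w \<le> R' / R}"
  define Y where "Y = {1..nat \<lfloor>R'\<rfloor>}"
  have finX: "finite X" by (simp add: X_def)
  have "(\<Sum>v\<in>F. 1 / real (kern v)) = (\<Sum>v\<in>F. 1 / real (kern (w v)) * (1 / real (s v)))"
  proof (intro sum.cong refl)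
    fix v assume "v \<in> F"
    then have "real (kern v) = real (kern (w v)) * real (s v)" using ks[of v] Fv by (metis of_nat_mult)
    then show "1 / real (kern v) = 1 / real (kern (w v)) * (1 / real (s v))" by simp
  qed
  also have "\<dots> = (\<Sum>(w, s)\<in>(\<lambda>v. (w v, s v)) ` F. 1 / real (kern w) * (1 / real s))"
    by (simp add: sum.reindex[OF inj])
  also have "\<dots> \<le> (\<Sum>(w, s)\<in>X \<times> Y. 1 / real (kern w) * (1 / real s))"
  proof (rule sum_mono2)
    show "(\<lambda>v. (w v, s v)) ` F \<subseteq> X \<times> Y"
    proof clarify
      fix v assume v: "v \<in> F"
      have v0: "v > 0" "real (kern v) > R" "real v \<le> R'" using Fv[OF v] by auto
      have "real v = real (kern v) * real (w v)" using vw[OF v0(1)] by (metis of_nat_mult)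
      moreover have "R * real (w v) \<le> real (kern v) * real (w v)" using v0(2) by (intro mult_right_mono) auto
      ultimately have "real (w v) \<le> R' / R" using v0(3) R by (simp add: field_simps)
      moreover have "s v \<le> v"
      proof -
        have "s v \<le> kern v" by (simp add: s_def)
        also have "\<dots> \<le> v" using kern_dvd[OF v0(1)] v0(1) by (rule dvd_imp_le)
        finally show ?thesis .
      qed
      then have "s v \<le> nat \<lfloor>R'\<rfloor>" using v0(3) by (intro le_nat_floor) linarith
      ultimately show "w v \<in> X \<and> s v \<in> Y" using w0[OF v0(1)] s0[OF v0(1)] by (simp add: X_def Y_def Suc_le_eq)
    qed
    show "finite (X \<times> Y)" using finX by (simp add: Y_def)
  qed auto
  also have "\<dots> = (\<Sum>w\<in>X. 1 / real (kern w)) * (\<Sum>s\<in>Y. 1 / real s)"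
    by (simp add: sum_product sum.cartesian_product)
  finally show ?thesis by (simp add: X_def Y_def)
qed

text \<open>From \<open>2 ^ omega w \<le> w\<close> one gets \<open>omega w \<le> 3 * t / 2\<close>,
  so the loss in \<open>inverse_kern_le_omega\<close> is at most \<open>t + 1\<close>.\<close>

lemma sum_inverse_kern_le_psum:
  assumes t: "t \<ge> 0"
  shows "(\<Sum>w | w > 0 \<and> real w \<le> exp t. 1 / real (kern w)) \<le> (t + 1) * psum {} (exp t)"
proof -
  have "(\<Sum>w | w > 0 \<and> real w \<le> exp t. 1 / real (kern w)) \<le> (\<Sum>w | w > 0 \<and> real w \<le> exp t. (t + 1) * fpsi w)"
  proof (rule sum_mono)
    fix w assume "w \<in> {w. w > 0 \<and> real w \<le> exp t}"
    then have w: "w > 0" "real w \<le> exp t" by auto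
    have "real (2 ^ omega w) \<le> real w" using two_power_omega_le[OF w(1)] by (simp only: of_nat_le_iff)
    then have "real (2 ^ omega w) \<le> exp t" using w(2) by (rule order.trans)
    then have "exp (real (omega w) * ln 2) \<le> exp t" by (simp add: exp_of_nat_mult)
    then have "real (omega w) * ln 2 \<le> t" by simp
    moreover have "real (omega w) * (2/3) \<le> real (omega w) * ln 2"
      using ln2_ge_two_thirds by (intro mult_left_mono) auto
    ultimately have "real (omega w + 2) / 2 \<le> t + 1" using t by simp
    then have "real (omega w + 2) / 2 * fpsi w \<le> (t + 1) * fpsi w" by (intro mult_right_mono) auto
    then show "1 / real (kern w) \<le> (t + 1) * fpsi w" using inverse_kern_le_omega[of w] by linarith
  qed
  also have "\<dots> = (t + 1) * psum {} (exp t)" by (simp add: psum_def avoiding_def sum_distrib_left)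
  finally show ?thesis .
qed

text \<open>Splitting off the power of 2 leaves an odd number, and there are at most
  \<open>2 * t + 2\<close> such powers. Needed because the lower bound \<open>H_ge_psum\<close> for
  \<open>H {}\<close> involves a sum that avoids a prime.\<close>

lemma psum_le_psum_odd:
  assumes t: "t \<ge> 0"
  shows "psum {} (exp t) \<le> (2 * t + 2) * psum {2} (exp t)"
proof -
  define V where "V = {v. v \<in> avoiding {} \<and> real v \<le> exp t}"
  let ?a = "ppart (\<lambda>p. p = 2)" and ?b = "ppart (\<lambda>p. p \<noteq> 2)"
  define X where "X = (\<lambda>j. (2::nat) ^ j) ` {..nat \<lfloor>2 * t\<rfloor>}"
  have Vpos: "v > 0" if "v \<in> V" for v using that by (simp add: V_def avoiding_def)
  have "psum {} (exp t) = (\<Sum>v\<in>V. fpsi (?a v) * fpsi (?b v))"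
    unfolding psum_def V_def[symmetric] using Vpos fpsi_ppart_mult[of _ "\<lambda>p. p = 2"] by (intro sum.cong) auto
  also have "\<dots> \<le> (\<Sum>a\<in>X. fpsi a) * (\<Sum>b | b \<in> avoiding {2} \<and> real b \<le> exp t. fpsi b)"
  proof (rule sum_ppart_mult_le)
    fix v assume v: "v \<in> V"
    note v0 = Vpos[OF v]
    show "v > 0" by (fact v0)
    have d: "?a v dvd v" "?b v dvd v" using ppart_dvd[OF v0] by auto
    then have le: "?a v \<le> v" "?b v \<le> v" using v0 by (auto intro: dvd_imp_le)
    have ve: "real v \<le> exp t" using v by (simp add: V_def)
    define m where "m = multiplicity 2 v"
    have am: "?a v = 2 ^ m"
    proof (cases "2 \<in> prime_factors v")
      case True
      then have "{p \<in> prime_factors v. p = 2} = {2}" by auto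
      then have "?a v = (\<Prod>p\<in>{2}. p ^ multiplicity p v)" unfolding ppart_def by (simp only:)
      then show ?thesis by (simp add: m_def)
    next
      case False
      then have "{p \<in> prime_factors v. p = 2} = {}" by auto
      then have "?a v = 1" unfolding ppart_def by (simp only: prod.empty)
      moreover have "m = 0" using False v0 by (simp add: m_def prime_factors_multiplicity)
      ultimately show ?thesis by simp
    qed
    have "real (2 ^ m) \<le> exp t" using am le(1) ve by (metis of_nat_le_iff order.trans)
    then have "exp (real m * ln 2) \<le> exp t" by (simp add: exp_of_nat_mult)
    then have "real m * ln 2 \<le> t" by simp
    moreover have "real m * (1/2) \<le> real m * ln 2" using ln2_ge_two_thirds by (intro mult_left_mono) auto
    ultimately have "real m \<le> 2 * t" by linarith
    then show "?a v \<in> X" unfolding am X_def by (auto simp: le_nat_floor)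
    have "\<not> 2 dvd ?b v" using prime_factors_ppart[of "\<lambda>p. p \<noteq> 2" v] ppart_pos[of "\<lambda>p. p \<noteq> 2" v]
      by (auto simp: prime_factors_dvd set_eq_iff)
    then show "?b v \<in> {b. b \<in> avoiding {2} \<and> real b \<le> exp t}"
      using le(2) ve ppart_pos by (auto simp: avoiding_def intro: order.trans[of _ "real v"])
  qed (auto simp: X_def)
  also have "\<dots> \<le> (2 * t + 2) * psum {2} (exp t)"
    unfolding psum_def[symmetric]
  proof (rule mult_right_mono[OF _ psum_nonneg])
    have "(\<Sum>a\<in>X. fpsi a) \<le> (\<Sum>a\<in>X. 1)" by (intro sum_mono fpsi_le_1)
    also have "\<dots> = real (card X)" by simp
    also have "\<dots> \<le> real (card {..nat \<lfloor>2 * t\<rfloor>})" unfolding X_def by (intro of_nat_mono card_image_le) auto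
    also have "\<dots> \<le> 2 * t + 2" using t by simp linarith
    finally show "(\<Sum>a\<in>X. fpsi a) \<le> 2 * t + 2" .
  qed
  finally show ?thesis .
qed

section \<open>Total error over the cofactors\<close>

context kernel
begin

text \<open>Three ranges of \<open>v\<close>. For kernels up to \<open>V powr d\<close> the power
  saving in the square-free count wins. For larger kernels the count and its main term are both
  bounded trivially: if \<open>v\<close> is far above \<open>V\<close>, the cut-off is small by a
  power of \<open>V\<close>; otherwise the cofactor of the kernel in \<open>v\<close> is at most
  \<open>V powr (1 - d / 2)\<close>, and the growth of \<open>psum\<close> gives a saving beyond
  every power of \<open>t\<close>.\<close>

lemma cofactor_error_le:
  assumes c: "0 < c" "c \<le> 1"
    and base: "\<And>J. J > 0 \<Longrightarrow> \<bar>real (card (sqfree_upto {} J)) - c * J\<bar> \<le> 20 * J powr (31/32)"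
  shows "\<forall>\<^sub>F t in at_top. \<forall>X F. X \<ge> exp (a / 2 * t) \<longrightarrow> finite F \<longrightarrow> (\<forall>v\<in>F. v > 0) \<longrightarrow>
    (\<Sum>v\<in>F. \<bar>real (kcount v (X * g (real v / exp t))) - c * (X * g (real v / exp t)) * fpsi v\<bar>)
      \<le> X * H {} (exp t) / t"
proof -
  define d where "d = min (a / 4) (1 / 2)"
  define e where "e = min (a / 256) (1 / 2)"
  have d: "d > 0" "d \<le> a / 4" "d \<le> 1/2" using a_pos by (auto simp: d_def)
  have e: "e > 0" "e \<le> a / 256" "e \<le> 1/2" using a_pos by (auto simp: e_def)
  obtain B1 where B1: "\<And>F. finite F \<Longrightarrow> (\<And>b. b \<in> F \<Longrightarrow> b > 0) \<Longrightarrow>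
      (\<Sum>b\<in>F. 8 ^ omega b * real b powr (- e) * fpsi b) \<le> B1"
    by (rule rankin_bounded[of e 8]) (use e in auto)
  obtain B2 where B2: "\<And>F. finite F \<Longrightarrow> (\<And>b. b \<in> F \<Longrightarrow> b > 0) \<Longrightarrow>
      (\<Sum>b\<in>F. 2 ^ omega b * real b powr (- (d / 8)) * fpsi b) \<le> B2"
    by (rule rankin_bounded[of "d / 8" 2]) (use d in auto)
  have B0: "B1 \<ge> 0" "B2 \<ge> 0" using B1[of "{}"] B2[of "{}"] by auto
  define c0 where "c0 = 2 powr (- a) / 3"
  have c0: "c0 > 0" by (simp add: c0_def)
  have "\<forall>\<^sub>F t in at_top. \<forall>M. few_primes M \<longrightarrow>
      psum M (exp ((1 - d / 2) * t)) * exp (t powr (21/50)) \<le> psum M (exp t)"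
    using d by (intro psum_growth) auto
  moreover have "\<forall>\<^sub>F t in at_top. 20 * B1 * exp (- (e * t)) \<le> c0 / (3 * t)" using e(1) c0 by real_asymp
  moreover have "\<forall>\<^sub>F t in at_top. 2 * B2 * exp (- (d / 8 * t)) \<le> c0 / (3 * t)" using d(1) c0 by real_asymp
  moreover have "\<forall>\<^sub>F t in at_top. 2 * (1 + 2 * t) * (t + 1) * (2 * t + 2) * exp (- (t powr (21/50))) \<le> c0 / (3 * t)"
    using c0 by real_asymp
  moreover have "\<forall>\<^sub>F t::real in at_top. t > 1" by (rule eventually_gt_at_top)
  ultimately show ?thesis
  proof eventually_elim
    case (elim t)
    show ?case
    proof (intro allI impI)
      fix X F assume X: "X \<ge> exp (a / 2 * t)" and F: "finite F" "\<forall>v\<in>F. v > (0::nat)"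
      define V where "V = exp t"
      have V: "V > 1" using elim by (simp add: V_def)
      have Vp: "V powr s = exp (s * t)" for s by (simp add: V_def powr_def)
      have X0: "X > 0" using X by (smt (verit) exp_gt_zero)
      define K where "K v = X * g (real v / V)" for v
      define er where "er v = \<bar>real (kcount v (K v)) - c * K v * fpsi v\<bar>" for v
      have Kpos: "K v > 0" if "v > 0" for v
        unfolding K_def using X0 V that by (intro mult_pos_pos g_pos) auto
      have er2: "er v \<le> 2 * (K v / real (kern v))" if "v > 0" for v
      proof -
        have k1: "real (kcount v (K v)) \<le> K v / real (kern v)" using Kpos[OF that] by (intro kcount_le) auto
        have "c * K v * fpsi v \<le> 1 * K v * (1 / real (kern v))"
          using c Kpos[OF that] fpsi_le_inverse_kern by (intro mult_mono) auto
        moreover have "c * K v * fpsi v \<ge> 0" using c Kpos[OF that] by auto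
        ultimately show ?thesis using k1 unfolding er_def by (simp add: abs_le_iff)
      qed
      \<comment> \<open>The exponents \<open>d\<close> for the kernel and \<open>1 + d / 2\<close>
        for \<open>v\<close> leave \<open>1 - d / 2 < 1\<close> for their quotient in the middle
        range.\<close>
      define FA where "FA = {v \<in> F. real (kern v) \<le> V powr d}"
      define FB where "FB = {v \<in> F. real (kern v) > V powr d \<and> real v \<le> V powr (1 + d / 2)}"
      define FC where "FC = {v \<in> F. real (kern v) > V powr d \<and> real v > V powr (1 + d / 2)}"
      have fin: "finite FA" "finite FB" "finite FC" using F by (auto simp: FA_def FB_def FC_def)
      have "F = FA \<union> (FB \<union> FC)" by (auto simp: FA_def FB_def FC_def)
      then have "(\<Sum>v\<in>F. er v) = (\<Sum>v\<in>FA. er v) + ((\<Sum>v\<in>FB. er v) + (\<Sum>v\<in>FC. er v))"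
      proof -
        have "(\<Sum>v\<in>FA \<union> (FB \<union> FC). er v) = (\<Sum>v\<in>FA. er v) + (\<Sum>v\<in>FB \<union> FC. er v)"
          using fin by (intro sum.union_disjoint) (auto simp: FA_def FB_def FC_def)
        also have "(\<Sum>v\<in>FB \<union> FC. er v) = (\<Sum>v\<in>FB. er v) + (\<Sum>v\<in>FC. er v)"
          using fin by (intro sum.union_disjoint) (auto simp: FB_def FC_def)
        finally show ?thesis using \<open>F = FA \<union> (FB \<union> FC)\<close> by simp
      qed
      moreover have "(\<Sum>v\<in>FA. er v) \<le> X * (20 * B1 * exp (- (e * t)))"
      proof -
        have "(\<Sum>v\<in>FA. er v) \<le> (\<Sum>v\<in>FA. 20 * X * V powr (- e) * (8 ^ omega v * real v powr (- e) * fpsi v))"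
        proof (rule sum_mono)
          fix v assume v: "v \<in> FA"
          then have v0: "v > 0" and kv: "real (kern v) \<le> V powr d" using F by (auto simp: FA_def)
          have k1: "real (kern v) > 0" using kern_pos[of v] by simp
          define y where "y = real v / V"
          have y: "y > 0" using v0 V by (simp add: y_def)
          have gp: "g y > 0" by (rule g_pos[OF y])
          have "(K v / real (kern v)) powr (31/32) = X powr (31/32) * g y powr (31/32) * (1 / real (kern v) powr (31/32))"
            unfolding K_def y_def[symmetric] using X0 gp k1 by (simp add: powr_divide powr_mult)
          also have "\<dots> \<le> (X * V powr (- (a / 64))) * (V powr e * real v powr (- e)) * (2 ^ omega v * fpsi v * V powr (d / 32))"
          proof (intro mult_mono)
            \<comment> \<open>The lower bound assumed for \<open>X\<close> enters here: the exponent
              \<open>31/32\<close> saves \<open>V powr (a / 64)\<close>.\<close>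
            have "X powr (31/32) = X * X powr (- (1/32))" using X0 powr_add[of X 1 "- (1/32)"] by simp
            also have "X powr (- (1/32)) \<le> exp (a / 2 * t) powr (- (1/32))" using X by (intro powr_mono2') auto
            also have "exp (a / 2 * t) powr (- (1/32)) = V powr (- (a / 64))" unfolding Vp by (simp add: powr_def)
            finally show "X powr (31/32) \<le> X * V powr (- (a / 64))" using X0 by simp
            have "g y powr (31/32) \<le> (y powr (- (e * (32/31)))) powr (31/32)"
              using e y gp by (intro powr_mono2 g_le_powr_neg) auto
            also have "\<dots> = y powr (- e)" by (simp add: powr_powr)
            also have "\<dots> = V powr e * real v powr (- e)"
              unfolding y_def using v0 V by (simp add: powr_divide powr_minus field_simps)
            finally show "g y powr (31/32) \<le> V powr e * real v powr (- e)" .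
            have "1 / real (kern v) powr (31/32) = 1 / real (kern v) * real (kern v) powr (1/32)"
            proof -
              have "real (kern v) = real (kern v) powr (31/32) * real (kern v) powr (1/32)"
                using k1 by (simp flip: powr_add)
              moreover have "real (kern v) powr (31/32) > 0" "real (kern v) powr (1/32) > 0" using k1 by auto
              ultimately show ?thesis using k1 by (simp add: field_simps)
            qed
            also have "\<dots> \<le> (2 ^ omega v * fpsi v) * (V powr d) powr (1/32)"
              using inverse_kern_le_power[of v] kv k1 by (intro mult_mono powr_mono2) auto
            also have "(V powr d) powr (1/32) = V powr (d / 32)" by (simp add: powr_powr)
            finally show "1 / real (kern v) powr (31/32) \<le> 2 ^ omega v * fpsi v * V powr (d / 32)" .
          qed (use X0 in auto)
          also have "\<dots> = X * (V powr (- (a / 64)) * V powr e * V powr (d / 32)) * (2 ^ omega v * real v powr (- e) * fpsi v)"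
            by (simp add: mult_ac)
          also have "V powr (- (a / 64)) * V powr e * V powr (d / 32) = V powr (- (a / 64) + e + d / 32)"
            by (simp only: powr_add)
          \<comment> \<open>The choice of \<open>d\<close> and \<open>e\<close> makes
            \<open>d / 32\<close> and \<open>2 * e\<close> at most \<open>a / 128\<close> each, so a
            factor \<open>V powr (- e)\<close> is left over.\<close>
          also have "X * V powr (- (a / 64) + e + d / 32) * (2 ^ omega v * real v powr (- e) * fpsi v) \<le>
              X * V powr (- e) * (2 ^ omega v * real v powr (- e) * fpsi v)"
            using X0 V d e by (intro mult_right_mono mult_left_mono powr_mono mult_nonneg_nonneg) auto
          finally have "20 * 4 ^ omega v * (K v / real (kern v)) powr (31/32) \<le>
              20 * 4 ^ omega v * (X * V powr (- e) * (2 ^ omega v * real v powr (- e) * fpsi v))"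
            by (intro mult_left_mono) auto
          also have "\<dots> = 20 * X * V powr (- e) * (8 ^ omega v * real v powr (- e) * fpsi v)"
          proof -
            have "(8::real) ^ omega v = 4 ^ omega v * 2 ^ omega v" by (simp flip: power_mult_distrib)
            then show ?thesis by (simp add: mult_ac)
          qed
          finally have fb: "20 * 4 ^ omega v * (K v / real (kern v)) powr (31/32) \<le>
              20 * X * V powr (- e) * (8 ^ omega v * real v powr (- e) * fpsi v)" .
          have "er v \<le> 20 * 4 ^ omega v * (K v / real (kern v)) powr (31/32)"
            unfolding er_def by (rule kcount_density[OF c]) (use base Kpos[OF v0] in auto)
          then show "er v \<le> 20 * X * V powr (- e) * (8 ^ omega v * real v powr (- e) * fpsi v)"
            using fb by (rule order.trans)
        qed
        also have "\<dots> = 20 * X * V powr (- e) * (\<Sum>v\<in>FA. 8 ^ omega v * real v powr (- e) * fpsi v)"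
          by (simp add: sum_distrib_left)
        also have "\<dots> \<le> 20 * X * V powr (- e) * B1"
          using X0 F fin by (intro mult_left_mono B1) (auto simp: FA_def)
        finally show ?thesis unfolding Vp by (simp add: mult_ac)
      qed
      moreover have "(\<Sum>v\<in>FC. er v) \<le> X * (2 * B2 * exp (- (d / 8 * t)))"
      proof -
        have "(\<Sum>v\<in>FC. er v) \<le> (\<Sum>v\<in>FC. 2 * X * V powr (- (d / 8)) * (2 ^ omega v * real v powr (- (d / 8)) * fpsi v))"
        proof (rule sum_mono)
          fix v assume v: "v \<in> FC"
          then have v0: "v > 0" and vv: "real v > V powr (1 + d / 2)" using F by (auto simp: FC_def)
          have "g (real v / V) \<le> V / real v" using g_le_inverse[of "real v / V"] by simp
          also have "V / real v = (V / real v) powr (1 - d / 8) * (V / real v) powr (d / 8)"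
            using v0 V by (simp flip: powr_add)
          also have "\<dots> \<le> V powr (- (d / 4)) * (V powr (d / 8) * real v powr (- (d / 8)))"
          proof (intro mult_mono)
            have "V / real v \<le> V / V powr (1 + d / 2)" using vv V v0 by (intro divide_left_mono) auto
            also have "\<dots> = V powr 1 / V powr (1 + d / 2)" using V by simp
            also have "\<dots> = V powr (1 - (1 + d / 2))" by (simp only: powr_diff)
            also have "\<dots> = V powr (- (d / 2))" by simp
            finally have "(V / real v) powr (1 - d / 8) \<le> (V powr (- (d / 2))) powr (1 - d / 8)"
              using d V by (intro powr_mono2) auto
            also have "\<dots> = V powr (- (d / 2) * (1 - d / 8))" by (rule powr_powr)
            also have "\<dots> \<le> V powr (- (d / 4))"
            proof (intro powr_mono)
              have "d / 2 * (1/2) \<le> d / 2 * (1 - d / 8)" using d by (intro mult_left_mono) auto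
              then show "- (d / 2) * (1 - d / 8) \<le> - (d / 4)" by simp
            qed (use V in auto)
            finally show "(V / real v) powr (1 - d / 8) \<le> V powr (- (d / 4))" .
            show "(V / real v) powr (d / 8) \<le> V powr (d / 8) * real v powr (- (d / 8))"
              using V v0 by (simp add: powr_divide powr_minus field_simps)
          qed auto
          also have "\<dots> = V powr (- (d / 8)) * real v powr (- (d / 8))"
            by (simp add: mult.assoc[symmetric] flip: powr_add)
          finally have gb: "g (real v / V) \<le> V powr (- (d / 8)) * real v powr (- (d / 8))" .
          have "er v \<le> 2 * (K v * (1 / real (kern v)))" using er2[OF v0] by simp
          also have "\<dots> \<le> 2 * ((X * (V powr (- (d / 8)) * real v powr (- (d / 8)))) * (2 ^ omega v * fpsi v))"
            unfolding K_def using gb X0 inverse_kern_le_power[of v] by (intro mult_left_mono mult_mono) auto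
          finally show "er v \<le> 2 * X * V powr (- (d / 8)) * (2 ^ omega v * real v powr (- (d / 8)) * fpsi v)"
            by (simp add: mult_ac)
        qed
        also have "\<dots> = 2 * X * V powr (- (d / 8)) * (\<Sum>v\<in>FC. 2 ^ omega v * real v powr (- (d / 8)) * fpsi v)"
          by (simp add: sum_distrib_left)
        also have "\<dots> \<le> 2 * X * V powr (- (d / 8)) * B2"
          using X0 F fin by (intro mult_left_mono B2) (auto simp: FC_def)
        finally show ?thesis unfolding Vp by (simp add: mult_ac)
      qed
      moreover have "(\<Sum>v\<in>FB. er v) \<le> X * (2 * (1 + 2 * t) * (t + 1) * (2 * t + 2) * exp (- (t powr (21/50))) * psum {2} V)"
      proof -
        have "(\<Sum>v\<in>FB. er v) \<le> (\<Sum>v\<in>FB. 2 * X * (1 / real (kern v)))"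
        proof (rule sum_mono)
          fix v assume "v \<in> FB"
          then have v0: "v > 0" using F by (auto simp: FB_def)
          have "g (real v / V) \<le> 1" using v0 V by (intro g_le_one) auto
          then have "K v \<le> X * 1" unfolding K_def using X0 by (intro mult_left_mono) auto
          then have "K v / real (kern v) \<le> X / real (kern v)" by (intro divide_right_mono) auto
          then show "er v \<le> 2 * X * (1 / real (kern v))" using er2[OF v0] by simp
        qed
        also have "\<dots> = 2 * X * (\<Sum>v\<in>FB. 1 / real (kern v))" by (simp add: sum_distrib_left)
        also have "\<dots> \<le> 2 * X * (((t + 1) * (exp (- (t powr (21/50))) * ((2 * t + 2) * psum {2} V))) * (1 + 2 * t))"
        proof (intro mult_left_mono)
          define n where "n = nat \<lfloor>V powr (1 + d / 2)\<rfloor>"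
          have V1: "V powr (1 + d / 2) \<ge> 1" using V d by (intro ge_one_powr_ge_zero) auto
          have n: "n \<ge> 1" "real n \<le> V powr (1 + d / 2)" unfolding n_def using V1 by (auto simp: le_nat_floor)
          have "(\<Sum>v\<in>FB. 1 / real (kern v)) \<le>
              (\<Sum>w | w > 0 \<and> real w \<le> V powr (1 + d / 2) / V powr d. 1 / real (kern w)) * (\<Sum>s\<in>{1..n}. 1 / real s)"
            unfolding n_def using F fin V by (intro sum_inverse_kern_le) (auto simp: FB_def)
          also have "V powr (1 + d / 2) / V powr d = exp ((1 - d / 2) * t)"
            by (simp add: Vp algebra_simps flip: exp_diff)
          also have "(\<Sum>w | w > 0 \<and> real w \<le> exp ((1 - d / 2) * t). 1 / real (kern w)) * (\<Sum>s\<in>{1..n}. 1 / real s)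
              \<le> ((t + 1) * (exp (- (t powr (21/50))) * ((2 * t + 2) * psum {2} V))) * (1 + 2 * t)"
          proof (intro mult_mono)
            have "(1 - d / 2) * t \<ge> 0" using d elim by simp
            then have "(\<Sum>w | w > 0 \<and> real w \<le> exp ((1 - d / 2) * t). 1 / real (kern w)) \<le>
                ((1 - d / 2) * t + 1) * psum {} (exp ((1 - d / 2) * t))"
              by (rule sum_inverse_kern_le_psum)
            also have "\<dots> \<le> (t + 1) * (exp (- (t powr (21/50))) * ((2 * t + 2) * psum {2} V))"
            proof (intro mult_mono)
              have "(1 - d / 2) * t \<le> 1 * t" using d elim by (intro mult_right_mono) auto
              then show "(1 - d / 2) * t + 1 \<le> t + 1" by simp
              have "psum {} (exp ((1 - d / 2) * t)) * exp (t powr (21/50)) \<le> psum {} (exp t)"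
                using elim(1) by (simp add: few_primes_def)
              then have "psum {} (exp ((1 - d / 2) * t)) \<le> exp (- (t powr (21/50))) * psum {} (exp t)"
                by (simp add: exp_minus field_simps)
              also have "\<dots> \<le> exp (- (t powr (21/50))) * ((2 * t + 2) * psum {2} V)"
                unfolding V_def using elim psum_le_psum_odd[of t] by (intro mult_left_mono) auto
              finally show "psum {} (exp ((1 - d / 2) * t)) \<le> exp (- (t powr (21/50))) * ((2 * t + 2) * psum {2} V)" .
            qed (use elim psum_nonneg in auto)
            finally show "(\<Sum>w | w > 0 \<and> real w \<le> exp ((1 - d / 2) * t). 1 / real (kern w)) \<le>
                (t + 1) * (exp (- (t powr (21/50))) * ((2 * t + 2) * psum {2} V))" .
            have "(\<Sum>s\<in>{1..n}. 1 / real s) \<le> 1 + ln (real n)" by (rule sum_inverse_le_ln[OF n(1)])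
            also have "ln (real n) \<le> 2 * t"
            proof (rule ln_le_of_le_exp)
              have "(1 + d / 2) * t \<le> 2 * t" using d elim by (intro mult_right_mono) auto
              then show "real n \<le> exp (2 * t)" using n(2) unfolding Vp by (smt (verit) exp_le_cancel_iff)
            qed (use n in auto)
            finally show "(\<Sum>s\<in>{1..n}. 1 / real s) \<le> 1 + 2 * t" by simp
          qed (use elim psum_nonneg in \<open>auto intro!: sum_nonneg mult_nonneg_nonneg\<close>)
          finally show "(\<Sum>v\<in>FB. 1 / real (kern v)) \<le>
              ((t + 1) * (exp (- (t powr (21/50))) * ((2 * t + 2) * psum {2} V))) * (1 + 2 * t)" .
        qed (use X0 in auto)
        finally show ?thesis by (simp only: mult_ac)
      qed
      ultimately have "(\<Sum>v\<in>F. er v) \<le> X * (20 * B1 * exp (- (e * t))) +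
          (X * (2 * (1 + 2 * t) * (t + 1) * (2 * t + 2) * exp (- (t powr (21/50))) * psum {2} V) +
           X * (2 * B2 * exp (- (d / 8 * t))))" by linarith
      also have "\<dots> \<le> X * (c0 / (3 * t) * psum {2} V) + (X * (c0 / (3 * t) * psum {2} V) + X * (c0 / (3 * t) * psum {2} V))"
      proof -
        have P1: "psum {2} V \<ge> 1" using V by (intro psum_ge_1) auto
        have ct: "c0 / (3 * t) \<ge> 0" using c0 elim by simp
        have up: "c0 / (3 * t) \<le> c0 / (3 * t) * psum {2} V" using mult_left_mono[OF P1 ct] by simp
        show ?thesis
        proof (intro add_mono mult_left_mono)
          show "20 * B1 * exp (- (e * t)) \<le> c0 / (3 * t) * psum {2} V" using elim(2) up by linarith
          show "2 * B2 * exp (- (d / 8 * t)) \<le> c0 / (3 * t) * psum {2} V" using elim(3) up by linarith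
          show "2 * (1 + 2 * t) * (t + 1) * (2 * t + 2) * exp (- (t powr (21/50))) * psum {2} V \<le> c0 / (3 * t) * psum {2} V"
            using elim(4) P1 by (intro mult_right_mono) auto
        qed (use X0 in auto)
      qed
      also have "\<dots> = X * (c0 * psum {2} V) / t" using elim by (simp add: field_simps)
      also have "\<dots> \<le> X * H {} V / t"
      proof (intro divide_right_mono mult_left_mono)
        \<comment> \<open>\<open>H_ge_psum\<close> with \<open>r = 2\<close>, which explains
          \<open>c0 = 2 powr (- a) / 3\<close>.\<close>
        show "c0 * psum {2} V \<le> H {} V"
          using H_ge_psum[of V 2 "{}"] V by (simp add: c0_def)
      qed (use X0 elim in auto)
      finally show "(\<Sum>v\<in>F. \<bar>real (kcount v (X * g (real v / exp t))) - c * (X * g (real v / exp t)) * fpsi v\<bar>)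
          \<le> X * H {} (exp t) / t" by (simp add: er_def K_def V_def)
    qed
  qed
qed

text \<open>With \<open>V = x powr (1 - th) / lam\<close> and \<open>X = x powr th * lam\<close> one
  has \<open>x = X * V\<close>, and the two bounds for the kernel agree at \<open>v = V\<close> with
  common value \<open>X\<close>. Changing \<open>lam\<close> thus rescales the sum and shifts
  \<open>V\<close>, nothing else.\<close>

lemma cofactor_bound_eq:
  fixes th lam x :: real
  assumes th: "0 < th" "th < 1" and a: "a = th / (1 - th)" and x: "x > 0" and lam: "lam > 0" and v: "v > (0::nat)"
  shows "min (x / real v) ((real v powr th * lam) powr (1 / (1 - th))) =
    (x powr th * lam) * g (real v / (x powr (1 - th) / lam))"
proof -
  define V where "V = x powr (1 - th) / lam"
  define X where "X = x powr th * lam"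
  have V: "V > 0" and X: "X > 0" using x lam by (auto simp: V_def X_def)
  have xVX: "x = X * V" unfolding X_def V_def using x lam by (simp flip: powr_add)
  have 1: "x / real v = X * (1 / (real v / V))" using xVX v V by simp
  have a1: "1 / (1 - th) = 1 + a" "th * (1 / (1 - th)) = a" unfolding a using th by (auto simp: field_simps)
  have "x = (V * lam) powr (1 + a)"
  proof -
    have "V * lam = x powr (1 - th)" using lam by (simp add: V_def)
    then have "(V * lam) powr (1 + a) = x powr ((1 - th) * (1 + a))" by (simp add: powr_powr)
    also have "(1 - th) * (1 + a) = 1" unfolding a1(1)[symmetric] using th by simp
    finally show ?thesis using x by simp
  qed
  then have "x = V powr (1 + a) * lam powr (1 + a)" using V lam by (simp add: powr_mult)
  then have "lam powr (1 + a) = X * V / V powr (1 + a)" using V xVX by (simp add: field_simps)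
  also have "\<dots> = X * V powr (- a)" using V by (simp add: powr_add powr_minus field_simps)
  finally have lx: "lam powr (1 + a) = X * V powr (- a)" .
  have "(real v powr th * lam) powr (1 / (1 - th)) = real v powr a * lam powr (1 + a)"
  proof -
    have "(real v powr th * lam) powr (1 / (1 - th)) = (real v powr th) powr (1 / (1 - th)) * lam powr (1 / (1 - th))"
      using v lam by (simp add: powr_mult)
    also have "\<dots> = real v powr (th * (1 / (1 - th))) * lam powr (1 / (1 - th))" by (simp only: powr_powr)
    finally show ?thesis unfolding a1(2) unfolding a1(1) .
  qed
  also have "\<dots> = X * (real v / V) powr a" unfolding lx using v V by (simp add: powr_divide powr_minus field_simps)
  finally have 2: "(real v powr th * lam) powr (1 / (1 - th)) = X * (real v / V) powr a" .
  have "min (X * (1 / (real v / V))) (X * (real v / V) powr a) = X * g (real v / V)"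
    unfolding g_def using X by (simp add: min_mult_distrib_left)
  then show ?thesis unfolding 2 1 by (simp add: X_def V_def)
qed

text \<open>For \<open>lam = 1\<close> one has \<open>x powr th = exp (a * t)\<close>; asking only
  for half that exponent leaves room for powers of \<open>ln x\<close> in
  \<open>lam\<close>.\<close>

lemma Tcount_approx:
  assumes c: "0 < c" "c \<le> 1"
    and base: "\<And>J. J > 0 \<Longrightarrow> \<bar>real (card (sqfree_upto {} J)) - c * J\<bar> \<le> 20 * J powr (31/32)"
    and th: "0 < th" "th < 1" and a: "a = th / (1 - th)"
  shows "\<forall>\<^sub>F t in at_top. \<forall>x lam. x > 0 \<longrightarrow> lam > 0 \<longrightarrow> x powr (1 - th) / lam = exp t \<longrightarrow>
    x powr th * lam \<ge> exp (a / 2 * t) \<longrightarrow>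
    \<bar>real (Tcount th lam x) - c * (x powr th * lam) * H {} (exp t)\<bar> \<le> x powr th * lam * H {} (exp t) / t"
proof -
  have "\<forall>\<^sub>F t in at_top. \<forall>X F. X \<ge> exp (a / 2 * t) \<longrightarrow> finite F \<longrightarrow> (\<forall>v\<in>F. v > 0) \<longrightarrow>
      (\<Sum>v\<in>F. \<bar>real (kcount v (X * g (real v / exp t))) - c * (X * g (real v / exp t)) * fpsi v\<bar>)
        \<le> X * H {} (exp t) / t"
    by (rule cofactor_error_le[OF c]) (rule base)
  then show ?thesis
proof eventually_elim
  case (elim t)
  show ?case
  proof (intro allI impI)
    fix x lam :: real
    assume x: "x > 0" and lam: "lam > 0" and V: "x powr (1 - th) / lam = exp t" and X: "x powr th * lam \<ge> exp (a / 2 * t)"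
    define X where "X = x powr th * lam"
    have X0: "X > 0" using x lam by (simp add: X_def)
    define E where "E = X * H {} (exp t) / t"
    define S where "S N = (\<Sum>v\<in>{1..N}. g (real v / exp t) * fpsi v)" for N
    have main: "\<bar>real (Tcount th lam x) - c * X * S N\<bar> \<le> E" if N: "real N \<ge> x" for N
    proof -
      have "real (Tcount th lam x) = (\<Sum>v\<in>{1..N}. real (kcount v (X * g (real v / exp t))))"
        unfolding Tcount_eq_sum[OF th lam N] of_nat_sum X_def
        using cofactor_bound_eq[OF th a x lam] V by (intro sum.cong refl) auto
      then have eq: "real (Tcount th lam x) - c * X * S N =
          (\<Sum>v\<in>{1..N}. real (kcount v (X * g (real v / exp t))) - c * (X * g (real v / exp t)) * fpsi v)"
        by (simp add: S_def sum_subtractf sum_distrib_left mult_ac)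
      have "\<bar>real (Tcount th lam x) - c * X * S N\<bar> \<le> (\<Sum>v\<in>{1..N}. \<bar>real (kcount v (X * g (real v / exp t))) - c * (X * g (real v / exp t)) * fpsi v\<bar>)"
        unfolding eq by (rule sum_abs)
      also have "\<dots> \<le> E" using elim X unfolding E_def X_def by auto
      finally show ?thesis .
    qed
    have cX: "c * X > 0" using c X0 by simp
    obtain N0 :: nat where N0: "real N0 \<ge> x" using real_arch_simple by blast
    have "S N0 \<le> H {} (exp t)" unfolding S_def by (intro sum_le_H) (auto simp: avoiding_def)
    then have "c * X * S N0 \<le> c * X * H {} (exp t)" using cX by (intro mult_left_mono) auto
    then have up: "real (Tcount th lam x) \<le> c * X * H {} (exp t) + E" using main[OF N0] by linarith
    \<comment> \<open>\<open>H\<close> is an infinite sum, while \<open>Tcount\<close> is a finite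
      one for every large \<open>N\<close>. The lower bound therefore lets \<open>N\<close> grow to
      cover an arbitrary finite set.\<close>
    have "H {} (exp t) \<le> (real (Tcount th lam x) + E) / (c * X)"
    proof (rule H_le)
      fix F :: "nat set" assume F: "finite F" "F \<subseteq> avoiding {}"
      define N where "N = max N0 (Max (insert 0 F))"
      have N: "real N \<ge> x" using N0 by (simp add: N_def)
      have "F \<subseteq> {1..N}"
      proof
        fix v assume v: "v \<in> F"
        then have "v \<le> Max (insert 0 F)" using F by (intro Max_ge) auto
        then have "v \<le> N" unfolding N_def by (rule max.coboundedI2)
        moreover have "v > 0" using v F by (auto simp: avoiding_def)
        ultimately show "v \<in> {1..N}" by simp
      qed
      then have "(\<Sum>v\<in>F. g (real v / exp t) * fpsi v) \<le> S N"
        unfolding S_def by (intro sum_mono2 mult_nonneg_nonneg g_nonneg) auto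
      also have "S N \<le> (real (Tcount th lam x) + E) / (c * X)"
        using main[OF N] cX by (simp add: pos_le_divide_eq mult.commute abs_le_iff)
      finally show "(\<Sum>v\<in>F. g (real v / exp t) * fpsi v) \<le> (real (Tcount th lam x) + E) / (c * X)" .
    qed simp
    then have "c * X * H {} (exp t) \<le> real (Tcount th lam x) + E"
      using cX by (simp add: pos_le_divide_eq mult.commute)
    with up have "\<bar>real (Tcount th lam x) - c * X * H {} (exp t)\<bar> \<le> E" by linarith
    then show "\<bar>real (Tcount th lam x) - c * (x powr th * lam) * H {} (exp t)\<bar> \<le> x powr th * lam * H {} (exp t) / t"
      by (simp add: E_def X_def)
  qed
qed
qed

end

lemma powr_near_one:
  fixes y r A Th :: real
  assumes y: "1 - r \<le> y" "y \<le> 1" and r: "0 \<le> r" "r \<le> 1/2" "2 * A * r \<le> 1" and Th: "\<bar>Th\<bar> \<le> A"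
  shows "\<bar>y powr Th - 1\<bar> \<le> 6 * A * r"
proof -
  have y0: "y > 0" using y r by linarith
  have "- r - 2 * r\<^sup>2 \<le> ln (1 - r)" using r by (intro ln_one_minus_pos_lower_bound) auto
  moreover have "ln (1 - r) \<le> ln y" using y r by simp
  moreover have "r\<^sup>2 \<le> r * (1/2)" unfolding power2_eq_square using r by (intro mult_left_mono) auto
  moreover have "ln y \<le> 0" using y y0 by simp
  ultimately have ly: "\<bar>ln y\<bar> \<le> 2 * r" by linarith
  define z where "z = Th * ln y"
  have A0: "A \<ge> 0" using Th by linarith
  have z: "\<bar>z\<bar> \<le> A * (2 * r)" unfolding z_def abs_mult using Th ly A0 by (intro mult_mono) auto
  then have z1: "\<bar>z\<bar> \<le> 1" using r by simp
  have "\<bar>y powr Th - 1\<bar> = \<bar>exp z - 1\<bar>" using y0 by (simp add: powr_def z_def)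
  also have "\<dots> \<le> \<bar>z\<bar> * exp \<bar>z\<bar>" by (rule abs_exp_minus_one_le)
  also have "\<dots> \<le> (A * (2 * r)) * 3"
  proof (intro mult_mono z)
    have "exp \<bar>z\<bar> \<le> exp 1" using z1 by simp
    then show "exp \<bar>z\<bar> \<le> 3" using exp_le by linarith
  qed (use A0 r in auto)
  finally show ?thesis by simp
qed

section \<open>Asymptotics of \<open>Tcount\<close>, uniform in the constant\<close>

context kernel
begin

definition main_term :: "real \<Rightarrow> real \<Rightarrow> real \<Rightarrow> real" where
  "main_term c th x = c * x powr th * H {} (x powr (1 - th))"

lemma main_term_pos: "c > 0 \<Longrightarrow> x > 0 \<Longrightarrow> main_term c th x > 0"
  unfolding main_term_def by (intro mult_pos_pos H_pos) auto

lemma H_eq_exp_L: "H {} (exp t) = exp (L {} t - L {} u) * H {} (exp u)"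
proof -
  have "H {} (exp t) > 0" "H {} (exp u) > 0" by (auto intro!: H_pos)
  then show ?thesis by (simp add: L_def exp_diff)
qed

text \<open>The power \<open>x powr th\<close> gains \<open>ln x powr (D * th)\<close>, and
  \<open>H\<close> changes by at most a factor 2, since its argument moves by
  \<open>O(ln (ln x))\<close> on the logarithmic scale.\<close>

lemma main_term_shift_le:
  assumes th: "0 < th" "th < 1" and c: "c > 0" and D: "D > 0"
  shows "\<forall>\<^sub>F x in at_top. main_term c th (x / ln x powr D) \<le> 2 * ln x powr (- (D * th)) * main_term c th x"
proof -
  obtain C where ev: "\<forall>\<^sub>F t in at_top. \<forall>s. \<bar>s\<bar> \<le> 2 * D * ln t \<longrightarrow>
      \<bar>L {} (t + s) - L {} t\<bar> \<le> C * (sg t * ln t)"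
    using L_shift_log[of "2 * D"] D by auto
  have "\<forall>\<^sub>F t in at_top. C * (sg t * ln t) \<le> 2/3" unfolding sg_def by real_asymp
  with ev have "\<forall>\<^sub>F t in at_top. \<forall>s. \<bar>s\<bar> \<le> 2 * D * ln t \<longrightarrow> \<bar>L {} (t + s) - L {} t\<bar> \<le> ln 2"
  proof eventually_elim
    case (elim t)
    then show ?case using ln2_ge_two_thirds by (meson order_trans)
  qed
  moreover have "filterlim (\<lambda>x. (1 - th) * ln x) at_top at_top" using th by real_asymp
  ultimately have "\<forall>\<^sub>F x in at_top. \<forall>s. \<bar>s\<bar> \<le> 2 * D * ln ((1 - th) * ln x) \<longrightarrow>
      \<bar>L {} ((1 - th) * ln x + s) - L {} ((1 - th) * ln x)\<bar> \<le> ln 2"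
    unfolding filterlim_iff by blast
  moreover have "\<forall>\<^sub>F x in at_top. ln (ln x) \<ge> - 2 * ln (1 - th)" by real_asymp
  moreover have "\<forall>\<^sub>F x::real in at_top. x > exp 1" by (rule eventually_gt_at_top)
  ultimately show ?thesis
  proof eventually_elim
    case (elim x)
    define l where "l = ln x"
    have "1 < exp (1::real)" by simp
    then have x: "x > 1" using elim(3) by linarith
    have l1: "l > 1"
    proof -
      have "ln (exp 1) < ln x" using elim x by (subst ln_less_cancel_iff) auto
      then show ?thesis by (simp add: l_def)
    qed
    define s where "s = - ((1 - th) * (D * ln l))"
    have "\<bar>s\<bar> \<le> 2 * D * ln ((1 - th) * l)"
    proof -
      have "\<bar>s\<bar> = (1 - th) * (D * ln l)" unfolding s_def using th D l1 by simp
      also have "\<dots> \<le> 1 * (D * ln l)" using th D l1 by (intro mult_right_mono) auto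
      also have "\<dots> \<le> D * (2 * ln (1 - th) + 2 * ln l)"
        using elim D by (simp add: l_def)
      also have "\<dots> = 2 * D * ln ((1 - th) * l)" using th l1 by (simp add: ln_mult distrib_left)
      finally show ?thesis .
    qed
    then have d: "\<bar>L {} ((1 - th) * l + s) - L {} ((1 - th) * l)\<bar> \<le> ln 2" using elim unfolding l_def by blast
    have e1: "x powr (1 - th) = exp ((1 - th) * l)" using x by (simp add: powr_def l_def)
    have lD: "l powr D > 0" using l1 by simp
    have e2: "(x / l powr D) powr (1 - th) = exp ((1 - th) * l + s)"
    proof -
      have "(x / l powr D) powr (1 - th) = x powr (1 - th) / l powr (D * (1 - th))"
        using x lD by (simp add: powr_divide powr_powr)
      also have "\<dots> = exp ((1 - th) * l) / exp (D * (1 - th) * ln l)" using l1 unfolding e1 by (simp add: powr_def)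
      also have "\<dots> = exp ((1 - th) * l + s)" by (simp add: s_def mult_ac flip: exp_diff)
      finally show ?thesis .
    qed
    have Hp: "H {} (exp ((1 - th) * l)) > 0" by (intro H_pos) auto
    have "H {} (exp ((1 - th) * l + s)) \<le> exp (ln 2) * H {} (exp ((1 - th) * l))"
      unfolding H_eq_exp_L[of "(1 - th) * l + s" "(1 - th) * l"] using d Hp
      by (intro mult_right_mono) (auto simp del: exp_ln)
    then have h2: "H {} (exp ((1 - th) * l + s)) \<le> 2 * H {} (exp ((1 - th) * l))" by simp
    have "main_term c th (x / l powr D) = c * (x powr th * l powr (- (D * th))) * H {} (exp ((1 - th) * l + s))"
      unfolding main_term_def e2 using x lD by (simp add: powr_divide powr_powr powr_minus_divide)
    also have "\<dots> \<le> c * (x powr th * l powr (- (D * th))) * (2 * H {} (exp ((1 - th) * l)))"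
      using h2 c by (intro mult_left_mono) auto
    also have "\<dots> = 2 * l powr (- (D * th)) * main_term c th x"
      unfolding main_term_def e1 by (simp add: mult_ac)
    finally show ?case by (simp add: l_def)
  qed
qed

text \<open>The argument of \<open>H\<close> moves from \<open>u = (1 - th) * ln x\<close> by
  \<open>- ln lam\<close>, which is \<open>O(ln u)\<close>; \<open>L_shift_log\<close> makes the
  resulting factor \<open>1 + O(sqrt (ln u / u))\<close>. The error \<open>1 / t\<close> from the
  cofactors is smaller.\<close>

lemma Tcount_asymptotic:
  assumes c: "0 < c" "c \<le> 1"
    and base: "\<And>J. J > 0 \<Longrightarrow> \<bar>real (card (sqfree_upto {} J)) - c * J\<bar> \<le> 20 * J powr (31/32)"
    and th: "0 < th" "th < 1" and a: "a = th / (1 - th)" and B: "B > 0"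
  shows "\<exists>C>0. \<forall>\<^sub>F x in at_top. \<forall>lam>0. \<bar>ln lam\<bar> \<le> B * ln (ln x) \<longrightarrow>
    \<bar>real (Tcount th lam x) - lam * main_term c th x\<bar> \<le> C * sqrt (ln (ln x) / ln x) * (lam * main_term c th x)"
proof -
  have "\<forall>\<^sub>F t in at_top. \<forall>x lam. x > 0 \<longrightarrow> lam > 0 \<longrightarrow> x powr (1 - th) / lam = exp t \<longrightarrow>
      x powr th * lam \<ge> exp (a / 2 * t) \<longrightarrow>
      \<bar>real (Tcount th lam x) - c * (x powr th * lam) * H {} (exp t)\<bar> \<le> x powr th * lam * H {} (exp t) / t"
    by (rule Tcount_approx[OF c _ th a]) (rule base)
  then obtain t0 where t0: "\<And>t x lam. t \<ge> t0 \<Longrightarrow> x > 0 \<Longrightarrow> lam > 0 \<Longrightarrow> x powr (1 - th) / lam = exp t \<Longrightarrow>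
      x powr th * lam \<ge> exp (a / 2 * t) \<Longrightarrow>
      \<bar>real (Tcount th lam x) - c * (x powr th * lam) * H {} (exp t)\<bar> \<le> x powr th * lam * H {} (exp t) / t"
    unfolding eventually_at_top_linorder by blast
  obtain C1 where C1: "C1 > 0" and ev1: "\<forall>\<^sub>F t in at_top. \<forall>s. \<bar>s\<bar> \<le> 2 * B * ln t \<longrightarrow>
      \<bar>L {} (t + s) - L {} t\<bar> \<le> C1 * (sg t * ln t)"
    using L_shift_log[of "2 * B"] B by auto
  have "filterlim (\<lambda>x. (1 - th) * ln x) at_top at_top" using th by real_asymp
  then have ev1': "\<forall>\<^sub>F x in at_top. \<forall>s. \<bar>s\<bar> \<le> 2 * B * ln ((1 - th) * ln x) \<longrightarrow>
      \<bar>L {} ((1 - th) * ln x + s) - L {} ((1 - th) * ln x)\<bar> \<le> C1 * (sg ((1 - th) * ln x) * ln ((1 - th) * ln x))"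
    using ev1 unfolding filterlim_iff by blast
  define C2 where "C2 = sqrt (1 / (1 - th))"
  have C2: "C2 > 0" using th by (simp add: C2_def)
  define C where "C = (6 / (1 - th) + 3 * C1 * C2) / c"
  have C: "C > 0" unfolding C_def using th C1 C2 c by (intro divide_pos_pos add_pos_pos) auto
  have "\<forall>\<^sub>F x in at_top. ln (ln x) \<ge> - 2 * ln (1 - th)" by real_asymp
  \<comment> \<open>Ensures \<open>ln (ln x) \<le> 2 * ln ((1 - th) * ln x)\<close>, so shifts
    measured in \<open>ln (ln x)\<close> fit the range \<open>2 * B * ln u\<close>.\<close>
  moreover have "\<forall>\<^sub>F x in at_top. C1 * C2 * sqrt (ln (ln x) / ln x) \<le> 1" by real_asymp
  moreover have "\<forall>\<^sub>F x in at_top. B * ln (ln x) \<le> (1 - th) * ln x / 2" using th B by real_asymp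
  moreover have "\<forall>\<^sub>F x in at_top. (1 + a / 2) * (B * ln (ln x)) \<le> th * ln x / 2" using th by real_asymp
  moreover have "\<forall>\<^sub>F x in at_top. (1 - th) * ln x / 2 \<ge> t0" using th by real_asymp
  moreover have "\<forall>\<^sub>F x in at_top. (1 - th) * ln x > 1" using th by real_asymp
  moreover have "\<forall>\<^sub>F x in at_top. ln (ln x) \<ge> 1 \<and> ln x > 1 \<and> x > (1::real)"
    by (intro eventually_conj eventually_gt_at_top; real_asymp)
  moreover note ev1'
  ultimately have "\<forall>\<^sub>F x in at_top. \<forall>lam>0. \<bar>ln lam\<bar> \<le> B * ln (ln x) \<longrightarrow>
      \<bar>real (Tcount th lam x) - lam * main_term c th x\<bar> \<le> C * sqrt (ln (ln x) / ln x) * (lam * main_term c th x)"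
  proof eventually_elim
    case (elim x)
    show ?case
    proof (intro allI impI)
      fix lam :: real assume lam: "lam > 0" "\<bar>ln lam\<bar> \<le> B * ln (ln x)"
      define l where "l = ln x"
      define u where "u = (1 - th) * l"
      define t where "t = u - ln lam"
      define eta where "eta = sqrt (ln l / l)"
      have l1: "l > 1" "ln l \<ge> 1" and x: "x > 1" using elim by (auto simp: l_def)
      have u1: "u > 1" using elim by (simp add: u_def l_def)
      have eu: "x powr (1 - th) = exp u" using x by (simp add: powr_def u_def l_def)
      have et: "x powr (1 - th) / lam = exp t" unfolding eu t_def using lam by (simp add: exp_diff)
      have tu: "t \<ge> u / 2" using lam(2) elim(3) by (simp add: t_def u_def l_def mult.commute[of "ln x"])
      have tt0: "t \<ge> t0" using tu elim by (simp add: u_def l_def)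
      define X where "X = x powr th * lam"
      have X0: "X > 0" using x lam by (simp add: X_def)
      have Xe: "X = exp (th * l + ln lam)" using x lam by (simp add: X_def powr_def exp_add l_def)
      have "a / 2 * t \<le> th * l + ln lam"
      proof -
        have au: "a * u = th * l" unfolding a u_def using th by simp
        have "(1 + a / 2) * \<bar>ln lam\<bar> \<le> (1 + a / 2) * (B * ln l)" using lam a_pos by (intro mult_left_mono) (auto simp: l_def)
        also have "\<dots> \<le> th * l / 2" using elim by (simp add: l_def)
        finally have "(1 + a / 2) * \<bar>ln lam\<bar> \<le> th * l / 2" .
        moreover have "(1 + a / 2) * (- ln lam) \<le> (1 + a / 2) * \<bar>ln lam\<bar>" using a_pos by (intro mult_left_mono) auto
        ultimately have "(1 + a / 2) * (- ln lam) \<le> th * l / 2" by linarith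
        moreover have "a / 2 * t = th * l / 2 - a / 2 * ln lam" unfolding t_def au[symmetric] by (simp add: right_diff_distrib)
        ultimately show ?thesis by (simp add: algebra_simps)
      qed
      then have Xge: "X \<ge> exp (a / 2 * t)" unfolding Xe by simp
      have T1: "\<bar>real (Tcount th lam x) - c * X * H {} (exp t)\<bar> \<le> X * H {} (exp t) / t"
        using t0[OF tt0 _ lam(1) et] Xge x unfolding X_def by simp
      define y where "y = L {} t - L {} u"
      have "\<bar>- ln lam\<bar> \<le> 2 * B * ln u"
      proof -
        have "B * ln l \<le> B * (2 * ln (1 - th) + 2 * ln l)" using elim B by (intro mult_left_mono) (auto simp: l_def)
        also have "\<dots> = 2 * B * ln u" using th l1 by (simp add: u_def ln_mult distrib_left)
        finally show ?thesis using lam by (simp add: l_def)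
      qed
      then have "\<bar>L {} (u + (- ln lam)) - L {} u\<bar> \<le> C1 * (sg u * ln u)"
        using elim unfolding u_def l_def by blast
      then have y: "\<bar>y\<bar> \<le> C1 * (sg u * ln u)" by (simp add: y_def t_def)
      have "sg u * ln u \<le> C2 * eta"
      proof -
        have "sg u * ln u = sqrt (ln u / u)"
        proof -
          have "ln u / sqrt (ln u) = sqrt (ln u)" using u1 by (intro real_div_sqrt) auto
          then have "sg u * ln u = sqrt (ln u) / sqrt u" using u1 by (simp add: sg_def real_sqrt_mult field_simps)
          then show ?thesis by (simp add: real_sqrt_divide)
        qed
        also have "\<dots> \<le> sqrt (1 / (1 - th) * (ln l / l))"
        proof (rule real_sqrt_le_mono)
          have "u \<le> 1 * l" unfolding u_def using th l1 by (intro mult_right_mono) auto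
          then have "ln u \<le> ln l" using u1 by simp
          then have "ln u / u \<le> ln l / u" using u1 by (intro divide_right_mono) auto
          then show "ln u / u \<le> 1 / (1 - th) * (ln l / l)" by (simp add: u_def)
        qed
        also have "\<dots> = C2 * eta" by (simp only: real_sqrt_mult C2_def eta_def)
        finally show ?thesis .
      qed
      then have "C1 * (sg u * ln u) \<le> C1 * (C2 * eta)" using C1 by (intro mult_left_mono) auto
      then have y2: "\<bar>y\<bar> \<le> C1 * C2 * eta" using y by simp
      have "C1 * C2 * eta \<le> 1" using elim by (simp add: eta_def l_def)
      then have "\<bar>y\<bar> \<le> 1" using y2 by linarith
      then have "exp \<bar>y\<bar> \<le> exp 1" by simp
      then have ey3: "exp \<bar>y\<bar> \<le> 3" using exp_le by linarith
      have Hu: "H {} (exp u) > 0" by (intro H_pos) auto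
      have Ht: "H {} (exp t) = exp y * H {} (exp u)" unfolding y_def by (rule H_eq_exp_L)
      have eta0: "eta \<ge> 0" using l1 by (simp add: eta_def)
      have "\<bar>exp y - 1\<bar> \<le> (C1 * C2 * eta) * 3"
        using abs_exp_minus_one_le[of y] mult_mono[OF y2 ey3] C1 C2 eta0 by (smt (verit) abs_ge_zero exp_gt_zero mult_nonneg_nonneg)
      then have d1: "\<bar>exp y - 1\<bar> \<le> 3 * C1 * C2 * eta" by simp
      have it: "1 / t \<le> 2 / (1 - th) * eta"
      proof -
        have "1 / t \<le> 1 / (u / 2)" using tu u1 by (intro divide_left_mono) auto
        also have "\<dots> = 2 / (1 - th) * (1 / l)" by (simp add: u_def)
        also have "1 / l \<le> eta"
        proof -
          have "(1 / l)\<^sup>2 \<le> ln l / l"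
          proof -
            have "(1 / l)\<^sup>2 = 1 / l / l" by (simp add: power2_eq_square)
            also have "\<dots> \<le> ln l / l"
            proof (intro divide_right_mono)
              have "1 / l \<le> 1" using l1 by simp
              then show "1 / l \<le> ln l" using l1 by linarith
            qed (use l1 in auto)
            finally show ?thesis .
          qed
          then show ?thesis unfolding eta_def by (rule real_le_rsqrt)
        qed
        then have "2 / (1 - th) * (1 / l) \<le> 2 / (1 - th) * eta" using th by (intro mult_left_mono) auto
        finally show ?thesis .
      qed
      have "X * H {} (exp t) / t \<le> X * H {} (exp u) * (6 / (1 - th) * eta)"
      proof -
        have "exp y \<le> exp \<bar>y\<bar>" by simp
        then have "exp y \<le> 3" using ey3 by linarith
        then have "X * (exp y * H {} (exp u)) * (1 / t) \<le> X * (3 * H {} (exp u)) * (2 / (1 - th) * eta)"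
          using it X0 Hu tu u1 eta0 by (intro mult_mono mult_left_mono mult_right_mono) auto
        then show ?thesis unfolding Ht by (simp add: mult_ac)
      qed
      moreover have "\<bar>c * X * H {} (exp t) - c * X * H {} (exp u)\<bar> \<le> X * H {} (exp u) * (3 * C1 * C2 * eta)"
      proof -
        have "c * X * H {} (exp t) - c * X * H {} (exp u) = (c * X * H {} (exp u)) * (exp y - 1)"
          unfolding Ht by (simp add: algebra_simps)
        then have "\<bar>c * X * H {} (exp t) - c * X * H {} (exp u)\<bar> = (c * X * H {} (exp u)) * \<bar>exp y - 1\<bar>"
          using c X0 Hu by (simp add: abs_mult)
        also have "\<dots> \<le> (1 * X * H {} (exp u)) * (3 * C1 * C2 * eta)"
          using d1 c X0 Hu by (intro mult_mono mult_right_mono) auto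
        finally show ?thesis by simp
      qed
      ultimately have "\<bar>real (Tcount th lam x) - c * X * H {} (exp u)\<bar> \<le>
          X * H {} (exp u) * (6 / (1 - th) * eta) + X * H {} (exp u) * (3 * C1 * C2 * eta)"
        using T1 by linarith
      also have "\<dots> = (C * c) * (eta * X * H {} (exp u))"
      proof -
        have "C * c = 6 / (1 - th) + 3 * C1 * C2" using c by (simp add: C_def)
        then show ?thesis by (simp add: algebra_simps)
      qed
      also have "\<dots> = C * eta * (c * X * H {} (exp u))" by (simp only: mult_ac)
      also have "c * X * H {} (exp u) = lam * main_term c th x"
        by (simp add: main_term_def X_def eu mult_ac)
      finally show "\<bar>real (Tcount th lam x) - lam * main_term c th x\<bar> \<le> C * sqrt (ln (ln x) / ln x) * (lam * main_term c th x)"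
        by (simp add: eta_def l_def)
    qed
  qed
  then show ?thesis using C by blast
qed

end

subsection \<open>Comparison of the two counting functions\<close>

lemma S1_eq_Tcount: "S1 th x = Tcount th 1 x"
  unfolding S1_def Tcount_def by (rule arg_cong[where f = card]) auto

lemma S2_le_Tcount:
  assumes up: "\<And>n. z < real n \<Longrightarrow> real n \<le> x \<Longrightarrow> ln (real n) powr Th \<le> lam"
    and low: "\<And>n. 2 \<le> n \<Longrightarrow> real n \<le> z \<Longrightarrow> ln (real n) powr Th \<le> mu"
  shows "S2 th Th x \<le> Tcount th lam x + Tcount th mu z"
proof -
  have "{n::nat. 2 \<le> n \<and> real n \<le> x \<and> real (kern n) \<le> real n powr th * ln (real n) powr Th} \<subseteq>
      {n. (0 < n \<and> real (kern n) \<le> real n powr th * lam) \<and> real n \<le> x} \<union>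
      {n. (0 < n \<and> real (kern n) \<le> real n powr th * mu) \<and> real n \<le> z}"
  proof
    fix n :: nat
    assume "n \<in> {n. 2 \<le> n \<and> real n \<le> x \<and> real (kern n) \<le> real n powr th * ln (real n) powr Th}"
    then have n: "2 \<le> n" "real n \<le> x" "real (kern n) \<le> real n powr th * ln (real n) powr Th" by auto
    show "n \<in> {n. (0 < n \<and> real (kern n) \<le> real n powr th * lam) \<and> real n \<le> x} \<union>
      {n. (0 < n \<and> real (kern n) \<le> real n powr th * mu) \<and> real n \<le> z}"
    proof (cases "real n \<le> z")
      case True
      then have "real n powr th * ln (real n) powr Th \<le> real n powr th * mu"
        using low n by (intro mult_left_mono) auto
      from order_trans[OF n(3) this] show ?thesis using n True by auto
    next
      case False
      then have "real n powr th * ln (real n) powr Th \<le> real n powr th * lam"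
        using up n by (intro mult_left_mono) auto
      from order_trans[OF n(3) this] show ?thesis using n by auto
    qed
  qed
  then show ?thesis unfolding S2_def Tcount_def
    by (intro order_trans[OF card_mono card_Un_le] finite_UnI finite_nat_real_le)
qed

text \<open>Only the \<open>n\<close> above \<open>z\<close> are compared; those below are counted
  again with the larger constant \<open>mu\<close>, so that one estimate covers the lower range in
  both directions.\<close>

lemma Tcount_le_S2:
  assumes up: "\<And>n. z < real n \<Longrightarrow> real n \<le> x \<Longrightarrow> lam \<le> ln (real n) powr Th"
    and le: "lam \<le> mu" and z: "1 \<le> z"
  shows "Tcount th lam x \<le> S2 th Th x + Tcount th mu z"
proof -
  have "{n. (0 < n \<and> real (kern n) \<le> real n powr th * lam) \<and> real n \<le> x} \<subseteq>
      {n::nat. 2 \<le> n \<and> real n \<le> x \<and> real (kern n) \<le> real n powr th * ln (real n) powr Th} \<union>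
      {n. (0 < n \<and> real (kern n) \<le> real n powr th * mu) \<and> real n \<le> z}"
  proof
    fix n :: nat
    assume "n \<in> {n. (0 < n \<and> real (kern n) \<le> real n powr th * lam) \<and> real n \<le> x}"
    then have n: "0 < n" "real n \<le> x" "real (kern n) \<le> real n powr th * lam" by auto
    show "n \<in> {n::nat. 2 \<le> n \<and> real n \<le> x \<and> real (kern n) \<le> real n powr th * ln (real n) powr Th} \<union>
      {n. (0 < n \<and> real (kern n) \<le> real n powr th * mu) \<and> real n \<le> z}"
    proof (cases "real n \<le> z")
      case True
      then have "real n powr th * lam \<le> real n powr th * mu"
        using le by (intro mult_left_mono) auto
      from order_trans[OF n(3) this] show ?thesis using n True by auto
    next
      case False
      then have "real n powr th * lam \<le> real n powr th * ln (real n) powr Th"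
        using up n by (intro mult_left_mono) auto
      from order_trans[OF n(3) this]
      have "real (kern n) \<le> real n powr th * ln (real n) powr Th" .
      moreover have "2 \<le> n" using False z by simp
      ultimately show ?thesis using n by auto
    qed
  qed
  moreover have "finite {n::nat. 2 \<le> n \<and> real n \<le> x \<and> real (kern n) \<le> real n powr th * ln (real n) powr Th}"
    by (rule finite_subset[OF _ finite_nat_real_le[of "\<lambda>_. True" x]]) auto
  ultimately show ?thesis unfolding S2_def Tcount_def
    by (intro order_trans[OF card_mono card_Un_le] finite_UnI finite_nat_real_le)
qed

text \<open>For negative \<open>Th\<close> the largest value is at \<open>n = 2\<close>, where
  \<open>ln 2 < 1\<close>; it is a constant and so below \<open>l\<close> eventually.\<close>

lemma ln_powr_le:
  assumes "2 \<le> n" "ln (real n) \<le> l" "1 \<le> l" "ln 2 powr Th \<le> l"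
  shows "ln (real n) powr Th \<le> l powr (\<bar>Th\<bar> + 1)"
proof (cases "Th \<ge> 0")
  case True
  have "ln (real n) powr Th \<le> l powr Th" using assms True by (intro powr_mono2) auto
  also have "\<dots> \<le> l powr (\<bar>Th\<bar> + 1)" using assms by (intro powr_mono) auto
  finally show ?thesis .
next
  case False
  have "ln (real n) powr Th \<le> ln 2 powr Th" using assms False by (intro powr_mono2') auto
  also have "\<dots> \<le> l powr 1" using assms by simp
  also have "\<dots> \<le> l powr (\<bar>Th\<bar> + 1)" using assms by (intro powr_mono) auto
  finally show ?thesis .
qed

text \<open>For \<open>n\<close> between \<open>x / ln x powr D\<close> and \<open>x\<close>,
  \<open>ln n powr Th\<close> differs from \<open>ln x powr Th\<close> by a relative
  \<open>O(ln (ln x) / ln x)\<close>. So \<open>S2\<close> lies between two values of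
  \<open>Tcount\<close> with constants this close, up to the \<open>n\<close> below that range,
  which are negligible.\<close>

theorem theorem3:
  fixes th Th :: real
  assumes "0 < th" and "th < 1"
  shows "\<exists>x0 C. C > 0 \<and> (\<forall>x::real. x \<ge> x0 \<longrightarrow>
     \<bar>real (S2 th Th x) - ln x powr Th * real (S1 th x)\<bar>
       \<le> C * ln x powr Th * real (S1 th x) * sqrt (ln (ln x) / ln x))"
proof -
  obtain c :: real where c: "0 < c" "c \<le> 1" and
    base: "\<And>J. J > 0 \<Longrightarrow> \<bar>real (card (sqfree_upto {} J)) - c * J\<bar> \<le> 20 * J powr (31/32)"
    using sqfree_density by metis
  define a where "a = th / (1 - th)"
  interpret kernel a by unfold_locales (use assms in \<open>simp add: a_def\<close>)
  define A where "A = \<bar>Th\<bar>"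
  \<comment> \<open>The lower range is counted with the constant \<open>ln x powr (A + 1)\<close>.
    As \<open>D * th = 2 * A + 2\<close>, its main term carries \<open>ln x powr (- A - 1)\<close>,
    at most \<open>ln x powr (Th - 1)\<close>.\<close>
  define D where "D = (2 * A + 2) / th"
  \<comment> \<open>The constant \<open>ln x powr (A + 1)\<close> must be admissible at the smaller
    point \<open>xs x\<close>; the extra 1 beyond \<open>A + 1\<close> covers the difference between
    \<open>ln (ln x)\<close> and \<open>ln (ln (xs x))\<close>.\<close>
  define B where "B = A + 2"
  have A: "A \<ge> 0" "\<bar>Th\<bar> = A" by (auto simp: A_def)
  have D: "D > 0" "D * th = 2 * A + 2" using A assms by (auto simp: D_def)
  have B: "B > 0" using A by (simp add: B_def)
  define P where "P = main_term c th"
  define R where "R = (\<lambda>x::real. sqrt (ln (ln x) / ln x))"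
  obtain C where C: "C > 0" and ev: "\<forall>\<^sub>F x in at_top. \<forall>lam>0. \<bar>ln lam\<bar> \<le> B * ln (ln x) \<longrightarrow>
      \<bar>real (Tcount th lam x) - lam * P x\<bar> \<le> C * R x * (lam * P x)"
  proof -
    have "\<exists>C>0. \<forall>\<^sub>F x in at_top. \<forall>lam>0. \<bar>ln lam\<bar> \<le> B * ln (ln x) \<longrightarrow>
      \<bar>real (Tcount th lam x) - lam * main_term c th x\<bar> \<le> C * sqrt (ln (ln x) / ln x) * (lam * main_term c th x)"
      by (rule Tcount_asymptotic[OF c _ assms a_def B]) (rule base)
    then show thesis using that unfolding P_def R_def by blast
  qed
  define xs where "xs = (\<lambda>x::real. x / ln x powr D)"
  have lim: "filterlim xs at_top at_top" unfolding xs_def by real_asymp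
  have ev': "\<forall>\<^sub>F x in at_top. \<forall>lam>0. \<bar>ln lam\<bar> \<le> B * ln (ln (xs x)) \<longrightarrow>
      \<bar>real (Tcount th lam (xs x)) - lam * P (xs x)\<bar> \<le> C * R (xs x) * (lam * P (xs x))"
    using ev lim unfolding filterlim_iff by blast
  have Rev': "\<forall>\<^sub>F x in at_top. C * R (xs x) \<le> 1"
  proof -
    have "\<forall>\<^sub>F x in at_top. C * R x \<le> 1" unfolding R_def by real_asymp
    then show ?thesis using lim unfolding filterlim_iff by blast
  qed
  \<comment> \<open>From \<open>powr_near_one\<close> with \<open>A + 1\<close> in place of
    \<open>A\<close>, which keeps \<open>C4\<close> positive also for \<open>Th = 0\<close>.\<close>
  define C4 where "C4 = 6 * (A + 1) * D"
  have C4: "C4 > 0" unfolding C4_def using A D by simp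
  define C5 where "C5 = C4 + 3 * C + 4"
  have C5: "C5 > 0" unfolding C5_def using C C4 by simp
  have evP: "\<forall>\<^sub>F x in at_top. P (xs x) \<le> 2 * ln x powr (- (D * th)) * P x"
    unfolding P_def xs_def by (rule main_term_shift_le[OF assms c(1) D(1)])
  have evR: "\<forall>\<^sub>F x in at_top. C * R x \<le> 1/2" unfolding R_def by real_asymp
  have ev6: "\<forall>\<^sub>F x in at_top. (A + 2) * ln 2 \<le> ln (ln x)" by real_asymp
  have ev7: "\<forall>\<^sub>F x in at_top. 2 * C4 * (ln (ln x) / ln x) \<le> 1" by real_asymp
  have ev8: "\<forall>\<^sub>F x in at_top. xs x \<ge> 2" using lim by (simp add: filterlim_at_top)
  have ev9: "\<forall>\<^sub>F x in at_top. ln 2 powr Th \<le> ln x" by real_asymp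
  have ev10: "\<forall>\<^sub>F x in at_top. ln (ln x) \<ge> 1 \<and> ln x > 1 \<and> x > (1::real)"
    by (intro eventually_conj eventually_gt_at_top; real_asymp)
  have ev11: "\<forall>\<^sub>F x in at_top. 2 * (D * (ln (ln x) / ln x)) \<le> 1" by real_asymp
  have "\<forall>\<^sub>F x in at_top. \<bar>real (S2 th Th x) - ln x powr Th * real (S1 th x)\<bar>
       \<le> (2 * C5) * ln x powr Th * real (S1 th x) * sqrt (ln (ln x) / ln x)"
    using ev ev' Rev' evP evR ev6 ev7 ev8 ev9 ev10 ev11
  proof eventually_elim
    case (elim x)
    note T = elim(1) and T' = elim(2) and R' = elim(3) and P' = elim(4) and Rx = elim(5)
    define l where "l = ln x"
    define q where "q = ln l / l"
    define rho where "rho = D * q"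
    define kap where "kap = C4 * q"
    have l: "l > 1" "ln l \<ge> 1" and x: "x > 1" using elim by (auto simp: l_def)
    have z2: "xs x \<ge> 2" using elim by simp
    have q0: "q \<ge> 0" using l by (simp add: q_def)
    have q1: "q \<le> 1" using l ln_le_minus_one[of l] by (simp add: q_def)
    have Rq: "R x = sqrt q" by (simp add: R_def q_def l_def)
    have qR: "q \<le> R x" unfolding Rq
    proof (rule real_le_rsqrt)
      have "q * q \<le> q * 1" using q0 q1 by (intro mult_left_mono) auto
      then show "q\<^sup>2 \<le> q" by (simp add: power2_eq_square)
    qed
    have R0: "R x \<ge> 0" using qR q0 by linarith
    have lR: "1 / l \<le> R x"
    proof -
      have "1 / l \<le> ln l / l" using l by (intro divide_right_mono) auto
      then show ?thesis using qR by (simp add: q_def)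
    qed
    have "2 * C4 * q \<le> 1" "2 * (D * q) \<le> 1" unfolding q_def l_def using elim(7,11) by auto
    then have kap: "0 \<le> kap" "kap \<le> 1/2" and rho: "0 \<le> rho" "rho \<le> 1/2"
      using C4 D q0 by (auto simp: kap_def rho_def)
    have kr: "kap = 6 * (A + 1) * rho" by (simp add: kap_def rho_def C4_def)
    have kR: "kap \<le> C4 * R x" unfolding kap_def using qR C4 by (intro mult_left_mono) auto
    have lnz: "ln (xs x) = l * (1 - rho)"
    proof -
      have "ln (xs x) = l - D * ln l" unfolding xs_def using x l by (simp add: ln_div ln_powr l_def)
      also have "D * ln l = l * rho" using l by (simp add: rho_def q_def)
      finally show ?thesis by (simp add: algebra_simps)
    qed
    have xsx: "xs x \<le> x"
    proof -
      have "l powr D \<ge> 1" using l D by (intro ge_one_powr_ge_zero) auto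
      then show ?thesis unfolding xs_def using x by (simp add: l_def divide_le_eq mult_le_cancel_left1)
    qed
    have lnlnz: "(A + 1) * ln l \<le> B * ln (ln (xs x))"
    proof -
      have "ln (l / 2) \<le> ln (ln (xs x))"
      proof -
        have "l * (1/2) \<le> l * (1 - rho)" using rho l by (intro mult_left_mono) auto
        then show ?thesis unfolding lnz using l by simp
      qed
      then have "ln l - ln 2 \<le> ln (ln (xs x))" using l by (simp add: ln_div)
      then have "B * (ln l - ln 2) \<le> B * ln (ln (xs x))" using B by (intro mult_left_mono) auto
      moreover have "(A + 1) * ln l \<le> B * (ln l - ln 2)"
        using elim(6) by (simp add: B_def l_def algebra_simps)
      ultimately show ?thesis by linarith
    qed
    have window: "\<bar>ln (real n) powr Th - l powr Th\<bar> \<le> l powr Th * kap" if n: "xs x < real n" "real n \<le> x" for n :: nat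
    proof -
      define y where "y = ln (real n) / l"
      have n0: "real n > 0" using n z2 by linarith
      have "ln (xs x) \<le> ln (real n)" using n z2 by simp
      then have y1: "1 - rho \<le> y" unfolding lnz y_def using l by (simp add: field_simps)
      have "ln (real n) \<le> l" unfolding l_def using n n0 by simp
      then have y2: "y \<le> 1" unfolding y_def using l by simp
      have "\<bar>y powr Th - 1\<bar> \<le> 6 * (A + 1) * rho"
      proof (rule powr_near_one[OF y1 y2 rho])
        show "2 * (A + 1) * rho \<le> 1" using kap kr by (simp add: algebra_simps)
      qed (simp add: A_def)
      then have yk: "\<bar>y powr Th - 1\<bar> \<le> kap" by (simp add: kr)
      have "y > 0" using y1 rho by linarith
      have "ln (real n) = l * y" using l by (simp add: y_def)
      then have "ln (real n) powr Th = l powr Th * y powr Th" using l \<open>y > 0\<close> by (simp add: powr_mult)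
      then have "ln (real n) powr Th - l powr Th = l powr Th * (y powr Th - 1)" by (simp add: right_diff_distrib)
      then have "\<bar>ln (real n) powr Th - l powr Th\<bar> = l powr Th * \<bar>y powr Th - 1\<bar>" by (simp add: abs_mult)
      also have "\<dots> \<le> l powr Th * kap" using yk by (intro mult_left_mono) auto
      finally show ?thesis .
    qed
    have lnlam: "\<bar>ln (l powr Th * s)\<bar> \<le> B * ln (ln x)" if s: "1/2 \<le> s" "s \<le> 2" for s
    proof -
      have "ln s \<le> ln 2" using s by simp
      moreover have "ln (1/2) \<le> ln s" using s by (subst ln_le_cancel_iff) auto
      moreover have "ln (1/2) = - ln (2::real)" by (simp add: ln_div)
      moreover have "ln (2::real) \<le> 1" using ln_le_minus_one[of 2] by simp
      ultimately have "\<bar>ln s\<bar> \<le> ln l" using l by linarith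
      moreover have "ln (l powr Th * s) = Th * ln l + ln s" using l s by (simp add: ln_mult ln_powr)
      moreover have "\<bar>Th * ln l\<bar> = A * ln l" using l by (simp add: abs_mult A_def)
      ultimately have "\<bar>ln (l powr Th * s)\<bar> \<le> A * ln l + ln l" by linarith
      also have "\<dots> \<le> B * ln l" using l by (simp add: B_def algebra_simps)
      finally show ?thesis by (simp add: l_def)
    qed
    define E where "E = l powr Th * P x"
    have Px: "P x > 0" unfolding P_def using c x by (intro main_term_pos) auto
    have E0: "E > 0" unfolding E_def using Px l by simp
    \<comment> \<open>The count up to \<open>xs x\<close> is at most twice its main term, which
      falls short of \<open>E\<close> by the factor \<open>1 / ln x\<close>; this is below
      \<open>R x\<close>.\<close>
    have low: "real (Tcount th (l powr (A + 1)) (xs x)) \<le> 4 * R x * E"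
    proof -
      define b where "b = l powr (A + 1)"
      have b: "b > 0" using l by (simp add: b_def)
      have Pz: "P (xs x) > 0" unfolding P_def using c z2 by (intro main_term_pos) auto
      have "ln b = (A + 1) * ln l" using l by (simp add: b_def ln_powr)
      then have "\<bar>ln b\<bar> \<le> B * ln (ln (xs x))" using lnlnz A l by simp
      then have "real (Tcount th b (xs x)) - b * P (xs x) \<le> C * R (xs x) * (b * P (xs x))"
        using T' b by (meson abs_le_D1)
      also have "\<dots> \<le> 1 * (b * P (xs x))" using R' b Pz by (intro mult_right_mono) auto
      finally have "real (Tcount th b (xs x)) \<le> 2 * b * P (xs x)" by simp
      also have "\<dots> \<le> 2 * b * (2 * l powr (- (D * th)) * P x)" using P' b by (intro mult_left_mono) (auto simp: l_def)
      also have "\<dots> = 4 * (b * l powr (- (D * th))) * P x" by simp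
      also have "b * l powr (- (D * th)) = l powr (- A - 1)"
        unfolding b_def D(2) by (simp flip: powr_add)
      also have "4 * l powr (- A - 1) * P x \<le> 4 * (l powr Th * R x) * P x"
      proof (intro mult_left_mono mult_right_mono)
        have "l powr (- A - 1) \<le> l powr (Th - 1)" using l by (intro powr_mono) (auto simp: A_def)
        also have "\<dots> = l powr Th * (1 / l)" using l by (simp add: powr_diff)
        also have "\<dots> \<le> l powr Th * R x" using lR by (intro mult_left_mono) auto
        finally show "l powr (- A - 1) \<le> l powr Th * R x" .
      qed (use Px in auto)
      finally show ?thesis by (simp add: b_def E_def mult_ac)
    qed
    have CR: "0 \<le> C * R x" using C R0 by simp
    have hi: "real (S2 th Th x) \<le> E * (1 + kap) * (1 + C * R x) + 4 * R x * E"
    proof -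
      define p where "p = l powr Th * (1 + kap)"
      have p: "p > 0" using l kap by (simp add: p_def)
      have "\<bar>ln p\<bar> \<le> B * ln (ln x)" unfolding p_def using kap by (intro lnlam) auto
      then have "real (Tcount th p x) - p * P x \<le> C * R x * (p * P x)"
        using T p by (meson abs_le_D1)
      then have "real (Tcount th p x) \<le> (p * P x) * (1 + C * R x)" by (simp add: algebra_simps)
      moreover have "p * P x = E * (1 + kap)" by (simp add: p_def E_def)
      moreover have "S2 th Th x \<le> Tcount th p x + Tcount th (l powr (A + 1)) (xs x)"
      proof (rule S2_le_Tcount)
        fix n :: nat assume "xs x < real n" "real n \<le> x"
        from window[OF this] show "ln (real n) powr Th \<le> p" by (simp add: p_def algebra_simps)
      next
        fix n :: nat assume n: "2 \<le> n" "real n \<le> xs x"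
        have "real n \<le> x" using n xsx by linarith
        then have "ln (real n) \<le> l" unfolding l_def using n by simp
        then show "ln (real n) powr Th \<le> l powr (A + 1)" unfolding A_def
          using n l elim(9) by (intro ln_powr_le) (auto simp: l_def)
      qed
      ultimately show ?thesis using low by simp
    qed
    have lo: "E * (1 - kap) * (1 - C * R x) \<le> real (S2 th Th x) + 4 * R x * E"
    proof -
      define p where "p = l powr Th * (1 - kap)"
      have p: "p > 0" using l kap by (simp add: p_def)
      have "\<bar>ln p\<bar> \<le> B * ln (ln x)" unfolding p_def using kap by (intro lnlam) auto
      then have "- (real (Tcount th p x) - p * P x) \<le> C * R x * (p * P x)"
        using T p by (meson abs_le_D2)
      then have "(p * P x) * (1 - C * R x) \<le> real (Tcount th p x)" by (simp add: algebra_simps)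
      moreover have "p * P x = E * (1 - kap)" by (simp add: p_def E_def)
      moreover have "Tcount th p x \<le> S2 th Th x + Tcount th (l powr (A + 1)) (xs x)"
      proof (rule Tcount_le_S2)
        fix n :: nat assume "xs x < real n" "real n \<le> x"
        from window[OF this] show "p \<le> ln (real n) powr Th" by (simp add: p_def algebra_simps)
      next
        have "p \<le> l powr Th * 1" unfolding p_def using kap by (intro mult_left_mono) auto
        also have "\<dots> \<le> l powr (A + 1)" using l by (simp add: A_def)
        finally show "p \<le> l powr (A + 1)" .
      qed (use z2 in simp)
      ultimately show ?thesis using low by simp
    qed
    have S2E: "\<bar>real (S2 th Th x) - E\<bar> \<le> (C4 + 2 * C + 4) * R x * E"
    proof -
      have k1: "kap * (C * R x) \<le> 1 * (C * R x)" using kap CR by (intro mult_right_mono) auto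
      have k0: "0 \<le> kap * (C * R x)" using kap CR by simp
      have "E * ((1 + kap) * (1 + C * R x)) \<le> E * (1 + C4 * R x + 2 * (C * R x))"
        using E0 k1 kR by (intro mult_left_mono) (auto simp: algebra_simps)
      moreover have "E * (1 - C4 * R x - 2 * (C * R x)) \<le> E * ((1 - kap) * (1 - C * R x))"
        using E0 k0 kR CR by (intro mult_left_mono) (auto simp: algebra_simps)
      ultimately show ?thesis using hi lo by (simp add: algebra_simps abs_le_iff)
    qed
    have "\<bar>real (S1 th x) - P x\<bar> \<le> C * R x * P x"
    proof -
      have "\<bar>ln (1::real)\<bar> \<le> B * ln (ln x)" using B l by (simp add: l_def)
      then show ?thesis using T[rule_format, of 1] by (simp add: S1_eq_Tcount)
    qed
    then have S1P: "\<bar>P x - real (S1 th x)\<bar> \<le> C * R x * P x" by (simp add: abs_minus_commute)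
    have "C * R x * P x \<le> 1/2 * P x" using Rx Px by (intro mult_right_mono) auto
    \<comment> \<open>The error is proved relative to the main term \<open>P x\<close>; this
      converts it into one relative to \<open>S1\<close>.\<close>
    then have S1h: "P x \<le> 2 * real (S1 th x)" using S1P by linarith
    have "\<bar>l powr Th * (P x - real (S1 th x))\<bar> \<le> l powr Th * (C * R x * P x)"
      unfolding abs_mult using S1P by (intro mult_mono) auto
    then have "\<bar>E - l powr Th * real (S1 th x)\<bar> \<le> C * R x * E" by (simp add: E_def right_diff_distrib mult_ac)
    then have "\<bar>real (S2 th Th x) - l powr Th * real (S1 th x)\<bar> \<le> (C4 + 2 * C + 4) * R x * E + C * R x * E"
      using S2E by linarith
    also have "\<dots> = C5 * R x * l powr Th * P x" by (simp add: C5_def E_def algebra_simps)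
    also have "\<dots> \<le> C5 * R x * l powr Th * (2 * real (S1 th x))"
      using S1h C5 R0 by (intro mult_left_mono) auto
    finally show ?case by (simp add: R_def l_def mult_ac)
  qed
  then obtain x0 where "\<forall>x\<ge>x0. \<bar>real (S2 th Th x) - ln x powr Th * real (S1 th x)\<bar>
       \<le> (2 * C5) * ln x powr Th * real (S1 th x) * sqrt (ln (ln x) / ln x)"
    unfolding eventually_at_top_linorder by blast
  then show ?thesis using C5 by (intro exI[of _ x0] exI[of _ "2 * C5"]) auto
qed

end
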